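(* Let $\ell\ge0$, let $\kappa$ be a positive integer, $\gamma\in\mathbb Z$, and let $\mathcal Q^{(\kappa)}_\gamma$ be the Baxter operator acting on symmetric polynomials in $\ell+1$ variables by $$\mathcal Q^{(\kappa)}_\gamma\cdot P^{(\kappa)}_\lambda(x)=\int_Td^\times y\;\prod_{i=1}^{\ell+1}(x_iy_i)^\gamma\prod_{i,j=1}^{\ell+1}\frac1{(1-x_iy_j)^\kappa}\;\Delta_{(\kappa)}(y)\,P^{(\kappa)}_\lambda(y^{-1}),\qquad 0<|x_i|<1,$$ where $P^{(\kappa)}_\lambda$ are the Jack polynomials, $\lambda=(\lambda_1\ge\dots\ge\lambda_{\ell+1}\ge0)$. Put $\varrho_i=\ell+1-i$ for $i=1,\dots,\ell+1$. (i) The action of the Baxter operator on the Jack polynomials is given by $$\mathcal Q^{(\kappa)}_\gamma\cdot P^{(\kappa)}_\lambda(x)=\mathcal L_\gamma(\lambda)\,P^{(\kappa)}_\lambda(x),\qquad \mathcal L_\gamma(\lambda)=\prod_{i=1}^{\ell+1}\frac{\Gamma(\lambda_i-\gamma+(\varrho_i+1)\kappa)}{\Gamma(\lambda_i-\gamma+\varrho_i\kappa+1)},\qquad\text{when }\gamma\le\lambda_{\ell+1}+\kappa,$$ and $$\mathcal Q^{(\kappa)}_\gamma\cdot P^{(\kappa)}_\lambda(x)=0\qquad\text{when }\gamma>\lambda_{\ell+1}+\kappa.$$ (ii) The Baxter operator $\mathcal Q^{(\kappa)}_\gamma$ commutes with the generating function $\mathcal D_{\ell+1}(X)$ of the Sekiguchi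 operators and satisfies the difference equation $$\mathcal D_{\ell+1}(\kappa-\gamma)\circ\mathcal D_{\ell+1}(1-\gamma)^{-1}\circ\mathcal Q^{(\kappa)}_\gamma=\mathcal Q^{(\kappa)}_{\gamma-1}.$$
   Context: Notation: $\Gamma$ is the classical Gamma function. $T=\{y\in\mathbb C^{\ell+1}:|y_i|=1\}$ is the torus with Haar measure $d^\times y=\prod_{i=1}^{\ell+1}\frac1{2\pi\sqrt{-1}}\,d\log y_i$, $y^{-1}=(y_1^{-1},\dots,y_{\ell+1}^{-1})$, and $\Delta_{(\kappa)}(y)=\prod_{i\ne j}(1-y_i^{-1}y_j)^\kappa$, $1\le i,j\le\ell+1$. Jack polynomials: $P^{(\kappa)}_\lambda=m_\lambda+\sum_{\mu<\lambda}u^{(\kappa)}_{\lambda\mu}m_\mu$ ($m_\mu$ monomial symmetric functions, $<$ dominance order on partitions of the same size), pairwise orthogonal for the scalar product on symmetric functions $\langle p_\lambda,p_\mu\rangle_\kappa=\kappa^{-l(\lambda)}\delta_{\lambda\mu}z_\lambda$, where $p_\lambda$ are products of power sums, $l(\lambda)$ is the number of nonzero parts, $z_\lambda=\prod_{n\ge1}n^{m_n}m_n!$, $m_n=|\{k:\lambda_k=n\}|$; then restricted to the variables $x_1,\dots,x_{\ell+1}$ (setting $x_i=0$ for $i>\ell+1$). Generating function of the Sekiguchi operators: $$\mathcal D_{\ell+1}(X)=\prod_{1\le i<j\le\ell+1}(x_i-x_j)^{-1}\sum_{\sigma\in\mathfrak S_{\ell+1}}(-1)^{\sigma}\prod_{i=1}^{\ell+1}x_i^{\sigma(\varrho_i)}\Bigl\{X+\sigma(\varrho_i)\kappa+x_i\frac{\partial}{\partial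 x_i}\Bigr\},$$ where $(-1)^\sigma$ is the sign of $\sigma$ and $\sigma(\varrho_i)=\varrho_{\sigma(i)}$. It acts on Jack polynomials by $\mathcal D_{\ell+1}(X)\cdot P^{(\kappa)}_\lambda=\prod_{i=1}^{\ell+1}(X+\lambda_i+\varrho_i\kappa)\,P^{(\kappa)}_\lambda$.
   Formalization: In (i) the eigenvalue is (ℓ+1)!/Γ(κ)^(ℓ+1) times L (printed L fails: ℓ=0, κ=3, γ=λ=0), read as 0 at γ=λ_{ℓ+1}+κ. In (ii) D(1-γ) is not invertible for γ≥1, so the equation is stated on the range of D(1-γ) (everything if γ≤0), and on all as D(κ-γ)Q_γ=D(1-γ)Q_{γ-1}. *)

theory Defs
  imports "HOL-Analysis.Analysis" "HOL-Library.Poly_Mapping" "HOL-Combinatorics.Permutations"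
begin

text \<open>
  Indices start at 0: the variables \<open>x\<^sub>1, \<dots>, x\<^sub>n\<close> are \<open>x 0, \<dots>, x (n - 1)\<close> and the
  parts \<open>\<lambda>\<^sub>1 \<ge> \<lambda>\<^sub>2 \<ge> \<dots>\<close> of a partition \<open>lam\<close> are \<open>lam 0 \<ge> lam 1 \<ge> \<dots>\<close>.
  A partition is a function with all trailing zeros included, so that partitions which differ only
  by trailing zeros are literally equal.
\<close>

section \<open>Partitions\<close>

definition is_partition :: "(nat \<Rightarrow> nat) \<Rightarrow> bool" where
  "is_partition lam \<longleftrightarrow> antimono lam \<and> finite {i. lam i \<noteq> 0}"

definition part_length :: "(nat \<Rightarrow> nat) \<Rightarrow> nat" where
  "part_length lam = card {i. lam i \<noteq> 0}"

definition part_size :: "(nat \<Rightarrow> nat) \<Rightarrow> nat" where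
  "part_size lam = (\<Sum>i | lam i \<noteq> 0. lam i)"

definition part_mult :: "(nat \<Rightarrow> nat) \<Rightarrow> nat \<Rightarrow> nat" where
  "part_mult lam k = card {i. lam i = k}"

definition z_part :: "(nat \<Rightarrow> nat) \<Rightarrow> nat" where
  "z_part lam = (\<Prod>k \<in> lam ` {i. lam i \<noteq> 0}. k ^ part_mult lam k * fact (part_mult lam k))"

definition dom_less :: "(nat \<Rightarrow> nat) \<Rightarrow> (nat \<Rightarrow> nat) \<Rightarrow> bool" where
  "dom_less \<mu> lam \<longleftrightarrow> is_partition \<mu> \<and> is_partition lam \<and> part_size \<mu> = part_size lam \<and> \<mu> \<noteq> lam \<and>
     (\<forall>k. (\<Sum>i<k. \<mu> i) \<le> (\<Sum>i<k. lam i))"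

section \<open>Symmetric functions in infinitely many variables\<close>

text \<open>
  A formal power series in infinitely many variables is its coefficient function on monomials;
  a monomial is a finitely supported exponent vector.
\<close>

type_synonym symfun = "(nat \<Rightarrow>\<^sub>0 nat) \<Rightarrow> complex"

definition sf_one :: symfun where
  "sf_one m = (if m = 0 then 1 else 0)"

definition sf_mult :: "symfun \<Rightarrow> symfun \<Rightarrow> symfun" where
  "sf_mult f g m = (\<Sum>(a, b) | a + b = m. f a * g b)"

definition power_sum :: "nat \<Rightarrow> symfun" where
  "power_sum r m = (if \<exists>i. m = Poly_Mapping.single i r then 1 else 0)"

definition power_sum_part :: "(nat \<Rightarrow> nat) \<Rightarrow> symfun" where
  "power_sum_part lam = foldr (\<lambda>i. sf_mult (power_sum (lam i))) [0..<part_length lam] sf_one"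

text \<open>\<open>m\<^sub>\<mu>\<close>: the sum of all distinct monomials whose non-zero exponents form the multiset of parts.\<close>

definition monomial_sf :: "(nat \<Rightarrow> nat) \<Rightarrow> symfun" where
  "monomial_sf \<mu> m =
     (if image_mset (Poly_Mapping.lookup m) (mset_set (Poly_Mapping.keys m))
         = image_mset \<mu> (mset_set {i. \<mu> i \<noteq> 0}) then 1 else 0)"

definition psum_expansion :: "symfun \<Rightarrow> ((nat \<Rightarrow> nat) \<Rightarrow> complex) \<Rightarrow> bool" where
  "psum_expansion f a \<longleftrightarrow> finite {lam. a lam \<noteq> 0} \<and> (\<forall>lam. a lam \<noteq> 0 \<longrightarrow> is_partition lam) \<and>
     f = (\<lambda>m. \<Sum>lam | a lam \<noteq> 0. a lam * power_sum_part lam m)"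

definition psum_coeff :: "symfun \<Rightarrow> (nat \<Rightarrow> nat) \<Rightarrow> complex" where
  "psum_coeff f = (THE a. psum_expansion f a)"

text \<open>The bilinear extension of \<open>\<langle>p\<^sub>\<lambda>, p\<^sub>\<mu>\<rangle> = \<kappa>\<close>-to-the-\<open>-l(\<lambda>)\<close> times \<open>\<delta>\<^sub>\<lambda>\<^sub>\<mu> z\<^sub>\<lambda>\<close>.\<close>

definition jack_scalar :: "nat \<Rightarrow> symfun \<Rightarrow> symfun \<Rightarrow> complex" where
  "jack_scalar \<kappa> f g =
     (\<Sum>lam | psum_coeff f lam \<noteq> 0.
        psum_coeff f lam * psum_coeff g lam * (of_nat (z_part lam) / of_nat \<kappa> ^ part_length lam))"

definition is_jack_family :: "nat \<Rightarrow> ((nat \<Rightarrow> nat) \<Rightarrow> symfun) \<Rightarrow> bool" where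
  "is_jack_family \<kappa> P \<longleftrightarrow>
     (\<forall>lam. is_partition lam \<longrightarrow>
        (\<exists>u. P lam = (\<lambda>m. monomial_sf lam m + (\<Sum>\<mu> | dom_less \<mu> lam. u \<mu> * monomial_sf \<mu> m)))) \<and>
     (\<forall>lam \<mu>. is_partition lam \<and> is_partition \<mu> \<and> lam \<noteq> \<mu> \<longrightarrow> jack_scalar \<kappa> (P lam) (P \<mu>) = 0)"

text \<open>The two conditions determine the family on partitions; other arguments are irrelevant.\<close>

definition jack_sf :: "nat \<Rightarrow> (nat \<Rightarrow> nat) \<Rightarrow> symfun" where
  "jack_sf \<kappa> = (SOME P. is_jack_family \<kappa> P)"

section \<open>Symmetric polynomials in finitely many variables\<close>

type_synonym mpol = "(nat \<Rightarrow>\<^sub>0 nat) \<Rightarrow>\<^sub>0 complex"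

definition sympol :: "nat \<Rightarrow> mpol set" where
  "sympol n = {f. (\<forall>m \<in> Poly_Mapping.keys f. Poly_Mapping.keys m \<subseteq> {..<n}) \<and>
     (\<forall>\<sigma> m. \<sigma> permutes {..<n} \<longrightarrow>
        Poly_Mapping.lookup f (Poly_Mapping.map_key \<sigma> m) = Poly_Mapping.lookup f m)}"

definition eval_pol :: "mpol \<Rightarrow> (nat \<Rightarrow> complex) \<Rightarrow> complex" where
  "eval_pol f x = (\<Sum>m \<in> Poly_Mapping.keys f.
     Poly_Mapping.lookup f m * (\<Prod>i \<in> Poly_Mapping.keys m. x i ^ Poly_Mapping.lookup m i))"

definition const_pol :: "complex \<Rightarrow> mpol" where
  "const_pol c = Poly_Mapping.single 0 c"

definition var :: "nat \<Rightarrow> mpol" where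
  "var i = Poly_Mapping.single (Poly_Mapping.single i 1) 1"

definition partial_deriv :: "nat \<Rightarrow> mpol \<Rightarrow> mpol" where
  "partial_deriv i f = (\<Sum>m \<in> Poly_Mapping.keys f.
     Poly_Mapping.single (m - Poly_Mapping.single i 1)
       (of_nat (Poly_Mapping.lookup m i) * Poly_Mapping.lookup f m))"

text \<open>Setting to zero all variables but the first \<open>n\<close>; meant for \<open>f\<close> of bounded degree.\<close>

definition restrict_vars :: "nat \<Rightarrow> symfun \<Rightarrow> mpol" where
  "restrict_vars n f = Abs_poly_mapping (\<lambda>m. if Poly_Mapping.keys m \<subseteq> {..<n} then f m else 0)"

definition jack :: "nat \<Rightarrow> nat \<Rightarrow> (nat \<Rightarrow> nat) \<Rightarrow> mpol" where
  "jack n \<kappa> lam = restrict_vars n (jack_sf \<kappa> lam)"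

section \<open>Sekiguchi operators\<close>

text \<open>\<open>\<rho>\<^sub>i = n - i\<close> for \<open>1 \<le> i \<le> n\<close>, with the index shifted by one.\<close>

definition rho :: "nat \<Rightarrow> nat \<Rightarrow> nat" where
  "rho n i = n - 1 - i"

definition sek_factor ::
  "nat \<Rightarrow> nat \<Rightarrow> complex \<Rightarrow> (nat \<Rightarrow> nat) \<Rightarrow> nat \<Rightarrow> mpol \<Rightarrow> mpol" where
  "sek_factor n \<kappa> X \<sigma> i f =
     var i ^ rho n (\<sigma> i) *
       (const_pol (X + of_nat (rho n (\<sigma> i)) * of_nat \<kappa>) * f + var i * partial_deriv i f)"

text \<open>
  The factors for different \<open>i\<close> commute, so the order of composition does not matter.  The
  quotient by the Vandermonde product is the quotient in the polynomial ring, an integral domain.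
\<close>

definition sekiguchi :: "nat \<Rightarrow> nat \<Rightarrow> complex \<Rightarrow> mpol \<Rightarrow> mpol" where
  "sekiguchi n \<kappa> X f = (THE g.
     (\<Prod>j<n. \<Prod>i<j. var i - var j) * g =
       (\<Sum>\<sigma> | \<sigma> permutes {..<n}. of_int (sign \<sigma>) * foldr (sek_factor n \<kappa> X \<sigma>) [0..<n] f))"

section \<open>The Baxter operator\<close>

definition torus_weight :: "nat \<Rightarrow> nat \<Rightarrow> (nat \<Rightarrow> complex) \<Rightarrow> complex" where
  "torus_weight n \<kappa> y = (\<Prod>i<n. \<Prod>j \<in> {..<n} - {i}. (1 - inverse (y i) * y j) ^ \<kappa>)"

text \<open>
  With \<open>y\<^sub>j = exp (2 \<pi> \<i> t\<^sub>j)\<close> the measure \<open>(2 \<pi> \<i>)\<close>-to-the-\<open>-1\<close> times \<open>d log y\<^sub>j\<close> is \<open>dt\<^sub>j\<close>.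
\<close>

definition torus_integral :: "nat \<Rightarrow> ((nat \<Rightarrow> complex) \<Rightarrow> complex) \<Rightarrow> complex" where
  "torus_integral n F =
     (\<integral>t. F (\<lambda>i. cis (2 * pi * t i)) \<partial>(PiM {..<n} (\<lambda>_. restrict_space lborel {0..1::real})))"

definition baxter_integral :: "nat \<Rightarrow> nat \<Rightarrow> int \<Rightarrow> mpol \<Rightarrow> (nat \<Rightarrow> complex) \<Rightarrow> complex" where
  "baxter_integral n \<kappa> \<gamma> f x = torus_integral n (\<lambda>y.
     (\<Prod>i<n. (x i * y i) powi \<gamma>) * (\<Prod>i<n. \<Prod>j<n. 1 / (1 - x i * y j) ^ \<kappa>) *
     torus_weight n \<kappa> y * eval_pol f (\<lambda>i. inverse (y i)))"

text \<open>\<open>g\<close> is the image of \<open>f\<close>: the symmetric polynomial which the integral represents.\<close>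

definition is_baxter_image :: "nat \<Rightarrow> nat \<Rightarrow> int \<Rightarrow> mpol \<Rightarrow> mpol \<Rightarrow> bool" where
  "is_baxter_image n \<kappa> \<gamma> f g \<longleftrightarrow> g \<in> sympol n \<and>
     (\<forall>x. (\<forall>i<n. 0 < norm (x i) \<and> norm (x i) < 1) \<longrightarrow> eval_pol g x = baxter_integral n \<kappa> \<gamma> f x)"

definition baxter :: "nat \<Rightarrow> nat \<Rightarrow> int \<Rightarrow> mpol \<Rightarrow> mpol" where
  "baxter n \<kappa> \<gamma> f = (THE g. is_baxter_image n \<kappa> \<gamma> f g)"

text \<open>
  At a pole \<open>Gamma\<close> is 0 in HOL, and division by 0 gives 0, which is the correct value of the
  reciprocal Gamma function.  A numerator can be at a pole only if \<open>\<gamma> \<ge> \<lambda>\<^sub>n + \<kappa>\<close>; at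
  \<open>\<gamma> = \<lambda>\<^sub>n + \<kappa>\<close> the last factor reads \<open>0 / 0 = 0\<close>, in accordance with the vanishing of the integral.
\<close>

definition baxter_eigenvalue :: "nat \<Rightarrow> nat \<Rightarrow> int \<Rightarrow> (nat \<Rightarrow> nat) \<Rightarrow> complex" where
  "baxter_eigenvalue n \<kappa> \<gamma> lam = (\<Prod>i<n.
     Gamma (of_int (int (lam i) - \<gamma> + (int (rho n i) + 1) * int \<kappa>)) /
     Gamma (of_int (int (lam i) - \<gamma> + int (rho n i) * int \<kappa> + 1)))"

text \<open>
  With the unnormalised weight \<^const>\<open>torus_weight\<close> and the total mass 1 of the torus, the Baxter
  operator has the eigenvalue \<^const>\<open>baxter_eigenvalue\<close> multiplied by this constant, which depends
  only on \<open>n\<close> and \<open>\<kappa>\<close>.  For example, for \<open>\<gamma> = 0\<close> and \<open>lam = 0\<close> the integral is the constant term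
  \<open>(n \<kappa>)!\<close> over \<open>(\<kappa>!)\<close>-to-the-\<open>n\<close> of the weight, while \<^const>\<open>baxter_eigenvalue\<close> alone gives
  \<open>\<Prod>i<n. Gamma ((i + 1) \<kappa>) / Gamma (i \<kappa> + 1)\<close>.
\<close>

definition baxter_norm :: "nat \<Rightarrow> nat \<Rightarrow> complex" where
  "baxter_norm n \<kappa> = fact n / Gamma (of_nat \<kappa>) ^ n"

end

theory Submission
  imports Defs "Jordan_Normal_Form.Determinant" "HOL-Computational_Algebra.Formal_Laurent_Series"
begin

text \<open>
  The Baxter operator is diagonal in the basis of Jack polynomials \<open>P\<^sub>\<lambda>\<close>, and so is the
  generating function \<open>D(X)\<close> of the Sekiguchi operators; every part of the theorem is then a
  statement about two families of eigenvalues.  The integrand contains the kernel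
  \<open>\<Prod>(1 - x\<^sub>i y\<^sub>j)\<close>-to-the-\<open>-\<kappa>\<close>, which is \<open>\<Sum> P\<^sub>\<mu>(x) P\<^sub>\<mu>(y) / N\<^sub>\<mu>\<close> with the norms
  \<open>N\<^sub>\<mu>\<close> of the power sum scalar product.  Integrating over the torus leaves the numbers
  \<open>\<langle>(y\<^sub>1 \<dots> y\<^sub>n)\<^sup>\<gamma> P\<^sub>\<mu>, P\<^sub>\<lambda>\<rangle>'\<close> of the torus pairing.  As multiplication by
  \<open>y\<^sub>1 \<dots> y\<^sub>n\<close> is an isometry which turns \<open>P\<^sub>\<mu>\<close> into \<open>P\<^sub>\<nu>\<close>, \<open>\<nu> = \<mu> + (1, \<dots>, 1)\<close>, only the
  term \<open>\<mu> = \<lambda> - (\<gamma>, \<dots>, \<gamma>)\<close> survives, and only if it is a partition; the eigenvalue is the ratio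
  \<open>c\<^sub>\<mu> = \<langle>P\<^sub>\<mu>, P\<^sub>\<mu>\<rangle>' / N\<^sub>\<mu>\<close> of the two norms.

  The Jack family.  Applying \<open>D(X)\<close> to
  the variables \<open>x\<close> or \<open>y\<close> of the kernel gives the same result (\<open>kernel_symmetry\<close>; both sides are
  determinants which factor through a Vandermonde matrix).  Hence \<open>D(X)\<close> is self-adjoint for
  the power sum scalar product.  It is triangular for the dominance order with separated
  eigenvalues, so its eigenvectors are a Jack family (\<open>jack_family_exists\<close>).  Conversely
  triangularity and self-adjointness force every Jack family to consist of eigenvectors
  (\<open>quot_op_jack\<close>), with the eigenvalue \<open>\<Prod>(X + a\<^sub>i)\<close>, \<open>a\<^sub>i = \<lambda>\<^sub>i + \<kappa> \<rho>\<^sub>i\<close>.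

  The norm ratio.  Let \<open>A = \<Sum> x\<^sub>k ((n - 1) \<kappa> + x\<^sub>k \<partial>\<^sub>k)\<close>, let \<open>p\<^sub>1\<close> be multiplication by
  \<open>x\<^sub>1 + \<dots> + x\<^sub>n\<close> and \<open>E = \<Sum> \<partial>\<^sub>k\<close>.  The commutation relation
  \<open>D(X) (X p\<^sub>1 + A) = ((X + 1) p\<^sub>1 + A) D(X)\<close> shows that \<open>p\<^sub>1 P\<^sub>\<mu>\<close> and \<open>A P\<^sub>\<mu>\<close> are sums of
  \<open>b\<^sub>i P\<^sub>\<nu>\<close> and of \<open>a\<^sub>i b\<^sub>i P\<^sub>\<nu>\<close>, where \<open>\<nu>\<close> is \<open>\<mu>\<close> with the \<open>i\<close>-th part raised by one
  (\<open>pieri_support\<close>).  The adjoint of \<open>E\<close> is \<open>A + \<kappa> p\<^sub>1\<close> for the power sum scalar product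
  (\<open>kernel_lowering\<close>) and \<open>A + p\<^sub>1\<close> for the torus pairing (\<open>tf_raising_lowering\<close>).
  Comparing the two gives \<open>c\<^sub>\<nu> = c\<^sub>\<mu> (a\<^sub>i + \<kappa>) / (a\<^sub>i + 1)\<close> along every edge with
  \<open>b\<^sub>i \<noteq> 0\<close>, and every partition is reached by such edges (\<open>pieri_edge\<close>).  The initial value is
  Dyson's constant term \<open>(n \<kappa>)! / (\<kappa>!)\<^sup>n\<close> (\<open>dyson_constant_term\<close>, by Good's proof), and the
  product telescopes to quotients of factorials, that is, to the Gamma quotients of the theorem.
\<close>

section \<open>Linear extension from monomials\<close>

abbreviation lkp :: "('a \<Rightarrow>\<^sub>0 'b::zero) \<Rightarrow> 'a \<Rightarrow> 'b" where "lkp \<equiv> Poly_Mapping.lookup"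
abbreviation kys :: "('a \<Rightarrow>\<^sub>0 'b::zero) \<Rightarrow> 'a set" where "kys \<equiv> Poly_Mapping.keys"
abbreviation mkey :: "(nat \<Rightarrow> nat) \<Rightarrow> (nat \<Rightarrow>\<^sub>0 nat) \<Rightarrow> (nat \<Rightarrow>\<^sub>0 nat)" where "mkey \<equiv> Poly_Mapping.map_key"
type_synonym natfun = "nat \<Rightarrow> nat"
type_synonym point = "nat \<Rightarrow> complex"
abbreviation sgl :: "'a \<Rightarrow> 'b \<Rightarrow> ('a \<Rightarrow>\<^sub>0 'b::zero)" where "sgl \<equiv> Poly_Mapping.single"

lemma lkp_0_iff: "lkp f m = 0 \<longleftrightarrow> m \<notin> kys f"
 by (simp add: in_keys_iff)

lemma poly_mapping_sum_single: "(f :: 'a \<Rightarrow>\<^sub>0 'b::comm_monoid_add) = (\<Sum>m\<in>kys f. sgl m (lkp f m))"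
 by (rule poly_mapping_eqI)
   (auto simp: lookup_sum lookup_single when_def in_keys_iff sum.delta' if_distrib cong: if_cong)

text \<open>
 Two additive maps agree as soon as they agree on monomials; almost all the ring identities below are
 proved in this way.\<close>

lemma poly_mapping_induct [case_names single add]:
 fixes f :: "'a \<Rightarrow>\<^sub>0 'b::comm_monoid_add"
 assumes "\<And>m c. P (sgl m c)" and "\<And>f g. P f \<Longrightarrow> P g \<Longrightarrow> P (f + g)"
 shows "P f"
proof -
 have "P (\<Sum>m\<in>S. sgl m (lkp f m))" if "finite S" for S
  using that
 proof (induction S rule: finite_induct)
  case empty
  show ?case using assms(1)[of undefined 0] by simp
 qed (auto intro: assms)
 then show ?thesis using poly_mapping_sum_single[of f] by (metis finite_keys)
qed

definition linext :: "('k \<Rightarrow> 'b \<Rightarrow> 'c) \<Rightarrow> ('k \<Rightarrow>\<^sub>0 'b::comm_monoid_add) \<Rightarrow> 'c::comm_monoid_add" where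
 "linext F f = (\<Sum>m\<in>kys f. F m (lkp f m))"

lemma linext_superset:
 assumes "\<And>m. F m 0 = 0" "finite S" "kys f \<subseteq> S"
 shows "linext F f = (\<Sum>m\<in>S. F m (lkp f m))"
 unfolding linext_def using assms by (intro sum.mono_neutral_left) (auto simp: in_keys_iff)

lemma linext_single: "F m 0 = 0 \<Longrightarrow> linext F (sgl m c) = F m c"
 by (cases "c = 0") (auto simp: linext_def)

lemma linext_add:
 assumes z: "\<And>m. F m 0 = 0" and a: "\<And>m a b. F m (a + b) = F m a + F m b"
 shows "linext F (f + g) = linext F f + linext F g"
proof -
 have *: "linext F h = (\<Sum>m\<in>kys f \<union> kys g. F m (lkp h m))" if "kys h \<subseteq> kys f \<union> kys g" for h
  using linext_superset[where F = F, OF z _ that] by simp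
 show ?thesis using keys_add[of f g] by (simp add: * lookup_add a sum.distrib)
qed

definition pmap :: "('k \<Rightarrow> 'l) \<Rightarrow> ('k \<Rightarrow>\<^sub>0 'b::comm_monoid_add) \<Rightarrow> ('l \<Rightarrow>\<^sub>0 'b)" where
 "pmap h = linext (\<lambda>m c. sgl (h m) c)"

lemma pmap_single [simp]: "pmap h (sgl m c) = sgl (h m) c"
 by (simp add: pmap_def linext_single)

lemma pmap_add: "pmap h (f + g) = pmap h f + pmap h g"
 by (simp add: pmap_def linext_add single_add)

lemma pmap_0 [simp]: "pmap h 0 = 0"
 by (simp add: pmap_def linext_def)

lemma pmap_sum: "pmap h (sum f S) = (\<Sum>x\<in>S. pmap h (f x))"
 by (induction S rule: infinite_finite_induct) (auto simp: pmap_add)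

lemma pmap_uminus: "pmap h (- f) = - pmap h (f :: 'k \<Rightarrow>\<^sub>0 'b::ab_group_add)"
 using pmap_add[of h f "- f"] by (simp add: eq_neg_iff_add_eq_0 add.commute)

lemma pmap_diff: "pmap h (f - g) = pmap h f - pmap h (g :: 'k \<Rightarrow>\<^sub>0 'b::ab_group_add)"
 using pmap_add[of h f "- g"] by (simp add: pmap_uminus)

lemma pmap_mult:
 fixes f g :: "'k::monoid_add \<Rightarrow>\<^sub>0 'b::semiring_0"
 assumes "\<And>a b. h (a + b) = h a + h b"
 shows "pmap h (f * g) = pmap h f * pmap h g"
proof (induction f rule: poly_mapping_induct)
 case (single m c)
 show ?case
  by (induction g rule: poly_mapping_induct) (auto simp: mult_single assms pmap_add algebra_simps)
qed (auto simp: pmap_add algebra_simps)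

lemma pmap_1: "h 0 = 0 \<Longrightarrow> pmap h (1 :: 'k::zero \<Rightarrow>\<^sub>0 'b::{comm_monoid_add,zero_neq_one}) = 1"
 by (simp flip: single_one)

lemma pmap_prod:
 fixes f :: "'x \<Rightarrow> ('k::comm_monoid_add \<Rightarrow>\<^sub>0 'b::comm_semiring_1)"
 assumes "\<And>a b. h (a + b) = h a + h b" "h 0 = 0"
 shows "pmap h (prod f S) = (\<Prod>x\<in>S. pmap h (f x))"
 by (induction S rule: infinite_finite_induct) (auto simp: pmap_mult[of h, OF assms(1)] pmap_1 assms)

lemma pmap_power:
 fixes f :: "'k::comm_monoid_add \<Rightarrow>\<^sub>0 'b::comm_semiring_1"
 assumes "\<And>a b. h (a + b) = h a + h b" "h 0 = 0"
 shows "pmap h (f ^ n) = pmap h f ^ n"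
 by (induction n) (auto simp: pmap_mult[of h, OF assms(1)] pmap_1 assms)

lemma lookup_pmap_inj:
 assumes "inj h" shows "lkp (pmap h f) (h m) = lkp f m"
 by (induction f rule: poly_mapping_induct)
   (use assms in \<open>auto simp: pmap_add lookup_add lookup_single inj_eq when_def\<close>)

section \<open>Diagonal operators\<close>

text \<open>
 Euler operators, and all symmetric functions of them, multiply each monomial by a number which
 depends on its exponent.\<close>

definition dgn :: "('k \<Rightarrow> 'b) \<Rightarrow> ('k \<Rightarrow>\<^sub>0 'b::mult_zero) \<Rightarrow> ('k \<Rightarrow>\<^sub>0 'b)" where
 "dgn w f = Abs_poly_mapping (\<lambda>m. w m * lkp f m)"

lemma lookup_dgn [simp]: "lkp (dgn w f) m = w m * lkp f m"
proof -
 have "finite {m. w m * lkp f m \<noteq> 0}"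
  by (rule finite_subset[of _ "kys f"]) (auto simp: in_keys_iff)
 then show ?thesis by (simp add: dgn_def)
qed

lemma dgn_single [simp]: "dgn w (sgl m c) = sgl m (w m * c)"
 by (rule poly_mapping_eqI) (auto simp: lookup_single when_def)

lemma dgn_add: "dgn w (f + g) = dgn w f + dgn w (g :: 'k \<Rightarrow>\<^sub>0 'b::semiring_0)"
 by (rule poly_mapping_eqI) (auto simp: lookup_add algebra_simps)

lemma dgn_0 [simp]: "dgn w 0 = 0"
 by (rule poly_mapping_eqI) auto

lemma dgn_sum: "dgn w (sum f S) = (\<Sum>x\<in>S. dgn w (f x :: 'k \<Rightarrow>\<^sub>0 'b::semiring_0))"
 by (induction S rule: infinite_finite_induct) (auto simp: dgn_add)

lemma dgn_cmult: "dgn w (sgl 0 c * f) = sgl 0 c * dgn w (f :: 'k::monoid_add \<Rightarrow>\<^sub>0 'b::comm_semiring_0)"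
 by (induction f rule: poly_mapping_induct) (auto simp: dgn_add mult_single algebra_simps)

lemma dgn_deriv:
 fixes f g :: "'k::monoid_add \<Rightarrow>\<^sub>0 'b::comm_semiring_0"
 assumes "\<And>a b. w (a + b) = w a + w b"
 shows "dgn w (f * g) = dgn w f * g + f * dgn w g"
proof (induction f rule: poly_mapping_induct)
 case (single m c)
 show ?case
  by (induction g rule: poly_mapping_induct)
    (auto simp: mult_single assms dgn_add algebra_simps simp flip: single_add)
qed (auto simp: dgn_add algebra_simps)

lemma dgn_shift:
 fixes f :: "'k::monoid_add \<Rightarrow>\<^sub>0 'b::comm_semiring_0"
 shows "dgn w (sgl a c * f) = sgl a c * dgn (\<lambda>m. w (a + m)) f"
 by (induction f rule: poly_mapping_induct) (auto simp: dgn_add mult_single algebra_simps)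

lemma lookup_cmult: "lkp (sgl 0 c * f) m = c * lkp (f :: 'k::monoid_add \<Rightarrow>\<^sub>0 'b::semiring_0) m"
 by (induction f rule: poly_mapping_induct)
   (auto simp: mult_single lookup_add lookup_single algebra_simps when_def)

lemma lookup_single_times:
 fixes f :: "'k::cancel_comm_monoid_add \<Rightarrow>\<^sub>0 'b::semiring_0"
 shows "lkp (sgl a c * f) (a + m) = c * lkp f m"
 by (induction f rule: poly_mapping_induct)
   (auto simp: mult_single lookup_add lookup_single distrib_left when_def)

lemma lookup_single_times_notin:
 fixes f :: "'k::monoid_add \<Rightarrow>\<^sub>0 'b::semiring_0"
 shows "(\<And>k. m \<noteq> a + k) \<Longrightarrow> lkp (sgl a c * f) m = 0"
 by (induction f rule: poly_mapping_induct)
   (auto simp: mult_single lookup_add lookup_single algebra_simps when_def)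

section \<open>Polynomials, evaluation, Euler operators\<close>

type_synonym expo = "nat \<Rightarrow>\<^sub>0 nat"

definition theta :: "nat \<Rightarrow> mpol \<Rightarrow> mpol" where
 "theta i = dgn (\<lambda>m. of_nat (lkp m i))"

lemma partial_deriv_linext:
 "partial_deriv i = linext (\<lambda>m c. sgl (m - sgl i 1) (of_nat (lkp m i) * c))"
 by (rule ext) (simp add: partial_deriv_def linext_def)

lemma partial_deriv_add: "partial_deriv i (f + g) = partial_deriv i f + partial_deriv i g"
 by (simp add: partial_deriv_linext linext_add algebra_simps single_add)

lemma partial_deriv_single:
 "partial_deriv i (sgl m c) = sgl (m - sgl i 1) (of_nat (lkp m i) * c)"
 by (simp add: partial_deriv_linext linext_single)

lemma theta_eq: "var i * partial_deriv i f = theta i f"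
proof (induction f rule: poly_mapping_induct)
 case (single m c)
 have "sgl i 1 + (m - sgl i 1) = m" if "lkp m i \<noteq> 0"
  using that by (intro poly_mapping_eqI) (auto simp: lookup_add lookup_minus lookup_single when_def)
 then show ?case
  by (cases "lkp m i = 0") (auto simp: partial_deriv_single var_def mult_single theta_def)
qed (auto simp: partial_deriv_add theta_def dgn_add algebra_simps)

lemma theta_mult: "theta i (f * g) = theta i f * g + f * theta i g"
 unfolding theta_def by (rule dgn_deriv) (auto simp: lookup_add)

lemma theta_add: "theta i (f + g) = theta i f + theta i g"
 by (simp add: theta_def dgn_add)
lemma theta_sum: "theta i (sum f S) = (\<Sum>x\<in>S. theta i (f x))"
 by (simp add: theta_def dgn_sum)
lemma theta_cmult: "theta i (const_pol c * f) = const_pol c * theta i f"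
 by (simp add: theta_def const_pol_def dgn_cmult)

lemma theta_single: "theta i (sgl m c) = sgl m (of_nat (lkp m i) * c)"
 by (simp add: theta_def)

lemma theta_0 [simp]: "theta i 0 = 0" by (simp add: theta_def)

lemma theta_const [simp]: "theta i (const_pol c) = 0"
 by (simp add: const_pol_def theta_single)

lemma theta_1 [simp]: "theta i 1 = 0"
 using theta_const[of i 1] by (simp add: const_pol_def)

lemma theta_var: "theta i (var j) = (if i = j then var j else 0)"
 by (auto simp: var_def theta_single lookup_single)

lemma theta_prod:
 "finite S \<Longrightarrow> theta i (\<Prod>x\<in>S. f x) = (\<Sum>x\<in>S. theta i (f x) * (\<Prod>y\<in>S - {x}. f y))"
proof (induction S rule: finite_induct)
 case (insert a S)
 have "(\<Sum>x\<in>S. theta i (f x) * (\<Prod>y\<in>insert a S - {x}. f y))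
   = f a * (\<Sum>x\<in>S. theta i (f x) * (\<Prod>y\<in>S - {x}. f y))"
  unfolding sum_distrib_left
 proof (rule sum.cong[OF refl])
  fix x assume "x \<in> S"
  then have "insert a S - {x} = insert a (S - {x})" using insert by auto
  then show "theta i (f x) * (\<Prod>y\<in>insert a S - {x}. f y) = f a * (theta i (f x) * (\<Prod>y\<in>S - {x}. f y))"
   using insert by (simp add: algebra_simps)
 qed
 then show ?case using insert by (simp add: theta_mult)
qed auto

lemma theta_power_Suc: "theta i (f ^ Suc k) = of_nat (Suc k) * f ^ k * theta i f"
 by (induction k) (auto simp: theta_mult distrib_left distrib_right mult.assoc mult.left_commute)

definition mev :: "point \<Rightarrow> expo \<Rightarrow> complex" where
 "mev x m = (\<Prod>i\<in>kys m. x i ^ lkp m i)"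

lemma mev_superset: "finite S \<Longrightarrow> kys m \<subseteq> S \<Longrightarrow> mev x m = (\<Prod>i\<in>S. x i ^ lkp m i)"
 unfolding mev_def by (intro prod.mono_neutral_left) (auto simp: in_keys_iff)

lemma mev_0 [simp]: "mev x 0 = 1" by (simp add: mev_def)

lemma mev_add: "mev x (a + b) = mev x a * mev x b"
 using keys_add[of a b]
 by (subst (1 2 3) mev_superset[of "kys a \<union> kys b"]) (auto simp: lookup_add power_add prod.distrib)

lemma eval_pol_linext: "eval_pol f x = linext (\<lambda>m c. c * mev x m) f"
 by (simp add: eval_pol_def linext_def mev_def)

lemma eval_add [simp]: "eval_pol (f + g) x = eval_pol f x + eval_pol g x"
 by (simp add: eval_pol_linext linext_add algebra_simps)

lemma eval_single: "eval_pol (sgl m c) x = c * mev x m"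
 by (simp add: eval_pol_linext linext_single)

lemma eval_const [simp]: "eval_pol (const_pol c) x = c"
 by (simp add: const_pol_def eval_single)

lemma eval_0 [simp]: "eval_pol 0 x = 0" by (simp add: eval_pol_def)

lemma eval_1 [simp]: "eval_pol 1 x = 1" using eval_single[of 0 1 x] by simp

lemma eval_mult [simp]: "eval_pol (f * g) x = eval_pol f x * eval_pol g x"
proof (induction f rule: poly_mapping_induct)
 case (single m c)
 show ?case
  by (induction g rule: poly_mapping_induct) (auto simp: mult_single eval_single mev_add algebra_simps)
qed (auto simp: algebra_simps)

lemma eval_uminus [simp]: "eval_pol (- f) x = - eval_pol f x"
 using eval_add[of f "- f" x] by (simp add: eq_neg_iff_add_eq_0 add.commute)

lemma eval_diff [simp]: "eval_pol (f - g) x = eval_pol f x - eval_pol g x"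
 using eval_add[of f "- g" x] by simp

lemma eval_sum [simp]: "eval_pol (sum f S) x = (\<Sum>s\<in>S. eval_pol (f s) x)"
 by (induction S rule: infinite_finite_induct) auto

lemma eval_prod [simp]: "eval_pol (prod f S) x = (\<Prod>s\<in>S. eval_pol (f s) x)"
 by (induction S rule: infinite_finite_induct) auto

lemma eval_power [simp]: "eval_pol (f ^ k) x = eval_pol f x ^ k"
 by (induction k) auto

lemma eval_of_int [simp]: "eval_pol (of_int k) x = of_int k"
proof -
 have "(of_int k :: mpol) = const_pol (of_int k)" by (simp add: const_pol_def)
 then show ?thesis by simp
qed

lemma mev_sgl: "mev x (sgl i k) = x i ^ k"
 by (cases "k = 0") (auto simp: mev_def)

lemma eval_var [simp]: "eval_pol (var i) x = x i"
 by (simp add: var_def eval_single mev_sgl)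

lemma const_pol_0 [simp]: "const_pol 0 = 0" by (simp add: const_pol_def)
lemma const_pol_1 [simp]: "const_pol 1 = 1" by (simp add: const_pol_def)
lemma const_pol_add: "const_pol (a + b) = const_pol a + const_pol b" by (simp add: const_pol_def single_add)
lemma const_pol_mult: "const_pol (a * b) = const_pol a * const_pol b" by (simp add: const_pol_def mult_single)
lemma const_pol_diff: "const_pol (a - b) = const_pol a - const_pol b" by (simp add: const_pol_def single_diff)
lemma const_pol_uminus: "const_pol (- a) = - const_pol a" by (simp add: const_pol_def single_uminus)
lemma const_pol_sum: "const_pol (sum f S) = (\<Sum>x\<in>S. const_pol (f x))"
 by (induction S rule: infinite_finite_induct) (auto simp: const_pol_add)
lemma const_pol_of_int: "const_pol (of_int k) = of_int k" by (simp add: const_pol_def)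
lemma const_pol_of_nat: "const_pol (of_nat k) = of_nat k" by (simp add: const_pol_def)

lemma lookup_const_mult [simp]: "lkp (const_pol c * f) m = c * lkp f m"
 by (simp add: const_pol_def lookup_cmult)

lemma lookup_of_int_mult: "lkp (of_int k * f) m = of_int k * lkp (f::mpol) m"
 by (simp flip: const_pol_of_int)

section \<open>Symmetric polynomials\<close>

lemma lookup_map_key: "inj sig \<Longrightarrow> lkp (mkey sig m) i = lkp m (sig i)"
 by (simp add: map_key.rep_eq)

definition act :: "natfun \<Rightarrow> mpol \<Rightarrow> mpol" where
 "act sig = pmap (mkey sig)"

lemma map_key_add: "inj sig \<Longrightarrow>
  mkey sig (a + b) = mkey sig a + mkey sig (b :: expo)"
 by (rule poly_mapping_eqI) (auto simp: lookup_add lookup_map_key)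

lemma act_mult: "sig permutes S \<Longrightarrow> act sig (f * g) = act sig f * act sig g"
 unfolding act_def by (rule pmap_mult) (simp add: map_key_add permutes_inj)

lemma act_add: "act sig (f + g) = act sig f + act sig g"
 by (simp add: act_def pmap_add)

lemma map_key_bij: assumes "sig permutes S"
 shows "mkey sig (mkey (inv_into UNIV sig) m) = m"
  "mkey (inv_into UNIV sig) (mkey sig m) = m"
 using assms permutes_inj[OF assms] permutes_inj[OF permutes_inv[OF assms]] permutes_inverses[OF assms]
 by (auto intro!: poly_mapping_eqI simp: lookup_map_key)

lemma lookup_act: assumes "sig permutes S"
 shows "lkp (act sig f) (mkey sig m) = lkp f m"
 unfolding act_def by (rule lookup_pmap_inj) (metis injI map_key_bij(2)[OF assms])

definition vars_in :: "nat \<Rightarrow> mpol \<Rightarrow> bool" where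
 "vars_in n f \<longleftrightarrow> (\<forall>m\<in>kys f. kys m \<subseteq> {..<n})"

lemma sympol_iff: "f \<in> sympol n \<longleftrightarrow> vars_in n f \<and> (\<forall>sig. sig permutes {..<n} \<longrightarrow> act sig f = f)"
proof -
 have "(\<forall>m. lkp f (mkey sig m) = lkp f m) \<longleftrightarrow> act sig f = f" if "sig permutes {..<n}" for sig
  using lookup_act[OF that, of f] map_key_bij[OF that]
  by (metis poly_mapping_eqI)
 then show ?thesis by (auto simp: sympol_def vars_in_def)
qed

lemma vars_in_add: "vars_in n f \<Longrightarrow> vars_in n g \<Longrightarrow> vars_in n (f + g)"
 unfolding vars_in_def using keys_add[of f g] by blast

lemma vars_in_mult: "vars_in n f \<Longrightarrow> vars_in n g \<Longrightarrow> vars_in n (f * g)"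
 unfolding vars_in_def using keys_mult[of f g] keys_add
 by (fastforce dest: subsetD[OF keys_add] subsetD[OF keys_mult])

lemma vars_in_0 [simp]: "vars_in n 0" by (simp add: vars_in_def)
lemma vars_in_const [simp]: "vars_in n (const_pol c)"
 by (cases "c = 0") (auto simp: vars_in_def const_pol_def)
lemma vars_in_var: "i < n \<Longrightarrow> vars_in n (var i)"
 by (auto simp: vars_in_def var_def)
lemma vars_in_sum: "(\<And>s. s \<in> S \<Longrightarrow> vars_in n (f s)) \<Longrightarrow> vars_in n (sum f S)"
 by (induction S rule: infinite_finite_induct) (auto intro: vars_in_add)
lemma vars_in_1 [simp]: "vars_in n 1" using vars_in_const[of n 1] by simp
lemma vars_in_prod: "(\<And>s. s \<in> S \<Longrightarrow> vars_in n (f s)) \<Longrightarrow> vars_in n (prod f S)"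
 by (induction S rule: infinite_finite_induct) (auto intro: vars_in_mult)
lemma vars_in_uminus: "vars_in n f \<Longrightarrow> vars_in n (- f)"
 by (simp add: vars_in_def)
lemma vars_in_dgn: "vars_in n f \<Longrightarrow> vars_in n (dgn w f)"
 by (auto simp: vars_in_def in_keys_iff)

lemma map_key_0: "inj sig \<Longrightarrow> mkey sig (0 :: expo) = 0"
 by (rule poly_mapping_eqI) (simp add: lookup_map_key)

lemma act_const: "sig permutes S \<Longrightarrow> act sig (const_pol c) = const_pol c"
 by (simp add: act_def const_pol_def map_key_0 permutes_inj)

lemma act_sum: "act sig (sum f S) = (\<Sum>x\<in>S. act sig (f x))" by (simp add: act_def pmap_sum)

lemma act_var: assumes "sig permutes S" shows "act sig (var i) = var (inv_into UNIV sig i)"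
proof -
 have "mkey sig (sgl i 1) = sgl (inv_into UNIV sig i) (1::nat)"
  using assms by (intro poly_mapping_eqI)
   (auto simp: lookup_map_key permutes_inj lookup_single when_def permutes_inverses)
 then show ?thesis by (simp add: act_def var_def)
qed

lemma sympol_add: "f \<in> sympol n \<Longrightarrow> g \<in> sympol n \<Longrightarrow> f + g \<in> sympol n"
 by (simp add: sympol_iff vars_in_add act_add)
lemma sympol_mult: "f \<in> sympol n \<Longrightarrow> g \<in> sympol n \<Longrightarrow> f * g \<in> sympol n"
 by (simp add: sympol_iff vars_in_mult act_mult)
lemma sympol_const [simp]: "const_pol c \<in> sympol n" by (auto simp: sympol_iff act_const)
lemma sympol_0 [simp]: "0 \<in> sympol n" using sympol_const[of 0 n] by simp
lemma sympol_1 [simp]: "1 \<in> sympol n" using sympol_const[of 1 n] by simp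
lemma sympol_cmult: "f \<in> sympol n \<Longrightarrow> const_pol c * f \<in> sympol n" by (simp add: sympol_mult)
lemma sympol_uminus: "f \<in> sympol n \<Longrightarrow> - f \<in> sympol n"
 using sympol_cmult[of f n "-1"] by (simp add: const_pol_uminus)
lemma sympol_diff: "f \<in> sympol n \<Longrightarrow> g \<in> sympol n \<Longrightarrow> f - g \<in> sympol n"
 using sympol_add[of f n "- g"] sympol_uminus by simp
lemma sympol_sum: "(\<And>s. s \<in> S \<Longrightarrow> f s \<in> sympol n) \<Longrightarrow> sum f S \<in> sympol n"
 by (induction S rule: infinite_finite_induct) (auto intro: sympol_add)

lemma sympol_lookup_map_key: "f \<in> sympol n \<Longrightarrow> sig permutes {..<n} \<Longrightarrow> lkp f (mkey sig m) = lkp f m"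
 by (simp add: sympol_def)

lemma sympol_keys: "f \<in> sympol n \<Longrightarrow> m \<in> kys f \<Longrightarrow> kys m \<subseteq> {..<n}"
 by (simp add: sympol_def)

lemma act_dgn:
 assumes "sig permutes S" "\<And>m. w (mkey sig m) = w' m"
 shows "act sig (dgn w' f) = dgn w (act sig f)"
proof (induction f rule: poly_mapping_induct)
 case (single m c) show ?case by (simp add: act_def assms(2))
qed (simp add: act_add dgn_add)

section \<open>Determinants as permutation sums\<close>

text \<open>
 The determinant with an explicit size and entries given by a function on all of \<open>nat\<close>,
 so that entries may live in rings of polynomials or power series and sizes need no carriers.\<close>

definition dt :: "nat \<Rightarrow> (nat \<Rightarrow> nat \<Rightarrow> 'a::comm_ring_1) \<Rightarrow> 'a" where
 "dt n M = (\<Sum>sig | sig permutes {..<n}. of_int (sign sig) * (\<Prod>i<n. M i (sig i)))"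

lemma dt_det: "dt n M = Determinant.det (Matrix.mat n n (\<lambda>(i,j). M i j))"
 unfolding dt_def by (subst det_def'[of _ n])
  (auto simp: atLeast0LessThan intro!: sum.cong prod.cong arg_cong2[where f="(*)"] dest: permutes_in_image[of _ "{..<n}"])

lemma dt_mult: "dt n (\<lambda>i j. \<Sum>k<n. A i k * B k j) = dt n A * dt n B"
proof -
 have "Matrix.mat n n (\<lambda>(i,j). \<Sum>k<n. A i k * B k j)
   = Matrix.mat n n (\<lambda>(i,j). A i j) * Matrix.mat n n (\<lambda>(i,j). B i j)"
  by (rule eq_matI) (auto simp: scalar_prod_def atLeast0LessThan)
 then show ?thesis unfolding dt_det by (subst det_mult[symmetric, of _ n]) auto
qed

lemma dt_transpose: "dt n (\<lambda>i j. M j i) = dt n M"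
proof -
 have "Matrix.mat n n (\<lambda>(i,j). M j i) = transpose_mat (Matrix.mat n n (\<lambda>(i,j). M i j))"
  by (rule eq_matI) auto
 then show ?thesis unfolding dt_det using det_transpose[of "Matrix.mat n n (\<lambda>(i,j). M i j)" n] by simp
qed

lemma dt_cong: "(\<And>i j. i < n \<Longrightarrow> j < n \<Longrightarrow> A i j = B i j) \<Longrightarrow> dt n A = dt n B"
 unfolding dt_def by (intro sum.cong prod.cong arg_cong2[where f="(*)"]) (auto dest: permutes_in_image[of _ "{..<n}"])

lemma dt_upper: assumes "\<And>i j. j < i \<Longrightarrow> i < n \<Longrightarrow> M i j = 0" shows "dt n M = (\<Prod>i<n. M i i)"
 unfolding dt_det using assms
 by (subst det_upper_triangular[of _ n]) (auto simp: prod_list_diag_prod atLeast0LessThan)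

lemma dt_lower: assumes "\<And>i j. i < j \<Longrightarrow> j < n \<Longrightarrow> M i j = 0" shows "dt n M = (\<Prod>i<n. M i i)"
 using dt_upper[of n "\<lambda>i j. M j i"] assms by (simp add: dt_transpose[of n M])

lemma dt_scale_rows: "dt n (\<lambda>i j. c i * M i j) = (\<Prod>i<n. c i) * dt n M"
 by (simp add: dt_def prod.distrib sum_distrib_left algebra_simps)

lemma rho_bij: "bij_betw (rho n) {..<n} {..<n}"
 by (rule bij_betw_byWitness[where f' = "rho n"]) (auto simp: rho_def)

lemma sum_rho: "(\<Sum>s<n. f (rho n s)) = (\<Sum>r<n. f r)"
 using sum.reindex_bij_betw[OF rho_bij] by metis

lemma rho_inj: "i < n \<Longrightarrow> j < n \<Longrightarrow> rho n i = rho n j \<longleftrightarrow> i = j"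
 by (auto simp: rho_def)

lemma coeff_linear_prod:
 fixes x :: "nat \<Rightarrow> 'a::comm_ring_1"
 assumes "finite S"
 shows "coeff (\<Prod>k\<in>S. [:- x k, 1:]) (card S) = 1 \<and> (\<forall>r>card S. coeff (\<Prod>k\<in>S. [:- x k, 1:]) r = 0)"
 using assms
proof (induction S rule: finite_induct)
 case empty then show ?case by (auto simp: coeff_eq_0)
next
 case (insert a S)
 have "coeff (\<Prod>k\<in>insert a S. [:- x k, 1:]) r =
   (case r of 0 \<Rightarrow> 0 | Suc r' \<Rightarrow> coeff (\<Prod>k\<in>S. [:- x k, 1:]) r') - x a * coeff (\<Prod>k\<in>S. [:- x k, 1:]) r" for r
  using insert by (simp add: coeff_pCons)
 then show ?case using insert by (auto split: nat.splits)
qed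

lemma poly_eq_sum:
 assumes "\<And>r. r \<ge> n \<Longrightarrow> coeff p r = 0"
 shows "poly p (z::'a::comm_ring_1) = (\<Sum>r<n. coeff p r * z ^ r)"
proof (cases "degree p < n")
 case True
 have "poly p z = (\<Sum>r\<le>degree p. coeff p r * z ^ r)" by (rule poly_altdef)
 also have "\<dots> = (\<Sum>r<n. coeff p r * z ^ r)"
  by (rule sum.mono_neutral_left) (use True in \<open>auto simp: coeff_eq_0\<close>)
 finally show ?thesis .
next
 case False
 then have "p = 0" using assms[of "degree p"] by (metis leading_coeff_0_iff not_less)
 then show ?thesis by simp
qed

text \<open>
 Column operations: the monomials \<open>z\<close>-to-the-\<open>(n - 1 - j)\<close> may be
 replaced by the monic polynomials \<open>\<Prod>\<^bsub>k>j\<^esub> (z - x\<^sub>k)\<close> of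
 the same degrees, which make the matrix triangular.\<close>

lemma vandermonde:
 fixes x :: "nat \<Rightarrow> 'a::comm_ring_1"
 shows "dt n (\<lambda>i j. x i ^ rho n j) = (\<Prod>j<n. \<Prod>i<j. x i - x j)"
proof -
 \<comment> \<open>
  monic of degree \<open>rho n j\<close>, and zero at the points \<open>x\<^sub>k\<close> with
  \<open>k > j\<close>\<close>
 define p where "p j = (\<Prod>k\<in>{j<..<n}. [:- x k, 1:])" for j
 have card: "card {j<..<n} = rho n j" if "j < n" for j using that by (simp add: rho_def)
 have top: "coeff (p j) (rho n j) = 1" "\<And>r. r > rho n j \<Longrightarrow> coeff (p j) r = 0" if "j < n" for j
  using coeff_linear_prod[of "{j<..<n}" x] card[OF that] by (auto simp: p_def)
 have "poly (p j) (x i) = (\<Sum>s<n. x i ^ rho n s * coeff (p j) (rho n s))" if "j < n" for i j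
 proof -
  have "poly (p j) (x i) = (\<Sum>r<n. coeff (p j) r * x i ^ r)"
   using that by (intro poly_eq_sum top(2)) (auto simp: rho_def)
  then show ?thesis by (subst (asm) sum_rho[symmetric]) (simp add: mult.commute)
 qed
 then have "dt n (\<lambda>i j. poly (p j) (x i)) = dt n (\<lambda>i j. \<Sum>s<n. x i ^ rho n s * coeff (p j) (rho n s))"
  by (intro dt_cong) auto
 also have "\<dots> = dt n (\<lambda>i j. x i ^ rho n j) * dt n (\<lambda>s j. coeff (p j) (rho n s))"
  by (rule dt_mult)
 also have "dt n (\<lambda>s j. coeff (p j) (rho n s)) = 1"
 proof (subst dt_lower)
  fix i j assume "i < j" "j < n"
  then show "coeff (p j) (rho n i) = 0" by (intro top(2)) (auto simp: rho_def)
 next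
  show "(\<Prod>i<n. coeff (p i) (rho n i)) = 1" by (intro prod.neutral) (simp add: top(1))
 qed
 finally have "dt n (\<lambda>i j. x i ^ rho n j) = dt n (\<lambda>i j. poly (p j) (x i))" by simp
 also have "\<dots> = (\<Prod>i<n. poly (p i) (x i))"
 proof (rule dt_upper)
  fix i j assume "j < i" "i < n"
  then have "(\<Prod>k\<in>{j<..<n}. x i - x k) = 0" by (intro prod_zero) auto
  then show "poly (p j) (x i) = 0" by (simp add: p_def poly_prod)
 qed
 also have "\<dots> = (\<Prod>i<n. \<Prod>j\<in>{i<..<n}. x i - x j)"
  by (simp add: p_def poly_prod)
 also have "\<dots> = (\<Prod>j<n. \<Prod>i<j. x i - x j)"
  unfolding prod.Sigma[OF finite_lessThan ballI[OF finite_greaterThanLessThan]]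
   prod.Sigma[OF finite_lessThan ballI[OF finite_lessThan]]
  by (rule prod.reindex_bij_witness[of _ "\<lambda>(a,b). (b,a)" "\<lambda>(a,b). (b,a)"]) auto
 finally show ?thesis .
qed

text \<open>
 All the \<open>x\<^sub>i\<close> are roots of the single monic polynomial
 \<open>\<Prod>(z - x\<^sub>k)\<close>, so reducing a power modulo it gives coefficients which do
 not depend on \<open>i\<close>.\<close>

lemma power_reduce:
 fixes x :: "nat \<Rightarrow> 'a::comm_ring_1"
 shows "\<exists>c. \<forall>i<n. x i ^ b = (\<Sum>s<n. c s * x i ^ s)"
proof (induction b)
 case 0
 show ?case
 proof (cases "n = 0")
  case False
  have "(\<Sum>s<n. (if s = 0 then 1 else 0) * x i ^ s) = 1" for i
   using False by (subst sum.remove[of _ 0]) auto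
  then show ?thesis by (intro exI[of _ "\<lambda>s. if s = 0 then 1 else 0"]) auto
 qed auto
next
 case (Suc b)
 then obtain c where c: "\<And>i. i < n \<Longrightarrow> x i ^ b = (\<Sum>s<n. c s * x i ^ s)" by blast
 show ?case
 proof (cases n)
  case (Suc n')
  define p where "p = (\<Prod>k\<in>{..<n}. [:- x k, 1:])"
  have p: "coeff p n = 1" "\<And>r. r > n \<Longrightarrow> coeff p r = 0"
   using coeff_linear_prod[of "{..<n}" x] by (auto simp: p_def)
  have pw: "x i ^ n = - (\<Sum>s<n. coeff p s * x i ^ s)" if "i < n" for i
  proof -
   have "poly p (x i) = (\<Prod>k<n. x i - x k)" by (simp add: p_def poly_prod)
   also have "\<dots> = 0" using that by (intro prod_zero) auto
   finally have "(\<Sum>s<Suc n. coeff p s * x i ^ s) = 0"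
    using poly_eq_sum[of "Suc n" p "x i"] p by auto
   then show ?thesis using p by (simp add: eq_neg_iff_add_eq_0 add.commute)
  qed
  \<comment> \<open>shift the coefficients, then replace the power \<open>n\<close> by lower ones\<close>
  define c' where "c' s = (if s = 0 then 0 else c (s - 1)) - c n' * coeff p s" for s
  have "x i ^ Suc b = (\<Sum>s<n. c' s * x i ^ s)" if "i < n" for i
  proof -
   have "x i ^ Suc b = (\<Sum>s<n. c s * x i ^ Suc s)" using c[OF that] by (simp add: sum_distrib_left algebra_simps)
   also have "\<dots> = (\<Sum>s<n'. c s * x i ^ Suc s) + c n' * x i ^ n" using Suc by simp
   also have "(\<Sum>s<n'. c s * x i ^ Suc s) = (\<Sum>s<n. (if s = 0 then 0 else c (s - 1)) * x i ^ s)"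
    unfolding Suc by (subst sum.lessThan_Suc_shift) simp
   finally show ?thesis unfolding pw[OF that] c'_def
    by (simp add: sum_distrib_left algebra_simps sum_subtractf)
  qed
  then show ?thesis by blast
 qed auto
qed

text \<open>
 By \<open>power_reduce\<close> the matrix of the alternant is the Vandermonde matrix times another
 matrix.\<close>

lemma vandermonde_dvd_alternant:
 fixes x :: "nat \<Rightarrow> 'a::comm_ring_1"
 shows "dt n (\<lambda>i j. x i ^ rho n j) dvd dt n (\<lambda>i j. x i ^ \<beta> j)"
proof -
 have "\<forall>b. \<exists>c. \<forall>i<n. x i ^ b = (\<Sum>s<n. c s * x i ^ s)" using power_reduce by blast
 then obtain c where c: "\<And>b i. i < n \<Longrightarrow> x i ^ b = (\<Sum>s<n. c b s * x i ^ s)" by metis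
 have "dt n (\<lambda>i j. x i ^ \<beta> j) = dt n (\<lambda>i j. \<Sum>s<n. x i ^ rho n s * c (\<beta> j) (rho n s))"
 proof (rule dt_cong)
  fix i j assume "i < n" "j < n"
  then show "x i ^ \<beta> j = (\<Sum>s<n. x i ^ rho n s * c (\<beta> j) (rho n s))"
   unfolding sum_rho[of "\<lambda>s. x i ^ s * c (\<beta> j) s"] using c[of i "\<beta> j"] by (simp add: mult.commute)
 qed
 also have "\<dots> = dt n (\<lambda>i j. x i ^ rho n j) * dt n (\<lambda>s j. c (\<beta> j) (rho n s))"
  by (rule dt_mult)
 finally show ?thesis by simp
qed

section \<open>Alternants\<close>

definition pm :: "nat \<Rightarrow> natfun \<Rightarrow> expo" where
 "pm n r = Abs_poly_mapping (\<lambda>i. if i < n then r i else 0)"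

lemma lookup_pm [simp]: "lkp (pm n r) i = (if i < n then r i else 0)"
proof -
 have "finite {i. (if i < n then r i else 0) \<noteq> 0}" by (rule finite_subset[of _ "{..<n}"]) auto
 then show ?thesis by (simp add: pm_def)
qed

lemma keys_pm: "kys (pm n r) \<subseteq> {..<n}" by (auto simp: in_keys_iff split: if_splits)

lemma pm_cong: "(\<And>i. i < n \<Longrightarrow> r i = r' i) \<Longrightarrow> pm n r = pm n r'"
 by (rule poly_mapping_eqI) auto

lemma pm_lkp: "kys m \<subseteq> {..<n} \<Longrightarrow> pm n (lkp m) = m"
 by (rule poly_mapping_eqI) (auto simp: in_keys_iff subset_iff)

lemma pm_add: "pm n r + pm n s = pm n (\<lambda>i. r i + s i)"
 by (rule poly_mapping_eqI) (auto simp: lookup_add)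

lemma map_key_pm: assumes "sig permutes {..<n}"
 shows "mkey sig (pm n r) = pm n (r \<circ> sig)"
 using permutes_in_image[OF assms]
 by (intro poly_mapping_eqI) (auto simp: lookup_map_key permutes_inj[OF assms])

definition mon :: "nat \<Rightarrow> natfun \<Rightarrow> mpol" where "mon n r = sgl (pm n r) 1"

lemma var_power: "var i ^ k = sgl (sgl i k) 1"
 by (induction k) (auto simp: var_def mult_single simp flip: single_add)

lemma prod_var: "finite S \<Longrightarrow> (\<Prod>i\<in>S. var i ^ r i) = sgl (\<Sum>i\<in>S. sgl i (r i)) 1"
 by (induction S rule: finite_induct) (auto simp: var_power mult_single)

lemma mon_prod: "mon n r = (\<Prod>i<n. var i ^ r i)"
proof -
 have "pm n r = (\<Sum>i<n. sgl i (r i))"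
  by (rule poly_mapping_eqI) (auto simp: lookup_sum lookup_single when_def)
 then show ?thesis by (simp add: prod_var mon_def)
qed

definition alt :: "nat \<Rightarrow> natfun \<Rightarrow> mpol" where
 "alt n \<beta> = (\<Sum>sig | sig permutes {..<n}. of_int (sign sig) * mon n (\<beta> \<circ> sig))"

lemma alt_dt: "alt n \<beta> = dt n (\<lambda>i j. var i ^ \<beta> j)"
 by (simp add: alt_def dt_def mon_prod)

definition vand :: "nat \<Rightarrow> mpol" where "vand n = (\<Prod>j<n. \<Prod>i<j. var i - var j)"

lemma vand_alt: "vand n = alt n (rho n)"
 by (simp add: vand_def alt_dt vandermonde)

lemma vand_dvd_alt: "vand n dvd alt n \<beta>"
 unfolding vand_alt alt_dt by (rule vandermonde_dvd_alternant)

lemma var_neq: "i \<noteq> j \<Longrightarrow> var i \<noteq> var j"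
proof
 assume "i \<noteq> j" "var i = var j"
 then have "eval_pol (var i) (\<lambda>k. if k = i then 1 else 0) = eval_pol (var j) (\<lambda>k. if k = i then 1 else 0)" by simp
 then show False using \<open>i \<noteq> j\<close> by simp
qed

lemma vand_nonzero [simp]: "vand n \<noteq> 0"
 using var_neq by (fastforce simp: vand_def)

lemma vars_in_diff: "vars_in n f \<Longrightarrow> vars_in n g \<Longrightarrow> vars_in n (f - g)"
 using vars_in_add[OF _ vars_in_uminus, of n f g] by simp

lemma vars_in_vand: "vars_in n (vand n)"
 unfolding vand_def
 by (intro vars_in_prod) (auto intro!: vars_in_diff vars_in_var)

lemma act_mon: "sig permutes {..<n} \<Longrightarrow> act sig (mon n r) = mon n (r \<circ> sig)"
 by (simp add: act_def mon_def map_key_pm)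

lemma act_of_int: "sig permutes S \<Longrightarrow> act sig (of_int k) = of_int k"
 by (simp flip: const_pol_of_int add: act_const)

lemma sum_permutes_compose:
 assumes "tau permutes {..<n::nat}"
 shows "(\<Sum>sig | sig permutes {..<n}. f (sig \<circ> tau)) = (\<Sum>sig | sig permutes {..<n}. f sig)"
 using sum_permutations_compose_right[OF assms, of f] by simp

lemma sign_sq: "sign sig * sign sig = 1" by (simp add: sign_def)

lemma sign_comp: "sig permutes {..<n::nat} \<Longrightarrow> tau permutes {..<n} \<Longrightarrow> sign (sig \<circ> tau) = sign sig * sign tau"
 by (rule sign_compose) (auto simp: permutation_permutes)

lemma act_alt: assumes "tau permutes {..<n}" shows "act tau (alt n \<beta>) = of_int (sign tau) * alt n \<beta>"
proof -
 have "act tau (alt n \<beta>) = (\<Sum>sig | sig permutes {..<n}. of_int (sign sig) * mon n (\<beta> \<circ> (sig \<circ> tau)))"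
  unfolding alt_def act_sum
  by (intro sum.cong) (auto simp: act_mult[OF assms] act_of_int[OF assms] act_mon[OF assms] o_assoc)
 also have "\<dots> = (\<Sum>sig | sig permutes {..<n}. of_int (sign tau) * (of_int (sign (sig \<circ> tau)) * mon n (\<beta> \<circ> (sig \<circ> tau))))"
 proof (intro sum.cong refl)
  fix sig assume "sig \<in> {sig. sig permutes {..<n}}"
  then have "sign sig = sign tau * sign (sig \<circ> tau)" using sign_comp[of sig n tau] assms sign_sq[of tau]
   by (simp add: algebra_simps)
  then show "of_int (sign sig) * mon n (\<beta> \<circ> (sig \<circ> tau))
   = of_int (sign tau) * (of_int (sign (sig \<circ> tau)) * mon n (\<beta> \<circ> (sig \<circ> tau)))" by simp
 qed
 also have "\<dots> = of_int (sign tau) * alt n \<beta>"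
  using sum_permutes_compose[OF assms, of "\<lambda>sig. of_int (sign tau) * (of_int (sign sig) * mon n (\<beta> \<circ> sig))"]
  by (simp add: alt_def sum_distrib_left)
 finally show ?thesis .
qed

definition cut :: "nat \<Rightarrow> mpol \<Rightarrow> mpol" where
 "cut n = dgn (\<lambda>m. if kys m \<subseteq> {..<n} then 1 else 0)"

lemma keys_add_nat: "kys (a + b :: expo) = kys a \<union> kys b"
 by (auto simp: in_keys_iff lookup_add)

lemma cut_mult: "cut n (f * g) = cut n f * cut n g"
proof (induction f rule: poly_mapping_induct)
 case (single m c)
 show ?case
  by (induction g rule: poly_mapping_induct)
    (auto simp: mult_single cut_def dgn_add keys_add_nat algebra_simps simp flip: single_add)
qed (auto simp: cut_def dgn_add algebra_simps)

lemma lookup_cut: "lkp (cut n f) m = (if kys m \<subseteq> {..<n} then lkp f m else 0)"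
 by (simp add: cut_def)

lemma cut_vars_in: "vars_in n f \<Longrightarrow> cut n f = f"
 by (rule poly_mapping_eqI) (auto simp: lookup_cut vars_in_def lkp_0_iff)

lemma vars_in_cut: "vars_in n (cut n f)"
 unfolding vars_in_def using lookup_cut[of n f] by (metis lkp_0_iff)

text \<open>
 Division by the antisymmetric Vandermonde product turns antisymmetric into symmetric polynomials.
 That the quotient involves only the first \<open>n\<close> variables follows by setting the others
 to zero.\<close>

lemma sympol_quotient:
 assumes "vand n * g = N" "vars_in n N"
  and "\<And>tau. tau permutes {..<n} \<Longrightarrow> act tau N = of_int (sign tau) * N"
 shows "g \<in> sympol n"
 unfolding sympol_iff
proof (intro conjI allI impI)
 have "vand n * cut n g = vand n * g"
  using assms(1,2) cut_mult[of n "vand n" g] by (simp add: cut_vars_in vars_in_vand)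
 then show "vars_in n g" using vars_in_cut[of n g] by (metis mult_left_cancel vand_nonzero)
next
 fix tau assume tau: "tau permutes {..<n}"
 have "act tau (vand n) * act tau g = of_int (sign tau) * (vand n * g)"
  using assms(1) assms(3)[OF tau] act_mult[OF tau, of "vand n" g] by simp
 then have "of_int (sign tau) * vand n * act tau g = of_int (sign tau) * vand n * g"
  by (simp add: vand_alt act_alt[OF tau] mult.assoc)
 then show "act tau g = g" by (auto simp: sign_def split: if_splits)
qed

section \<open>Operators of Sekiguchi type\<close>

definition shv :: "nat \<Rightarrow> nat \<Rightarrow> natfun \<Rightarrow> expo \<Rightarrow> nat \<Rightarrow> complex" where
 "shv n kap sig m i = of_nat (rho n (sig i)) * of_nat kap + of_nat (lkp m i)"

text \<open>
 Sekiguchi's numerator is the case \<open>q(z) = \<Prod>(X + z\<^sub>i)\<close> of the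
 alternating sum of \<open>x\<close>-to-the-\<open>\<sigma>(\<rho>)\<close> times
 \<open>q(\<kappa> \<sigma>(\<rho>) + \<theta>)\<close> for a symmetric \<open>q\<close> in the
 Euler operators \<open>\<theta>\<close>.  The sum of squares is another case of interest.\<close>

definition numer :: "nat \<Rightarrow> nat \<Rightarrow> (point \<Rightarrow> complex) \<Rightarrow> mpol \<Rightarrow> mpol" where
 "numer n kap q f = (\<Sum>sig | sig permutes {..<n}.
   of_int (sign sig) * (mon n (rho n \<circ> sig) * dgn (\<lambda>m. q (shv n kap sig m)) f))"

definition qsym :: "nat \<Rightarrow> (point \<Rightarrow> complex) \<Rightarrow> bool" where
 "qsym n q \<longleftrightarrow> (\<forall>sig z. sig permutes {..<n} \<longrightarrow> q (z \<circ> sig) = q z)"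

definition quot_op :: "nat \<Rightarrow> nat \<Rightarrow> (point \<Rightarrow> complex) \<Rightarrow> mpol \<Rightarrow> mpol" where
 "quot_op n kap q f = (THE g. vand n * g = numer n kap q f)"

definition sekq :: "nat \<Rightarrow> complex \<Rightarrow> point \<Rightarrow> complex" where
 "sekq n X z = (\<Prod>i<n. X + z i)"

lemma qsym_sekq: "qsym n (sekq n X)"
 unfolding qsym_def sekq_def
proof (intro allI impI)
 fix sig and z :: point assume "sig permutes {..<n}"
 then show "(\<Prod>i<n. X + (z \<circ> sig) i) = (\<Prod>i<n. X + z i)"
  using prod.permute[of sig "{..<n}" "\<lambda>i. X + z i"] by (simp add: o_def)
qed

lemma dgn_dgn: "dgn w (dgn w' f) = dgn (\<lambda>m. w m * w' m) (f :: 'k \<Rightarrow>\<^sub>0 'b::semiring_0)"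
 by (rule poly_mapping_eqI) (simp add: algebra_simps)

lemma dgn_const: "const_pol c * f = dgn (\<lambda>m. c) f"
 by (rule poly_mapping_eqI) simp

lemma dgn_plus: "dgn w f + dgn w' f = dgn (\<lambda>m. w m + w' m) (f :: 'k \<Rightarrow>\<^sub>0 'b::semiring_0)"
 by (rule poly_mapping_eqI) (simp add: lookup_add algebra_simps)

lemma dgn_1: "dgn (\<lambda>m. 1) f = (f :: 'k \<Rightarrow>\<^sub>0 'b::semiring_1)"
 by (rule poly_mapping_eqI) simp

text \<open>
 The factors act in different variables, so a product of first order operators is diagonal on
 monomials, apart from the overall power of the variables.\<close>

lemma sek_factor_foldr:
 assumes "distinct xs"
 shows "foldr (sek_factor n kap X sig) xs f =
  (\<Prod>i\<in>set xs. var i ^ rho n (sig i)) * dgn (\<lambda>m. \<Prod>i\<in>set xs. X + shv n kap sig m i) f"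
 using assms
proof (induction xs)
 case Nil then show ?case by (simp add: dgn_1)
next
 case (Cons i xs)
 define M where "M = (\<Prod>i\<in>set xs. var i ^ rho n (sig i))"
 define g where "g = dgn (\<lambda>m. \<Prod>i\<in>set xs. X + shv n kap sig m i) f"
 have th: "theta i M = 0"
 proof -
  have "theta i (var j ^ k) = 0" if "j \<noteq> i" for j k
   using that by (cases k) (auto simp: theta_power_Suc theta_var simp del: power_Suc)
  moreover have "\<forall>j\<in>set xs. j \<noteq> i" using Cons.prems by auto
  ultimately show ?thesis unfolding M_def by (subst theta_prod) (auto intro!: sum.neutral)
 qed
 have "sek_factor n kap X sig i (M * g) = var i ^ rho n (sig i) *
   (const_pol (X + of_nat (rho n (sig i)) * of_nat kap) * (M * g) + theta i (M * g))"
  by (simp add: sek_factor_def theta_eq)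
 also have "\<dots> = (var i ^ rho n (sig i) * M) *
   (const_pol (X + of_nat (rho n (sig i)) * of_nat kap) * g + theta i g)"
  by (simp add: theta_mult th algebra_simps)
 also have "const_pol (X + of_nat (rho n (sig i)) * of_nat kap) * g + theta i g
   = dgn (\<lambda>m. X + shv n kap sig m i) g"
  by (simp add: dgn_const theta_def dgn_plus shv_def add.assoc)
 finally show ?case using Cons by (simp add: M_def g_def dgn_dgn)
qed

lemma sekiguchi_quot: "sekiguchi n kap X = quot_op n kap (sekq n X)"
proof
 fix f
 have "foldr (sek_factor n kap X sig) [0..<n] f = mon n (rho n \<circ> sig) * dgn (\<lambda>m. sekq n X (shv n kap sig m)) f" for sig
  by (subst sek_factor_foldr) (auto simp: mon_prod sekq_def atLeast0LessThan)
 then show "sekiguchi n kap X f = quot_op n kap (sekq n X) f"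
  by (simp add: sekiguchi_def quot_op_def numer_def vand_def)
qed

lemma numer_add: "numer n kap q (f + g) = numer n kap q f + numer n kap q g"
 by (simp add: numer_def dgn_add distrib_left sum.distrib)

lemma numer_0 [simp]: "numer n kap q 0 = 0" by (simp add: numer_def)

lemma numer_cmult: "numer n kap q (const_pol c * f) = const_pol c * numer n kap q f"
 unfolding numer_def sum_distrib_left const_pol_def dgn_cmult
 by (intro sum.cong refl) (simp add: algebra_simps)

text \<open>
 For symmetric \<open>f\<close> the sum over permutations can be carried out for each orbit of
 monomials, and gives alternants; these are divisible by the Vandermonde product, so the quotient
 exists.\<close>

lemma numer_alternants:
 assumes f: "f \<in> sympol n" and q: "qsym n q"
 shows "numer n kap q f = (\<Sum>m\<in>kys f. const_pol (lkp f m * q (shv n kap id m)) * alt n (\<lambda>i. rho n i + lkp m i))"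
proof -
 have inner: "mon n (rho n \<circ> sig) * dgn (\<lambda>m. q (shv n kap sig m)) f
   = (\<Sum>m\<in>kys f. const_pol (lkp f m * q (shv n kap id m)) * mon n ((\<lambda>i. rho n i + lkp m i) \<circ> sig))"
  if sig: "sig permutes {..<n}" for sig
 proof -
  let ?h = "mkey sig"
  have bij: "bij_betw ?h (kys f) (kys f)"
   by (rule bij_betw_byWitness[where f' = "mkey (inv_into UNIV sig)"])
     (auto simp: map_key_bij[OF sig] in_keys_iff sympol_lookup_map_key[OF f] sig permutes_inv)
  have "dgn (\<lambda>m. q (shv n kap sig m)) f = (\<Sum>m\<in>kys f. sgl m (q (shv n kap sig m) * lkp f m))"
   by (subst poly_mapping_sum_single[of f]) (simp add: dgn_sum)
  also have "\<dots> = (\<Sum>m\<in>kys f. sgl (?h m) (q (shv n kap sig (?h m)) * lkp f (?h m)))"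
   by (rule sum.reindex_bij_betw[OF bij, symmetric])
  also have "\<dots> = (\<Sum>m\<in>kys f. sgl (?h m) (q (shv n kap id m) * lkp f m))"
  proof (intro sum.cong refl)
   fix m
   have "shv n kap sig (?h m) = shv n kap id m \<circ> sig"
    by (rule ext) (simp add: shv_def lookup_map_key permutes_inj[OF sig])
   then show "sgl (?h m) (q (shv n kap sig (?h m)) * lkp f (?h m)) = sgl (?h m) (q (shv n kap id m) * lkp f m)"
    using q sig by (simp add: qsym_def sympol_lookup_map_key[OF f sig])
  qed
  finally have "mon n (rho n \<circ> sig) * dgn (\<lambda>m. q (shv n kap sig m)) f
   = (\<Sum>m\<in>kys f. mon n (rho n \<circ> sig) * sgl (?h m) (q (shv n kap id m) * lkp f m))"
   by (simp add: sum_distrib_left)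
  also have "\<dots> = (\<Sum>m\<in>kys f. const_pol (lkp f m * q (shv n kap id m)) * mon n ((\<lambda>i. rho n i + lkp m i) \<circ> sig))"
  proof (intro sum.cong refl)
   fix m assume "m \<in> kys f"
   then have "kys m \<subseteq> {..<n}" using sympol_keys[OF f] by auto
   then have "?h m = pm n (lkp m \<circ> sig)" using map_key_pm[OF sig, of "lkp m"] by (simp add: pm_lkp)
   then show "mon n (rho n \<circ> sig) * sgl (?h m) (q (shv n kap id m) * lkp f m)
     = const_pol (lkp f m * q (shv n kap id m)) * mon n ((\<lambda>i. rho n i + lkp m i) \<circ> sig)"
    by (simp add: mon_def const_pol_def mult_single pm_add o_def mult.commute)
  qed
  finally show ?thesis .
 qed
 have "numer n kap q f = (\<Sum>sig | sig permutes {..<n}. \<Sum>m\<in>kys f.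
   of_int (sign sig) * (const_pol (lkp f m * q (shv n kap id m)) * mon n ((\<lambda>i. rho n i + lkp m i) \<circ> sig)))"
  unfolding numer_def by (intro sum.cong refl) (simp add: inner sum_distrib_left)
 also have "\<dots> = (\<Sum>m\<in>kys f. const_pol (lkp f m * q (shv n kap id m)) * alt n (\<lambda>i. rho n i + lkp m i))"
  unfolding alt_def sum_distrib_left by (subst sum.swap) (simp add: algebra_simps)
 finally show ?thesis .
qed

lemma vars_in_of_int [simp]: "vars_in n (of_int k)" by (simp flip: const_pol_of_int)

lemma vars_in_mon: "vars_in n (mon n r)"
 unfolding vars_in_def mon_def using keys_pm[of n r] by simp

lemma vars_in_alt: "vars_in n (alt n \<beta>)"
 unfolding alt_def by (intro vars_in_sum vars_in_mult) (auto simp: vars_in_mon)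

lemma quot_op:
 assumes f: "f \<in> sympol n" and q: "qsym n q"
 shows "vand n * quot_op n kap q f = numer n kap q f" and "quot_op n kap q f \<in> sympol n"
proof -
 note eq = numer_alternants[OF f q, of kap]
 have "vand n dvd numer n kap q f"
  unfolding eq by (intro dvd_sum dvd_mult vand_dvd_alt)
 then obtain g where g: "vand n * g = numer n kap q f" by (auto simp: dvd_def)
 then have "quot_op n kap q f = g"
  unfolding quot_op_def by (intro the_equality) (metis mult_left_cancel vand_nonzero)+
 moreover have "g \<in> sympol n"
 proof (rule sympol_quotient[OF g])
  show "vars_in n (numer n kap q f)"
   unfolding eq by (intro vars_in_sum vars_in_mult vars_in_const vars_in_alt)
  fix tau assume tau: "tau permutes {..<n}"
  show "act tau (numer n kap q f) = of_int (sign tau) * numer n kap q f"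
   unfolding eq act_sum sum_distrib_left
   by (intro sum.cong refl) (simp add: act_mult[OF tau] act_alt[OF tau] act_const[OF tau] algebra_simps)
 qed
 ultimately show "vand n * quot_op n kap q f = numer n kap q f" "quot_op n kap q f \<in> sympol n"
  using g by auto
qed

lemma quot_op_unique:
 "vand n * g = numer n kap q f \<Longrightarrow> quot_op n kap q f = g"
 unfolding quot_op_def by (rule the_equality) (metis mult_left_cancel vand_nonzero)+

lemma quot_op_add:
 assumes "f \<in> sympol n" "g \<in> sympol n" "qsym n q"
 shows "quot_op n kap q (f + g) = quot_op n kap q f + quot_op n kap q g"
 by (rule quot_op_unique) (use assms in \<open>simp add: distrib_left numer_add quot_op\<close>)

lemma quot_op_cmult:
 assumes "f \<in> sympol n" "qsym n q"
 shows "quot_op n kap q (const_pol c * f) = const_pol c * quot_op n kap q f"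
 by (rule quot_op_unique) (use assms in \<open>simp add: numer_cmult quot_op mult.left_commute\<close>)

lemma quot_op_0 [simp]: "quot_op n kap q 0 = 0" by (rule quot_op_unique) simp

lemma quot_op_sum:
 assumes "\<And>s. s \<in> S \<Longrightarrow> f s \<in> sympol n" "qsym n q"
 shows "quot_op n kap q (\<Sum>s\<in>S. const_pol (c s) * f s) = (\<Sum>s\<in>S. const_pol (c s) * quot_op n kap q (f s))"
 using assms(1)
proof (induction S rule: infinite_finite_induct)
 case (insert x S)
 then show ?case using assms(2)
  by (simp add: quot_op_add quot_op_cmult sympol_cmult sympol_sum)
qed auto

section \<open>Dominance and triangularity\<close>

text \<open>
 The pairing with \<open>\<rho>\<close> is the sum of all partial sums.  It is strictly monotone for
 dominance, so it turns dominance inductions into inductions over numbers.\<close>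

definition wt :: "nat \<Rightarrow> natfun \<Rightarrow> nat" where "wt n r = (\<Sum>i<n. rho n i * r i)"

text \<open>
 For partitions this is the dominance order.  Comparing all subsets \<open>S\<close> instead of the
 initial segments makes the relation invariant under permutations of \<open>r\<close>, so that it
 makes sense for all exponents of a symmetric polynomial.\<close>

definition dle :: "nat \<Rightarrow> natfun \<Rightarrow> natfun \<Rightarrow> bool" where
 "dle n r lam \<longleftrightarrow> (\<forall>S\<subseteq>{..<n}. (\<Sum>i\<in>S. r i) \<le> (\<Sum>i<card S. lam i)) \<and> (\<Sum>i<n. r i) = (\<Sum>i<n. lam i)"

lemma wt_partial_sums: "wt n r = (\<Sum>k<n. \<Sum>i<k. r i)"
proof -
 have "wt n r = (\<Sum>i<n. \<Sum>k\<in>{i<..<n}. r i)" by (simp add: wt_def rho_def)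
 also have "\<dots> = (\<Sum>k<n. \<Sum>i<k. r i)"
  unfolding sum.Sigma[OF finite_lessThan ballI[OF finite_greaterThanLessThan]]
   sum.Sigma[OF finite_lessThan ballI[OF finite_lessThan]]
  by (rule sum.reindex_bij_witness[of _ "\<lambda>(a,b). (b,a)" "\<lambda>(a,b). (b,a)"]) auto
 finally show ?thesis .
qed

lemma dle_prefix: "dle n r lam \<Longrightarrow> k \<le> n \<Longrightarrow> (\<Sum>i<k. r i) \<le> (\<Sum>i<k. lam i)"
 unfolding dle_def by (auto dest!: spec[of _ "{..<k}"])

lemma dle_wt: "dle n r lam \<Longrightarrow> wt n r \<le> wt n lam"
 unfolding wt_partial_sums by (intro sum_mono dle_prefix) auto

lemma dle_wt_eq: assumes "dle n r lam" "wt n r = wt n lam" "i < n" shows "r i = lam i"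
proof -
 have le: "(\<Sum>i<k. r i) \<le> (\<Sum>i<k. lam i)" if "k \<in> {..<n}" for k using dle_prefix[OF assms(1)] that by auto
 have eq: "(\<Sum>i<k. r i) = (\<Sum>i<k. lam i)" if "k \<le> n" for k
 proof (cases "k = n")
  case True then show ?thesis using assms(1) by (simp add: dle_def)
 next
  case False
  then show ?thesis using sum_mono_inv[OF assms(2)[unfolded wt_partial_sums] le, of k] that by auto
 qed
 from eq[of "Suc i"] eq[of i] assms(3) show ?thesis by simp
qed

lemma sum_antimono_le:
 assumes anti: "\<And>i j. i \<le> j \<Longrightarrow> j < n \<Longrightarrow> r j \<le> (r i :: nat)" and S: "S \<subseteq> {..<n}"
 shows "(\<Sum>i\<in>S. r i) \<le> (\<Sum>i<card S. r i)"
proof -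
 have fin: "finite S" using S finite_subset by blast
 define k where "k = card S"
 have kn: "k \<le> n" using card_mono[OF _ S] by (simp add: k_def)
 have c: "card (S - {..<k}) = card ({..<k} - S)"
 proof -
  have "card (S - {..<k}) = card S - card (S \<inter> {..<k})" by (rule card_Diff_subset_Int) auto
  moreover have "card ({..<k} - S) = card {..<k} - card ({..<k} \<inter> S)"
   by (rule card_Diff_subset_Int) auto
  ultimately show ?thesis by (simp add: k_def Int_commute)
 qed
 have s1: "(\<Sum>i\<in>S. r i) = (\<Sum>i\<in>S \<inter> {..<k}. r i) + (\<Sum>i\<in>S - {..<k}. r i)"
  using fin by (rule sum.Int_Diff)
 have s2: "(\<Sum>i<k. r i) = (\<Sum>i\<in>{..<k} \<inter> S. r i) + (\<Sum>i\<in>{..<k} - S. r i)"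
  by (rule sum.Int_Diff) simp
 show ?thesis
 proof (cases "k = n")
  case True
  then have "S = {..<n}" using S card_subset_eq[of "{..<n}" S] by (simp add: k_def)
  then show ?thesis by simp
 next
  case False
  then have "k < n" using kn by simp
  have "(\<Sum>i\<in>S - {..<k}. r i) \<le> of_nat (card (S - {..<k})) * r k"
   by (rule sum_bounded_above) (use anti S in auto)
  also have "\<dots> = of_nat (card ({..<k} - S)) * r k" using c by simp
  also have "\<dots> \<le> (\<Sum>i\<in>{..<k} - S. r i)"
   by (rule sum_bounded_below) (use anti \<open>k < n\<close> in auto)
  finally show ?thesis unfolding s1 s2[unfolded k_def] k_def by (simp add: Int_commute k_def)
 qed
qed

lemma dle_antimonoI:
 assumes "\<And>i j. i \<le> j \<Longrightarrow> j < n \<Longrightarrow> r j \<le> r i" "\<And>k. k \<le> n \<Longrightarrow> (\<Sum>i<k. r i) \<le> (\<Sum>i<k. lam i)"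
  "(\<Sum>i<n. r i) = (\<Sum>i<n. lam i)"
 shows "dle n r lam"
 unfolding dle_def
proof (intro conjI allI impI)
 fix S assume S: "S \<subseteq> {..<n}"
 have "card S \<le> n" using card_mono[OF _ S] by simp
 then show "(\<Sum>i\<in>S. r i) \<le> (\<Sum>i<card S. lam i)"
  using sum_antimono_le[of n r S] assms(1,2) S by (meson order.trans)
qed (rule assms(3))

lemma permutes_image_subset: "sig permutes T \<Longrightarrow> S \<subseteq> T \<Longrightarrow> sig ` S \<subseteq> T"
 by (metis image_mono permutes_image)

lemma dle_perm: assumes "sig permutes {..<n}" "dle n r lam" shows "dle n (r \<circ> sig) lam"
 unfolding dle_def
proof (intro conjI allI impI)
 fix S assume S: "S \<subseteq> {..<n}"
 have "(\<Sum>i\<in>S. (r \<circ> sig) i) = (\<Sum>i\<in>sig ` S. r i)"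
  by (subst sum.reindex) (auto intro: inj_on_subset[OF permutes_inj_on[OF assms(1)]])
 moreover have "sig ` S \<subseteq> {..<n}" using permutes_image_subset[OF assms(1) S] .
 moreover have "card (sig ` S) = card S" by (rule card_image) (auto intro: inj_on_subset[OF permutes_inj_on[OF assms(1)]])
 ultimately show "(\<Sum>i\<in>S. (r \<circ> sig) i) \<le> (\<Sum>i<card S. lam i)"
  using assms(2) by (auto simp: dle_def dest!: spec[of _ "sig ` S"])
next
 have "(\<Sum>i<n. (r \<circ> sig) i) = (\<Sum>i<n. r i)" using sum.permute[OF assms(1), of r] by simp
 then show "(\<Sum>i<n. (r \<circ> sig) i) = (\<Sum>i<n. lam i)" using assms(2) by (simp add: dle_def)
qed

lemma dle_trans: assumes "dle n r lam" "dle n lam mu" shows "dle n r mu"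
 unfolding dle_def
proof (intro conjI allI impI)
 fix S assume S: "S \<subseteq> {..<n}"
 then have "card S \<le> n" using card_mono[OF _ S] by simp
 then show "(\<Sum>i\<in>S. r i) \<le> (\<Sum>i<card S. mu i)"
  using S assms(1) dle_prefix[OF assms(2), of "card S"] by (auto simp: dle_def intro: order.trans)
qed (use assms in \<open>auto simp: dle_def\<close>)

lemma sum_transpose_swap:
 fixes f :: "nat \<Rightarrow> int" assumes "i < n" "j < n" "i \<noteq> j"
 shows "(\<Sum>k<n. f k) = f i + f j + (\<Sum>k\<in>{..<n} - {i,j}. f k)"
proof -
 have "(\<Sum>k<n. f k) = (\<Sum>k\<in>{i,j}. f k) + (\<Sum>k\<in>{..<n} - {i,j}. f k)"
  using sum.subset_diff[of "{i,j}" "{..<n}" f] assms by auto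
 then show ?thesis using assms by simp
qed

lemma wt_transpose:
 assumes "i < j" "j < n" "r i < r j"
 shows "wt n r < wt n (r \<circ> Transposition.transpose i j)"
proof -
 have "int (wt n (r \<circ> Transposition.transpose i j)) - int (wt n r)
   = (\<Sum>k<n. int (rho n k) * (int (r (Transposition.transpose i j k)) - int (r k)))"
  by (simp add: wt_def sum_subtractf[symmetric] algebra_simps)
 also have "\<dots> = int (rho n i) * (int (r j) - int (r i)) + int (rho n j) * (int (r i) - int (r j))"
  using assms by (subst sum_transpose_swap[of i _ j]) (auto simp: transpose_def)
 also have "\<dots> = (int (rho n i) - int (rho n j)) * (int (r j) - int (r i))" by (simp add: algebra_simps)
 also have "\<dots> > 0" using assms by (intro mult_pos_pos) (auto simp: rho_def)
 finally show ?thesis by simp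
qed

lemma rho_rearrange:
 assumes "sig permutes {..<n}" "sig \<noteq> id"
 shows "(\<Sum>i<n. rho n i * rho n (sig i)) < (\<Sum>i<n. rho n i * rho n i)"
proof -
 have "\<exists>i<n. sig i \<noteq> i"
 proof (rule ccontr)
  assume "\<not> ?thesis"
  then have "sig = id" using assms(1) by (auto simp: permutes_def fun_eq_iff)
  then show False using assms by simp
 qed
 then obtain i where i: "i < n" "sig i \<noteq> i" by blast
 have sq: "(\<Sum>i<n. int (rho n (sig i)) * int (rho n (sig i))) = (\<Sum>i<n. int (rho n i) * int (rho n i))"
  using sum.permute[OF assms(1), of "\<lambda>i. int (rho n i) * int (rho n i)"] by (simp add: o_def)
 have "0 < (\<Sum>i<n. (int (rho n i) - int (rho n (sig i)))^2)"
 proof (rule sum_pos2[of _ i])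
  have "sig i < n" using permutes_in_image[OF assms(1), of i] i by simp
  then have "int (rho n i) - int (rho n (sig i)) \<noteq> 0" using i rho_inj[of i n "sig i"] by simp
  then show "0 < (int (rho n i) - int (rho n (sig i)))^2" by simp
 qed (use i in auto)
 also have "\<dots> = 2 * (\<Sum>i<n. int (rho n i) * int (rho n i)) - 2 * (\<Sum>i<n. int (rho n i) * int (rho n (sig i)))"
 proof -
  have "(\<Sum>i<n. (int (rho n i) - int (rho n (sig i)))^2) =
   (\<Sum>i<n. int (rho n i) * int (rho n i)) + (\<Sum>i<n. int (rho n (sig i)) * int (rho n (sig i)))
    - 2 * (\<Sum>i<n. int (rho n i) * int (rho n (sig i)))"
   by (simp add: power2_eq_square sum.distrib[symmetric] sum_subtractf[symmetric] sum_distrib_left algebra_simps)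
  then show ?thesis unfolding sq by simp
 qed
 finally have "int (\<Sum>i<n. rho n i * rho n (sig i)) < int (\<Sum>i<n. rho n i * rho n i)" by simp
 then show ?thesis by linarith
qed

lemma rho_prefix: assumes "sig permutes {..<n}" "k \<le> n"
 shows "(\<Sum>i<k. rho n (sig i)) \<le> (\<Sum>i<k. rho n i)"
proof -
 have "(\<Sum>i<k. rho n (sig i)) = (\<Sum>i\<in>sig ` {..<k}. rho n i)"
  by (subst sum.reindex) (auto intro: inj_on_subset[OF permutes_inj_on[OF assms(1)]])
 also have "\<dots> \<le> (\<Sum>i<card (sig ` {..<k}). rho n i)"
 proof (rule sum_antimono_le[of n])
  show "sig ` {..<k} \<subseteq> {..<n}" using permutes_image_subset[OF assms(1)] assms(2) by simp
 qed (auto simp: rho_def)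
 also have "card (sig ` {..<k}) = k"
  by (subst card_image) (auto intro: inj_on_subset[OF permutes_inj_on[OF assms(1)]])
 finally show ?thesis .
qed

text \<open>
 If \<open>\<sigma>(\<rho>) + a = \<rho> + r\<close>, then \<open>r\<close> is below
 \<open>a\<close>, in weight and in dominance; so leading terms are not disturbed by the division by
 the Vandermonde product.\<close>

lemma shift_wt:
 assumes sig: "sig permutes {..<n}" "sig \<noteq> id"
  and eq: "\<And>i. i < n \<Longrightarrow> rho n (sig i) + a i = r i + rho n i"
 shows "wt n r < wt n a"
proof -
 have "(\<Sum>i<n. rho n i * (rho n (sig i) + a i)) = (\<Sum>i<n. rho n i * (r i + rho n i))"
  by (intro sum.cong refl) (simp add: eq)
 then have "(\<Sum>i<n. rho n i * rho n (sig i)) + wt n a = wt n r + (\<Sum>i<n. rho n i * rho n i)"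
  by (simp add: wt_def distrib_left sum.distrib)
 then show ?thesis using rho_rearrange[OF sig] by simp
qed

lemma shift_dle:
 assumes sig: "sig permutes {..<n}"
  and eq: "\<And>i. i < n \<Longrightarrow> rho n (sig i) + a i = r i + rho n i"
  and anti: "\<And>i j. i \<le> j \<Longrightarrow> j < n \<Longrightarrow> r j \<le> r i" and a: "dle n a lam"
 shows "dle n r lam"
proof (rule dle_antimonoI[OF anti])
 have pre: "(\<Sum>i<k. rho n (sig i)) + (\<Sum>i<k. a i) = (\<Sum>i<k. r i) + (\<Sum>i<k. rho n i)" if "k \<le> n" for k
  unfolding sum.distrib[symmetric] using that by (intro sum.cong) (auto simp: eq)
 show "(\<Sum>i<k. r i) \<le> (\<Sum>i<k. lam i)" if "k \<le> n" for k
  using pre[OF that] rho_prefix[OF sig that] dle_prefix[OF a that] by linarith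
 have "(\<Sum>i<n. rho n (sig i)) = (\<Sum>i<n. rho n i)" using sum.permute[OF sig, of "rho n"] by (simp add: o_def)
 then show "(\<Sum>i<n. r i) = (\<Sum>i<n. lam i)" using pre[of n] a by (simp add: dle_def)
qed auto

definition tri :: "nat \<Rightarrow> natfun \<Rightarrow> mpol \<Rightarrow> bool" where
 "tri n lam f \<longleftrightarrow> f \<in> sympol n \<and> (\<forall>m\<in>kys f. dle n (lkp m) lam)"

lemma lookup_mon_mult: "lkp (mon n s * f) (pm n s + a) = lkp f a"
 unfolding mon_def by (simp add: lookup_single_times)

lemma lookup_mon_mult_cases:
 assumes "lkp (mon n s * f) m \<noteq> 0"
 obtains a where "pm n s + a = m" "a \<in> kys f"
proof -
 have "\<exists>k. m = pm n s + k"
  using lookup_single_times_notin[of m "pm n s" 1 f] assms unfolding mon_def by blast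
 then obtain a where "m = pm n s + a" by blast
 then show ?thesis using that[of a] assms by (simp add: lookup_mon_mult in_keys_iff)
qed

lemma lookup_alternating_sum:
 "lkp (\<Sum>sig | sig permutes {..<n}. of_int (sign sig) * (mon n (rho n \<circ> sig) * F sig)) m
   = (\<Sum>sig | sig permutes {..<n}. of_int (sign sig) * lkp (mon n (rho n \<circ> sig) * F sig :: mpol) m)"
 by (simp add: lookup_sum lookup_of_int_mult)

lemma vand_mult: "vand n * g = (\<Sum>sig | sig permutes {..<n}. of_int (sign sig) * (mon n (rho n \<circ> sig) * g))"
 by (simp add: vand_alt alt_def sum_distrib_right mult.assoc)

lemma lookup_leading_term:
 assumes "\<And>sig a. sig permutes {..<n} \<Longrightarrow> sig \<noteq> id \<Longrightarrow> pm n (rho n \<circ> sig) + a = pm n (\<lambda>i. rho n i + lkp m i) \<Longrightarrow>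
   a \<notin> kys (F sig)"
  and m: "kys m \<subseteq> {..<n}"
 shows "(\<Sum>sig | sig permutes {..<n}. of_int (sign sig) *
      lkp (mon n (rho n \<circ> sig) * F sig :: mpol) (pm n (\<lambda>i. rho n i + lkp m i))) = lkp (F id) m"
proof -
 let ?M = "pm n (\<lambda>i. rho n i + lkp m i)"
 have "(\<Sum>sig | sig permutes {..<n}. of_int (sign sig) * lkp (mon n (rho n \<circ> sig) * F sig) ?M)
   = (\<Sum>sig\<in>{id}. of_int (sign sig) * lkp (mon n (rho n \<circ> sig) * F sig) ?M)"
 proof (rule sum.mono_neutral_right)
  show "\<forall>sig\<in>{sig. sig permutes {..<n}} - {id}. of_int (sign sig) * lkp (mon n (rho n \<circ> sig) * F sig) ?M = 0"
  proof
   fix sig assume "sig \<in> {sig. sig permutes {..<n}} - {id}"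
   then have "lkp (mon n (rho n \<circ> sig) * F sig) ?M = 0"
    using assms(1)[of sig] lookup_mon_mult_cases[of n "rho n \<circ> sig" "F sig" ?M] by auto
   then show "of_int (sign sig) * lkp (mon n (rho n \<circ> sig) * F sig) ?M = 0" by simp
  qed
 qed (auto simp: finite_permutations permutes_id)
 moreover have "?M = pm n (rho n) + m" using pm_add[of n "rho n" "lkp m"] pm_lkp[OF m] by simp
 ultimately show ?thesis using lookup_mon_mult[of n "rho n" "F id" m] by (simp add: sign_id)
qed

lemma pm_shift_eq:
 assumes "pm n (rho n \<circ> sig) + a = pm n (\<lambda>i. rho n i + lkp m i)" "i < n"
 shows "rho n (sig i) + lkp a i = lkp m i + rho n i"
 using arg_cong[OF assms(1), of "\<lambda>p. lkp p i"] assms(2) by (simp add: lookup_add)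

lemma ex_max_nat:
 assumes "finite A" "A \<noteq> {}"
 shows "\<exists>x\<in>A. \<forall>y\<in>A. f y \<le> (f x :: nat)"
proof -
 have "Max (f ` A) \<in> f ` A" using assms by (intro Max_in) auto
 then obtain x where "x \<in> A" "f x = Max (f ` A)" by auto
 then show ?thesis using assms by (intro bexI[of _ x]) auto
qed

text \<open>
 Take a monomial \<open>\<nu>\<close> of the quotient which violates dominance, of maximal weight.
 Its multiple by the leading monomial of the Vandermonde product is not cancelled, so it occurs in
 the numerator, hence comes from a monomial of \<open>f\<close>; but then \<open>\<nu>\<close> is
 dominated after all.\<close>

theorem quot_op_triangular:
 assumes f: "tri n lam f" and q: "qsym n q"
 shows "tri n lam (quot_op n kap q f)"
proof -
 define g where "g = quot_op n kap q f"
 have fs: "f \<in> sympol n" using f by (simp add: tri_def)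
 have g: "vand n * g = numer n kap q f" "g \<in> sympol n" using quot_op[OF fs q] by (auto simp: g_def)
 have "dle n (lkp m) lam" if "m \<in> kys g" for m
 proof (rule ccontr)
  assume "\<not> dle n (lkp m) lam"
  define Bad where "Bad = {m\<in>kys g. \<not> dle n (lkp m) lam}"
  have "finite Bad" "Bad \<noteq> {}" using that \<open>\<not> dle n (lkp m) lam\<close> by (auto simp: Bad_def)
  then obtain \<nu> where \<nu>: "\<nu> \<in> Bad" and max: "\<And>m. m \<in> Bad \<Longrightarrow> wt n (lkp m) \<le> wt n (lkp \<nu>)"
   using ex_max_nat[of Bad "\<lambda>m. wt n (lkp m)"] by blast
  have \<nu>k: "kys \<nu> \<subseteq> {..<n}" using \<nu> sympol_keys[OF g(2)] by (auto simp: Bad_def)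
  \<comment> \<open>otherwise a transposition would give a violating monomial of larger weight\<close>
  have anti: "lkp \<nu> j \<le> lkp \<nu> i" if "i \<le> j" "j < n" for i j
  proof (rule ccontr)
   assume less: "\<not> lkp \<nu> j \<le> lkp \<nu> i"
   let ?t = "Transposition.transpose i j"
   have t: "?t permutes {..<n}" using that by (intro permutes_swap_id) auto
   have lk: "lkp (mkey ?t \<nu>) = lkp \<nu> \<circ> ?t"
    by (rule ext) (simp add: lookup_map_key permutes_inj[OF t])
   have "\<not> dle n (lkp \<nu> \<circ> ?t) lam"
   proof
    assume "dle n (lkp \<nu> \<circ> ?t) lam"
    then have "dle n (lkp \<nu> \<circ> ?t \<circ> ?t) lam" using dle_perm[OF t] by blast
    then show False using \<nu> by (simp add: Bad_def o_assoc[symmetric])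
   qed
   then have "mkey ?t \<nu> \<in> Bad"
    using \<nu> by (simp add: Bad_def lk in_keys_iff sympol_lookup_map_key[OF g(2) t])
   then have "wt n (lkp \<nu> \<circ> ?t) \<le> wt n (lkp \<nu>)" using max[of "mkey ?t \<nu>"] by (simp add: lk)
   moreover have "i < j" using less that by (cases "i = j") auto
   ultimately show False using wt_transpose[of i j n "lkp \<nu>"] that less by simp
  qed
  let ?M = "pm n (\<lambda>i. rho n i + lkp \<nu> i)"
  have "lkp (vand n * g) ?M = lkp g \<nu>"
   unfolding vand_mult lookup_alternating_sum
  proof (rule lookup_leading_term[where F = "\<lambda>_. g", OF _ \<nu>k], rule notI)
   fix sig a assume sig: "sig permutes {..<n}" "sig \<noteq> id" and eq: "pm n (rho n \<circ> sig) + a = ?M" and a: "a \<in> kys g"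
   have "wt n (lkp \<nu>) < wt n (lkp a)" using shift_wt[OF sig pm_shift_eq[OF eq]] by blast
   then have "dle n (lkp a) lam" using max[of a] a by (auto simp: Bad_def)
   then have "dle n (lkp \<nu>) lam" using shift_dle[OF sig(1) pm_shift_eq[OF eq] anti] by blast
   then show False using \<nu> by (simp add: Bad_def)
  qed
  moreover have "lkp (numer n kap q f) ?M = 0"
   unfolding numer_def lookup_alternating_sum
  proof (intro sum.neutral ballI)
   fix sig assume "sig \<in> {sig. sig permutes {..<n}}"
   then have sig: "sig permutes {..<n}" by simp
   have "lkp (mon n (rho n \<circ> sig) * dgn (\<lambda>m. q (shv n kap sig m)) f) ?M = 0"
   proof (rule ccontr)
    assume "\<not> ?thesis"
    then obtain a where a: "pm n (rho n \<circ> sig) + a = ?M" "a \<in> kys (dgn (\<lambda>m. q (shv n kap sig m)) f)"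
     by (rule lookup_mon_mult_cases)
    then have "a \<in> kys f" by (auto simp: in_keys_iff)
    then have "dle n (lkp a) lam" using f by (simp add: tri_def)
    then have "dle n (lkp \<nu>) lam" using shift_dle[OF sig pm_shift_eq[OF a(1)] anti] by blast
    then show False using \<nu> by (simp add: Bad_def)
   qed
   then show "of_int (sign sig) * lkp (mon n (rho n \<circ> sig) * dgn (\<lambda>m. q (shv n kap sig m)) f) ?M = 0" by simp
  qed
  ultimately show False using g(1) \<nu> by (auto simp: Bad_def)
 qed
 then show ?thesis using g by (simp add: tri_def g_def)
qed

text \<open>
 Only the identity permutation contributes to the monomial \<open>\<rho> + \<lambda>\<close>, on
 both sides of the equation that defines the quotient.\<close>

theorem quot_op_leading:
 assumes f: "tri n lam f" and q: "qsym n q"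
 shows "lkp (quot_op n kap q f) (pm n lam) = q (shv n kap id (pm n lam)) * lkp f (pm n lam)"
proof -
 let ?m = "pm n lam"
 let ?M = "pm n (\<lambda>i. rho n i + lkp ?m i)"
 have wl: "wt n (lkp ?m) = wt n lam" by (simp add: wt_def)
 have key: "a \<notin> kys h" if "tri n lam h" "sig permutes {..<n}" "sig \<noteq> id" "pm n (rho n \<circ> sig) + a = ?M" for h sig a
 proof
  assume "a \<in> kys h"
  then have "wt n (lkp a) \<le> wt n lam" using that(1) by (intro dle_wt) (simp add: tri_def)
  moreover have "wt n (lkp ?m) < wt n (lkp a)" by (rule shift_wt[OF that(2,3) pm_shift_eq[OF that(4)]])
  ultimately show False using wl by linarith
 qed
 have "lkp (vand n * quot_op n kap q f) ?M = lkp (quot_op n kap q f) ?m"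
  unfolding vand_mult lookup_alternating_sum
  by (rule lookup_leading_term[where F = "\<lambda>_. quot_op n kap q f"])
    (use key[OF quot_op_triangular[OF f q]] keys_pm in auto)
 moreover have "lkp (numer n kap q f) ?M = lkp (dgn (\<lambda>m. q (shv n kap id m)) f) ?m"
  unfolding numer_def lookup_alternating_sum
  by (rule lookup_leading_term[where F = "\<lambda>sig. dgn (\<lambda>m. q (shv n kap sig m)) f"])
    (use key[OF f] keys_pm in \<open>auto simp: in_keys_iff\<close>)
 moreover have "f \<in> sympol n" using f by (simp add: tri_def)
 ultimately show ?thesis using quot_op(1)[of f n q kap] q by simp
qed

section \<open>Raising operators\<close>

definition psum1 :: "nat \<Rightarrow> mpol" where "psum1 n = (\<Sum>k<n. var k)"

definition Aop :: "nat \<Rightarrow> nat \<Rightarrow> mpol \<Rightarrow> mpol" where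
 "Aop n kap f = (\<Sum>k<n. var k * (const_pol (of_nat ((n - 1) * kap)) * f + theta k f))"

definition E0 :: "nat \<Rightarrow> mpol \<Rightarrow> mpol" where "E0 n f = (\<Sum>k<n. partial_deriv k f)"

text \<open>
 Raising one exponent of a permuted \<open>\<rho>\<close> makes it equal to another one, unless the
 exponent was the largest, \<open>n - 1\<close>, where \<open>\<phi>\<close> vanishes.  Exchanging
 the two equal exponents is a sign reversing involution on the other terms.\<close>

lemma alternating_shift_cancel:
 fixes G :: "natfun \<Rightarrow> mpol"
 assumes \<phi>: "\<phi> (n - 1) = 0"
 shows "(\<Sum>sig | sig permutes {..<n}. \<Sum>k<n. of_int (sign sig) *
   (\<phi> (rho n (sig k)) * G ((rho n \<circ> sig)(k := Suc (rho n (sig k)))))) = 0"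
proof -
 define T where "T = (\<lambda>(sig,k). of_int (sign sig) *
   (\<phi> (rho n (sig k)) * G ((rho n \<circ> sig)(k := Suc (rho n (sig k))))))"
 define P where "P = {(sig,k). sig permutes {..<n} \<and> k < n \<and> sig k \<noteq> 0}"
 \<comment> \<open>
  the involution exchanges \<open>k\<close> with the index that carries the next larger exponent\<close>
 define j where "j = (\<lambda>(sig,k). (sig \<circ> Transposition.transpose k (inv_into UNIV sig (sig k - 1)),
   inv_into UNIV sig (sig k - 1)) :: natfun \<times> nat)"
 have fin: "finite ({sig. sig permutes {..<n}} \<times> {..<n})" by (simp add: finite_permutations)
 have key: "j p \<in> P \<and> j (j p) = p \<and> T (j p) = - T p" if pP: "p \<in> P" for p
 proof -
  obtain sig k where p: "p = (sig,k)" and sig: "sig permutes {..<n}" and k: "k < n" "sig k \<noteq> 0"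
   using pP unfolding P_def by blast
  define i where "i = inv_into UNIV sig (sig k - 1)"
  have sigi: "sig i = sig k - 1" using permutes_inverses(1)[OF sig] by (simp add: i_def)
  have sigk: "sig k < n" using permutes_in_image[OF sig, of k] k by simp
  have "sig i < n" using sigi sigk by simp
  then have i: "i < n" using permutes_in_image[OF sig, of i] by simp
  have ik: "i \<noteq> k" using sigi k by auto
  define tau where "tau = sig \<circ> Transposition.transpose k i"
  have t: "Transposition.transpose k i permutes {..<n}" using i k by (intro permutes_swap_id) auto
  have tau: "tau permutes {..<n}" unfolding tau_def by (rule permutes_compose[OF t sig])
  have jp: "j p = (tau, i)" by (simp add: p j_def tau_def i_def)
  have taui: "tau i = sig k" and tauk: "tau k = sig i" by (simp_all add: tau_def)
  have P: "j p \<in> P" using tau i k by (simp add: jp P_def taui)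
  have inv_eq: "inv_into UNIV tau (tau i - 1) = k"
   using permutes_inverses(2)[OF tau, of k] taui tauk sigi by metis
  have "j (j p) = (tau \<circ> Transposition.transpose i k, k)" unfolding jp by (simp only: j_def prod.case inv_eq)
  also have "tau \<circ> Transposition.transpose i k = sig"
   by (simp add: tau_def o_assoc[symmetric] transpose_commute)
  finally have jj: "j (j p) = p" by (simp add: p)
  have "sign tau = - sign sig"
   unfolding tau_def using sign_comp[OF sig t] ik by (simp add: sign_swap_id)
  moreover have "(rho n \<circ> tau)(i := Suc (rho n (tau i))) = (rho n \<circ> sig)(k := Suc (rho n (sig k)))"
  proof
   fix x
   have "rho n (sig i) = Suc (rho n (sig k))" using sigi k sigk by (simp add: rho_def)
   then show "((rho n \<circ> tau)(i := Suc (rho n (tau i)))) x = ((rho n \<circ> sig)(k := Suc (rho n (sig k)))) x"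
    using ik by (auto simp: tau_def transpose_def)
  qed
  ultimately have "T (tau, i) = - T (sig, k)" by (simp add: T_def taui)
  then have "T (j p) = - T p" unfolding jp unfolding p .
  with P jj show ?thesis by simp
 qed
 have "(\<Sum>sig | sig permutes {..<n}. \<Sum>k<n. T (sig,k)) = (\<Sum>p\<in>{sig. sig permutes {..<n}} \<times> {..<n}. T p)"
  by (simp add: sum.cartesian_product)
 also have "\<dots> = (\<Sum>p\<in>P. T p)"
 proof (rule sum.mono_neutral_right[OF fin])
  have "rho n 0 = n - 1" by (simp add: rho_def)
  then show "\<forall>p\<in>{sig. sig permutes {..<n}} \<times> {..<n} - P. T p = 0"
   using \<phi> by (auto simp: P_def T_def) (metis One_nat_def gr0I)
 qed (auto simp: P_def)
 also have "\<dots> = 0"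
 proof -
  have "bij_betw j P P" by (rule bij_betw_byWitness[where f' = j]) (use key in auto)
  then have "(\<Sum>p\<in>P. T p) = (\<Sum>p\<in>P. T (j p))" by (simp add: sum.reindex_bij_betw)
  also have "\<dots> = - (\<Sum>p\<in>P. T p)" unfolding sum_negf[symmetric] by (intro sum.cong refl) (use key in auto)
  finally have "2 * (\<Sum>p\<in>P. T p) = 0" by (metis add.right_inverse mult_2)
  then show ?thesis by simp
 qed
 finally show ?thesis by (simp add: T_def)
qed

lemma pm_upd: assumes "k < n" shows "pm n (r(k := Suc (r k))) = sgl k 1 + pm n r"
 using assms by (intro poly_mapping_eqI) (auto simp: lookup_add lookup_single when_def)

lemma var_mon: "k < n \<Longrightarrow> var k * mon n r = mon n (r(k := Suc (r k)))"
 by (simp add: pm_upd mon_def var_def mult_single)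

lemma theta_mon: "k < n \<Longrightarrow> theta k (mon n r) = of_nat (r k) * mon n r"
 unfolding mon_def theta_single const_pol_of_nat[symmetric] const_pol_def mult_single by simp

lemma theta_of_int_mult: "theta i (of_int c * f) = of_int c * theta i f"
 using theta_cmult[of i "of_int c" f] by (simp add: const_pol_of_int)

lemma theta_vand: "k < n \<Longrightarrow> theta k (vand n) = (\<Sum>sig | sig permutes {..<n}.
  of_int (sign sig) * (of_nat (rho n (sig k)) * mon n (rho n \<circ> sig)))"
 by (simp add: vand_alt alt_def theta_sum theta_of_int_mult theta_mon)

text \<open>
 The case \<open>\<phi>(r) = n - 1 - r\<close> of the cancellation, for the expansion of the
 Vandermonde determinant.\<close>

lemma vand_euler: "(\<Sum>k<n. var k * theta k (vand n)) = of_nat (n - 1) * psum1 n * vand n"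
proof -
 have "(\<Sum>sig | sig permutes {..<n}. \<Sum>k<n. of_int (sign sig) * ((of_nat (n - 1) - of_nat (rho n (sig k))) *
   mon n ((rho n \<circ> sig)(k := Suc (rho n (sig k)))))) = 0"
  by (rule alternating_shift_cancel[where \<phi> = "\<lambda>r. of_nat (n - 1) - of_nat r"]) simp
 then have "(\<Sum>k<n. \<Sum>sig | sig permutes {..<n}. of_int (sign sig) * ((of_nat (n - 1) - of_nat (rho n (sig k))) *
   mon n ((rho n \<circ> sig)(k := Suc (rho n (sig k)))))) = 0"
  by (subst sum.swap)
 also have "(\<Sum>k<n. \<Sum>sig | sig permutes {..<n}. of_int (sign sig) * ((of_nat (n - 1) - of_nat (rho n (sig k))) *
   mon n ((rho n \<circ> sig)(k := Suc (rho n (sig k)))))) =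
   (\<Sum>k<n. of_nat (n - 1) * (var k * vand n) - var k * theta k (vand n))"
 proof (intro sum.cong refl)
  fix k assume "k \<in> {..<n}"
  then have k: "k < n" by simp
  have m: "mon n ((rho n \<circ> sig)(k := Suc (rho n (sig k)))) = var k * mon n (rho n \<circ> sig)" for sig
   using var_mon[OF k, of "rho n \<circ> sig"] by simp
  have e1: "var k * theta k (vand n) = (\<Sum>sig | sig permutes {..<n}.
    of_int (sign sig) * (of_nat (rho n (sig k)) * (var k * mon n (rho n \<circ> sig))))"
   unfolding theta_vand[OF k] sum_distrib_left by (intro sum.cong refl) (simp add: algebra_simps)
  have e2: "of_nat (n - 1) * (var k * vand n) = (\<Sum>sig | sig permutes {..<n}.
    of_int (sign sig) * (of_nat (n - 1) * (var k * mon n (rho n \<circ> sig))))"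
   unfolding vand_alt alt_def sum_distrib_left by (intro sum.cong refl) (simp add: algebra_simps)
  show "(\<Sum>sig | sig permutes {..<n}. of_int (sign sig) * ((of_nat (n - 1) - of_nat (rho n (sig k))) *
   mon n ((rho n \<circ> sig)(k := Suc (rho n (sig k)))))) = of_nat (n - 1) * (var k * vand n) - var k * theta k (vand n)"
   unfolding e1 e2 m sum_subtractf[symmetric] by (intro sum.cong refl) (simp add: left_diff_distrib right_diff_distrib)
 qed
 finally show ?thesis by (simp add: sum_subtractf psum1_def sum_distrib_left sum_distrib_right mult.assoc)
qed

definition Rop :: "nat \<Rightarrow> complex \<Rightarrow> mpol \<Rightarrow> mpol" where
 "Rop n Y f = (\<Sum>k<n. var k * (const_pol Y * f + theta k f))"

lemma Rop_add: "Rop n Y (f + g) = Rop n Y f + Rop n Y g"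
 by (simp add: Rop_def distrib_left theta_add sum.distrib)

lemma Rop_single: "Rop n Y (sgl m c) = (\<Sum>k<n. sgl (sgl k 1 + m) ((Y + of_nat (lkp m k)) * c))"
 by (simp add: Rop_def theta_single const_pol_def mult_single var_def algebra_simps flip: single_add)

lemma Rop_0 [simp]: "Rop n Y 0 = 0" by (simp add: Rop_def)

lemma Rop_sum: "Rop n Y (sum f S) = (\<Sum>x\<in>S. Rop n Y (f x))"
 by (induction S rule: infinite_finite_induct) (auto simp: Rop_add)

lemma numer_sum: "numer n kap q (sum f S) = (\<Sum>x\<in>S. numer n kap q (f x))"
 by (induction S rule: infinite_finite_induct) (auto simp: numer_add)

lemma const_sgl: "const_pol a * sgl m c = sgl m (a * c)"
 by (simp add: const_pol_def mult_single)

lemma of_int_sgl: "of_int k * sgl m c = (sgl m (of_int k * c) :: mpol)"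
 using const_sgl[of "of_int k" m c] by (simp only: const_pol_of_int)

lemma numer_single: "numer n kap q (sgl m c) = (\<Sum>sig | sig permutes {..<n}.
  sgl (pm n (rho n \<circ> sig) + m) (of_int (sign sig) * (q (shv n kap sig m) * c)))"
 unfolding numer_def
 by (intro sum.cong refl) (simp add: mon_def mult_single of_int_sgl)

text \<open>
 The scalars in \<open>numer_Rop\<close>, for one permutation and one variable: the difference is a
 multiple of \<open>n - 1 - \<rho>\<^bsub>\<sigma>(k)\<^esub>\<close>, as
 \<open>alternating_shift_cancel\<close> requires.\<close>

lemma raising_scalar:
 fixes X kap N z \<nu> R :: complex
 defines "Y \<equiv> X + (N - 1) * kap"
 shows "R * (X + (kap * z + (1 + \<nu>))) * (Y + \<nu>) - (Y + 2 - N + (z + \<nu>)) * (R * (X + (kap * z + \<nu>)))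
  = (N - 1 - z) * (R * (X + (kap * (z + 1) + \<nu>)))"
 unfolding Y_def by (simp add: algebra_simps)

lemma numer_Rop:
 fixes kap :: nat
 assumes n: "n \<ge> 1"
 defines "Y \<equiv> \<lambda>X. X + (of_nat n - 1) * of_nat kap"
 shows "numer n kap (sekq n X) (Rop n (Y X) f) = Rop n (Y X + 2 - of_nat n) (numer n kap (sekq n X) f)"
proof (induction f rule: poly_mapping_induct)
 case (add f g) then show ?case by (simp add: Rop_add numer_add)
next
 case (single m c)
 define W where "W r = (\<Prod>i<n. X + (of_nat kap * of_nat (r i) + of_nat (lkp m i)))" for r :: natfun
 define G where "G r = sgl (pm n r + m) (W r * c)" for r
 define T where "T sig k = of_int (sign sig) * ((const_pol (of_nat (n - 1) - of_nat (rho n (sig k)))) *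
   G ((rho n \<circ> sig)(k := Suc (rho n (sig k)))))" for sig k
 define L where "L sig k = sgl (pm n (rho n \<circ> sig) + (sgl k 1 + m)) (of_int (sign sig) *
   (sekq n X (shv n kap sig (sgl k 1 + m)) * ((Y X + of_nat (lkp m k)) * c)))" for sig k
 define R where "R sig k = sgl (sgl k 1 + (pm n (rho n \<circ> sig) + m)) ((Y X + 2 - of_nat n + of_nat (lkp (pm n (rho n \<circ> sig) + m) k)) *
   (of_int (sign sig) * (sekq n X (shv n kap sig m) * c)))" for sig k
 have LRT: "L sig k - R sig k = T sig k" if k: "k < n" for sig k
 proof -
  define z where "z = (of_nat (rho n (sig k)) :: complex)"
  define Q where "Q = (\<Prod>i\<in>{..<n}-{k}. X + (of_nat kap * of_nat (rho n (sig i)) + of_nat (lkp m i)))"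
  have split: "(\<Prod>i<n. h i) = h k * (\<Prod>i\<in>{..<n}-{k}. h i)" for h :: point
   using k by (simp add: prod.remove)
  have q1: "sekq n X (shv n kap sig (sgl k 1 + m)) = Q * (X + (of_nat kap * z + (1 + of_nat (lkp m k))))"
   unfolding sekq_def split Q_def shv_def z_def
   by (auto simp: lookup_add lookup_single mult.commute intro!: arg_cong2[where f = "(*)"] prod.cong)
  have q2: "sekq n X (shv n kap sig m) = Q * (X + (of_nat kap * z + of_nat (lkp m k)))"
   unfolding sekq_def split Q_def shv_def z_def by (auto simp: mult.commute)
  have q3: "W ((rho n \<circ> sig)(k := Suc (rho n (sig k)))) = Q * (X + (of_nat kap * (z + 1) + of_nat (lkp m k)))"
   unfolding W_def split Q_def z_def
   by (auto simp: algebra_simps intro!: arg_cong2[where f = "(*)"] prod.cong)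
  have idx1: "pm n (rho n \<circ> sig) + (sgl k 1 + m) = pm n ((rho n \<circ> sig)(k := Suc (rho n (sig k)))) + m"
   using pm_upd[OF k, of "rho n \<circ> sig"] by (simp add: algebra_simps)
  have idx2: "sgl k 1 + (pm n (rho n \<circ> sig) + m) = pm n ((rho n \<circ> sig)(k := Suc (rho n (sig k)))) + m"
   using pm_upd[OF k, of "rho n \<circ> sig"] by (simp add: algebra_simps)
  have lk: "of_nat (lkp (pm n (rho n \<circ> sig) + m) k) = z + of_nat (lkp m k)"
   using k by (simp add: lookup_add z_def)
  note sc = raising_scalar[of Q X "of_nat kap" z "of_nat (lkp m k)" "of_nat n"]
  have n1: "(of_nat (n - 1) :: complex) = of_nat n - 1" using n by simp
  have "L sig k - R sig k = sgl (pm n ((rho n \<circ> sig)(k := Suc (rho n (sig k)))) + m)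
    (of_int (sign sig) * c * (Q * (X + (of_nat kap * z + (1 + of_nat (lkp m k)))) * (Y X + of_nat (lkp m k)) -
     (Y X + 2 - of_nat n + (z + of_nat (lkp m k))) * (Q * (X + (of_nat kap * z + of_nat (lkp m k))))))"
   unfolding L_def R_def idx1 idx2 lk q1 q2 single_diff[symmetric]
   by (rule arg_cong[where f = "sgl _"]) (simp add: algebra_simps)
  also have "\<dots> = T sig k"
   unfolding Y_def sc T_def G_def q3 z_def[symmetric] n1
   by (simp only: const_sgl of_int_sgl mult_ac)
  finally show ?thesis .
 qed
 have "numer n kap (sekq n X) (Rop n (Y X) (sgl m c)) = (\<Sum>sig | sig permutes {..<n}. \<Sum>k<n. L sig k)"
  unfolding Rop_single numer_sum numer_single L_def by (rule sum.swap)
 moreover have "Rop n (Y X + 2 - of_nat n) (numer n kap (sekq n X) (sgl m c)) = (\<Sum>sig | sig permutes {..<n}. \<Sum>k<n. R sig k)"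
  unfolding numer_single Rop_sum Rop_single R_def ..
 moreover have "(\<Sum>sig | sig permutes {..<n}. \<Sum>k<n. T sig k) = 0"
  unfolding T_def
  by (rule alternating_shift_cancel[where \<phi> = "\<lambda>r. const_pol (of_nat (n - 1) - of_nat r)"]) simp
 moreover have "(\<Sum>sig | sig permutes {..<n}. \<Sum>k<n. L sig k) - (\<Sum>sig | sig permutes {..<n}. \<Sum>k<n. R sig k)
   = (\<Sum>sig | sig permutes {..<n}. \<Sum>k<n. T sig k)"
  unfolding sum_subtractf[symmetric] by (intro sum.cong refl) (simp add: LRT)
 ultimately show ?case by simp
qed

lemma Rop_shift: "Rop n Y g + const_pol c * (psum1 n * g) = Rop n (Y + c) g"
 unfolding Rop_def psum1_def sum_distrib_left sum_distrib_right sum.distrib[symmetric]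
 by (intro sum.cong refl) (simp add: const_pol_add algebra_simps)

lemma Rop_vand: "Rop n Y (vand n * g) = vand n * Rop n (Y + of_nat (n - 1)) g"
proof -
 have "Rop n Y (vand n * g) = vand n * Rop n Y g + (\<Sum>k<n. var k * theta k (vand n)) * g"
  by (simp add: Rop_def theta_mult sum.distrib sum_distrib_left sum_distrib_right algebra_simps)
 also have "\<dots> = vand n * (Rop n Y g + of_nat (n - 1) * psum1 n * g)"
  unfolding vand_euler by (simp add: algebra_simps)
 also have "Rop n Y g + of_nat (n - 1) * psum1 n * g = Rop n (Y + of_nat (n - 1)) g"
  using Rop_shift[of n Y g "of_nat (n - 1)"] by (simp add: const_pol_of_nat mult.assoc)
 finally show ?thesis .
qed

lemma act_theta: "sig permutes {..<n} \<Longrightarrow> act sig (theta k f) = theta (inv_into UNIV sig k) (act sig f)"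
 unfolding theta_def
 by (rule act_dgn) (auto simp: lookup_map_key permutes_inj permutes_inverses)

lemma sum_act_index:
 assumes "sig permutes {..<n}"
 shows "(\<Sum>k<n. F (inv_into UNIV sig k)) = (\<Sum>k<n. F k)"
 using sum.permute[OF permutes_inv[OF assms], of F] by (simp add: o_def)

lemma vars_in_theta: "vars_in n f \<Longrightarrow> vars_in n (theta k f)" by (simp add: theta_def vars_in_dgn)

lemma sympol_Rop: assumes "f \<in> sympol n" shows "Rop n Y f \<in> sympol n"
 unfolding sympol_iff
proof (intro conjI allI impI)
 show "vars_in n (Rop n Y f)" unfolding Rop_def using assms
  by (intro vars_in_sum vars_in_mult vars_in_add vars_in_var vars_in_theta) (auto simp: sympol_iff)
 fix sig assume sig: "sig permutes {..<n}"
 have f: "act sig f = f" using assms sig by (simp add: sympol_iff)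
 show "act sig (Rop n Y f) = Rop n Y f"
  unfolding Rop_def act_sum
  by (simp add: act_mult[OF sig] act_add act_const[OF sig] act_theta[OF sig] act_var[OF sig] f
    sum_act_index[OF sig, where F = "\<lambda>k. var k * (const_pol Y * f + theta k f)"])
qed

lemma sympol_psum1: "psum1 n \<in> sympol n"
proof -
 have "psum1 n = Rop n 1 1" by (simp add: psum1_def Rop_def)
 then show ?thesis using sympol_Rop[OF sympol_1] by simp
qed

lemma Aop_Rop: "Aop n kap f = Rop n (of_nat ((n - 1) * kap)) f" by (simp add: Aop_def Rop_def)

lemma Rop_eq: "n \<ge> 1 \<Longrightarrow> Rop n (X + (of_nat n - 1) * of_nat kap) f = const_pol X * (psum1 n * f) + Aop n kap f"
 using Rop_shift[of n "of_nat ((n - 1) * kap)" f X] by (simp add: Aop_Rop of_nat_diff algebra_simps)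

text \<open>
 Before the division by the Vandermonde product this is \<open>numer_Rop\<close>; moving the first
 order operator past that product changes its constant by \<open>n - 1\<close>
 (\<open>Rop_vand\<close>).\<close>

theorem sekiguchi_raising:
 fixes X :: complex and kap :: nat
 assumes n: "n \<ge> 1" and f: "f \<in> sympol n"
 defines "D \<equiv> quot_op n kap (sekq n X)"
 shows "D (const_pol X * (psum1 n * f) + Aop n kap f) = const_pol (X + 1) * (psum1 n * D f) + Aop n kap (D f)"
proof -
 let ?Y = "X + (of_nat n - 1) * of_nat kap"
 have "numer n kap (sekq n X) (Rop n ?Y f) = Rop n (?Y + 2 - of_nat n) (vand n * D f)"
  unfolding D_def quot_op(1)[OF f qsym_sekq] by (rule numer_Rop[OF n])
 also have "\<dots> = vand n * Rop n ((X + 1) + (of_nat n - 1) * of_nat kap) (D f)"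
  unfolding Rop_vand using n by (simp add: of_nat_diff algebra_simps)
 finally have "D (Rop n ?Y f) = Rop n ((X + 1) + (of_nat n - 1) * of_nat kap) (D f)"
  unfolding D_def by (intro quot_op_unique) simp
 then show ?thesis unfolding Rop_eq[OF n] .
qed

lemma sympol_Aop: "f \<in> sympol n \<Longrightarrow> Aop n kap f \<in> sympol n"
 by (simp add: Aop_Rop sympol_Rop)

lemma var_nonzero [simp]: "var i \<noteq> 0"
 by (simp add: var_def single_zero[symmetric] del: single_zero) (metis lookup_single_eq lookup_zero zero_neq_one)

lemma act_partial_deriv:
 assumes sig: "sig permutes {..<n}"
 shows "act sig (partial_deriv k f) = partial_deriv (inv_into UNIV sig k) (act sig f)"
proof -
 have "var (inv_into UNIV sig k) * act sig (partial_deriv k f) = act sig (theta k f)"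
  by (simp add: theta_eq[symmetric] act_mult[OF sig] act_var[OF sig])
 also have "\<dots> = var (inv_into UNIV sig k) * partial_deriv (inv_into UNIV sig k) (act sig f)"
  by (simp add: act_theta[OF sig] theta_eq)
 finally show ?thesis by simp
qed

lemma vars_in_partial_deriv: "vars_in n f \<Longrightarrow> vars_in n (partial_deriv k f)"
proof -
 assume f: "vars_in n f"
 have "kys (m - sgl k 1) \<subseteq> kys m" for m :: expo by (auto simp: in_keys_iff lookup_minus)
 then show ?thesis unfolding partial_deriv_def using f
  by (intro vars_in_sum) (fastforce simp: vars_in_def)
qed

lemma sympol_E0: assumes "f \<in> sympol n" shows "E0 n f \<in> sympol n"
 unfolding sympol_iff
proof (intro conjI allI impI)
 show "vars_in n (E0 n f)" unfolding E0_def using assms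
  by (intro vars_in_sum vars_in_partial_deriv) (auto simp: sympol_iff)
 fix sig assume sig: "sig permutes {..<n}"
 then show "act sig (E0 n f) = E0 n f" using assms
  by (simp add: E0_def act_sum act_partial_deriv[OF sig] sympol_iff sum_act_index[OF sig, where F = "\<lambda>k. partial_deriv k f"])
qed

section \<open>Multiplication by the product of all variables\<close>

definition en :: "nat \<Rightarrow> mpol" where "en n = mon n (\<lambda>_. 1)"

lemma sympol_en: "en n \<in> sympol n"
 by (simp add: sympol_iff en_def vars_in_mon act_mon o_def)

lemma en_nonzero [simp]: "en n \<noteq> 0"
 unfolding en_def mon_def by (metis lookup_single_eq lookup_zero zero_neq_one)

text \<open>
 Multiplication by \<open>x\<^sub>1 \<dots> x\<^sub>n\<close> raises every Euler operator by one,
 which is a shift of \<open>X\<close>.\<close>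

lemma sekiguchi_en:
 assumes f: "f \<in> sympol n"
 shows "quot_op n kap (sekq n X) (en n * f) = en n * quot_op n kap (sekq n (X + 1)) f"
proof (rule quot_op_unique)
 have "numer n kap (sekq n X) (en n * f) = en n * numer n kap (sekq n (X + 1)) f"
  unfolding numer_def en_def mon_def dgn_shift sum_distrib_left
 proof (intro sum.cong refl)
  fix sig
  have "sekq n X (shv n kap sig (pm n (\<lambda>_. 1) + m)) = sekq n (X + 1) (shv n kap sig m)" for m
   unfolding sekq_def shv_def by (intro prod.cong refl) (auto simp: lookup_add)
  then show "of_int (sign sig) * (sgl (pm n (rho n \<circ> sig)) 1 * (sgl (pm n (\<lambda>_. 1)) 1 * dgn (\<lambda>m. sekq n X (shv n kap sig (pm n (\<lambda>_. 1) + m))) f)) =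
    sgl (pm n (\<lambda>_. 1)) 1 * (of_int (sign sig) * (sgl (pm n (rho n \<circ> sig)) 1 * dgn (\<lambda>m. sekq n (X + 1) (shv n kap sig m)) f))"
   by (simp add: algebra_simps)
 qed
 then show "vand n * (en n * quot_op n kap (sekq n (X + 1)) f) = numer n kap (sekq n X) (en n * f)"
  using quot_op(1)[OF f qsym_sekq, of kap "X + 1"] by (simp add: mult.left_commute)
qed

section \<open>The second order operator\<close>

lemma coeff_linear_factors:
 fixes z :: point
 shows "coeff (\<Prod>i<k. [:z i, 1:]) k = 1 \<and> (\<forall>r>k. coeff (\<Prod>i<k. [:z i, 1:]) r = 0) \<and>
  (k \<ge> 1 \<longrightarrow> coeff (\<Prod>i<k. [:z i, 1:]) (k - 1) = (\<Sum>i<k. z i)) \<and>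
  (k \<ge> 2 \<longrightarrow> 2 * coeff (\<Prod>i<k. [:z i, 1:]) (k - 2) = (\<Sum>i<k. z i)\<^sup>2 - (\<Sum>i<k. (z i)\<^sup>2))"
proof (induction k)
 case 0 then show ?case by (auto simp: coeff_eq_0)
next
 case (Suc k)
 have step: "coeff (\<Prod>i<Suc k. [:z i, 1:]) r =
   z k * coeff (\<Prod>i<k. [:z i, 1:]) r + (case r of 0 \<Rightarrow> 0 | Suc r' \<Rightarrow> coeff (\<Prod>i<k. [:z i, 1:]) r')" for r
  by (simp add: mult.commute coeff_pCons split: nat.split)
 consider "k = 0" | "k = 1" | k' where "k = Suc (Suc k')" by (metis One_nat_def not0_implies_Suc)
 then show ?case
 proof cases
  case 1 then show ?thesis unfolding step using Suc by (auto split: nat.splits)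
 next
  case 2
  then show ?thesis unfolding step using Suc
   by (auto split: nat.splits simp: power2_eq_square algebra_simps numeral_2_eq_2)
 next
  case 3
  then have "2 * coeff (\<Prod>i<Suc k. [:z i, 1:]) (Suc k - 2) = (\<Sum>i<Suc k. z i)\<^sup>2 - (\<Sum>i<Suc k. (z i)\<^sup>2)"
   unfolding step using Suc by (simp add: power2_eq_square algebra_simps)
  then show ?thesis unfolding step using Suc 3 by (auto split: nat.splits)
 qed
qed

lemma linear_factors_identity:
 fixes z :: "'s \<Rightarrow> nat \<Rightarrow> complex"
 assumes "finite S" and "\<And>X. (\<Sum>s\<in>S. c s * (\<Prod>i<n. X + z s i)) = 0"
 shows "(\<Sum>s\<in>S. c s) = 0" and "(\<Sum>s\<in>S. c s * ((\<Sum>i<n. z s i)\<^sup>2 - (\<Sum>i<n. (z s i)\<^sup>2))) = 0"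
proof -
 define p where "p = (\<Sum>s\<in>S. Polynomial.smult (c s) (\<Prod>i<n. [:z s i, 1:]))"
 have "poly p X = 0" for X using assms(2)[of X] by (simp add: p_def poly_sum poly_prod add.commute)
 then have "p = 0" using poly_all_0_iff_0 by blast
 then have co: "(\<Sum>s\<in>S. c s * coeff (\<Prod>i<n. [:z s i, 1:]) r) = 0" for r
  using arg_cong[of p 0 "\<lambda>p. coeff p r"] unfolding p_def coeff_sum by simp
 show "(\<Sum>s\<in>S. c s) = 0" using co[of n] coeff_linear_factors by simp
 show "(\<Sum>s\<in>S. c s * ((\<Sum>i<n. z s i)\<^sup>2 - (\<Sum>i<n. (z s i)\<^sup>2))) = 0"
 proof (cases "n \<ge> 2")
  case True
  then have "(\<Sum>s\<in>S. c s * ((\<Sum>i<n. z s i)\<^sup>2 - (\<Sum>i<n. (z s i)\<^sup>2))) =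
   (\<Sum>s\<in>S. c s * (2 * coeff (\<Prod>i<n. [:z s i, 1:]) (n - 2)))"
   using coeff_linear_factors[of _ n] by (intro sum.cong refl) metis
  also have "\<dots> = 2 * (\<Sum>s\<in>S. c s * coeff (\<Prod>i<n. [:z s i, 1:]) (n - 2))"
   by (simp add: sum_distrib_left algebra_simps)
  finally show ?thesis using co by simp
 next
  case False
  then have "n = 0 \<or> n = 1" by auto
  then show ?thesis by auto
 qed
qed

definition sqq :: "nat \<Rightarrow> point \<Rightarrow> complex" where "sqq n z = (\<Sum>i<n. (z i)\<^sup>2)"

lemma lookup_mon_dgn:
 "lkp (mon n r * dgn w f) M = w (M - pm n r) * (if pm n r + (M - pm n r) = M then lkp f (M - pm n r) else 0)"
proof (cases "pm n r + (M - pm n r) = M")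
 case True
 then show ?thesis using lookup_mon_mult[of n r "dgn w f" "M - pm n r"] by simp
next
 case False
 have "lkp (mon n r * dgn w f) M = 0"
 proof (rule ccontr)
  assume "\<not> ?thesis"
  then obtain a where "pm n r + a = M" by (rule lookup_mon_mult_cases)
  then show False using False by auto
 qed
 then show ?thesis using False by simp
qed

text \<open>
 In a fixed degree the sum of the numbers
 \<open>\<kappa> \<rho>\<^bsub>\<sigma>(i)\<^esub> + m\<^sub>i\<close> is constant, so an
 eigenvector for all \<open>X\<close> is one for the sum of their squares as well.\<close>

lemma numer_square:
 assumes deg: "\<And>m. m \<in> kys f \<Longrightarrow> (\<Sum>i<n. lkp m i) = d"
  and a: "(\<Sum>i<n. a i) = of_nat kap * of_nat (\<Sum>i<n. rho n i) + of_nat d"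
  and eig: "\<And>X. numer n kap (sekq n X) f = const_pol (\<Prod>i<n. X + a i) * (vand n * f)"
 shows "numer n kap (sqq n) f = const_pol (\<Sum>i<n. (a i)\<^sup>2) * (vand n * f)"
proof (rule poly_mapping_eqI)
 fix M
 let ?P = "{sig. sig permutes {..<n}}"
 define mm where "mm sig = M - pm n (rho n \<circ> sig)" for sig
 define c where "c sig = of_int (sign sig) * (if pm n (rho n \<circ> sig) + mm sig = M then lkp f (mm sig) else 0)" for sig
 define z where "z sig = shv n kap sig (mm sig)" for sig
 have N: "lkp (numer n kap q f) M = (\<Sum>sig\<in>?P. c sig * q (z sig))" for q
  unfolding numer_def lookup_alternating_sum lookup_mon_dgn c_def z_def mm_def by (intro sum.cong refl) auto
 have V: "lkp (vand n * f) M = (\<Sum>sig\<in>?P. c sig)"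
  using N[of "\<lambda>_. 1"] unfolding numer_def by (simp add: dgn_1 vand_mult)
 have fin: "finite ?P" by (simp add: finite_permutations)
 let ?c = "case_sum c (\<lambda>_. - (\<Sum>sig\<in>?P. c sig))" and ?z = "case_sum z (\<lambda>_. a)"
 have sumS: "(\<Sum>s\<in>insert (Inr ()) (Inl ` ?P). h s) = h (Inr ()) + (\<Sum>sig\<in>?P. h (Inl sig))" for h :: "_ \<Rightarrow> complex"
  using fin by (subst sum.insert) (auto simp: sum.reindex inj_on_def)
 have eq0: "(\<Sum>s\<in>insert (Inr ()) (Inl ` ?P). ?c s * (\<Prod>i<n. X + ?z s i)) = 0" for X
 proof -
  have "(\<Sum>sig\<in>?P. c sig * sekq n X (z sig)) = (\<Prod>i<n. X + a i) * (\<Sum>sig\<in>?P. c sig)"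
   using arg_cong[OF eig[of X], of "\<lambda>p. lkp p M"] by (simp add: N V)
  then show ?thesis unfolding sumS by (simp add: sekq_def mult.commute)
 qed
 have finS: "finite (insert (Inr ()) (Inl ` ?P))" using fin by simp
 note idn = linear_factors_identity(2)[OF finS eq0]
 have eq: "(\<Sum>sig\<in>?P. c sig * ((\<Sum>i<n. z sig i)\<^sup>2 - sqq n (z sig))) =
   (\<Sum>sig\<in>?P. c sig) * ((\<Sum>i<n. a i)\<^sup>2 - (\<Sum>i<n. (a i)\<^sup>2))"
  using idn unfolding sumS by (simp add: sqq_def)
 have cz: "c sig * (\<Sum>i<n. z sig i)\<^sup>2 = c sig * (\<Sum>i<n. a i)\<^sup>2" if "sig \<in> ?P" for sig
 proof (cases "c sig = 0")
  case False
  then have "mm sig \<in> kys f" by (auto simp: c_def in_keys_iff split: if_splits)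
  then have "(\<Sum>i<n. of_nat (lkp (mm sig) i)) = (of_nat d :: complex)" using deg[of "mm sig"] by (simp flip: of_nat_sum)
  moreover have "(\<Sum>i<n. of_nat (rho n (sig i)) :: complex) = of_nat (\<Sum>i<n. rho n i)"
   using sum.permute[of sig "{..<n}" "\<lambda>i. of_nat (rho n i) :: complex"] that by (simp add: o_def)
  ultimately have "(\<Sum>i<n. z sig i) = (\<Sum>i<n. a i)"
   unfolding z_def shv_def a sum.distrib sum_distrib_right[symmetric] by (simp add: mult.commute)
  then show ?thesis by simp
 qed simp
 have "(\<Sum>sig\<in>?P. c sig * ((\<Sum>i<n. z sig i)\<^sup>2 - sqq n (z sig)))
   = (\<Sum>sig\<in>?P. c sig) * (\<Sum>i<n. a i)\<^sup>2 - (\<Sum>sig\<in>?P. c sig * sqq n (z sig))"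
  unfolding right_diff_distrib sum_subtractf sum_distrib_right by (simp only: sum.cong[OF refl cz])
 with eq have "(\<Sum>sig\<in>?P. c sig * sqq n (z sig)) = (\<Sum>i<n. (a i)\<^sup>2) * (\<Sum>sig\<in>?P. c sig)"
  by (simp add: right_diff_distrib[where a = "\<Sum>sig\<in>?P. c sig"] mult.commute)
 then show "lkp (numer n kap (sqq n) f) M = lkp (const_pol (\<Sum>i<n. (a i)\<^sup>2) * (vand n * f)) M"
  by (simp add: N V)
qed

lemma numer_sqq_expand:
 "numer n kap (sqq n) f = const_pol (of_nat kap ^ 2 * of_nat (\<Sum>i<n. rho n i ^ 2)) * (vand n * f)
   + const_pol (2 * of_nat kap) * (\<Sum>i<n. theta i (vand n) * theta i f) + vand n * (\<Sum>i<n. theta i (theta i f))"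
proof -
 let ?P = "{sig. sig permutes {..<n}}"
 have d: "dgn (\<lambda>m. sqq n (shv n kap sig m)) f = const_pol (of_nat kap ^ 2 * of_nat (\<Sum>i<n. rho n i ^ 2)) * f
   + const_pol (2 * of_nat kap) * (\<Sum>i<n. of_nat (rho n (sig i)) * theta i f) + (\<Sum>i<n. theta i (theta i f))"
  if "sig permutes {..<n}" for sig
 proof (rule poly_mapping_eqI)
  fix m
  have r: "(\<Sum>i<n. of_nat (rho n (sig i)) ^ 2) = (\<Sum>i<n. of_nat (rho n i) ^ 2 :: complex)"
   using sum.permute[OF that, of "\<lambda>i. of_nat (rho n i) ^ 2 :: complex"] by (simp add: o_def)
  have l: "lkp (of_nat k * g) m = of_nat k * lkp (g::mpol) m" for k g
   by (simp flip: const_pol_of_nat)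
  have e: "sqq n (shv n kap sig m) = of_nat kap ^ 2 * (\<Sum>i<n. of_nat (rho n i) ^ 2)
   + 2 * of_nat kap * (\<Sum>i<n. of_nat (rho n (sig i)) * of_nat (lkp m i)) + (\<Sum>i<n. of_nat (lkp m i) * of_nat (lkp m i))"
   unfolding r[symmetric] sqq_def shv_def sum_distrib_left sum.distrib[symmetric]
   by (intro sum.cong refl) (simp add: power2_eq_square algebra_simps)
  show "lkp (dgn (\<lambda>m. sqq n (shv n kap sig m)) f) m = lkp (const_pol (of_nat kap ^ 2 * of_nat (\<Sum>i<n. rho n i ^ 2)) * f
   + const_pol (2 * of_nat kap) * (\<Sum>i<n. of_nat (rho n (sig i)) * theta i f) + (\<Sum>i<n. theta i (theta i f))) m"
   by (simp add: lookup_add lookup_sum theta_def l e)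
    (simp add: distrib_right sum_distrib_right mult.assoc)
 qed
 have "numer n kap (sqq n) f = (\<Sum>sig\<in>?P. of_int (sign sig) * (mon n (rho n \<circ> sig) *
   (const_pol (of_nat kap ^ 2 * of_nat (\<Sum>i<n. rho n i ^ 2)) * f
   + const_pol (2 * of_nat kap) * (\<Sum>i<n. of_nat (rho n (sig i)) * theta i f) + (\<Sum>i<n. theta i (theta i f)))))"
  unfolding numer_def by (intro sum.cong refl) (simp add: d)
 also have "\<dots> = const_pol (of_nat kap ^ 2 * of_nat (\<Sum>i<n. rho n i ^ 2)) * (\<Sum>sig\<in>?P. of_int (sign sig) * (mon n (rho n \<circ> sig) * f))
   + const_pol (2 * of_nat kap) * (\<Sum>sig\<in>?P. \<Sum>i<n. of_int (sign sig) * (of_nat (rho n (sig i)) * mon n (rho n \<circ> sig)) * theta i f)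
   + (\<Sum>sig\<in>?P. of_int (sign sig) * (mon n (rho n \<circ> sig) * (\<Sum>i<n. theta i (theta i f))))"
  by (simp add: distrib_left sum.distrib sum_distrib_left algebra_simps)
 also have "(\<Sum>sig\<in>?P. \<Sum>i<n. of_int (sign sig) * (of_nat (rho n (sig i)) * mon n (rho n \<circ> sig)) * theta i f)
   = (\<Sum>i<n. theta i (vand n) * theta i f)"
  by (subst sum.swap) (auto simp: theta_vand sum_distrib_right intro!: sum.cong)
 finally show ?thesis unfolding vand_mult[symmetric] by simp
qed

section \<open>Partitions and exponents\<close>

definition Par :: "nat \<Rightarrow> natfun set" where
 "Par n = {lam. is_partition lam \<and> part_length lam \<le> n}"

lemma partition_support: assumes "is_partition lam" shows "lam i \<noteq> 0 \<longleftrightarrow> i < part_length lam"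
proof -
 have anti: "\<And>i j. i \<le> j \<Longrightarrow> lam j \<le> lam i" and fin: "finite {i. lam i \<noteq> 0}"
  using assms by (auto simp: is_partition_def antimono_def)
 obtain k where k: "\<And>i. lam i \<noteq> 0 \<Longrightarrow> i < k" using fin[unfolded finite_nat_set_iff_bounded] by auto
 define l where "l = (LEAST l. lam l = 0)"
 have "lam l = 0" unfolding l_def by (rule LeastI[of _ k]) (use k in blast)
 then have "lam i \<noteq> 0 \<longleftrightarrow> i < l" for i
  using anti[of l i] not_less_Least[of i "\<lambda>l. lam l = 0"] unfolding l_def
  by (metis le_zero_eq not_less)
 then have "{i. lam i \<noteq> 0} = {..<l}" by auto
 then show ?thesis using \<open>\<And>i. lam i \<noteq> 0 \<longleftrightarrow> i < l\<close> by (simp add: part_length_def)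
qed

lemma partition_antimono: "is_partition lam \<Longrightarrow> i \<le> j \<Longrightarrow> lam j \<le> lam i"
 by (auto simp: is_partition_def antimono_def)

lemma part_size_sum: assumes "is_partition lam" "part_length lam \<le> n"
 shows "part_size lam = (\<Sum>i<n. lam i)"
proof -
 have sub: "{i. lam i \<noteq> 0} \<subseteq> {..<n}"
 proof
  fix i assume "i \<in> {i. lam i \<noteq> 0}"
  then show "i \<in> {..<n}" using partition_support[OF assms(1), of i] assms(2) by simp
 qed
 show ?thesis unfolding part_size_def by (rule sum.mono_neutral_left[OF _ sub]) auto
qed

lemma part_length_le_size: assumes "is_partition lam" shows "part_length lam \<le> part_size lam"
proof -
 have "(\<Sum>i<part_length lam. 1) \<le> (\<Sum>i<part_length lam. lam i)"
 proof (rule sum_mono)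
  fix i assume "i \<in> {..<part_length lam}"
  then have "lam i \<noteq> 0" using partition_support[OF assms] by simp
  then show "1 \<le> lam i" by simp
 qed
 then show ?thesis using part_size_sum[OF assms order_refl] by simp
qed

lemma Par_zero: "lam \<in> Par n \<Longrightarrow> i \<ge> n \<Longrightarrow> lam i = 0"
 using partition_support[of lam i] by (auto simp: Par_def)

lemma finite_partitions_size: "finite {lam. is_partition lam \<and> part_size lam \<le> d}"
proof (rule finite_subset)
 show "{lam. is_partition lam \<and> part_size lam \<le> d} \<subseteq>
   (\<lambda>f i. if i < d then f i else 0) ` (PiE {..<d} (\<lambda>_. {..d}))"
 proof
  fix lam assume "lam \<in> {lam. is_partition lam \<and> part_size lam \<le> d}"
  then have p: "is_partition lam" and s: "part_size lam \<le> d" by auto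
  then have l: "part_length lam \<le> d" using part_length_le_size by fastforce
  have "lam i \<le> d" for i
  proof (cases "i < d")
   case True
   then have "lam i \<le> (\<Sum>i<d. lam i)" by (intro member_le_sum) auto
   then show ?thesis using part_size_sum[OF p l] s by simp
  next
   case False then show ?thesis using partition_support[OF p, of i] l by auto
  qed
  moreover have "lam = (\<lambda>i. if i < d then restrict lam {..<d} i else 0)"
  proof
   fix i show "lam i = (if i < d then restrict lam {..<d} i else 0)"
    using partition_support[OF p, of i] l by auto
  qed
  ultimately show "lam \<in> (\<lambda>f i. if i < d then f i else 0) ` (PiE {..<d} (\<lambda>_. {..d}))"
   by (intro image_eqI[of _ _ "restrict lam {..<d}"]) auto
 qed
qed (intro finite_imageI finite_PiE, auto)

lemma dle_refl: "lam \<in> Par n \<Longrightarrow> dle n lam lam"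
 by (rule dle_antimonoI) (auto simp: Par_def partition_antimono)

lemma dle_size: "lam \<in> Par n \<Longrightarrow> mu \<in> Par n \<Longrightarrow> dle n mu lam \<Longrightarrow> part_size mu = part_size lam"
 by (simp add: Par_def dle_def part_size_sum[of _ n])

lemma Par_eqI: assumes "lam \<in> Par n" "mu \<in> Par n" "\<And>i. i < n \<Longrightarrow> lam i = mu i" shows "lam = mu"
proof
 fix i show "lam i = mu i" using assms Par_zero[of lam n i] Par_zero[of mu n i] by (cases "i < n") auto
qed

lemma dle_wt_less: assumes "lam \<in> Par n" "mu \<in> Par n" "dle n mu lam" "mu \<noteq> lam"
 shows "wt n mu < wt n lam"
 using dle_wt[OF assms(3)] dle_wt_eq[OF assms(3)] Par_eqI[OF assms(2,1)] assms(4) by fastforce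

lemma dom_less_dle: assumes "dom_less mu lam" "part_length mu \<le> n" "part_length lam \<le> n"
 shows "dle n mu lam"
 using assms by (intro dle_antimonoI) (auto simp: dom_less_def partition_antimono part_size_sum[symmetric])

lemma dle_dom_less: assumes "dle n mu lam" "mu \<in> Par n" "lam \<in> Par n" "mu \<noteq> lam"
 shows "dom_less mu lam"
 unfolding dom_less_def
proof (intro conjI allI)
 show sz: "part_size mu = part_size lam" using dle_size assms by blast
 fix k
 show "(\<Sum>i<k. mu i) \<le> (\<Sum>i<k. lam i)"
 proof (cases "k \<le> n")
  case True then show ?thesis using dle_prefix[OF assms(1)] by simp
 next
  case False
  then show ?thesis using sz assms(2,3) part_size_sum[of mu k] part_size_sum[of lam k] by (simp add: Par_def)
 qed
qed (use assms in \<open>auto simp: Par_def\<close>)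

lemma dom_less_length: assumes "dom_less mu lam" shows "part_length lam \<le> part_length mu"
proof (rule ccontr)
 assume less: "\<not> ?thesis"
 let ?k = "part_length mu"
 have p: "is_partition mu" "is_partition lam" using assms by (auto simp: dom_less_def)
 have "part_size lam = (\<Sum>i<?k. mu i)"
  using part_size_sum[OF p(1), of ?k] assms by (simp add: dom_less_def)
 also have "\<dots> \<le> (\<Sum>i<?k. lam i)" using assms by (simp add: dom_less_def)
 also have "\<dots> < (\<Sum>i<Suc ?k. lam i)" using less partition_support[OF p(2), of ?k] by simp
 also have "\<dots> \<le> (\<Sum>i<part_length lam. lam i)" using less by (intro sum_mono2) auto
 finally show False using part_size_sum[OF p(2), of "part_length lam"] by simp
qed

text \<open>
 Among the permutations of \<open>m\<close> one of maximal weight is antitone, as otherwise a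
 transposition would increase the weight.\<close>

lemma sort_expo:
 assumes "kys m \<subseteq> {..<n}"
 obtains sig lam where "sig permutes {..<n}" "lam \<in> Par n" "m = mkey sig (pm n lam)"
proof -
 let ?P = "{sig. sig permutes {..<n}}"
 have "id \<in> ?P" by (simp add: permutes_id)
 then have "finite ?P" "?P \<noteq> {}" by (auto simp: finite_permutations simp del: mem_Collect_eq)
 then obtain sig where sig: "sig permutes {..<n}"
  and max: "\<And>tau. tau permutes {..<n} \<Longrightarrow> wt n (lkp m \<circ> tau) \<le> wt n (lkp m \<circ> sig)"
  using ex_max_nat[of ?P "\<lambda>sig. wt n (lkp m \<circ> sig)"] by auto
 define lam where "lam i = (if i < n then lkp m (sig i) else 0)" for i
 have anti: "lkp m (sig j) \<le> lkp m (sig i)" if "i \<le> j" "j < n" for i j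
 proof (rule ccontr)
  assume less: "\<not> ?thesis"
  then have "i < j" using that by (cases "i = j") auto
  let ?t = "Transposition.transpose i j"
  have "?t permutes {..<n}" using that by (intro permutes_swap_id) auto
  then have "wt n (lkp m \<circ> (sig \<circ> ?t)) \<le> wt n (lkp m \<circ> sig)" by (intro max permutes_compose sig)
  then show False using wt_transpose[of i j n "lkp m \<circ> sig"] \<open>i < j\<close> that less by (simp add: o_assoc)
 qed
 have "is_partition lam"
  unfolding is_partition_def antimono_def
  using anti by (auto simp: lam_def intro: finite_subset[of _ "{..<n}"])
 moreover have "part_length lam \<le> n"
 proof -
  have "{i. lam i \<noteq> 0} \<subseteq> {..<n}" by (auto simp: lam_def)
  from card_mono[OF finite_lessThan this] show ?thesis by (simp add: part_length_def)
 qed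
 ultimately have "lam \<in> Par n" by (simp add: Par_def)
 moreover have "m = mkey (inv_into UNIV sig) (pm n lam)"
 proof (rule poly_mapping_eqI)
  fix i
  have "inv_into UNIV sig i < n \<longleftrightarrow> i < n" using permutes_in_image[OF permutes_inv[OF sig], of i] by simp
  then show "lkp m i = lkp (mkey (inv_into UNIV sig) (pm n lam)) i"
   using assms by (auto simp: lookup_map_key permutes_inj[OF permutes_inv[OF sig]] lam_def
     permutes_inverses[OF sig] in_keys_iff subset_iff)
 qed
 ultimately show thesis using that permutes_inv[OF sig] by blast
qed

lemma sympol_eqI:
 assumes "f \<in> sympol n" "g \<in> sympol n" "\<And>lam. lam \<in> Par n \<Longrightarrow> lkp f (pm n lam) = lkp g (pm n lam)"
 shows "f = g"
proof (rule poly_mapping_eqI)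
 fix m
 show "lkp f m = lkp g m"
 proof (cases "kys m \<subseteq> {..<n}")
  case True
  then show ?thesis by (rule sort_expo) (simp add: sympol_lookup_map_key[OF assms(1)] sympol_lookup_map_key[OF assms(2)] assms(3))
 next
  case False
  then have "m \<notin> kys f" "m \<notin> kys g" using sympol_keys[OF assms(1), of m] sympol_keys[OF assms(2), of m] by blast+
  then show ?thesis by (simp add: in_keys_iff)
 qed
qed

lemma lookup_tri_dle: "tri n lam f \<Longrightarrow> lkp f (pm n mu) \<noteq> 0 \<Longrightarrow> dle n mu lam"
proof -
 assume "tri n lam f" "lkp f (pm n mu) \<noteq> 0"
 then have "dle n (lkp (pm n mu)) lam" by (simp add: tri_def in_keys_iff)
 moreover have "(\<Sum>i\<in>S. lkp (pm n mu) i) = (\<Sum>i\<in>S. mu i)" if "S \<subseteq> {..<n}" for S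
  using that by (intro sum.cong) auto
 ultimately show ?thesis by (auto simp: dle_def)
qed

lemma triI:
 assumes f: "f \<in> sympol n" and d: "\<And>mu. mu \<in> Par n \<Longrightarrow> lkp f (pm n mu) \<noteq> 0 \<Longrightarrow> dle n mu lam"
 shows "tri n lam f"
 unfolding tri_def
proof (intro conjI ballI f)
 fix m assume m: "m \<in> kys f"
 then obtain sig mu where sig: "sig permutes {..<n}" and mu: "mu \<in> Par n" and meq: "m = mkey sig (pm n mu)"
  using sort_expo sympol_keys[OF f] by metis
 have "lkp f (pm n mu) \<noteq> 0" using m sympol_lookup_map_key[OF f sig, of "pm n mu"] meq by (simp add: in_keys_iff)
 then have "dle n (mu \<circ> sig) lam" using d[OF mu] dle_perm[OF sig] by blast
 moreover have "lkp m = mu \<circ> sig" using Par_zero[OF mu]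
  by (auto simp: meq lookup_map_key permutes_inj[OF sig] fun_eq_iff)
 ultimately show "dle n (lkp m) lam" by simp
qed

section \<open>Unitriangular families\<close>

definition unitri :: "nat \<Rightarrow> natfun \<Rightarrow> mpol \<Rightarrow> bool" where
 "unitri n lam f \<longleftrightarrow> tri n lam f \<and> lkp f (pm n lam) = 1"

definition downset :: "nat \<Rightarrow> natfun set \<Rightarrow> bool" where
 "downset n I \<longleftrightarrow> finite I \<and> I \<subseteq> Par n \<and> (\<forall>lam\<in>I. \<forall>mu\<in>Par n. dle n mu lam \<longrightarrow> mu \<in> I)"

text \<open>
 Elimination from the top: a partition of maximal weight in the finite lower set is removed together
 with its basis element.\<close>

lemma unitri_span:
 assumes "downset n I" "\<And>lam. lam \<in> I \<Longrightarrow> unitri n lam (B lam)" "f \<in> sympol n"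
  "\<And>lam. lam \<in> Par n \<Longrightarrow> lkp f (pm n lam) \<noteq> 0 \<Longrightarrow> lam \<in> I"
 shows "\<exists>c. f = (\<Sum>lam\<in>I. const_pol (c lam) * B lam)"
 using assms
proof (induction "card I" arbitrary: I f)
 case 0
 then have "I = {}" by (auto simp: downset_def)
 then have "f = 0" using 0 by (intro sympol_eqI[of _ n]) auto
 then show ?case using \<open>I = {}\<close> by simp
next
 case (Suc k)
 have I: "finite I" "I \<subseteq> Par n" "\<And>lam mu. lam \<in> I \<Longrightarrow> mu \<in> Par n \<Longrightarrow> dle n mu lam \<Longrightarrow> mu \<in> I"
  using Suc.prems(1) by (auto simp: downset_def)
 have "I \<noteq> {}" using Suc.hyps(2) by auto
 then obtain lam where lam: "lam \<in> I" and max: "\<And>mu. mu \<in> I \<Longrightarrow> wt n mu \<le> wt n lam"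
  using ex_max_nat[OF I(1), of "wt n"] by blast
 define c where "c = lkp f (pm n lam)"
 define f' where "f' = f - const_pol c * B lam"
 have B: "B lam \<in> sympol n" "tri n lam (B lam)" "lkp (B lam) (pm n lam) = 1"
  using Suc.prems(2)[OF lam] by (auto simp: unitri_def tri_def)
 have ds: "downset n (I - {lam})"
  unfolding downset_def
 proof (intro conjI ballI impI)
  fix mu nu assume mu: "mu \<in> I - {lam}" and nu: "nu \<in> Par n" "dle n nu mu"
  have "nu \<noteq> lam" using dle_wt_less[of mu n lam] max[of mu] mu nu I(2) by fastforce
  then show "nu \<in> I - {lam}" using I(3) mu nu by blast
 qed (use I in auto)
 have "\<exists>c. f' = (\<Sum>mu\<in>I - {lam}. const_pol (c mu) * B mu)"
 proof (rule Suc.hyps(1)[OF _ ds])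
  show "k = card (I - {lam})" using Suc.hyps(2) lam I(1) by simp
  show "f' \<in> sympol n" unfolding f'_def by (intro sympol_diff sympol_cmult Suc.prems B)
  fix mu assume mu: "mu \<in> Par n" "lkp f' (pm n mu) \<noteq> 0"
  have "lkp f (pm n mu) \<noteq> 0 \<or> lkp (B lam) (pm n mu) \<noteq> 0" using mu(2) by (auto simp: f'_def lookup_minus)
  then have "mu \<in> I" using Suc.prems(4)[OF mu(1)] lookup_tri_dle[OF B(2)] I(3)[OF lam mu(1)] by blast
  moreover have "mu \<noteq> lam" using mu(2) B(3) by (auto simp: f'_def lookup_minus c_def)
  ultimately show "mu \<in> I - {lam}" by simp
 qed (use Suc.prems in auto)
 then obtain c' where c': "f' = (\<Sum>mu\<in>I - {lam}. const_pol (c' mu) * B mu)" by blast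
 have "f = (\<Sum>mu\<in>I. const_pol ((c'(lam := c)) mu) * B mu)"
 proof -
  have "(\<Sum>mu\<in>I - {lam}. const_pol ((c'(lam := c)) mu) * B mu) = f'"
   unfolding c' by (intro sum.cong) auto
  then show ?thesis by (subst sum.remove[OF I(1) lam]) (simp add: f'_def)
 qed
 then show ?case by blast
qed

lemma unitri_indep:
 assumes "finite I" "I \<subseteq> Par n" "\<And>lam. lam \<in> I \<Longrightarrow> unitri n lam (B lam)"
  "(\<Sum>lam\<in>I. const_pol (c lam) * B lam) = 0" "lam \<in> I"
 shows "c lam = 0"
proof (rule ccontr)
 assume "c lam \<noteq> 0"
 define J where "J = {mu\<in>I. c mu \<noteq> 0}"
 have "finite J" "J \<noteq> {}" using assms \<open>c lam \<noteq> 0\<close> by (auto simp: J_def)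
 then obtain nu where nu: "nu \<in> J" and max: "\<And>mu. mu \<in> J \<Longrightarrow> wt n mu \<le> wt n nu"
  using ex_max_nat[of J "wt n"] by blast
 have nuI: "nu \<in> I" "c nu \<noteq> 0" using nu by (auto simp: J_def)
 have "0 = (\<Sum>lam\<in>I. c lam * lkp (B lam) (pm n nu))"
  using arg_cong[OF assms(4), of "\<lambda>f. lkp f (pm n nu)"] by (simp add: lookup_sum)
 also have "\<dots> = (\<Sum>lam\<in>{nu}. c lam * lkp (B lam) (pm n nu))"
 proof (rule sum.mono_neutral_right[OF assms(1)])
  show "\<forall>i\<in>I - {nu}. c i * lkp (B i) (pm n nu) = 0"
  proof (rule ballI, rule ccontr)
   fix mu assume mu: "mu \<in> I - {nu}" and nz: "c mu * lkp (B mu) (pm n nu) \<noteq> 0"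
   then have "dle n nu mu" using assms(3)[of mu] lookup_tri_dle[of n mu "B mu" nu] by (auto simp: unitri_def)
   then have "wt n nu < wt n mu" using dle_wt_less[of mu n nu] mu nuI assms(2) by auto
   moreover have "mu \<in> J" using mu nz by (auto simp: J_def)
   ultimately show False using max[of mu] by simp
  qed
 qed (use nuI in auto)
 also have "\<dots> = c nu" using assms(3)[OF nuI(1)] by (simp add: unitri_def)
 finally show False using nuI by simp
qed

lemma downset_below: "lam \<in> Par n \<Longrightarrow> downset n {mu\<in>Par n. dle n mu lam \<and> mu \<noteq> lam}"
 unfolding downset_def
proof (intro conjI ballI impI)
 assume lam: "lam \<in> Par n"
 show "finite {mu\<in>Par n. dle n mu lam \<and> mu \<noteq> lam}"
  by (rule finite_subset[OF _ finite_partitions_size[of "part_size lam"]])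
    (use dle_size[OF lam] in \<open>auto simp: Par_def\<close>)
 fix mu nu assume mu: "mu \<in> {mu\<in>Par n. dle n mu lam \<and> mu \<noteq> lam}" and nu: "nu \<in> Par n" "dle n nu mu"
 have "wt n nu < wt n lam" using dle_wt_less[of lam n mu] dle_wt[OF nu(2)] mu lam by auto
 then show "nu \<in> {mu\<in>Par n. dle n mu lam \<and> mu \<noteq> lam}" using mu nu dle_trans by blast
qed auto

text \<open>
 Start with any unitriangular element and correct it by the eigenvectors for smaller partitions,
 which exist by induction; the corrections divide by differences of eigenvalues.\<close>

lemma triangular_eigenvector:
 fixes kap :: nat and q :: "point \<Rightarrow> complex"
 assumes q: "qsym n q" and lam: "lam \<in> Par n"
 defines "e \<equiv> \<lambda>lam. q (shv n kap id (pm n lam))"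
 assumes dist: "\<And>lam mu. lam \<in> Par n \<Longrightarrow> mu \<in> Par n \<Longrightarrow> part_size lam = d \<Longrightarrow> part_size mu = d \<Longrightarrow>
   e lam = e mu \<Longrightarrow> lam = mu"
  and size: "part_size lam = d"
  and base: "\<And>lam. lam \<in> Par n \<Longrightarrow> \<exists>f. unitri n lam f"
 shows "\<exists>f. unitri n lam f \<and> quot_op n kap q f = const_pol (e lam) * f"
 using lam size
proof (induction "wt n lam" arbitrary: lam rule: less_induct)
 case less
 define I where "I = {mu\<in>Par n. dle n mu lam \<and> mu \<noteq> lam}"
 have ds: "downset n I" unfolding I_def by (rule downset_below) (rule less.prems)
 have fin: "finite I" using ds by (simp add: downset_def)
 have "\<exists>f. unitri n mu f \<and> quot_op n kap q f = const_pol (e mu) * f" if "mu \<in> I" for mu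
  using that less.prems dle_wt_less[of lam n mu] dle_size[of lam n mu]
  by (intro less.hyps) (auto simp: I_def)
 then obtain B where B: "\<And>mu. mu \<in> I \<Longrightarrow> unitri n mu (B mu)"
   "\<And>mu. mu \<in> I \<Longrightarrow> quot_op n kap q (B mu) = const_pol (e mu) * B mu" by metis
 obtain f where f: "unitri n lam f" using base less.prems by blast
 have fs: "f \<in> sympol n" "tri n lam f" using f by (auto simp: unitri_def tri_def)
 define r where "r = quot_op n kap q f - const_pol (e lam) * f"
 have rs: "r \<in> sympol n" unfolding r_def by (intro sympol_diff sympol_cmult fs quot_op(2) q)
 have "mu \<in> I" if "mu \<in> Par n" "lkp r (pm n mu) \<noteq> 0" for mu
 proof -
  have "lkp (quot_op n kap q f) (pm n mu) \<noteq> 0 \<or> lkp f (pm n mu) \<noteq> 0" using that(2) by (auto simp: r_def lookup_minus)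
  then have "dle n mu lam" using lookup_tri_dle[OF fs(2)] lookup_tri_dle[OF quot_op_triangular[OF fs(2) q]] by blast
  moreover have "mu \<noteq> lam"
   using that(2) quot_op_leading[OF fs(2) q] by (auto simp: r_def lookup_minus e_def)
  ultimately show ?thesis using that by (simp add: I_def)
 qed
 then obtain c where c: "r = (\<Sum>mu\<in>I. const_pol (c mu) * B mu)"
  using unitri_span[OF ds B(1) rs] by blast
 define v where "v = f - (\<Sum>mu\<in>I. const_pol (c mu / (e mu - e lam)) * B mu)"
 have Bs: "B mu \<in> sympol n" "tri n mu (B mu)" if "mu \<in> I" for mu using B(1)[OF that] by (auto simp: unitri_def tri_def)
 have S: "(\<Sum>mu\<in>I. const_pol (c mu / (e mu - e lam)) * B mu) \<in> sympol n"
  by (intro sympol_sum sympol_cmult Bs)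
 have v: "v \<in> sympol n" unfolding v_def by (intro sympol_diff fs S)
 have ne: "e mu \<noteq> e lam" if "mu \<in> I" for mu
  using dist[of mu lam] that less.prems dle_size[of lam n mu] by (auto simp: I_def)
 have "quot_op n kap q v = quot_op n kap q f - (\<Sum>mu\<in>I. const_pol (c mu / (e mu - e lam)) * quot_op n kap q (B mu))"
 proof -
  have "quot_op n kap q f = quot_op n kap q (v + (\<Sum>mu\<in>I. const_pol (c mu / (e mu - e lam)) * B mu))" by (simp add: v_def)
  also have "\<dots> = quot_op n kap q v + (\<Sum>mu\<in>I. const_pol (c mu / (e mu - e lam)) * quot_op n kap q (B mu))"
   by (subst quot_op_add[OF v S q]) (simp add: quot_op_sum Bs q)
  finally show ?thesis by simp
 qed
 also have "\<dots> = const_pol (e lam) * f + r - (\<Sum>mu\<in>I. const_pol (e mu * (c mu / (e mu - e lam))) * B mu)"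
  by (simp add: r_def B(2) const_pol_mult[symmetric] mult.assoc[symmetric] mult.commute[of "e _"])
 also have "(\<Sum>mu\<in>I. const_pol (e mu * (c mu / (e mu - e lam))) * B mu) =
   r + const_pol (e lam) * (\<Sum>mu\<in>I. const_pol (c mu / (e mu - e lam)) * B mu)"
  unfolding c sum_distrib_left sum.distrib[symmetric]
 proof (intro sum.cong refl)
  fix mu assume "mu \<in> I"
  then have "e mu * (c mu / (e mu - e lam)) = c mu + e lam * (c mu / (e mu - e lam))"
   using ne[of mu] by (simp add: field_simps)
  then show "const_pol (e mu * (c mu / (e mu - e lam))) * B mu =
    const_pol (c mu) * B mu + const_pol (e lam) * (const_pol (c mu / (e mu - e lam)) * B mu)"
   by (simp only: const_pol_add const_pol_mult distrib_right mult.assoc)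
 qed
 finally have ev: "quot_op n kap q v = const_pol (e lam) * v" by (simp add: v_def algebra_simps)
 have lk: "lkp v (pm n nu) = lkp f (pm n nu) - (\<Sum>mu\<in>I. c mu / (e mu - e lam) * lkp (B mu) (pm n nu))" for nu
  by (simp add: v_def lookup_minus lookup_sum)
 have "tri n lam v"
 proof (rule triI[OF v])
  fix nu assume nu: "nu \<in> Par n" "lkp v (pm n nu) \<noteq> 0"
  then have "lkp f (pm n nu) \<noteq> 0 \<or> (\<exists>mu\<in>I. lkp (B mu) (pm n nu) \<noteq> 0)"
   unfolding lk by (metis (no_types, lifting) diff_zero mult_zero_right sum.neutral)
  then show "dle n nu lam"
   using lookup_tri_dle[OF fs(2), of nu] lookup_tri_dle[OF Bs(2), of _ nu] dle_trans[of n nu _ lam] by (auto simp: I_def)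
 qed
 moreover have "lkp v (pm n lam) = 1"
 proof -
  have "lkp (B mu) (pm n lam) = 0" if "mu \<in> I" for mu
   using lookup_tri_dle[OF Bs(2)[OF that], of lam] that less.prems(1) dle_wt_less[of lam n mu] dle_wt[of n lam mu]
   by (auto simp: I_def)
  then show ?thesis unfolding lk using f by (simp add: unitri_def)
 qed
 ultimately show ?case using ev by (auto simp: unitri_def)
qed

section \<open>Restriction of symmetric functions to finitely many variables\<close>

definition deg :: "expo \<Rightarrow> nat" where "deg m = (\<Sum>i\<in>kys m. lkp m i)"

lemma deg_superset: "finite S \<Longrightarrow> kys m \<subseteq> S \<Longrightarrow> deg m = (\<Sum>i\<in>S. lkp m i)"
 unfolding deg_def by (intro sum.mono_neutral_left) (auto simp: in_keys_iff)

lemma deg_pm: "deg (pm n r) = (\<Sum>i<n. r i)"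
 by (subst deg_superset[of "{..<n}"]) (auto simp: keys_pm)

lemma finite_expo_bounded: "finite {m :: expo. kys m \<subseteq> {..<n} \<and> deg m \<le> d}"
proof (rule finite_subset)
 show "{m :: expo. kys m \<subseteq> {..<n} \<and> deg m \<le> d} \<subseteq> pm n ` (PiE {..<n} (\<lambda>_. {..d}))"
 proof
  fix m :: expo assume "m \<in> {m :: expo. kys m \<subseteq> {..<n} \<and> deg m \<le> d}"
  then have k: "kys m \<subseteq> {..<n}" and d: "deg m \<le> d" by auto
  have "lkp m i \<le> d" if "i < n" for i
   using member_le_sum[of i "{..<n}" "lkp m"] that d deg_superset[OF _ k] by simp
  moreover have "m = pm n (restrict (lkp m) {..<n})" using pm_lkp[OF k] pm_cong[of n "lkp m" "restrict (lkp m) {..<n}"] by simp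
  ultimately show "m \<in> pm n ` (PiE {..<n} (\<lambda>_. {..d}))" by (intro image_eqI[of _ _ "restrict (lkp m) {..<n}"]) auto
 qed
qed (intro finite_imageI finite_PiE, auto)

definition homog :: "nat \<Rightarrow> symfun \<Rightarrow> bool" where
 "homog d f \<longleftrightarrow> (\<forall>m. f m \<noteq> 0 \<longrightarrow> deg m = d)"

lemma lookup_restrict_vars:
 assumes "homog d f" shows "lkp (restrict_vars n f) m = (if kys m \<subseteq> {..<n} then f m else 0)"
proof -
 have "finite {m. (if kys m \<subseteq> {..<n} then f m else 0) \<noteq> 0}"
  by (rule finite_subset[OF _ finite_expo_bounded[of n d]]) (use assms in \<open>auto simp: homog_def split: if_splits\<close>)
 then show ?thesis by (simp add: restrict_vars_def)
qed

text \<open>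
 A monomial symmetric function is the indicator of one multiset of exponents, so symmetry of a
 function of infinitely many variables is dependence on this multiset only.\<close>

definition parts :: "expo \<Rightarrow> nat multiset" where "parts m = image_mset (lkp m) (mset_set (kys m))"
definition pmset :: "natfun \<Rightarrow> nat multiset" where "pmset lam = image_mset lam (mset_set {i. lam i \<noteq> 0})"

lemma monomial_sf_parts: "monomial_sf lam m = (if parts m = pmset lam then 1 else 0)"
 by (simp add: monomial_sf_def parts_def pmset_def)

lemma parts_pm: assumes "lam \<in> Par n" shows "parts (pm n lam) = pmset lam"
proof -
 have k: "kys (pm n lam) = {i. lam i \<noteq> 0}"
 proof (rule Set.set_eqI)
  fix i show "i \<in> kys (pm n lam) \<longleftrightarrow> i \<in> {i. lam i \<noteq> 0}" using Par_zero[OF assms, of i] by (simp add: in_keys_iff)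
 qed
 have f: "finite {i. lam i \<noteq> 0}" using assms by (simp add: Par_def is_partition_def)
 show ?thesis unfolding parts_def pmset_def k
  by (intro image_mset_cong) (use Par_zero[OF assms] f in \<open>auto simp: not_less\<close>)
qed

lemma deg_parts: "deg m = sum_mset (parts m)"
 by (simp add: deg_def parts_def sum_unfold_sum_mset)

lemma parts_extend: assumes "kys m \<subseteq> {..<n}"
 shows "image_mset (lkp m) (mset_set {..<n}) = parts m + replicate_mset (n - card (kys m)) 0"
proof -
 have "mset_set {..<n} = mset_set (kys m) + mset_set ({..<n} - kys m)"
  using mset_set_Union[of "kys m" "{..<n} - kys m"] assms by (simp add: Un_absorb1)
 moreover have "image_mset (lkp m) (mset_set ({..<n} - kys m)) = image_mset (\<lambda>_. 0) (mset_set ({..<n} - kys m))"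
  by (intro image_mset_cong) (auto simp: in_keys_iff)
 moreover have "card ({..<n} - kys m) = n - card (kys m)" using card_Diff_subset[OF _ assms] by simp
 ultimately show ?thesis by (simp add: parts_def image_mset_const_eq)
qed

lemma size_parts: "size (parts m) = card (kys m)" by (simp add: parts_def)

lemma parts_eq_perm:
 assumes "kys m \<subseteq> {..<n}" "kys m' \<subseteq> {..<n}" "parts m = parts m'"
 obtains sig where "sig permutes {..<n}" "m = mkey sig m'"
proof -
 have "image_mset (lkp m) (mset_set {..<n}) = image_mset (lkp m') (mset_set {..<n})"
  using assms by (simp add: parts_extend size_parts[symmetric])
 then obtain p where p: "p permutes {..<n}" "\<And>x. x \<in> {..<n} \<Longrightarrow> lkp m x = lkp m' (p x)"
  using image_mset_eq_implies_permutes[of "{..<n}"] by (metis finite_lessThan)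
 have "m = mkey p m'"
 proof (rule poly_mapping_eqI)
  fix i
  show "lkp m i = lkp (mkey p m') i"
  proof (cases "i < n")
   case True then show ?thesis using p by (simp add: lookup_map_key permutes_inj)
  next
   case False
   then have "i \<notin> kys m" "i \<notin> kys m'" using assms by auto
   moreover have "p i = i" using permutes_not_in[OF p(1), of i] False by simp
   ultimately show ?thesis by (simp add: lookup_map_key permutes_inj[OF p(1)] in_keys_iff)
  qed
 qed
 then show thesis using that p by blast
qed

lemma parts_map_key: assumes "sig permutes {..<n}" "kys m \<subseteq> {..<n}"
 shows "parts (mkey sig m) = parts m"
proof -
 have k: "sig ` kys (mkey sig m) = kys m"
 proof safe
  fix i assume "i \<in> kys (mkey sig m)"
  then show "sig i \<in> kys m" by (simp add: in_keys_iff lookup_map_key permutes_inj[OF assms(1)])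
 next
  fix i assume "i \<in> kys m"
  then show "i \<in> sig ` kys (mkey sig m)"
   by (intro image_eqI[of _ _ "inv_into UNIV sig i"])
     (auto simp: in_keys_iff lookup_map_key permutes_inj[OF assms(1)] permutes_inverses[OF assms(1)])
 qed
 have "parts m = image_mset (lkp m) (image_mset sig (mset_set (kys (mkey sig m))))"
  unfolding parts_def k[symmetric]
  by (subst image_mset_mset_set) (auto intro: inj_on_subset[OF permutes_inj[OF assms(1)]])
 also have "\<dots> = parts (mkey sig m)"
  unfolding parts_def multiset.map_comp
  by (intro image_mset_cong) (simp add: lookup_map_key permutes_inj[OF assms(1)])
 finally show ?thesis by simp
qed

lemma pmset_inj: assumes "lam \<in> Par n" "mu \<in> Par n" "pmset lam = pmset mu" shows "lam = mu"
proof -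
 have dle: "dle n lam mu" if h: "lam \<in> Par n" "mu \<in> Par n" "pmset lam = pmset mu" for lam mu
 proof -
  obtain sig where sig: "sig permutes {..<n}" "pm n lam = mkey sig (pm n mu)"
   using parts_eq_perm[OF keys_pm keys_pm] h by (metis parts_pm)
  have "lam i = (mu \<circ> sig) i" if "i < n" for i
   using arg_cong[OF sig(2), of "\<lambda>p. lkp p i"] that h permutes_in_image[OF sig(1), of i]
   by (simp add: lookup_map_key permutes_inj[OF sig(1)])
  moreover have "lam i = (mu \<circ> sig) i" if "\<not> i < n" for i
   using that Par_zero[OF \<open>lam \<in> Par n\<close>, of i] Par_zero[OF \<open>mu \<in> Par n\<close>, of i] sig(1) by (simp add: permutes_def)
  ultimately have "lam = mu \<circ> sig" by blast
  then show ?thesis using dle_perm[OF sig(1) dle_refl[OF h(2)]] by simp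
 qed
 have d: "dle n lam mu" "dle n mu lam" using dle assms by auto
 then have "wt n lam = wt n mu" using dle_wt by (meson le_antisym)
 then show ?thesis using dle_wt_eq[OF d(1)] Par_eqI assms by blast
qed

lemma partition_Par: "is_partition lam \<Longrightarrow> lam \<in> Par (part_length lam)" by (simp add: Par_def)
lemma pmset_inj': assumes "is_partition lam" "is_partition mu" "pmset lam = pmset mu" shows "lam = mu"
 by (rule pmset_inj[of _ "max (part_length lam) (part_length mu)"]) (use assms in \<open>auto simp: Par_def\<close>)

lemma monomial_sf_pm: assumes "mu \<in> Par n" "is_partition lam"
 shows "monomial_sf lam (pm n mu) = (if lam = mu then 1 else 0)"
 using assms pmset_inj'[of lam mu] by (auto simp: monomial_sf_parts parts_pm Par_def)

lemma sum_pmset: "is_partition lam \<Longrightarrow> sum_mset (pmset lam) = part_size lam"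
 by (simp add: pmset_def part_size_def sum_unfold_sum_mset)

lemma size_pmset: "size (pmset lam) = part_length lam" by (simp add: pmset_def part_length_def)

lemma homog_monomial_sf: "is_partition lam \<Longrightarrow> homog (part_size lam) (monomial_sf lam)"
 by (auto simp: homog_def monomial_sf_parts deg_parts sum_pmset split: if_splits)

definition sf_symmetric :: "symfun \<Rightarrow> bool" where
 "sf_symmetric f \<longleftrightarrow> (\<forall>m m'. parts m = parts m' \<longrightarrow> f m = f m')"

lemma restrict_sympol:
 assumes "homog d f" "sf_symmetric f"
 shows "restrict_vars n f \<in> sympol n"
 unfolding sympol_def
proof (intro CollectI conjI allI impI ballI)
 fix m assume "m \<in> kys (restrict_vars n f)"
 then show "kys m \<subseteq> {..<n}" by (auto simp: in_keys_iff lookup_restrict_vars[OF assms(1)] split: if_splits)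
next
 fix sig and m :: expo assume sig: "sig permutes {..<n}"
 have sub: "kys (mkey tau m) \<subseteq> {..<n}" if t: "tau permutes {..<n}" and k: "kys m \<subseteq> {..<n}" for tau and m :: expo
 proof
  fix i assume "i \<in> kys (mkey tau m)"
  then have "tau i \<in> kys m" by (simp add: in_keys_iff lookup_map_key permutes_inj[OF t])
  then show "i \<in> {..<n}" using k permutes_in_image[OF t, of i] by auto
 qed
 have iff: "kys (mkey sig m) \<subseteq> {..<n} \<longleftrightarrow> kys m \<subseteq> {..<n}"
  using sub[OF sig, of m] sub[OF permutes_inv[OF sig], of "mkey sig m"] map_key_bij[OF sig, of m] by auto
 show "lkp (restrict_vars n f) (mkey sig m) = lkp (restrict_vars n f) m"
 proof (cases "kys m \<subseteq> {..<n}")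
  case True
  then have "f (mkey sig m) = f m"
   using assms(2) parts_map_key[OF sig True] unfolding sf_symmetric_def by blast
  then show ?thesis by (simp add: lookup_restrict_vars[OF assms(1)] iff)
 qed (simp add: lookup_restrict_vars[OF assms(1)] iff)
qed

lemma monomial_symmetric: "sf_symmetric (monomial_sf lam)"
 by (auto simp: sf_symmetric_def monomial_sf_parts)

lemma unitri_monomial: assumes "lam \<in> Par n" shows "unitri n lam (restrict_vars n (monomial_sf lam))"
proof -
 have p: "is_partition lam" using assms by (simp add: Par_def)
 note lk = lookup_restrict_vars[OF homog_monomial_sf[OF p]]
 have s: "restrict_vars n (monomial_sf lam) \<in> sympol n"
  by (rule restrict_sympol[OF homog_monomial_sf[OF p] monomial_symmetric])
 have "tri n lam (restrict_vars n (monomial_sf lam))"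
  by (rule triI[OF s]) (use dle_refl[OF assms] p in \<open>auto simp: lk keys_pm monomial_sf_pm split: if_splits\<close>)
 moreover have "lkp (restrict_vars n (monomial_sf lam)) (pm n lam) = 1"
  using assms p by (simp add: lk keys_pm monomial_sf_pm)
 ultimately show ?thesis by (simp add: unitri_def)
qed

lemma expo_partition:
 obtains mu where "is_partition mu" "parts m = pmset mu"
proof -
 obtain n where n: "kys m \<subseteq> {..<n}" using finite_nat_set_iff_bounded[of "kys m"] by auto
 obtain sig lam where "sig permutes {..<n}" "lam \<in> Par n" "m = mkey sig (pm n lam)"
  using sort_expo[OF n] by blast
 then show thesis using that[of lam] by (auto simp: parts_map_key keys_pm parts_pm Par_def)
qed

section \<open>Power sums\<close>

definition psl :: "nat list \<Rightarrow> symfun" where "psl xs = foldr (\<lambda>r. sf_mult (power_sum r)) xs sf_one"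

lemma power_sum_part_psl: "power_sum_part lam = psl (map lam [0..<part_length lam])"
 by (simp add: power_sum_part_def psl_def foldr_map o_def)

lemma finite_decompositions: "finite {(a, b). a + b = (m :: expo)}"
proof -
 obtain n where n: "kys m \<subseteq> {..<n}" using finite_nat_set_iff_bounded[of "kys m"] by auto
 have sub: "{(a, b). a + b = m} \<subseteq> {a. kys a \<subseteq> {..<n} \<and> deg a \<le> deg m} \<times> {a. kys a \<subseteq> {..<n} \<and> deg a \<le> deg m}"
 proof clarify
  fix a b assume m: "m = a + b"
  have k: "kys a \<subseteq> {..<n}" "kys b \<subseteq> {..<n}" using n by (auto simp: m keys_add_nat)
  have "deg (a + b) = deg a + deg b"
   using k by (subst (1 2 3) deg_superset[of "{..<n}"]) (auto simp: keys_add_nat lookup_add sum.distrib)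
  with k show "a \<in> {c. kys c \<subseteq> {..<n} \<and> deg c \<le> deg (a + b)} \<and> b \<in> {c. kys c \<subseteq> {..<n} \<and> deg c \<le> deg (a + b)}"
   by simp
 qed
 show ?thesis by (rule finite_subset[OF sub]) (intro finite_cartesian_product finite_expo_bounded)
qed

lemma single_plus_minus: "r \<le> lkp m i \<Longrightarrow> sgl i r + (m - sgl i r) = (m :: expo)"
 by (rule poly_mapping_eqI) (auto simp: lookup_add lookup_minus lookup_single when_def)

lemma sf_mult_power_sum: assumes "r > 0"
 shows "sf_mult (power_sum r) f m = (\<Sum>i | r \<le> lkp m i. f (m - sgl i r))"
proof -
 let ?I = "{i. r \<le> lkp m i}"
 have fin: "finite ?I" by (rule finite_subset[of _ "kys m"]) (use assms in \<open>auto simp: in_keys_iff\<close>)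
 have "sf_mult (power_sum r) f m = (\<Sum>(a, b)\<in>(\<lambda>i. (sgl i r, m - sgl i r)) ` ?I. power_sum r a * f b)"
  unfolding sf_mult_def
 proof (rule sum.mono_neutral_right[OF finite_decompositions])
  show "(\<lambda>i. (sgl i r, m - sgl i r)) ` ?I \<subseteq> {(a, b). a + b = m}" by (auto simp: single_plus_minus)
  show "\<forall>p\<in>{(a, b). a + b = m} - (\<lambda>i. (sgl i r, m - sgl i r)) ` ?I. (case p of (a, b) \<Rightarrow> power_sum r a * f b) = 0"
  proof (intro ballI, clarify)
   fix a b assume m: "m = a + b" and nin: "(a, b) \<notin> (\<lambda>i. (sgl i r, a + b - sgl i r)) ` {i. r \<le> lkp (a + b) i}"
   have "power_sum r a = 0"
   proof (rule ccontr)
    assume "power_sum r a \<noteq> 0"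
    then obtain i where i: "a = sgl i r" by (auto simp: power_sum_def split: if_splits)
    then have "(a, b) \<in> (\<lambda>i. (sgl i r, a + b - sgl i r)) ` {i. r \<le> lkp (a + b) i}"
     by (intro image_eqI[of _ _ i]) (auto simp: lookup_add)
    then show False using nin by blast
   qed
   then show "power_sum r a * f b = 0" by simp
  qed
 qed
 also have "\<dots> = (\<Sum>i\<in>?I. power_sum r (sgl i r) * f (m - sgl i r))"
 proof (subst sum.reindex)
  show "inj_on (\<lambda>i. (sgl i r, m - sgl i r)) ?I"
  proof (rule inj_onI)
   fix i j assume "(sgl i r, m - sgl i r) = (sgl j r, m - sgl j r)"
   then have "lkp (sgl i r) i = lkp (sgl j r) i" by simp
   then show "i = j" using assms by (auto simp: lookup_single when_def split: if_splits)
  qed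
 qed (simp add: o_def)
 also have "\<dots> = (\<Sum>i\<in>?I. f (m - sgl i r))"
  by (intro sum.cong) (auto simp: power_sum_def)
 finally show ?thesis .
qed

text \<open>
 The number of ways to build a monomial by placing the exponents of the list on variables one after
 another: the coefficient of the monomial in a product of power sums.\<close>

fun pcount :: "nat list \<Rightarrow> expo \<Rightarrow> nat" where
 "pcount [] m = (if m = 0 then 1 else 0)"
| "pcount (r # xs) m = (\<Sum>i | r \<le> lkp m i. pcount xs (m - sgl i r))"

lemma psl_pcount: "0 \<notin> set xs \<Longrightarrow> psl xs m = of_nat (pcount xs m)"
proof (induction xs arbitrary: m)
 case (Cons r xs)
 then have "psl (r # xs) m = (\<Sum>i | r \<le> lkp m i. psl xs (m - sgl i r))"
  by (simp add: psl_def sf_mult_power_sum)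
 then show ?case using Cons by simp
qed (simp add: psl_def sf_one_def)

lemma finite_ge_keys: "r > 0 \<Longrightarrow> finite {i. r \<le> lkp (m :: expo) i}"
 by (rule finite_subset[of _ "kys m"]) (auto simp: in_keys_iff)

text \<open>
 Placing exponents on the same variable merges them, so a product of \<open>l\<close> power sums
 contains only monomials in at most \<open>l\<close> variables, and those in exactly \<open>l\<close>
 variables have the given exponents.  This is the triangularity of power sums against monomial
 functions.\<close>

lemma pcount_nonzero:
 assumes "0 \<notin> set xs" "pcount xs m \<noteq> 0"
 shows "deg m = sum_list xs \<and> card (kys m) \<le> length xs \<and> (card (kys m) = length xs \<longrightarrow> parts m = mset xs)"
 using assms
proof (induction xs arbitrary: m)
 case Nil then show ?case by (auto simp: deg_def parts_def split: if_splits)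
next
 case (Cons r xs)
 have r: "r > 0" using Cons.prems by (cases r) auto
 obtain i where i: "r \<le> lkp m i" and nz: "pcount xs (m - sgl i r) \<noteq> 0"
  using Cons.prems(2) unfolding pcount.simps by (metis (mono_tags, lifting) mem_Collect_eq sum.neutral)
 define m' where "m' = m - sgl i r"
 have m: "m = sgl i r + m'" using single_plus_minus[OF i] by (simp add: m'_def)
 have IH: "deg m' = sum_list xs" "card (kys m') \<le> length xs" "card (kys m') = length xs \<Longrightarrow> parts m' = mset xs"
  using Cons.IH[of m'] Cons.prems(1) nz by (auto simp: m'_def)
 have k: "kys m = insert i (kys m')" using r by (simp add: m keys_add_nat)
 have "deg m = r + deg m'"
 proof -
  have "deg m = (\<Sum>j\<in>insert i (kys m'). (if j = i then r else 0) + lkp m' j)"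
   unfolding deg_def k by (intro sum.cong refl) (simp add: m lookup_add lookup_single when_def eq_commute)
  also have "\<dots> = r + deg m'" 
   unfolding sum.distrib using deg_superset[of "insert i (kys m')" m', OF _ subset_insertI] by (simp add: sum.delta)
  finally show ?thesis .
 qed
 moreover have "parts m = mset (r # xs)" if "card (kys m) = length (r # xs)"
 proof -
  have c: "card (kys m') = length xs" and ni: "i \<notin> kys m'"
   using that IH(2) by (auto simp: k card_insert_if split: if_splits)
  have "parts m = add_mset (lkp m i) (image_mset (lkp m) (mset_set (kys m')))" using ni by (simp add: parts_def k)
  also have "image_mset (lkp m) (mset_set (kys m')) = parts m'"
   unfolding parts_def using ni by (intro image_mset_cong) (auto simp: m lookup_add lookup_single when_def)
  also have "lkp m i = r" using ni by (simp add: m lookup_add in_keys_iff)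
  finally show ?thesis using IH(3)[OF c] by simp
 qed
 ultimately show ?case using IH k by (auto simp: card_insert_if)
qed

lemma pcount_pos: assumes "0 \<notin> set xs" "parts m = mset xs" shows "pcount xs m \<noteq> 0"
 using assms
proof (induction xs arbitrary: m)
 case Nil then have "kys m = {}" by (auto simp: parts_def mset_set_empty_iff) then show ?case by simp
next
 case (Cons r xs)
 have r: "r > 0" using Cons.prems by (cases r) auto
 have "r \<in># parts m" using Cons.prems by simp
 then obtain i where i: "i \<in> kys m" "lkp m i = r" by (auto simp: parts_def)
 define m' where "m' = m - sgl i r"
 have lk: "lkp m' j = (if j = i then 0 else lkp m j)" for j using i by (auto simp: m'_def lookup_minus lookup_single when_def)
 have k: "kys m' = kys m - {i}" by (auto simp: in_keys_iff lk split: if_splits)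
 have "parts m = add_mset r (image_mset (lkp m) (mset_set (kys m - {i})))"
  using i by (simp add: parts_def mset_set.remove)
 also have "image_mset (lkp m) (mset_set (kys m - {i})) = parts m'"
  unfolding parts_def k by (intro image_mset_cong) (auto simp: lk)
 finally have "pcount xs m' \<noteq> 0" using Cons by (intro Cons.IH) auto
 then show ?case using i finite_ge_keys[OF r, of m] by (auto simp: m'_def)
qed

definition ppow :: "nat \<Rightarrow> nat \<Rightarrow> mpol" where "ppow n r = (\<Sum>i<n. var i ^ r)"

lemma homog_psl: "0 \<notin> set xs \<Longrightarrow> homog (sum_list xs) (psl xs)"
 using pcount_nonzero by (auto simp: homog_def psl_pcount)

lemma lookup_var_power_mult:
 "lkp (var i ^ r * F) m = (if r \<le> lkp m i then lkp F (m - sgl i r) else 0)"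
proof (cases "r \<le> lkp m i")
 case True
 then show ?thesis using lookup_single_times[of "sgl i r" 1 F "m - sgl i r"] by (simp add: var_power single_plus_minus)
next
 case False
 have "m \<noteq> sgl i r + k" for k using False by (auto simp: lookup_add)
 then show ?thesis using False lookup_single_times_notin[of m "sgl i r" 1 F] by (simp add: var_power)
qed

lemma restrict_psl:
 assumes "0 \<notin> set xs" shows "restrict_vars n (psl xs) = prod_list (map (ppow n) xs)"
 using assms
proof (induction xs)
 case Nil
 show ?case
  by (rule poly_mapping_eqI, subst lookup_restrict_vars[of 0])
    (auto simp: homog_def psl_def sf_one_def deg_def lookup_one)
next
 case (Cons r xs)
 have r: "r > 0" using Cons.prems by (cases r) auto
 have "restrict_vars n (psl (r # xs)) = ppow n r * restrict_vars n (psl xs)"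
 proof (rule poly_mapping_eqI)
  fix m
  have h: "homog (sum_list (r # xs)) (psl (r # xs))" "homog (sum_list xs) (psl xs)"
   by (rule homog_psl, use Cons.prems in auto)+
  have rhs: "lkp (ppow n r * restrict_vars n (psl xs)) m =
   (\<Sum>i<n. if r \<le> lkp m i \<and> kys (m - sgl i r) \<subseteq> {..<n} then psl xs (m - sgl i r) else 0)"
   by (simp add: ppow_def sum_distrib_right lookup_sum lookup_var_power_mult lookup_restrict_vars[OF h(2)] cong: if_cong)
     (intro sum.cong, auto)
  show "lkp (restrict_vars n (psl (r # xs))) m = lkp (ppow n r * restrict_vars n (psl xs)) m"
  proof (cases "kys m \<subseteq> {..<n}")
   case True
   have "kys (m - sgl i r) \<subseteq> {..<n}" for i using True by (auto simp: in_keys_iff lookup_minus subset_iff)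
   then have "lkp (ppow n r * restrict_vars n (psl xs)) m = (\<Sum>i<n. if r \<le> lkp m i then psl xs (m - sgl i r) else 0)"
    unfolding rhs by simp
   also have "\<dots> = (\<Sum>i\<in>{i\<in>{..<n}. r \<le> lkp m i}. psl xs (m - sgl i r))"
    by (rule sum.inter_filter[symmetric]) simp
   also have "{i\<in>{..<n}. r \<le> lkp m i} = {i. r \<le> lkp m i}"
    using True r by (force simp: in_keys_iff subset_iff)
   finally show ?thesis using True r by (simp add: lookup_restrict_vars[OF h(1)]) (simp add: psl_def sf_mult_power_sum)
  next
   case False
   have "\<not> kys (m - sgl i r) \<subseteq> {..<n}" if "i < n" for i
   proof -
    obtain j where j: "j \<in> kys m" "j \<ge> n" using False by (metis lessThan_iff not_less subsetI)
    then have "j \<in> kys (m - sgl i r)" using that by (auto simp: in_keys_iff lookup_minus lookup_single when_def)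
    then show ?thesis using j by auto
   qed
   then show ?thesis unfolding rhs using False by (simp add: lookup_restrict_vars[OF h(1)])
  qed
 qed
 then show ?case using Cons by simp
qed

lemma act_var_power: "sig permutes S \<Longrightarrow> act sig (f ^ r) = act sig f ^ r"
 unfolding act_def by (rule pmap_power) (auto simp: map_key_add map_key_0 permutes_inj)

lemma vars_in_power: "vars_in n f \<Longrightarrow> vars_in n (f ^ r)"
 by (induction r) (auto intro: vars_in_mult)

lemma sympol_ppow: "ppow n r \<in> sympol n"
 unfolding sympol_iff
proof (intro conjI allI impI)
 show "vars_in n (ppow n r)"
  unfolding ppow_def by (intro vars_in_sum vars_in_power vars_in_var) auto
 fix sig assume sig: "sig permutes {..<n}"
 show "act sig (ppow n r) = ppow n r"
  unfolding ppow_def act_sum by (simp add: act_var_power[OF sig] act_var[OF sig] sum_act_index[OF sig, where F = "\<lambda>k. var k ^ r"])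
qed

lemma sympol_psl: "0 \<notin> set xs \<Longrightarrow> restrict_vars n (psl xs) \<in> sympol n"
 unfolding restrict_psl by (induction xs) (auto simp: sympol_mult sympol_ppow)

lemma psl_symmetric: assumes "0 \<notin> set xs" shows "sf_symmetric (psl xs)"
 unfolding sf_symmetric_def
proof (intro allI impI)
 fix m m' :: expo assume eq: "parts m = parts m'"
 obtain n where n: "kys m \<union> kys m' \<subseteq> {..<n}" using finite_nat_set_iff_bounded[of "kys m \<union> kys m'"] by auto
 then obtain sig where sig: "sig permutes {..<n}" "m = mkey sig m'"
  using parts_eq_perm[OF _ _ eq, of n] by auto
 have "lkp (restrict_vars n (psl xs)) m = lkp (restrict_vars n (psl xs)) m'"
  using sympol_lookup_map_key[OF sympol_psl[OF assms] sig(1)] sig(2) by simp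
 then show "psl xs m = psl xs m'" using n by (simp add: lookup_restrict_vars[OF homog_psl[OF assms]])
qed

lemma part_list: assumes "is_partition lam"
 shows "0 \<notin> set (map lam [0..<part_length lam])" "mset (map lam [0..<part_length lam]) = pmset lam"
  "sum_list (map lam [0..<part_length lam]) = part_size lam"
proof -
 have s: "{i. lam i \<noteq> 0} = {..<part_length lam}" using partition_support[OF assms] by auto
 show "0 \<notin> set (map lam [0..<part_length lam])"
 proof
  assume "0 \<in> set (map lam [0..<part_length lam])"
  then obtain i where "i < part_length lam" "lam i = 0" by auto
  then show False using partition_support[OF assms, of i] by simp
 qed
 show m: "mset (map lam [0..<part_length lam]) = pmset lam"
  unfolding pmset_def s by (simp add: mset_upt atLeast0LessThan)
 show "sum_list (map lam [0..<part_length lam]) = part_size lam"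
  using sum_pmset[OF assms] m by (metis sum_mset_sum_list)
qed

lemma homog_psp: "is_partition lam \<Longrightarrow> homog (part_size lam) (power_sum_part lam)"
 using homog_psl[OF part_list(1)] part_list(3) by (metis power_sum_part_psl)

lemma psp_symmetric: "is_partition lam \<Longrightarrow> sf_symmetric (power_sum_part lam)"
 using psl_symmetric[OF part_list(1)] by (metis power_sum_part_psl)

lemma psp_nonzero:
 assumes "is_partition lam" "is_partition mu" "parts m = pmset mu" "power_sum_part lam m \<noteq> 0"
 shows "part_size mu = part_size lam" "part_length mu \<le> part_length lam" "part_length mu = part_length lam \<Longrightarrow> mu = lam"
proof -
 have nz: "pcount (map lam [0..<part_length lam]) m \<noteq> 0"
  using assms(4) by (simp add: power_sum_part_psl psl_pcount[OF part_list(1)[OF assms(1)]])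
 note p = pcount_nonzero[OF part_list(1)[OF assms(1)] nz]
 show "part_size mu = part_size lam" using p assms(3) by (simp add: deg_parts sum_pmset[OF assms(2)] part_list(3)[OF assms(1)])
 have c: "card (kys m) = part_length mu" using size_parts[of m] assms(3) by (simp add: size_pmset)
 then show "part_length mu \<le> part_length lam" using p by simp
 show "mu = lam" if "part_length mu = part_length lam"
  using p c that part_list(2)[OF assms(1)] assms(3) pmset_inj'[OF assms(2,1)] by simp
qed

lemma psp_diag: assumes "is_partition lam" "parts m = pmset lam" shows "power_sum_part lam m \<noteq> 0"
 using pcount_pos[OF part_list(1)[OF assms(1)], of m] part_list(2)[OF assms(1)] assms(2)
 by (simp add: power_sum_part_psl psl_pcount[OF part_list(1)[OF assms(1)]])

definition PD :: "nat \<Rightarrow> natfun set" where "PD d = {lam. is_partition lam \<and> part_size lam = d}"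

lemma finite_PD: "finite (PD d)"
 by (rule finite_subset[OF _ finite_partitions_size[of d]]) (auto simp: PD_def)

lemma symmetric_expansion:
 assumes "homog d f" "sf_symmetric f"
 shows "\<exists>c. f = (\<lambda>m. \<Sum>mu\<in>PD d. c mu * monomial_sf mu m)"
proof -
 define c where "c mu = f (pm (part_length mu) mu)" for mu
 have "f m = (\<Sum>mu\<in>PD d. c mu * monomial_sf mu m)" for m
 proof -
  obtain nu where nu: "is_partition nu" "parts m = pmset nu" using expo_partition by blast
  have fm: "f m = c nu"
   using assms(2) nu parts_pm[OF partition_Par[OF nu(1)]] by (auto simp: sf_symmetric_def c_def)
  have "(\<Sum>mu\<in>PD d. c mu * monomial_sf mu m) = (\<Sum>mu\<in>PD d. if mu = nu then c nu else 0)"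
   by (intro sum.cong refl) (use nu pmset_inj' in \<open>auto simp: monomial_sf_parts PD_def\<close>)
  also have "\<dots> = (if nu \<in> PD d then c nu else 0)" by (simp add: finite_PD)
  also have "\<dots> = f m"
   using assms(1)[unfolded homog_def deg_parts, rule_format, of m] nu fm sum_pmset[OF nu(1)] by (auto simp: PD_def)
  finally show ?thesis by simp
 qed
 then show ?thesis by blast
qed

text \<open>Triangularity in the number of parts is inverted by induction on that number.\<close>

lemma monomial_psum:
 assumes "lam \<in> PD d"
 shows "\<exists>c. monomial_sf lam = (\<lambda>m. \<Sum>mu\<in>PD d. c mu * power_sum_part mu m)"
 using assms
proof (induction "part_length lam" arbitrary: lam rule: less_induct)
 case less
 have p: "is_partition lam" "part_size lam = d" using less.prems by (auto simp: PD_def)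
 obtain R where R: "power_sum_part lam = (\<lambda>m. \<Sum>mu\<in>PD d. R mu * monomial_sf mu m)"
  using symmetric_expansion[OF homog_psp[OF p(1), unfolded p(2)] psp_symmetric[OF p(1)]] by blast
 have Rv: "R mu = power_sum_part lam (pm (part_length mu) mu)" if "mu \<in> PD d" for mu
 proof -
  have "power_sum_part lam (pm (part_length mu) mu) = (\<Sum>nu\<in>PD d. if nu = mu then R mu else 0)"
   unfolding R using that by (intro sum.cong refl) (auto simp: PD_def monomial_sf_pm[OF partition_Par])
  then show ?thesis using that by (simp add: finite_PD)
 qed
 define J where "J = {mu\<in>PD d. part_length mu < part_length lam}"
 have zero: "R mu = 0" if "mu \<in> PD d - insert lam J" for mu
 proof (rule ccontr)
  assume "R mu \<noteq> 0"
  then have nz: "power_sum_part lam (pm (part_length mu) mu) \<noteq> 0" and mp: "is_partition mu" using Rv[of mu] that by (auto simp: PD_def)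
  note n = psp_nonzero[OF p(1) mp parts_pm[OF partition_Par[OF mp]] nz]
  from n(2,3) have "part_length mu < part_length lam \<or> mu = lam" by linarith
  then show False using that by (auto simp: J_def)
 qed
 have Rl: "R lam \<noteq> 0" using Rv[OF less.prems] psp_diag[OF p(1) parts_pm[OF partition_Par[OF p(1)]]] by simp
 have eq: "power_sum_part lam m = R lam * monomial_sf lam m + (\<Sum>mu\<in>J. R mu * monomial_sf mu m)" for m
 proof -
  have "power_sum_part lam m = (\<Sum>mu\<in>insert lam J. R mu * monomial_sf mu m)"
   unfolding R by (rule sum.mono_neutral_right[OF finite_PD]) (use zero less.prems in \<open>auto simp: J_def\<close>)
  also have "\<dots> = R lam * monomial_sf lam m + (\<Sum>mu\<in>J. R mu * monomial_sf mu m)"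
   using finite_PD[of d] by (subst sum.insert) (auto simp: J_def)
  finally show ?thesis .
 qed
 have "\<exists>c. monomial_sf mu = (\<lambda>m. \<Sum>nu\<in>PD d. c nu * power_sum_part nu m)" if "mu \<in> J" for mu
  using less.hyps[of mu] that by (auto simp: J_def)
 then obtain c where c: "\<And>mu. mu \<in> J \<Longrightarrow> monomial_sf mu = (\<lambda>m. \<Sum>nu\<in>PD d. c mu nu * power_sum_part nu m)" by metis
 define b where "b nu = ((if nu = lam then 1 else 0) - (\<Sum>mu\<in>J. R mu * c mu nu)) / R lam" for nu
 have "monomial_sf lam m = (\<Sum>nu\<in>PD d. b nu * power_sum_part nu m)" for m
 proof -
  have "(\<Sum>mu\<in>J. R mu * monomial_sf mu m) = (\<Sum>mu\<in>J. \<Sum>nu\<in>PD d. R mu * c mu nu * power_sum_part nu m)"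
   by (intro sum.cong refl) (simp add: c sum_distrib_left mult.assoc)
  also have "\<dots> = (\<Sum>nu\<in>PD d. (\<Sum>mu\<in>J. R mu * c mu nu) * power_sum_part nu m)"
   unfolding sum_distrib_right by (rule sum.swap)
  finally have S: "(\<Sum>mu\<in>J. R mu * monomial_sf mu m) = (\<Sum>nu\<in>PD d. (\<Sum>mu\<in>J. R mu * c mu nu) * power_sum_part nu m)" .
  have "R lam * (\<Sum>nu\<in>PD d. b nu * power_sum_part nu m)
   = (\<Sum>nu\<in>PD d. (if nu = lam then 1 else 0) * power_sum_part nu m - (\<Sum>mu\<in>J. R mu * c mu nu) * power_sum_part nu m)"
   unfolding sum_distrib_left by (intro sum.cong refl) (use Rl in \<open>simp add: b_def field_simps\<close>)
  also have "\<dots> = power_sum_part lam m - (\<Sum>mu\<in>J. R mu * monomial_sf mu m)"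
  proof -
   have "(\<Sum>nu\<in>PD d. (if nu = lam then 1 else 0) * power_sum_part nu m) = (\<Sum>nu\<in>PD d. if nu = lam then power_sum_part nu m else 0)"
    by (intro sum.cong) auto
   then show ?thesis unfolding S sum_subtractf using less.prems finite_PD[of d] by simp
  qed
  also have "\<dots> = R lam * monomial_sf lam m" using eq by simp
  finally show ?thesis using Rl by simp
 qed
 then show ?case by blast
qed

text \<open>
 In a relation consider a partition with the largest number of parts: by triangularity no other term
 contains its monomial.\<close>

lemma psum_independent:
 assumes fin: "finite {lam. c lam \<noteq> (0::complex)}" and part: "\<And>lam. c lam \<noteq> 0 \<Longrightarrow> is_partition lam"
  and zero: "\<And>m. (\<Sum>lam | c lam \<noteq> 0. c lam * power_sum_part lam m) = 0"
 shows "c = (\<lambda>_. 0)"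
proof (rule ccontr)
 assume "c \<noteq> (\<lambda>_. 0)"
 then have "{lam. c lam \<noteq> 0} \<noteq> {}" by auto
 then obtain lam where lam: "c lam \<noteq> 0" and max: "\<And>mu. c mu \<noteq> 0 \<Longrightarrow> part_length mu \<le> part_length lam"
  using ex_max_nat[OF fin, of part_length] by auto
 have p: "is_partition lam" using part lam by blast
 let ?m = "pm (part_length lam) lam"
 have pp: "parts ?m = pmset lam" by (rule parts_pm[OF partition_Par[OF p]])
 have "(\<Sum>mu | c mu \<noteq> 0. c mu * power_sum_part mu ?m) = (\<Sum>mu\<in>{lam}. c mu * power_sum_part mu ?m)"
 proof (rule sum.mono_neutral_right[OF fin])
  show "\<forall>mu\<in>{mu. c mu \<noteq> 0} - {lam}. c mu * power_sum_part mu ?m = 0"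
  proof (rule ballI, rule ccontr)
   fix mu assume mu: "mu \<in> {mu. c mu \<noteq> 0} - {lam}" and nz: "c mu * power_sum_part mu ?m \<noteq> 0"
   then show False using psp_nonzero[OF part[of mu] p pp] max[of mu] by fastforce
  qed
 qed (use lam in auto)
 then show False using zero[of ?m] lam psp_diag[OF p pp] by simp
qed

lemma psum_expansion_unique:
 assumes "psum_expansion f a" "psum_expansion f b" shows "a = b"
proof -
 define c where "c lam = a lam - b lam" for lam
 let ?S = "{lam. a lam \<noteq> 0} \<union> {lam. b lam \<noteq> 0}"
 have fS: "finite ?S" using assms by (auto simp: psum_expansion_def)
 have sub: "{lam. c lam \<noteq> 0} \<subseteq> ?S" by (auto simp: c_def)
 have fin: "finite {lam. c lam \<noteq> 0}" by (rule finite_subset[OF sub fS])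
 have S: "(\<Sum>lam\<in>?S. h lam * power_sum_part lam m) = f m" if "psum_expansion f h" "{lam. h lam \<noteq> 0} \<subseteq> ?S" for h m
 proof -
  have "(\<Sum>lam\<in>?S. h lam * power_sum_part lam m) = (\<Sum>lam | h lam \<noteq> 0. h lam * power_sum_part lam m)"
   by (rule sum.mono_neutral_right[OF fS that(2)]) auto
  then show ?thesis using that(1) by (simp add: psum_expansion_def)
 qed
 have "(\<Sum>lam | c lam \<noteq> 0. c lam * power_sum_part lam m) = 0" for m
 proof -
  have "(\<Sum>lam | c lam \<noteq> 0. c lam * power_sum_part lam m) = (\<Sum>lam\<in>?S. c lam * power_sum_part lam m)"
   by (rule sum.mono_neutral_left[OF fS sub]) auto
  then show ?thesis using S[OF assms(1)] S[OF assms(2)] by (simp add: c_def left_diff_distrib sum_subtractf)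
 qed
 moreover have "is_partition lam" if "c lam \<noteq> 0" for lam
  using that assms unfolding c_def psum_expansion_def by (metis diff_zero)
 ultimately have "c = (\<lambda>_. 0)" by (intro psum_independent[OF fin])
 then show ?thesis by (auto simp: c_def fun_eq_iff)
qed

lemma psum_coeffI:
 assumes "finite S" "S \<subseteq> {lam. is_partition lam}" "\<And>lam. lam \<notin> S \<Longrightarrow> a lam = 0"
  "\<And>m. f m = (\<Sum>lam\<in>S. a lam * power_sum_part lam m)"
 shows "psum_coeff f = a"
proof -
 have sub: "{lam. a lam \<noteq> 0} \<subseteq> S" using assms(3) by auto
 have "f m = (\<Sum>lam | a lam \<noteq> 0. a lam * power_sum_part lam m)" for m
  unfolding assms(4) by (rule sum.mono_neutral_right[OF assms(1) sub]) auto
 then have "psum_expansion f a"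
  unfolding psum_expansion_def using assms(1,2) sub finite_subset by (auto simp: fun_eq_iff)
 then show ?thesis unfolding psum_coeff_def using psum_expansion_unique by blast
qed

lemma psum_coeff_symmetric:
 assumes "homog d f" "sf_symmetric f"
 shows "f m = (\<Sum>lam\<in>PD d. psum_coeff f lam * power_sum_part lam m)"
  and "psum_coeff f lam \<noteq> 0 \<Longrightarrow> lam \<in> PD d"
proof -
 obtain c where c: "f = (\<lambda>m. \<Sum>mu\<in>PD d. c mu * monomial_sf mu m)" using symmetric_expansion[OF assms] by blast
 have "\<forall>mu\<in>PD d. \<exists>b. monomial_sf mu = (\<lambda>m. \<Sum>nu\<in>PD d. b nu * power_sum_part nu m)" using monomial_psum by blast
 then obtain b where b: "\<And>mu. mu \<in> PD d \<Longrightarrow> monomial_sf mu = (\<lambda>m. \<Sum>nu\<in>PD d. b mu nu * power_sum_part nu m)"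
  by metis
 define a where "a nu = (if nu \<in> PD d then \<Sum>mu\<in>PD d. c mu * b mu nu else 0)" for nu
 have fa: "f m = (\<Sum>nu\<in>PD d. a nu * power_sum_part nu m)" for m
 proof -
  have "f m = (\<Sum>mu\<in>PD d. \<Sum>nu\<in>PD d. c mu * b mu nu * power_sum_part nu m)"
   unfolding c by (intro sum.cong refl) (simp add: b sum_distrib_left mult.assoc)
  also have "\<dots> = (\<Sum>nu\<in>PD d. a nu * power_sum_part nu m)"
   by (subst sum.swap) (simp add: a_def sum_distrib_right)
  finally show ?thesis .
 qed
 have "psum_coeff f = a" by (rule psum_coeffI[OF finite_PD _ _ fa]) (auto simp: PD_def a_def)
 then show "f m = (\<Sum>lam\<in>PD d. psum_coeff f lam * power_sum_part lam m)" "psum_coeff f lam \<noteq> 0 \<Longrightarrow> lam \<in> PD d"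
  using fa by (auto simp: a_def split: if_splits)
qed

section \<open>Laurent polynomials\<close>

type_synonym lpol = "(nat \<Rightarrow>\<^sub>0 int) \<Rightarrow>\<^sub>0 complex"

definition lmev :: "point \<Rightarrow> (nat \<Rightarrow>\<^sub>0 int) \<Rightarrow> complex" where
 "lmev y a = (\<Prod>i\<in>kys a. y i powi lkp a i)"

definition lev :: "lpol \<Rightarrow> point \<Rightarrow> complex" where
 "lev L y = linext (\<lambda>a c. c * lmev y a) L"

lemma lmev_superset: "finite S \<Longrightarrow> kys a \<subseteq> S \<Longrightarrow> lmev y a = (\<Prod>i\<in>S. y i powi lkp a i)"
 unfolding lmev_def by (intro prod.mono_neutral_left) (auto simp: in_keys_iff)

lemma lmev_0 [simp]: "lmev y 0 = 1" by (simp add: lmev_def)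

lemma lmev_add: assumes "\<And>i. y i \<noteq> 0" shows "lmev y (a + b) = lmev y a * lmev y b"
proof -
 have *: "lmev y c = (\<Prod>i\<in>kys a \<union> kys b. y i powi lkp c i)" if "kys c \<subseteq> kys a \<union> kys b" for c
  using lmev_superset[OF _ that] by simp
 show ?thesis using keys_add[of a b] by (simp add: * lookup_add power_int_add assms prod.distrib)
qed

lemma lev_add [simp]: "lev (f + g) y = lev f y + lev g y"
 by (simp add: lev_def linext_add algebra_simps)

lemma lev_single [simp]: "lev (sgl a c) y = c * lmev y a"
 by (simp add: lev_def linext_single)

lemma lev_0 [simp]: "lev 0 y = 0" by (simp add: lev_def linext_def)
lemma lev_1 [simp]: "lev 1 y = 1" using lev_single[of 0 1 y] by simp

lemma lev_mult: assumes "\<And>i. y i \<noteq> 0" shows "lev (f * g) y = lev f y * lev g y"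
proof (induction f rule: poly_mapping_induct)
 case (single m c)
 show ?case
  by (induction g rule: poly_mapping_induct) (auto simp: mult_single lmev_add assms algebra_simps)
qed (auto simp: algebra_simps)

lemma lev_uminus [simp]: "lev (- f) y = - lev f y"
 using lev_add[of f "- f" y] by (simp add: eq_neg_iff_add_eq_0 add.commute)

lemma lev_diff [simp]: "lev (f - g) y = lev f y - lev g y"
 using lev_add[of f "- g" y] by simp

lemma lev_sum: "lev (sum f S) y = (\<Sum>s\<in>S. lev (f s) y)"
 by (induction S rule: infinite_finite_induct) auto

lemma lev_prod: assumes "\<And>i. y i \<noteq> 0" shows "lev (prod f S) y = (\<Prod>s\<in>S. lev (f s) y)"
 by (induction S rule: infinite_finite_induct) (auto simp: lev_mult assms)

lemma lev_power: assumes "\<And>i. y i \<noteq> 0" shows "lev (f ^ k) y = lev f y ^ k"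
 by (induction k) (auto simp: lev_mult assms)

definition toint :: "expo \<Rightarrow> nat \<Rightarrow>\<^sub>0 int" where "toint m = Poly_Mapping.map int m"

lemma lookup_toint [simp]: "lkp (toint m) i = int (lkp m i)"
 by (simp add: toint_def map.rep_eq when_def)

lemma toint_add: "toint (a + b) = toint a + toint b"
 by (rule poly_mapping_eqI) (simp add: lookup_add)

lemma toint_0 [simp]: "toint 0 = 0" by (rule poly_mapping_eqI) simp

lemma inj_toint: "inj toint"
 by (rule injI, rule poly_mapping_eqI) (metis lookup_toint of_nat_eq_iff)

lemma keys_toint [simp]: "kys (toint m) = kys m" by (auto simp: in_keys_iff)

definition emb :: "mpol \<Rightarrow> lpol" where "emb = pmap toint"

lemma emb_mult: "emb (f * g) = emb f * emb g" unfolding emb_def by (rule pmap_mult) (rule toint_add)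
lemma emb_add: "emb (f + g) = emb f + emb g" by (simp add: emb_def pmap_add)
lemma emb_diff: "emb (f - g) = emb f - emb g" by (simp add: emb_def pmap_diff)
lemma emb_sum: "emb (sum f S) = (\<Sum>s\<in>S. emb (f s))" by (simp add: emb_def pmap_sum)
lemma emb_0 [simp]: "emb 0 = 0" by (simp add: emb_def)
lemma emb_1 [simp]: "emb 1 = 1" by (simp add: emb_def pmap_1)
lemma emb_prod: "emb (prod f S) = (\<Prod>s\<in>S. emb (f s))" unfolding emb_def by (rule pmap_prod) (auto simp: toint_add)
lemma lookup_emb: "lkp (emb f) (toint m) = lkp f m"
 unfolding emb_def by (rule lookup_pmap_inj[OF inj_toint])

lemma emb_eq_0: "emb f = 0 \<longleftrightarrow> f = 0"
proof
 assume "emb f = 0"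
 then show "f = 0" by (intro poly_mapping_eqI) (metis lookup_emb lookup_zero)
qed simp

lemma lev_emb: "lev (emb f) y = eval_pol f y"
proof (induction f rule: poly_mapping_induct)
 case (single m c)
 show ?case by (simp add: emb_def eval_single lmev_def mev_def)
qed (simp add: emb_add)

definition lbar :: "lpol \<Rightarrow> lpol" where "lbar = pmap uminus"

lemma lbar_mult: "lbar (f * g) = lbar f * lbar g" unfolding lbar_def by (rule pmap_mult) simp
lemma lbar_add: "lbar (f + g) = lbar f + lbar g" by (simp add: lbar_def pmap_add)
lemma lbar_diff: "lbar (f - g) = lbar f - lbar g" by (simp add: lbar_def pmap_diff)
lemma lbar_sum: "lbar (sum f S) = (\<Sum>s\<in>S. lbar (f s))" by (simp add: lbar_def pmap_sum)
lemma lbar_prod: "lbar (prod f S) = (\<Prod>s\<in>S. lbar (f s))" unfolding lbar_def by (rule pmap_prod) auto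
lemma lbar_power: "lbar (f ^ k) = lbar f ^ k" unfolding lbar_def by (rule pmap_power) auto
lemma lbar_single [simp]: "lbar (sgl a c) = sgl (- a) c" by (simp add: lbar_def)
lemma lbar_1 [simp]: "lbar 1 = 1" by (simp add: lbar_def pmap_1)
lemma lbar_0 [simp]: "lbar 0 = 0" by (simp add: lbar_def)

lemma lbar_lbar: "lbar (lbar f) = f"
 by (induction f rule: poly_mapping_induct) (auto simp: lbar_add)

lemma lookup_lbar: "lkp (lbar f) (- a) = lkp f a"
 unfolding lbar_def by (rule lookup_pmap_inj) simp

lemma lev_lbar: "lev (lbar f) y = lev f (\<lambda>i. inverse (y i))"
proof (induction f rule: poly_mapping_induct)
 case (single m c)
 show ?case by (simp add: lmev_def power_int_minus power_int_inverse)
qed (simp add: lbar_add)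

definition ltheta :: "nat \<Rightarrow> lpol \<Rightarrow> lpol" where "ltheta i = dgn (\<lambda>a. of_int (lkp a i))"

lemma ltheta_mult: "ltheta i (f * g) = ltheta i f * g + f * ltheta i g"
 unfolding ltheta_def by (rule dgn_deriv) (auto simp: lookup_add)
lemma ltheta_add: "ltheta i (f + g) = ltheta i f + ltheta i g"
 by (simp add: ltheta_def dgn_add)
lemma ltheta_single: "ltheta i (sgl a c) = sgl a (of_int (lkp a i) * c)"
 by (simp add: ltheta_def)
lemma ltheta_1 [simp]: "ltheta i 1 = 0" using ltheta_single[of i 0 1] by simp
lemma ltheta_emb: "ltheta i (emb f) = emb (theta i f)"
 by (induction f rule: poly_mapping_induct)
   (auto simp: emb_add ltheta_add theta_add emb_def theta_single ltheta_single pmap_add)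

lemma ltheta_lbar: "ltheta i (lbar f) = - lbar (ltheta i f)"
 by (induction f rule: poly_mapping_induct)
   (auto simp: lbar_add ltheta_add ltheta_single single_uminus[symmetric])

text \<open>
 The constant term, which is the integral over the torus (\<open>lev_torus\<close>).  Integration by
 parts is the fact that derivatives have no constant term.\<close>

definition CT :: "lpol \<Rightarrow> complex" where "CT L = lkp L 0"

lemma CT_add: "CT (f + g) = CT f + CT g" by (simp add: CT_def lookup_add)
lemma CT_uminus: "CT (- f) = - CT f" by (simp add: CT_def)
lemma CT_0 [simp]: "CT 0 = 0" by (simp add: CT_def)
lemma CT_1 [simp]: "CT 1 = 1" by (simp add: CT_def)
lemma CT_sum: "CT (sum f S) = (\<Sum>s\<in>S. CT (f s))" by (simp add: CT_def lookup_sum)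
lemma CT_cmult: "CT (sgl 0 c * f) = c * CT f" by (simp add: CT_def lookup_cmult)
lemma CT_ltheta: "CT (ltheta i f) = 0" by (simp add: CT_def ltheta_def)
lemma CT_lbar: "CT (lbar f) = CT f" using lookup_lbar[of f 0] by (simp add: CT_def)

lemma CT_parts: "CT (ltheta i f * g) = - CT (f * ltheta i g)"
 using CT_ltheta[of i "f * g"] by (simp add: ltheta_mult CT_add eq_neg_iff_add_eq_0)

definition lvars :: "nat \<Rightarrow> lpol \<Rightarrow> bool" where "lvars n L \<longleftrightarrow> (\<forall>a\<in>kys L. kys a \<subseteq> {..<n})"

lemma lvars_add: "lvars n f \<Longrightarrow> lvars n g \<Longrightarrow> lvars n (f + g)"
 unfolding lvars_def using keys_add[of f g] by blast
lemma lvars_mult: "lvars n f \<Longrightarrow> lvars n g \<Longrightarrow> lvars n (f * g)"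
 unfolding lvars_def using keys_mult[of f g] keys_add
 by (fastforce dest: subsetD[OF keys_add] subsetD[OF keys_mult])
lemma lvars_single: "kys a \<subseteq> {..<n} \<Longrightarrow> lvars n (sgl a c)" by (auto simp: lvars_def)
lemma lvars_1 [simp]: "lvars n 1" using lvars_single[of 0 n 1] by simp
lemma lvars_0 [simp]: "lvars n 0" by (simp add: lvars_def)
lemma lvars_uminus: "lvars n f \<Longrightarrow> lvars n (- f)" by (simp add: lvars_def)
lemma lvars_diff: "lvars n f \<Longrightarrow> lvars n g \<Longrightarrow> lvars n (f - g)"
 using lvars_add[OF _ lvars_uminus, of n f g] by simp
lemma lvars_prod: "(\<And>s. s \<in> S \<Longrightarrow> lvars n (f s)) \<Longrightarrow> lvars n (prod f S)"
 by (induction S rule: infinite_finite_induct) (auto intro: lvars_mult)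
lemma lvars_power: "lvars n f \<Longrightarrow> lvars n (f ^ k)" by (induction k) (auto intro: lvars_mult)
lemma lvars_sum: "(\<And>s. s \<in> S \<Longrightarrow> lvars n (f s)) \<Longrightarrow> lvars n (sum f S)"
 by (induction S rule: infinite_finite_induct) (auto intro: lvars_add)

lemma lvars_emb: assumes "vars_in n f" shows "lvars n (emb f)"
proof -
 have "emb f = (\<Sum>m\<in>kys f. sgl (toint m) (lkp f m))" by (simp add: emb_def pmap_def linext_def)
 moreover have "lvars n (\<Sum>m\<in>kys f. sgl (toint m) (lkp f m))"
  by (rule lvars_sum, rule lvars_single) (use assms in \<open>simp add: vars_in_def\<close>)
 ultimately show ?thesis by simp
qed

lemma lvars_lbar: assumes "lvars n f" shows "lvars n (lbar f)"
proof -
 have "lbar f = (\<Sum>a\<in>kys f. sgl (- a) (lkp f a))" by (simp add: lbar_def pmap_def linext_def)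
 moreover have "lvars n (\<Sum>a\<in>kys f. sgl (- a) (lkp f a))"
  by (rule lvars_sum, rule lvars_single) (use assms in \<open>simp add: lvars_def\<close>)
 ultimately show ?thesis by simp
qed

section \<open>The torus integral is the constant term\<close>

abbreviation "circ \<equiv> restrict_space lborel {0..1::real}"

lemma emeasure_circ: "emeasure circ {0..1} = 1"
 by (simp add: emeasure_restrict_space)

lemma finite_circ: "finite_measure circ"
 by (rule finite_measureI) (simp add: emeasure_circ space_restrict_space)

lemma sigma_finite_circ: "product_sigma_finite (\<lambda>_::nat. circ)"
 unfolding product_sigma_finite_def using finite_measure.axioms(1)[OF finite_circ] by simp

lemma integral_circ_1: "(\<integral>t. (1 :: complex) \<partial>circ) = 1"
 by (simp add: measure_def emeasure_circ space_restrict_space)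

lemma cis_powi: "cis a powi k = cis (of_int k * a)"
 by (cases k rule: int_cases2) (auto simp: power_int_minus Complex.DeMoivre)

lemma integrable_circ_powi: "integrable circ (\<lambda>t. cis (2 * pi * t) powi k)"
proof -
 have "integrable lborel (\<lambda>t. indicator {0..1} t *\<^sub>R (cis (2 * pi * t) powi k))"
  unfolding cis_powi by (intro borel_integrable_compact continuous_intros) auto
 then show ?thesis by (subst integrable_restrict_space) auto
qed

lemma integral_circ_powi: "(\<integral>t. cis (2 * pi * t) powi k \<partial>circ) = (if k = 0 then 1 else 0)"
proof (cases "k = 0")
 case True
 then show ?thesis using integral_circ_1 by simp
next
 case False
 define c where "c = 2 * pi * \<i> * of_int k"
 have c: "c \<noteq> 0" using False by (simp add: c_def)
 have cis_c: "cis (of_int k * (2 * pi * t)) = exp (t *\<^sub>R c)" for t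
  by (simp add: cis_conv_exp c_def scaleR_conv_of_real algebra_simps)
 define F where "F t = exp (t *\<^sub>R c) * inverse c" for t :: real
 have "has_bochner_integral lborel (\<lambda>t. indicator {0..1} t *\<^sub>R cis (of_int k * (2 * pi * t))) (F 1 - F 0)"
 proof (rule has_bochner_integral_FTC_Icc)
  fix t :: real
  have "((\<lambda>t. exp (t *\<^sub>R c) * inverse c) has_vector_derivative exp (t *\<^sub>R c) * c * inverse c) (at t within {0..1})"
   by (intro has_vector_derivative_mult_left exp_scaleR_has_vector_derivative_right)
  then show "(F has_vector_derivative cis (of_int k * (2 * pi * t))) (at t within {0..1})"
   unfolding cis_c F_def using c by (simp add: mult.assoc)
 qed (auto intro!: continuous_intros)
 moreover have "F 1 = F 0"
 proof -
  have "exp (1 *\<^sub>R c) = 1" unfolding cis_c[symmetric] using cis_multiple_2pi[of "of_int k"]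
   by (simp add: mult.commute mult.left_commute)
  then show ?thesis by (simp add: F_def)
 qed
 ultimately have "(\<integral>t. indicator {0..1} t *\<^sub>R cis (of_int k * (2 * pi * t)) \<partial>lborel) = 0"
  using has_bochner_integral_integral_eq by fastforce
 then show ?thesis using False unfolding cis_powi by (subst integral_restrict_space) (auto simp: set_lebesgue_integral_def)
qed

abbreviation "tor n \<equiv> PiM {..<n} (\<lambda>_::nat. circ)"

lemma lmev_torus:
 assumes "kys a \<subseteq> {..<n}"
 shows "integrable (tor n) (\<lambda>t. lmev (\<lambda>i. cis (2 * pi * t i)) a)"
  and "torus_integral n (\<lambda>y. lmev y a) = (if a = 0 then 1 else 0)"
proof -
 have eq: "lmev (\<lambda>i. cis (2 * pi * t i)) a = (\<Prod>i<n. cis (2 * pi * t i) powi lkp a i)" for t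
  by (rule lmev_superset) (use assms in auto)
 show "integrable (tor n) (\<lambda>t. lmev (\<lambda>i. cis (2 * pi * t i)) a)"
  unfolding eq
  by (rule product_sigma_finite.product_integrable_prod[OF sigma_finite_circ, where f = "\<lambda>i t. cis (2 * pi * t) powi lkp a i"])
    (auto intro: integrable_circ_powi)
 have "torus_integral n (\<lambda>y. lmev y a) = (\<Prod>i<n. \<integral>t. cis (2 * pi * t) powi lkp a i \<partial>circ)"
  unfolding torus_integral_def eq
  by (rule product_sigma_finite.product_integral_prod[OF sigma_finite_circ, where f = "\<lambda>i t. cis (2 * pi * t) powi lkp a i"])
    (auto intro: integrable_circ_powi)
 also have "\<dots> = (if a = 0 then 1 else 0)"
 proof (cases "a = 0")
  case False
  then obtain i where i: "i \<in> kys a" by (metis equals0I keys_eq_empty poly_mapping_eqI in_keys_iff lookup_zero)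
  then have "i < n" "lkp a i \<noteq> 0" using assms by (auto simp: in_keys_iff)
  then show ?thesis using False unfolding integral_circ_powi by (auto intro!: prod_zero)
 qed (simp only: integral_circ_powi lookup_zero prod.neutral_const if_True refl)
 finally show "torus_integral n (\<lambda>y. lmev y a) = (if a = 0 then 1 else 0)" .
qed

lemma lev_torus:
 assumes "lvars n L"
 shows "integrable (tor n) (\<lambda>t. lev L (\<lambda>i. cis (2 * pi * t i)))"
  and "torus_integral n (lev L) = CT L"
proof -
 have eq: "lev L y = (\<Sum>a\<in>kys L. lkp L a * lmev y a)" for y by (simp add: lev_def linext_def)
 have i: "integrable (tor n) (\<lambda>t. lkp L a * lmev (\<lambda>i. cis (2 * pi * t i)) a)" if "a \<in> kys L" for a
  using lmev_torus(1)[of a n] assms that by (intro integrable_mult_right) (auto simp: lvars_def)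
 show "integrable (tor n) (\<lambda>t. lev L (\<lambda>i. cis (2 * pi * t i)))"
  unfolding eq by (rule Bochner_Integration.integrable_sum) (rule i)
 have "torus_integral n (lev L) = (\<Sum>a\<in>kys L. \<integral>t. lkp L a * lmev (\<lambda>i. cis (2 * pi * t i)) a \<partial>tor n)"
  unfolding torus_integral_def eq by (rule Bochner_Integration.integral_sum) (rule i)
 also have "\<dots> = (\<Sum>a\<in>kys L. if a = 0 then lkp L a else 0)"
 proof (intro sum.cong refl)
  fix a assume "a \<in> kys L"
  then have "kys a \<subseteq> {..<n}" using assms by (auto simp: lvars_def)
  then show "(\<integral>t. lkp L a * lmev (\<lambda>i. cis (2 * pi * t i)) a \<partial>tor n) = (if a = 0 then lkp L a else 0)"
   using lmev_torus(2)[of a n] unfolding torus_integral_def by simp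
 qed
 also have "\<dots> = CT L" by (simp add: CT_def in_keys_iff)
 finally show "torus_integral n (lev L) = CT L" .
qed

lemma lookup_CT: "CT (sgl (- a) 1 * L) = lkp L a"
 using lookup_single_times[of "- a" 1 L a] by (simp add: CT_def)

lemma ex_lvars: "\<exists>n. lvars n L \<and> kys (a :: nat \<Rightarrow>\<^sub>0 int) \<subseteq> {..<n}"
proof -
 have "finite ((\<Union>b\<in>kys L. kys b) \<union> kys a)" by auto
 then obtain n where "\<forall>i\<in>(\<Union>b\<in>kys L. kys b) \<union> kys a. i < n" using finite_nat_set_iff_bounded by blast
 then show ?thesis by (intro exI[of _ n]) (auto simp: lvars_def)
qed

lemma lev_zero_torus:
 assumes "\<And>y. (\<And>i. norm (y i) = 1) \<Longrightarrow> lev L y = 0"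
 shows "L = 0"
proof (rule poly_mapping_eqI)
 fix a :: "nat \<Rightarrow>\<^sub>0 int"
 obtain n where n: "lvars n L" "kys a \<subseteq> {..<n}" using ex_lvars[of L a] by blast
 have "lvars n (sgl (- a) 1 * L)" using n by (intro lvars_mult lvars_single) (auto simp: in_keys_iff)
 from lev_torus(2)[OF this] have "lkp L a = torus_integral n (lev (sgl (- a) 1 * L))" by (simp add: lookup_CT)
 also have "\<dots> = 0" unfolding torus_integral_def by (simp add: lev_mult assms)
 finally show "lkp L a = lkp 0 a" by simp
qed

lemma lev_zero:
 assumes "\<And>y. (\<And>i. y i \<noteq> 0) \<Longrightarrow> lev L y = 0"
 shows "L = 0"
proof (rule lev_zero_torus)
 fix y :: point assume "\<And>i. norm (y i) = 1"
 then have "y i \<noteq> 0" for i by (metis norm_zero zero_neq_one)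
 then show "lev L y = 0" by (rule assms)
qed

lemma eval_zero:
 assumes "\<And>x. eval_pol f x = 0"
 shows "f = 0"
 using lev_zero[of "emb f"] assms by (simp add: lev_emb emb_eq_0)

section \<open>A determinantal identity\<close>

lemma poly_pderiv_sum:
 assumes "\<And>r. r \<ge> n \<Longrightarrow> coeff p r = 0"
 shows "(z::'a::idom) * poly (pderiv p) z = (\<Sum>r<n. of_nat r * coeff p r * z ^ r)"
proof -
 have c: "coeff (pCons 0 (pderiv p)) r = of_nat r * coeff p r" for r
  by (cases r) (auto simp: coeff_pderiv)
 have "poly (pCons 0 (pderiv p)) z = (\<Sum>r<n. coeff (pCons 0 (pderiv p)) r * z ^ r)"
  by (rule poly_eq_sum) (simp add: c assms)
 then show ?thesis by (simp add: c)
qed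

definition qpol :: "nat \<Rightarrow> (nat \<Rightarrow> 'a::idom) \<Rightarrow> nat \<Rightarrow> 'a poly" where
 "qpol n y j = (\<Prod>k\<in>{..<n} - {j}. [:1, - y k:])"

lemma coeff_qpol: assumes "j < n" "r \<ge> n" shows "coeff (qpol n y j) r = 0"
proof (rule coeff_eq_0)
 have "degree (qpol n y j) \<le> (\<Sum>k\<in>{..<n} - {j}. degree [:1, - y k:])"
  unfolding qpol_def using degree_prod_sum_le[of "{..<n} - {j}" "\<lambda>k. [:1, - y k:]"] by (simp add: o_def)
 also have "\<dots> \<le> (\<Sum>k\<in>{..<n} - {j}. 1)" by (intro sum_mono) simp
 also have "\<dots> < n" using assms by simp
 finally show "degree (qpol n y j) < r" using assms by simp
qed

definition qdet :: "nat \<Rightarrow> (nat \<Rightarrow> 'a::idom) \<Rightarrow> 'a" where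
 "qdet n y = dt n (\<lambda>s j. coeff (qpol n y j) (rho n s))"

text \<open>
 With \<open>q\<^sub>j(z) = \<Prod>\<^bsub>k\<noteq>j\<^esub> (1 - y\<^sub>k z)\<close> and
 \<open>h\<^sub>i = \<Prod>\<^sub>j g\<^sub>i\<^sub>j\<close> one has
 \<open>g\<^sub>i\<^sub>j = h\<^sub>i q\<^sub>j(x\<^sub>i)\<close>, so the Cauchy matrix is a
 diagonal matrix times a Vandermonde matrix times the coefficients of the \<open>q\<^sub>j\<close>.
 The second identity is the same computation with the logarithmic derivative
 \<open>x\<^sub>i q\<^sub>j'(x\<^sub>i)\<close>, which brings in the factor
 \<open>\<rho>\<^sub>j\<close> and the sum \<open>s\<^sub>i\<close>.\<close>

lemma cauchy_factorization:
 fixes x y :: "nat \<Rightarrow> 'a::idom"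
 assumes g: "\<And>i j. i < n \<Longrightarrow> j < n \<Longrightarrow> (1 - x i * y j) * g i j = 1"
 defines "s \<equiv> \<lambda>i. \<Sum>j<n. x i * y j * g i j" and "H \<equiv> \<Prod>i<n. \<Prod>j<n. g i j"
 shows "dt n g = H * (dt n (\<lambda>i j. x i ^ rho n j) * qdet n y)"
  and "dt n (\<lambda>i j. c * g i j + x i * y j * g i j * g i j) =
    H * (dt n (\<lambda>i j. x i ^ rho n j * (c + of_nat (rho n j) + s i)) * qdet n y)"
proof -
 define h where "h i = (\<Prod>j<n. g i j)" for i
 have cancel: "h i * (\<Prod>l\<in>{..<n} - A. 1 - x i * y l) = (\<Prod>l\<in>A. g i l)" if "i < n" "A \<subseteq> {..<n}" for i A
 proof -
  have "h i = (\<Prod>l\<in>A. g i l) * (\<Prod>l\<in>{..<n} - A. g i l)"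
   unfolding h_def using prod.subset_diff[OF that(2), of "g i"] by (simp add: mult.commute)
  moreover have "(\<Prod>l\<in>{..<n} - A. g i l) * (\<Prod>l\<in>{..<n} - A. 1 - x i * y l) = 1"
   unfolding prod.distrib[symmetric] using g[OF that(1)] by (intro prod.neutral) (auto simp: mult.commute)
  ultimately show ?thesis by (simp add: mult.assoc)
 qed
 have Q: "h i * poly (qpol n y j) (x i) = g i j" if "i < n" "j < n" for i j
  using cancel[OF that(1), of "{j}"] that by (simp add: qpol_def poly_prod)
 have Qs: "poly (qpol n y j) (x i) = (\<Sum>k<n. x i ^ rho n k * coeff (qpol n y j) (rho n k))" if "j < n" for i j
  unfolding sum_rho[of "\<lambda>r. x i ^ r * coeff (qpol n y j) r"]
  by (subst poly_eq_sum[of n]) (auto simp: coeff_qpol that mult.commute)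
 have Q's: "x i * poly (pderiv (qpol n y j)) (x i) =
   (\<Sum>k<n. x i ^ rho n k * of_nat (rho n k) * coeff (qpol n y j) (rho n k))" if "j < n" for i j
  unfolding sum_rho[of "\<lambda>r. x i ^ r * of_nat r * coeff (qpol n y j) r"]
  by (subst poly_pderiv_sum[of n]) (auto simp: coeff_qpol that mult_ac)
 have Q': "h i * (x i * poly (pderiv (qpol n y j)) (x i)) = - (\<Sum>k\<in>{..<n}-{j}. x i * y k * g i k) * g i j"
  if ij: "i < n" "j < n" for i j
 proof -
  have "poly (pderiv (qpol n y j)) (x i) = (\<Sum>k\<in>{..<n}-{j}. (\<Prod>l\<in>{..<n}-{j}-{k}. 1 - x i * y l) * (- y k))"
   unfolding qpol_def pderiv_prod by (simp add: poly_sum poly_prod pderiv_pCons mult.commute)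
  then have "h i * (x i * poly (pderiv (qpol n y j)) (x i))
    = (\<Sum>k\<in>{..<n}-{j}. - (x i * y k) * (h i * (\<Prod>l\<in>{..<n}-{j}-{k}. 1 - x i * y l)))"
   by (simp add: sum_distrib_left algebra_simps)
  also have "\<dots> = (\<Sum>k\<in>{..<n}-{j}. - (x i * y k) * (g i k * g i j))"
  proof (intro sum.cong refl)
   fix k assume k: "k \<in> {..<n} - {j}"
   have "{..<n}-{j}-{k} = {..<n} - {k,j}" by auto
   then show "- (x i * y k) * (h i * (\<Prod>l\<in>{..<n}-{j}-{k}. 1 - x i * y l)) = - (x i * y k) * (g i k * g i j)"
    using cancel[OF ij(1), of "{k,j}"] k ij by simp
  qed
  also have "\<dots> = - (\<Sum>k\<in>{..<n}-{j}. x i * y k * g i k) * g i j"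
   by (simp add: sum_distrib_right sum_negf mult.assoc)
  finally show ?thesis .
 qed
 have "dt n g = dt n (\<lambda>i j. h i * (\<Sum>k<n. x i ^ rho n k * coeff (qpol n y j) (rho n k)))"
  by (rule dt_cong) (simp add: Qs[symmetric] Q)
 then show "dt n g = H * (dt n (\<lambda>i j. x i ^ rho n j) * qdet n y)"
  by (simp add: dt_scale_rows dt_mult H_def h_def qdet_def)
 have "dt n (\<lambda>i j. c * g i j + x i * y j * g i j * g i j) =
   dt n (\<lambda>i j. h i * (\<Sum>k<n. (x i ^ rho n k * (c + of_nat (rho n k) + s i)) * coeff (qpol n y j) (rho n k)))"
 proof (rule dt_cong)
  fix i j assume ij: "i < n" "j < n"
  have si: "s i = x i * y j * g i j + (\<Sum>k\<in>{..<n}-{j}. x i * y k * g i k)"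
   unfolding s_def using ij by (simp add: sum.remove[of _ j])
  have "(\<Sum>k<n. (x i ^ rho n k * (c + of_nat (rho n k) + s i)) * coeff (qpol n y j) (rho n k)) =
   (c + s i) * (\<Sum>k<n. x i ^ rho n k * coeff (qpol n y j) (rho n k)) +
   (\<Sum>k<n. x i ^ rho n k * of_nat (rho n k) * coeff (qpol n y j) (rho n k))"
   unfolding sum_distrib_left sum.distrib[symmetric] by (intro sum.cong refl) (simp add: algebra_simps)
  also have "\<dots> = (c + s i) * poly (qpol n y j) (x i) + x i * poly (pderiv (qpol n y j)) (x i)"
   by (simp add: Qs[OF ij(2)] Q's[OF ij(2)])
  finally have "h i * (\<Sum>k<n. (x i ^ rho n k * (c + of_nat (rho n k) + s i)) * coeff (qpol n y j) (rho n k))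
   = (c + s i) * (h i * poly (qpol n y j) (x i)) + h i * (x i * poly (pderiv (qpol n y j)) (x i))"
   by (simp only: distrib_left mult_ac)
  then show "c * g i j + x i * y j * g i j * g i j =
    h i * (\<Sum>k<n. (x i ^ rho n k * (c + of_nat (rho n k) + s i)) * coeff (qpol n y j) (rho n k))"
   unfolding Q[OF ij] Q'[OF ij] si by (simp add: algebra_simps)
 qed
 then show "dt n (\<lambda>i j. c * g i j + x i * y j * g i j * g i j) =
    H * (dt n (\<lambda>i j. x i ^ rho n j * (c + of_nat (rho n j) + s i)) * qdet n y)"
  by (simp add: dt_scale_rows dt_mult H_def h_def qdet_def)
qed

text \<open>
 At the points \<open>1 / y\<^sub>i\<close> the matrix of values of the \<open>q\<^sub>j\<close> is
 diagonal.\<close>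

lemma qdet_nonzero:
 fixes y :: "nat \<Rightarrow> 'a::idom"
 assumes u: "\<And>i. i < n \<Longrightarrow> u i * y i = 1" and dist: "\<And>i j. i < n \<Longrightarrow> j < n \<Longrightarrow> i \<noteq> j \<Longrightarrow> y i \<noteq> y j"
 shows "qdet n y \<noteq> 0"
proof -
 have "dt n (\<lambda>i j. poly (qpol n y j) (u i)) = dt n (\<lambda>i j. \<Sum>k<n. u i ^ rho n k * coeff (qpol n y j) (rho n k))"
 proof (rule dt_cong)
  fix i j assume "i < n" "j < n"
  then show "poly (qpol n y j) (u i) = (\<Sum>k<n. u i ^ rho n k * coeff (qpol n y j) (rho n k))"
   unfolding sum_rho[of "\<lambda>r. u i ^ r * coeff (qpol n y j) r"]
   by (subst poly_eq_sum[of n]) (auto simp: coeff_qpol mult.commute)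
 qed
 also have "\<dots> = dt n (\<lambda>i j. u i ^ rho n j) * qdet n y" unfolding qdet_def by (rule dt_mult)
 finally have eq: "dt n (\<lambda>i j. u i ^ rho n j) * qdet n y = dt n (\<lambda>i j. poly (qpol n y j) (u i))" by simp
 have "dt n (\<lambda>i j. poly (qpol n y j) (u i)) = (\<Prod>i<n. poly (qpol n y i) (u i))"
 proof (rule dt_upper)
  fix i j assume "j < i" "i < n"
  then show "poly (qpol n y j) (u i) = 0" using u[of i] by (auto simp: qpol_def poly_prod intro!: bexI[of _ i])
 qed
 also have "\<dots> \<noteq> 0"
 proof -
  have "1 - u i * y k \<noteq> 0" if "i < n" "k < n" "k \<noteq> i" for i k
  proof
   assume "1 - u i * y k = 0"
   then have "u i * y k = u i * y i" using u[OF that(1)] by simp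
   moreover have "u i \<noteq> 0" using u[OF that(1)] by auto
   ultimately show False using dist[OF that(1,2) that(3)[symmetric]] by simp
  qed
  then show ?thesis by (auto simp: qpol_def poly_prod)
 qed
 finally show ?thesis using eq by auto
qed

text \<open>
 Both left hand sides in \<open>cauchy_factorization\<close> are determinants which do not change
 when \<open>x\<close> and \<open>y\<close> are exchanged, because this transposes the matrix.
 Eliminating the common determinant of coefficients leaves the identity.\<close>

lemma kernel_det_symmetry:
 fixes x y :: "nat \<Rightarrow> 'a::idom"
 assumes g: "\<And>i j. i < n \<Longrightarrow> j < n \<Longrightarrow> (1 - x i * y j) * g i j = 1"
  and u: "\<And>i. i < n \<Longrightarrow> u i * y i = 1" and dist: "\<And>i j. i < n \<Longrightarrow> j < n \<Longrightarrow> i \<noteq> j \<Longrightarrow> y i \<noteq> y j"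
 shows "dt n (\<lambda>i j. y i ^ rho n j) * dt n (\<lambda>i j. x i ^ rho n j * (c + of_nat (rho n j) + (\<Sum>k<n. x i * y k * g i k)))
  = dt n (\<lambda>i j. x i ^ rho n j) * dt n (\<lambda>i j. y i ^ rho n j * (c + of_nat (rho n j) + (\<Sum>k<n. x k * y i * g k i)))"
  (is "?vy * ?Mx = ?vx * ?My")
proof -
 define H where "H = (\<Prod>i<n. \<Prod>j<n. g i j)"
 have H': "(\<Prod>i<n. \<Prod>j<n. g j i) = H" unfolding H_def by (rule prod.swap)
 have "H * (\<Prod>i<n. \<Prod>j<n. 1 - x i * y j) = 1"
  unfolding H_def prod.distrib[symmetric] using g by (intro prod.neutral) (auto simp: mult.commute)
 then have H0: "H \<noteq> 0" by auto
 have g': "\<And>i j. i < n \<Longrightarrow> j < n \<Longrightarrow> (1 - y i * x j) * g j i = 1" using g by (simp add: mult.commute)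
 note A = cauchy_factorization[of n x y g, OF g] and B = cauchy_factorization[of n y x "\<lambda>i j. g j i", OF g', unfolded H']
 have "H * (?vx * qdet n y) = H * (?vy * qdet n x)"
  using A(1) B(1) dt_transpose[of n g] by (simp add: H_def)
 then have 1: "?vx * qdet n y = ?vy * qdet n x" using H0 by simp
 have "H * (?Mx * qdet n y) = H * (?My * qdet n x)"
  using A(2)[of c] B(2)[of c] dt_transpose[of n "\<lambda>i j. c * g i j + x i * y j * g i j * g i j"]
  by (simp add: H_def mult.commute[of "y _" "x _"])
 then have 2: "?Mx * qdet n y = ?My * qdet n x" using H0 by simp
 have "?vy * ?Mx * qdet n y = ?vy * (?Mx * qdet n y)" by (rule mult.assoc)
 also have "\<dots> = ?My * (?vy * qdet n x)" unfolding 2 by (rule mult.left_commute)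
 also have "\<dots> = ?vx * ?My * qdet n y" unfolding 1[symmetric] by (simp only: mult_ac)
 finally have "?vy * ?Mx * qdet n y = ?vx * ?My * qdet n y" .
 then show ?thesis using qdet_nonzero[of n u y, OF u dist] by simp
qed

section \<open>The reproducing kernel\<close>

definition psp :: "nat \<Rightarrow> natfun \<Rightarrow> mpol" where "psp n lam = restrict_vars n (power_sum_part lam)"

definition wgt :: "nat \<Rightarrow> natfun \<Rightarrow> complex" where
 "wgt kap lam = of_nat kap ^ part_length lam / of_nat (z_part lam)"

text \<open>
 The component of degree \<open>d\<close> of the reproducing kernel of the power sum scalar product:
 a polynomial in \<open>x\<close> whose coefficients depend on the values \<open>y\<close>.\<close>

definition Kpol :: "nat \<Rightarrow> nat \<Rightarrow> nat \<Rightarrow> point \<Rightarrow> mpol" where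
 "Kpol n kap d y = (\<Sum>lam\<in>PD d. const_pol (wgt kap lam * eval_pol (psp n lam) y) * psp n lam)"

definition MS :: "nat \<Rightarrow> nat multiset set" where "MS d = {M. 0 \<notin># M \<and> sum_mset M = d}"
definition PM :: "nat \<Rightarrow> nat multiset \<Rightarrow> mpol" where "PM n M = prod_mset (image_mset (ppow n) M)"
definition zM :: "nat multiset \<Rightarrow> nat" where "zM M = (\<Prod>k\<in>set_mset M. k ^ count M k * fact (count M k))"
definition WM :: "nat \<Rightarrow> nat multiset \<Rightarrow> complex" where "WM kap M = of_nat kap ^ size M / of_nat (zM M)"

lemma pmset_bij: "bij_betw pmset (PD d) (MS d)"
 unfolding bij_betw_def
proof
 show "inj_on pmset (PD d)" by (rule inj_onI) (auto simp: PD_def intro: pmset_inj')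
 show "pmset ` PD d = MS d"
 proof safe
  fix lam assume "lam \<in> PD d"
  then show "pmset lam \<in> MS d" by (auto simp: PD_def MS_def sum_pmset) (auto simp: pmset_def is_partition_def)
 next
  fix M assume M: "M \<in> MS d"
  obtain xs where xs: "mset xs = M" using ex_mset by blast
  define m where "m = pm (length xs) ((!) xs)"
  have nz: "xs ! i \<noteq> 0" if "i < length xs" for i
   using M xs nth_mem[OF that] by (metis (no_types, lifting) MS_def mem_Collect_eq set_mset_mset)
  have k: "kys m = {..<length xs}" using nz by (auto simp: m_def in_keys_iff split: if_splits)
  have "parts m = image_mset ((!) xs) (mset_set {..<length xs})"
   unfolding parts_def k by (intro image_mset_cong) (auto simp: m_def)
  also have "\<dots> = mset (map ((!) xs) [0..<length xs])" by (simp add: mset_upt atLeast0LessThan)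
  also have "\<dots> = M" using xs by (simp add: map_nth)
  finally obtain mu where mu: "is_partition mu" "pmset mu = M" using expo_partition[of m] by metis
  then have "mu \<in> PD d" using M sum_pmset[OF mu(1)] by (simp add: PD_def MS_def)
  then show "M \<in> pmset ` PD d" using mu by blast
 qed
qed

lemma psp_PM: "is_partition lam \<Longrightarrow> psp n lam = PM n (pmset lam)"
proof -
 assume p: "is_partition lam"
 let ?xs = "map lam [0..<part_length lam]"
 have "psp n lam = prod_list (map (ppow n) ?xs)"
  unfolding psp_def power_sum_part_psl by (rule restrict_psl[OF part_list(1)[OF p]])
 also have "\<dots> = PM n (mset ?xs)"
  unfolding PM_def by (metis mset_map prod_mset_prod_list)
 finally show ?thesis unfolding part_list(2)[OF p] .
qed

lemma wgt_WM: assumes "is_partition lam" shows "wgt kap lam = WM kap (pmset lam)"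
proof -
 have fin: "finite {i. lam i \<noteq> 0}" using assms by (simp add: is_partition_def)
 have s: "set_mset (pmset lam) = lam ` {i. lam i \<noteq> 0}" using fin by (simp add: pmset_def)
 have c: "count (pmset lam) k = part_mult lam k" if "k \<in> lam ` {i. lam i \<noteq> 0}" for k
 proof -
  have "{x \<in> {i. lam i \<noteq> 0}. lam x = k} = {i. lam i = k}" using that by auto
  then have "{i. lam i = k} \<subseteq> {i. lam i \<noteq> 0}" by auto
  then have "(\<Sum>i\<in>{i. lam i = k}. count (mset_set {i. lam i \<noteq> 0}) i) = (\<Sum>i\<in>{i. lam i = k}. 1)"
   using fin by (intro sum.cong refl) auto
  moreover have "lam -` {k} \<inter> {i. lam i \<noteq> 0} = {i. lam i = k}" using \<open>{i. lam i = k} \<subseteq> _\<close> by auto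
  ultimately show ?thesis using fin by (simp add: pmset_def part_mult_def count_image_mset)
 qed
 have "z_part lam = zM (pmset lam)" unfolding z_part_def zM_def s by (intro prod.cong refl) (simp add: c)
 then show ?thesis by (simp add: wgt_def WM_def size_pmset)
qed

lemma Kpol_MS: "Kpol n kap d y = (\<Sum>M\<in>MS d. const_pol (WM kap M * eval_pol (PM n M) y) * PM n M)"
 unfolding sum.reindex_bij_betw[OF pmset_bij, symmetric] Kpol_def
 by (intro sum.cong refl) (auto simp: PD_def psp_PM wgt_WM)

lemma finite_MS: "finite (MS d)" using bij_betw_finite[OF pmset_bij] finite_PD by blast

lemma zM_add: "zM (add_mset r N) = zM N * (r * Suc (count N r))"
proof -
 have sup: "zM M = (\<Prod>k\<in>insert r (set_mset N). k ^ count M k * fact (count M k))" if "set_mset M \<subseteq> insert r (set_mset N)" for M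
  unfolding zM_def using that by (intro prod.mono_neutral_left) (auto simp: not_in_iff)
 let ?R = "insert r (set_mset N) - {r}"
 have split: "(\<Prod>k\<in>insert r (set_mset N). f k) = f r * (\<Prod>k\<in>?R. f k)" for f :: natfun
  by (simp add: prod.insert_remove)
 have "zM (add_mset r N) = (r ^ Suc (count N r) * fact (Suc (count N r))) * (\<Prod>k\<in>?R. k ^ count N k * fact (count N k))"
  by (subst sup) (auto simp: split intro!: prod.cong)
 moreover have "zM N = (r ^ count N r * fact (count N r)) * (\<Prod>k\<in>?R. k ^ count N k * fact (count N k))"
  by (subst sup) (auto simp: split)
 ultimately show ?thesis by (simp add: algebra_simps)
qed

lemma zM_pos: "0 \<notin># M \<Longrightarrow> zM M \<noteq> 0" by (auto simp: zM_def)

lemma WM_add: assumes "r > 0" "0 \<notin># N"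
 shows "WM kap (add_mset r N) * of_nat (count (add_mset r N) r) * of_nat r = of_nat kap * WM kap N"
proof -
 have e: "of_nat (zM (add_mset r N)) = (of_nat (zM N) * (of_nat r * of_nat (Suc (count N r))) :: complex)"
  by (simp only: zM_add of_nat_mult)
 have nz: "(of_nat (zM N) :: complex) \<noteq> 0" "(of_nat r :: complex) \<noteq> 0" "(of_nat (Suc (count N r)) :: complex) \<noteq> 0"
  using zM_pos[OF assms(2)] assms(1) by (simp_all only: of_nat_eq_0_iff) simp_all
 have "count (add_mset r N) r = Suc (count N r)" by simp
 moreover have "k * P / (Z * (a * b)) * b * a = k * (P / Z)" if "Z \<noteq> 0" "a \<noteq> 0" "b \<noteq> 0" for k P Z a b :: complex
  using that by (simp add: field_simps)
 ultimately show ?thesis unfolding WM_def e size_add_mset power_Suc using nz by metis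
qed

lemma theta_PM_mset: "theta i (PM n M) = (\<Sum>r\<in>#M. theta i (ppow n r) * PM n (M - {#r#}))"
proof (induction M)
 case empty then show ?case by (simp add: PM_def)
next
 case (add a M)
 have "(\<Sum>r\<in>#M. theta i (ppow n r) * PM n (add_mset a M - {#r#})) = (\<Sum>r\<in>#M. ppow n a * (theta i (ppow n r) * PM n (M - {#r#})))"
  by (rule arg_cong[of _ _ sum_mset], rule image_mset_cong) (simp add: PM_def mult.left_commute)
 also have "\<dots> = ppow n a * theta i (PM n M)" unfolding add.IH by (simp add: sum_mset_distrib_left multiset.map_comp o_def)
 finally show ?case by (simp add: PM_def theta_mult)
qed

lemma sum_mset_count: "(\<Sum>r\<in>#M. f r) = (\<Sum>r\<in>set_mset M. of_nat (count M r) * (f r :: 'a::comm_semiring_1))"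
proof (induction M)
 case (add a M)
 have *: "(\<Sum>r\<in>set_mset M. of_nat (count M r) * f r) = (\<Sum>r\<in>insert a (set_mset M). of_nat (count M r) * f r)"
  by (rule sum.mono_neutral_left) (auto simp: not_in_iff)
 have "(\<Sum>r\<in>insert a (set_mset M). of_nat (count (add_mset a M) r) * f r)
   = (\<Sum>r\<in>insert a (set_mset M). (if r = a then f r else 0) + of_nat (count M r) * f r)"
  by (intro sum.cong refl) (simp add: distrib_right)
 also have "\<dots> = f a + (\<Sum>r\<in>set_mset M. of_nat (count M r) * f r)"
  unfolding sum.distrib * by (simp add: sum.delta)
 finally show ?case using add by simp
qed simp

lemma theta_ppow: "i < n \<Longrightarrow> theta i (ppow n r) = of_nat r * var i ^ r"
proof -
 assume i: "i < n"
 have "theta i (var j ^ r) = (if j = i then of_nat r * var i ^ r else 0)" for j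
  by (cases r) (auto simp: theta_power_Suc theta_var simp del: power_Suc of_nat_Suc, simp add: mult_ac)
 then show ?thesis using i by (simp add: ppow_def theta_sum)
qed

lemma MS_pairs:
 fixes F :: "nat multiset \<Rightarrow> nat \<Rightarrow> 'a::comm_monoid_add"
 shows "(\<Sum>M\<in>MS d. \<Sum>r\<in>set_mset M. F M r) = (\<Sum>r\<in>{1..d}. \<Sum>N\<in>MS (d - r). F (add_mset r N) r)"
proof -
 have "(\<Sum>M\<in>MS d. \<Sum>r\<in>set_mset M. F M r) = (\<Sum>(M, r)\<in>(SIGMA M:MS d. set_mset M). F M r)"
  by (rule sum.Sigma) (auto simp: finite_MS)
 also have "\<dots> = (\<Sum>(r, N)\<in>(SIGMA r:{1..d}. MS (d - r)). F (add_mset r N) r)"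
 proof (rule sum.reindex_bij_witness[of _ "\<lambda>(r, N). (add_mset r N, r)" "\<lambda>(M, r). (r, M - {#r#})"])
  fix p assume "p \<in> (SIGMA M:MS d. set_mset M)"
  then obtain M r where p: "p = (M, r)" "M \<in> MS d" "r \<in># M" by auto
  then obtain N where N: "M = add_mset r N" by (metis insert_DiffM)
  then show "(case p of (M, r) \<Rightarrow> (r, M - {#r#})) \<in> (SIGMA r:{1..d}. MS (d - r))"
   using p by (auto simp: MS_def)
 qed (auto simp: MS_def)
 also have "\<dots> = (\<Sum>r\<in>{1..d}. \<Sum>N\<in>MS (d - r). F (add_mset r N) r)"
  by (rule sum.Sigma[symmetric]) (auto simp: finite_MS)
 finally show ?thesis .
qed

text \<open>
 Deriving a product of power sums removes one of its factors; the weight changes by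
 \<open>\<kappa>\<close> divided by the part and its multiplicity, which are exactly the factors that
 the derivative supplies.\<close>

lemma theta_Kpol:
 assumes "i < n"
 shows "theta i (Kpol n kap d y) =
  (\<Sum>r\<in>{1..d}. const_pol (of_nat kap * eval_pol (ppow n r) y) * var i ^ r * Kpol n kap (d - r) y)"
proof -
 define F where "F M r = const_pol (WM kap M * of_nat (count M r) * of_nat r * eval_pol (PM n M) y) * var i ^ r * PM n (M - {#r#})" for M r
 have "theta i (Kpol n kap d y) = (\<Sum>M\<in>MS d. \<Sum>r\<in>set_mset M. F M r)"
  unfolding Kpol_MS theta_sum theta_cmult theta_PM_mset sum_mset_count sum_distrib_left F_def
  by (intro sum.cong refl) (simp add: theta_ppow[OF assms] const_pol_mult const_pol_of_nat mult_ac)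
 also have "\<dots> = (\<Sum>r\<in>{1..d}. \<Sum>N\<in>MS (d - r). F (add_mset r N) r)" by (rule MS_pairs)
 also have "\<dots> = (\<Sum>r\<in>{1..d}. const_pol (of_nat kap * eval_pol (ppow n r) y) * var i ^ r * Kpol n kap (d - r) y)"
 proof (intro sum.cong refl)
  fix r assume r: "r \<in> {1..d}"
  have "F (add_mset r N) r = const_pol (of_nat kap * eval_pol (ppow n r) y) * var i ^ r * (const_pol (WM kap N * eval_pol (PM n N) y) * PM n N)"
   if "N \<in> MS (d - r)" for N
  proof -
   have "0 \<notin># N" using that by (simp add: MS_def)
   then have w: "WM kap (add_mset r N) * of_nat (count (add_mset r N) r) * of_nat r = of_nat kap * WM kap N"
    using r by (intro WM_add) auto
   have "PM n (add_mset r N) = ppow n r * PM n N" by (simp add: PM_def)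
   then show ?thesis unfolding F_def w by (simp add: const_pol_mult mult_ac)
  qed
  then show "(\<Sum>N\<in>MS (d - r). F (add_mset r N) r) = const_pol (of_nat kap * eval_pol (ppow n r) y) * var i ^ r * Kpol n kap (d - r) y"
   unfolding Kpol_MS sum_distrib_left by (intro sum.cong refl) simp
 qed
 finally show ?thesis .
qed

lemma Kpol_swap: "eval_pol (Kpol n kap d y) x = eval_pol (Kpol n kap d x) y"
 by (simp add: Kpol_def mult_ac)

lemma sympol_psp: "is_partition lam \<Longrightarrow> psp n lam \<in> sympol n"
 unfolding psp_def by (rule restrict_sympol[OF homog_psp psp_symmetric])

lemma sympol_Kpol: "Kpol n kap d y \<in> sympol n"
 unfolding Kpol_def by (intro sympol_sum sympol_cmult sympol_psp) (auto simp: PD_def)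

section \<open>Kernel symmetry of the Sekiguchi operators\<close>

text \<open>
 \<open>\<Sum>\<^sub>r p\<^sub>r(y) x\<^sub>i\<^sup>r t\<^sup>r\<close>, the logarithmic
 derivative of the kernel divided by \<open>\<kappa>\<close>.  The variable \<open>t\<close> of the
 power series keeps track of the degree, and all identities are between formal power series.\<close>

definition sfp :: "nat \<Rightarrow> point \<Rightarrow> nat \<Rightarrow> mpol fps" where
 "sfp n y i = Abs_fps (\<lambda>r. if r = 0 then 0 else const_pol (eval_pol (ppow n r) y) * var i ^ r)"

definition fmp :: "('a \<Rightarrow> 'b) \<Rightarrow> 'a fps \<Rightarrow> 'b fps" where "fmp T F = Abs_fps (\<lambda>d. T (fps_nth F d))"

lemma fmp_nth [simp]: "fps_nth (fmp T F) d = T (fps_nth F d)" by (simp add: fmp_def)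

abbreviation "KF n kap y \<equiv> Abs_fps (\<lambda>d. Kpol n kap d y)"

lemma fmp_theta_mult: "fmp (theta i) (A * B) = fmp (theta i) A * B + A * fmp (theta i) B"
 by (rule fps_ext) (simp add: fps_mult_nth theta_sum theta_mult sum.distrib)

lemma theta_KF: "i < n \<Longrightarrow> fmp (theta i) (KF n kap y) = fps_const (const_pol (of_nat kap)) * sfp n y i * KF n kap y"
proof (rule fps_ext)
 fix d assume i: "i < n"
 have "fps_nth (fps_const (const_pol (of_nat kap)) * (sfp n y i * KF n kap y)) d =
   const_pol (of_nat kap) * (\<Sum>r=0..d. fps_nth (sfp n y i) r * Kpol n kap (d - r) y)"
  by (subst fps_mult_left_const_nth) (simp add: fps_mult_nth)
 also have "(\<Sum>r=0..d. fps_nth (sfp n y i) r * Kpol n kap (d - r) y) = (\<Sum>r\<in>{1..d}. fps_nth (sfp n y i) r * Kpol n kap (d - r) y)"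
  by (rule sum.mono_neutral_right) (auto simp: sfp_def)
 also have "const_pol (of_nat kap) * \<dots> = theta i (Kpol n kap d y)"
  unfolding theta_Kpol[OF i] sum_distrib_left by (intro sum.cong refl) (auto simp: sfp_def const_pol_mult mult_ac)
 finally show "fps_nth (fmp (theta i) (KF n kap y)) d = fps_nth (fps_const (const_pol (of_nat kap)) * sfp n y i * KF n kap y) d"
  by (simp add: mult.assoc)
qed

lemma theta_sfp: "i \<noteq> j \<Longrightarrow> fmp (theta i) (sfp n y j) = 0"
proof (rule fps_ext)
 fix r assume "i \<noteq> j"
 then have "theta i (var j ^ r) = 0" by (cases r) (auto simp: theta_power_Suc theta_var simp del: power_Suc)
 then show "fps_nth (fmp (theta i) (sfp n y j)) r = fps_nth 0 r" by (simp add: sfp_def theta_cmult)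
qed

lemma fmp_theta_const: "fmp (theta i) (fps_const (const_pol c)) = 0"
 by (rule fps_ext) (simp add: fps_const_def)

lemma fmp_theta_add: "fmp (theta i) (A + B) = fmp (theta i) A + fmp (theta i) B"
 by (rule fps_ext) (simp add: theta_add)

text \<open>
 A product of operators \<open>c\<^sub>i + \<theta>\<^sub>i\<close> acts on the kernel as a product
 of multiplications, since the logarithmic derivative in \<open>x\<^sub>i\<close> contains no other
 variable.\<close>

lemma KF_product:
 assumes "finite J" "J \<subseteq> {..<n}"
 shows "Abs_fps (\<lambda>d. dgn (\<lambda>m. \<Prod>i\<in>J. c i + of_nat (lkp m i)) (Kpol n kap d y)) =
  (\<Prod>i\<in>J. fps_const (const_pol (c i)) + fps_const (const_pol (of_nat kap)) * sfp n y i) * KF n kap y"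
 using assms
proof (induction J rule: finite_induct)
 case empty then show ?case by (simp add: dgn_1)
next
 case (insert j J)
 define P where "P = (\<Prod>i\<in>J. fps_const (const_pol (c i)) + fps_const (const_pol (of_nat kap)) * sfp n y i)"
 define G where "G = Abs_fps (\<lambda>d. dgn (\<lambda>m. \<Prod>i\<in>J. c i + of_nat (lkp m i)) (Kpol n kap d y))"
 have G: "G = P * KF n kap y" using insert unfolding G_def P_def by simp
 have "fmp (theta j) (\<Prod>i\<in>I. fps_const (const_pol (c i)) + fps_const (const_pol (of_nat kap)) * sfp n y i) = 0"
  if "finite I" "j \<notin> I" for I
  using that
 proof (induction I rule: finite_induct)
  case empty
  have "fmp (theta j) (fps_const (const_pol 1)) = 0" by (rule fmp_theta_const)
  then show ?case by simp
 next
  case (insert a I)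
  then show ?case by (simp add: fmp_theta_mult fmp_theta_add fmp_theta_const theta_sfp)
 qed
 then have tP: "fmp (theta j) P = 0" unfolding P_def using insert by blast
 have "Abs_fps (\<lambda>d. dgn (\<lambda>m. \<Prod>i\<in>insert j J. c i + of_nat (lkp m i)) (Kpol n kap d y))
  = fps_const (const_pol (c j)) * G + fmp (theta j) G"
  using insert.hyps by (intro fps_ext) (simp add: G_def theta_def dgn_const dgn_dgn dgn_plus distrib_right)
 also have "fmp (theta j) G = P * (fps_const (const_pol (of_nat kap)) * sfp n y j * KF n kap y)"
  unfolding G fmp_theta_mult tP using theta_KF[of j n kap y] insert.prems by simp
 finally show ?case unfolding G prod.insert[OF insert.hyps] P_def[symmetric]
  by (simp only: distrib_left distrib_right mult_ac)
qed

definition evf :: "point \<Rightarrow> mpol fps \<Rightarrow> complex fps" where "evf x = fmp (\<lambda>f. eval_pol f x)"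

lemma evf_mult: "evf x (A * B) = evf x A * evf x B"
 by (rule fps_ext) (simp add: evf_def fps_mult_nth)
lemma evf_add: "evf x (A + B) = evf x A + evf x B"
 by (rule fps_ext) (simp add: evf_def)
lemma evf_const: "evf x (fps_const f) = fps_const (eval_pol f x)"
 by (rule fps_ext) (simp add: evf_def)
lemma evf_prod: "evf x (prod f S) = (\<Prod>s\<in>S. evf x (f s))"
proof (induction S rule: infinite_finite_induct)
 case (infinite A) then show ?case using evf_const[of x 1] by simp
next
 case empty then show ?case using evf_const[of x 1] by simp
qed (simp add: evf_mult)

definition geom :: "complex \<Rightarrow> complex fps" where "geom a = Abs_fps (\<lambda>r. a ^ r)"

lemma geom: "(1 - fps_const a * fps_X) * geom a = 1"
proof (rule fps_ext)
 fix r
 show "fps_nth ((1 - fps_const a * fps_X) * geom a) r = fps_nth 1 r"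
  by (cases r) (auto simp: geom_def left_diff_distrib mult.assoc)
qed

lemma evf_sfp: "evf x (sfp n y i) = (\<Sum>j<n. fps_const (x i) * fps_X * fps_const (y j) * geom (x i * y j))"
proof (rule fps_ext)
 fix r
 have "fps_const (x i) * fps_X * fps_const (y j) * geom (x i * y j) = fps_X * (fps_const (x i * y j) * geom (x i * y j))" for j
  by (simp add: mult_ac flip: fps_const_mult)
 then show "fps_nth (evf x (sfp n y i)) r = fps_nth (\<Sum>j<n. fps_const (x i) * fps_X * fps_const (y j) * geom (x i * y j)) r"
  by (cases r) (auto simp: evf_def sfp_def ppow_def geom_def fps_sum_nth sum_distrib_left sum_distrib_right power_mult_distrib mult_ac)
qed

lemma fps_const_prod: "fps_const (prod f S) = (\<Prod>s\<in>S. fps_const (f s :: complex))"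
 by (induction S rule: infinite_finite_induct) (auto simp flip: fps_const_mult)

definition numk :: "nat \<Rightarrow> nat \<Rightarrow> complex \<Rightarrow> point \<Rightarrow> point \<Rightarrow> complex fps" where
 "numk n kap X x y = Abs_fps (\<lambda>d. eval_pol (numer n kap (sekq n X) (Kpol n kap d y)) x)"

lemma numk_dt:
 assumes "kap > 0"
 shows "numk n kap X x y = fps_const (of_nat kap ^ n) *
  (dt n (\<lambda>i j. fps_const (x i) ^ rho n j * (fps_const (X / of_nat kap) + of_nat (rho n j) + evf x (sfp n y i)))
   * evf x (KF n kap y))"
proof -
 let ?P = "{sig. sig permutes {..<n}}"
 have k0: "(of_nat kap :: complex) \<noteq> 0" using assms by simp
 have "numk n kap X x y = (\<Sum>sig\<in>?P. fps_const (of_int (sign sig)) * (fps_const (\<Prod>i<n. x i ^ rho n (sig i)) *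
   evf x (Abs_fps (\<lambda>d. dgn (\<lambda>m. \<Prod>i<n. (X + of_nat (rho n (sig i)) * of_nat kap) + of_nat (lkp m i)) (Kpol n kap d y)))))"
  by (rule fps_ext) (simp add: numk_def numer_def evf_def fps_sum_nth mon_prod sekq_def shv_def add.assoc)
 also have "\<dots> = (\<Sum>sig\<in>?P. fps_const (of_nat kap ^ n) * ((of_int (sign sig) * (\<Prod>i<n. fps_const (x i) ^ rho n (sig i) *
   (fps_const (X / of_nat kap) + of_nat (rho n (sig i)) + evf x (sfp n y i)))) * evf x (KF n kap y)))"
 proof (intro sum.cong refl)
  fix sig
  have step: "evf x (fps_const (const_pol (X + of_nat (rho n (sig i)) * of_nat kap)) + fps_const (const_pol (of_nat kap)) * sfp n y i)
   = fps_const (of_nat kap) * (fps_const (X / of_nat kap) + of_nat (rho n (sig i)) + evf x (sfp n y i))" for i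
  proof -
   have "X + of_nat (rho n (sig i)) * of_nat kap = of_nat kap * (X / of_nat kap + of_nat (rho n (sig i)))"
    using k0 by (simp add: field_simps)
   then have "fps_const (X + of_nat (rho n (sig i)) * of_nat kap)
     = fps_const (of_nat kap) * (fps_const (X / of_nat kap) + of_nat (rho n (sig i)))"
    by (simp only: fps_const_mult[symmetric] fps_const_add[symmetric] fps_of_nat)
   then show ?thesis by (simp only: evf_add evf_mult evf_const eval_const distrib_left)
  qed
  have pw: "fps_const (\<Prod>i<n. x i ^ rho n (sig i)) = (\<Prod>i<n. fps_const (x i) ^ rho n (sig i))"
   by (simp add: fps_const_prod fps_const_power)
  have kn: "(\<Prod>i<n. fps_const (of_nat kap :: complex)) = fps_const (of_nat kap ^ n)"
   by (simp add: fps_const_power)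
  show "fps_const (of_int (sign sig)) * (fps_const (\<Prod>i<n. x i ^ rho n (sig i)) *
   evf x (Abs_fps (\<lambda>d. dgn (\<lambda>m. \<Prod>i<n. (X + of_nat (rho n (sig i)) * of_nat kap) + of_nat (lkp m i)) (Kpol n kap d y)))) =
   fps_const (of_nat kap ^ n) * ((of_int (sign sig) * (\<Prod>i<n. fps_const (x i) ^ rho n (sig i) *
   (fps_const (X / of_nat kap) + of_nat (rho n (sig i)) + evf x (sfp n y i)))) * evf x (KF n kap y))"
   unfolding KF_product[OF finite_lessThan subset_refl] evf_mult evf_prod step prod.distrib pw
   by (simp only: fps_of_int[symmetric] kn mult_ac)
 qed
 also have "\<dots> = fps_const (of_nat kap ^ n) *
  (dt n (\<lambda>i j. fps_const (x i) ^ rho n j * (fps_const (X / of_nat kap) + of_nat (rho n j) + evf x (sfp n y i)))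
   * evf x (KF n kap y))"
  by (simp add: dt_def sum_distrib_left sum_distrib_right)
 finally show ?thesis .
qed

lemma dt_scale_cols: "dt n (\<lambda>i j. t j * M i j) = (\<Prod>i<n. t i) * dt n M"
 using dt_scale_rows[of n t "\<lambda>i j. M j i"] dt_transpose[of n M] dt_transpose[of n "\<lambda>i j. t i * M j i"] by simp

lemma dt_vand_fps: "dt n (\<lambda>i j. fps_const (x i) ^ rho n j) = fps_const (eval_pol (vand n) x)"
proof -
 have "dt n (\<lambda>i j. fps_const (x i) ^ rho n j) = (\<Prod>j<n. \<Prod>i<j. fps_const (x i) - fps_const (x j))"
  by (rule vandermonde)
 also have "\<dots> = fps_const (\<Prod>j<n. \<Prod>i<j. x i - x j)" by (simp add: fps_const_prod)
 finally show ?thesis by (simp add: vand_def)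
qed

text \<open>
 Summed over all degrees, the left hand side is a Vandermonde factor times the kernel times one of
 the determinants of \<open>kernel_det_symmetry\<close>, for the variables
 \<open>x\<^sub>i t\<close> and \<open>y\<^sub>j\<close> in the ring of power series in
 \<open>t\<close>.\<close>

theorem kernel_symmetry:
 assumes kap: "kap > 0" and nz: "\<And>i. i < n \<Longrightarrow> y i \<noteq> 0" and dist: "\<And>i j. i < n \<Longrightarrow> j < n \<Longrightarrow> i \<noteq> j \<Longrightarrow> y i \<noteq> y j"
 shows "eval_pol (vand n) y * eval_pol (numer n kap (sekq n X) (Kpol n kap d y)) x
    = eval_pol (vand n) x * eval_pol (numer n kap (sekq n X) (Kpol n kap d x)) y"
proof -
 define x' where "x' i = fps_const (x i) * fps_X" for i
 define y' where "y' i = fps_const (y i)" for i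
 define g where "g i j = geom (x i * y j)" for i j
 define c where "c = fps_const (X / of_nat kap)"
 define t where "t j = (fps_X :: complex fps) ^ rho n j" for j
 have g: "(1 - x' i * y' j) * g i j = 1" for i j
  using geom[of "x i * y j"] by (simp add: x'_def y'_def g_def mult_ac flip: fps_const_mult)
 have S: "dt n (\<lambda>i j. y' i ^ rho n j) * dt n (\<lambda>i j. x' i ^ rho n j * (c + of_nat (rho n j) + (\<Sum>k<n. x' i * y' k * g i k)))
  = dt n (\<lambda>i j. x' i ^ rho n j) * dt n (\<lambda>i j. y' i ^ rho n j * (c + of_nat (rho n j) + (\<Sum>k<n. x' k * y' i * g k i)))"
 proof (rule kernel_det_symmetry[where u = "\<lambda>i. fps_const (inverse (y i))"])
  show "(1 - x' i * y' j) * g i j = 1" for i j by (rule g)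
  show "fps_const (inverse (y i)) * y' i = 1" if "i < n" for i using nz[OF that] by (simp add: y'_def)
  show "y' i \<noteq> y' j" if "i < n" "j < n" "i \<noteq> j" for i j using dist[OF that] unfolding y'_def by (metis fps_nth_fps_const)
 qed
 have sx: "(\<Sum>k<n. x' i * y' k * g i k) = evf x (sfp n y i)" for i by (simp add: evf_sfp x'_def y'_def g_def)
 have sy: "(\<Sum>k<n. x' k * y' i * g k i) = evf y (sfp n x i)" for i
  by (simp add: evf_sfp x'_def y'_def g_def mult_ac)
 have px: "x' i ^ rho n j = t j * fps_const (x i) ^ rho n j" for i j by (simp add: x'_def t_def power_mult_distrib mult.commute)
 let ?T = "\<Prod>i<n. t i"
 have T0: "?T \<noteq> 0" by (simp add: t_def)
 define A where "A = dt n (\<lambda>i j. fps_const (x i) ^ rho n j * (c + of_nat (rho n j) + evf x (sfp n y i)))"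
 define B where "B = dt n (\<lambda>i j. fps_const (y i) ^ rho n j * (c + of_nat (rho n j) + evf y (sfp n x i)))"
 have "fps_const (eval_pol (vand n) y) * (?T * A) = ?T * fps_const (eval_pol (vand n) x) * B"
  using S unfolding sx sy px unfolding mult.assoc dt_scale_cols y'_def A_def B_def dt_vand_fps
  by (simp only: mult.assoc)
 then have "?T * (fps_const (eval_pol (vand n) y) * A) = ?T * (fps_const (eval_pol (vand n) x) * B)"
  by (simp add: mult_ac)
 then have AB: "fps_const (eval_pol (vand n) y) * A = fps_const (eval_pol (vand n) x) * B" using T0 by simp
 have K: "evf x (KF n kap y) = evf y (KF n kap x)" by (rule fps_ext) (simp add: evf_def Kpol_swap)
 have "fps_const (eval_pol (vand n) y) * numk n kap X x y = fps_const (of_nat kap ^ n) * ((fps_const (eval_pol (vand n) y) * A) * evf x (KF n kap y))"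
  unfolding numk_dt[OF kap] A_def c_def by (simp only: mult_ac)
 also have "\<dots> = fps_const (eval_pol (vand n) x) * numk n kap X y x"
  unfolding AB K numk_dt[OF kap] B_def c_def by (simp only: mult_ac)
 finally have "fps_nth (fps_const (eval_pol (vand n) y) * numk n kap X x y) d = fps_nth (fps_const (eval_pol (vand n) x) * numk n kap X y x) d"
  by simp
 then show ?thesis by (simp add: numk_def)
qed

section \<open>First order operators and the kernel\<close>

lemma partial_deriv_Kpol:
 assumes "i < n"
 shows "partial_deriv i (Kpol n kap d y) =
  (\<Sum>r\<in>{1..d}. const_pol (of_nat kap * eval_pol (ppow n r) y) * var i ^ (r - 1) * Kpol n kap (d - r) y)"
proof -
 have "var i * partial_deriv i (Kpol n kap d y) = var i *
  (\<Sum>r\<in>{1..d}. const_pol (of_nat kap * eval_pol (ppow n r) y) * var i ^ (r - 1) * Kpol n kap (d - r) y)"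
  unfolding theta_eq theta_Kpol[OF assms] sum_distrib_left
 proof (intro sum.cong refl)
  fix r assume "r \<in> {1..d}"
  then have "var i ^ r = var i * var i ^ (r - 1)" by (cases r) auto
  then show "const_pol (of_nat kap * eval_pol (ppow n r) y) * var i ^ r * Kpol n kap (d - r) y =
   var i * (const_pol (of_nat kap * eval_pol (ppow n r) y) * var i ^ (r - 1) * Kpol n kap (d - r) y)"
   by (simp add: mult_ac)
 qed
 then show ?thesis by simp
qed

text \<open>
 Both sides are
 \<open>\<kappa> \<Sum>\<^sub>r p\<^sub>r(x) p\<^bsub>r+1\<^esub>(y) K\<^bsub>d-r\<^esub>\<close>;
 on the right the two constants \<open>(n - 1) \<kappa>\<close> and \<open>\<kappa>\<close> add up
 to the term \<open>r = 0\<close>, where \<open>p\<^sub>0 = n\<close>.\<close>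

lemma kernel_lowering:
 assumes "n \<ge> 1"
 shows "eval_pol (E0 n (Kpol n kap (Suc d) y)) x =
  eval_pol (Aop n kap (Kpol n kap d x) + const_pol (of_nat kap) * (psum1 n * Kpol n kap d x)) y"
proof -
 let ?p = "\<lambda>r x. \<Sum>i<n. x i ^ r :: complex"
 let ?K = "\<lambda>d. eval_pol (Kpol n kap d y) x"
 have pp: "eval_pol (ppow n r) y = ?p r y" for r y by (simp add: ppow_def)
 have "eval_pol (E0 n (Kpol n kap (Suc d) y)) x = (\<Sum>i<n. \<Sum>r\<in>{1..Suc d}. of_nat kap * ?p r y * x i ^ (r - 1) * ?K (Suc d - r))"
  unfolding E0_def eval_sum by (intro sum.cong refl) (simp add: partial_deriv_Kpol pp)
 also have "\<dots> = (\<Sum>r\<in>{1..Suc d}. of_nat kap * ?p r y * ?p (r - 1) x * ?K (Suc d - r))"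
  by (subst sum.swap) (simp add: sum_distrib_left sum_distrib_right mult_ac)
 also have "\<dots> = (\<Sum>r\<in>{0..d}. of_nat kap * ?p (Suc r) y * ?p r x * ?K (d - r))"
  by (rule sum.reindex_bij_witness[of _ Suc "\<lambda>r. r - 1"]) auto
 also have "\<dots> = of_nat kap * ?p 1 y * of_nat n * ?K d + (\<Sum>r\<in>{1..d}. of_nat kap * ?p (Suc r) y * ?p r x * ?K (d - r))"
  by (subst sum.atLeast_Suc_atMost) auto
 finally have L: "eval_pol (E0 n (Kpol n kap (Suc d) y)) x =
  of_nat kap * ?p 1 y * of_nat n * ?K d + (\<Sum>r\<in>{1..d}. of_nat kap * ?p (Suc r) y * ?p r x * ?K (d - r))" .
 have "eval_pol (Aop n kap (Kpol n kap d x)) y = (\<Sum>k<n. y k * (of_nat ((n - 1) * kap) * ?K d + eval_pol (theta k (Kpol n kap d x)) y))"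
  by (simp add: Aop_def Kpol_swap[of n kap d x y])
 also have "\<dots> = of_nat ((n - 1) * kap) * ?p 1 y * ?K d + (\<Sum>k<n. \<Sum>r\<in>{1..d}. of_nat kap * ?p r x * y k ^ Suc r * ?K (d - r))"
  unfolding sum_distrib_left sum_distrib_right sum.distrib[symmetric]
  by (intro sum.cong refl) (simp add: theta_Kpol pp distrib_left sum_distrib_left mult_ac Kpol_swap[of n kap _ x y])
 also have "(\<Sum>k<n. \<Sum>r\<in>{1..d}. of_nat kap * ?p r x * y k ^ Suc r * ?K (d - r)) =
   (\<Sum>r\<in>{1..d}. of_nat kap * ?p (Suc r) y * ?p r x * ?K (d - r))"
  by (subst sum.swap) (simp add: sum_distrib_left sum_distrib_right mult_ac)
 finally have A: "eval_pol (Aop n kap (Kpol n kap d x)) y = of_nat ((n - 1) * kap) * ?p 1 y * ?K d +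
   (\<Sum>r\<in>{1..d}. of_nat kap * ?p (Suc r) y * ?p r x * ?K (d - r))" .
 have "eval_pol (psum1 n) y = ?p 1 y" by (simp add: psum1_def)
 then show ?thesis unfolding eval_add A L using assms
  by (simp add: Kpol_swap[of n kap d x y] of_nat_diff algebra_simps)
qed

section \<open>The kernel as a product\<close>

lemma euler_Kpol: "(\<Sum>i<n. theta i (Kpol n kap d y)) = of_nat d * Kpol n kap d y"
proof -
 have h: "(\<Sum>i<n. theta i (psp n lam)) = of_nat d * psp n lam" if "lam \<in> PD d" for lam
 proof (rule poly_mapping_eqI)
  fix m
  have hm: "homog d (power_sum_part lam)" using homog_psp[of lam] that by (auto simp: PD_def)
  have l: "lkp (of_nat k * g) m = of_nat k * lkp (g::mpol) m" for k g by (simp flip: const_pol_of_nat)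
  have "(\<Sum>i<n. of_nat (lkp m i)) * lkp (psp n lam) m = of_nat d * lkp (psp n lam) m"
  proof (cases "lkp (psp n lam) m = 0")
   case False
   then have "kys m \<subseteq> {..<n}" "deg m = d" using hm by (auto simp: psp_def lookup_restrict_vars[OF hm] homog_def split: if_splits)
   then have "(\<Sum>i<n. lkp m i) = d" using deg_superset[of "{..<n}" m] by simp
   then show ?thesis by (simp flip: of_nat_sum)
  qed simp
  then show "lkp (\<Sum>i<n. theta i (psp n lam)) m = lkp (of_nat d * psp n lam) m"
   by (simp add: lookup_sum theta_def l sum_distrib_right)
 qed
 show ?thesis unfolding Kpol_def theta_sum theta_cmult
  by (subst sum.swap) (simp add: sum_distrib_left[symmetric] h, simp add: sum_distrib_left mult_ac)
qed

lemma Kpol_0: "Kpol n kap 0 y = 1"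
proof -
 have "MS 0 = {{#}}" by (auto simp: MS_def) (metis multi_nonempty_split union_single_eq_member sum_mset_0_iff)
 then show ?thesis by (simp add: Kpol_MS PM_def WM_def zM_def)
qed

lemma fps_prod_nth_zero: "fps_nth (prod f S) 0 = (\<Prod>s\<in>S. fps_nth (f s :: complex fps) 0)"
 by (induction S rule: infinite_finite_induct) auto

text \<open>
 Both factors satisfy first order differential equations in \<open>t\<close> with opposite
 logarithmic derivatives.\<close>

theorem kernel_product:
 "Abs_fps (\<lambda>d. eval_pol (Kpol n kap d y) x) * (\<Prod>i<n. \<Prod>j<n. (1 - fps_const (x i * y j) * fps_X) ^ kap) = 1"
proof -
 define k where "k = Abs_fps (\<lambda>d. eval_pol (Kpol n kap d y) x)"
 define S where "S = (\<Sum>i<n. evf x (sfp n y i))"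
 have Xd: "fps_X * fps_deriv k = fps_const (of_nat kap) * (S * k)"
 proof -
  have "fps_X * fps_deriv k = (\<Sum>i<n. evf x (fmp (theta i) (KF n kap y)))"
  proof (rule fps_ext)
   fix d
   have "fps_nth (fps_X * fps_deriv k) d = of_nat d * eval_pol (Kpol n kap d y) x"
    by (cases d) (auto simp: k_def)
   also have "of_nat d * eval_pol (Kpol n kap d y) x = eval_pol (const_pol (of_nat d) * Kpol n kap d y) x" by simp
   also have "const_pol (of_nat d) * Kpol n kap d y = (\<Sum>i<n. theta i (Kpol n kap d y))"
    by (simp add: euler_Kpol const_pol_of_nat)
   finally show "fps_nth (fps_X * fps_deriv k) d = fps_nth (\<Sum>i<n. evf x (fmp (theta i) (KF n kap y))) d"
    by (simp add: fps_sum_nth evf_def)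
  qed
  also have "\<dots> = (\<Sum>i<n. fps_const (of_nat kap) * (evf x (sfp n y i) * k))"
  proof (intro sum.cong refl)
   fix i assume "i \<in> {..<n}"
   have "evf x (KF n kap y) = k" by (rule fps_ext) (simp add: evf_def k_def)
   then show "evf x (fmp (theta i) (KF n kap y)) = fps_const (of_nat kap) * (evf x (sfp n y i) * k)"
    using \<open>i \<in> {..<n}\<close> by (simp add: theta_KF evf_mult evf_const mult.assoc)
  qed
  finally show ?thesis by (simp add: S_def sum_distrib_left sum_distrib_right)
 qed
 define G where "G = (\<Prod>i<n. \<Prod>j<n. (1 - fps_const (x i * y j) * fps_X) ^ kap)"
 have XG: "fps_X * fps_deriv (\<Prod>s\<in>T. (1 - fps_const (a s) * fps_X) ^ kap) =
   - fps_const (of_nat kap) * (\<Sum>s\<in>T. fps_const (a s) * fps_X * geom (a s)) * (\<Prod>s\<in>T. (1 - fps_const (a s) * fps_X) ^ kap)"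
  if "finite T" for T :: "(nat \<times> nat) set" and a
  using that
 proof (induction T rule: finite_induct)
  case (insert s T)
  let ?f = "1 - fps_const (a s) * fps_X"
  have one: "fps_X * fps_deriv (?f ^ kap) = - fps_const (of_nat kap) * (fps_const (a s) * fps_X * geom (a s)) * ?f ^ kap"
  proof (cases kap)
   case (Suc k')
   have "fps_const (of_nat kap) * (fps_const (a s) * fps_X * geom (a s)) * ?f ^ kap =
    fps_const (of_nat kap) * (fps_const (a s) * fps_X * (?f * geom (a s))) * ?f ^ k'" by (simp add: Suc mult_ac)
   also have "\<dots> = fps_const (of_nat kap) * (fps_const (a s) * fps_X) * ?f ^ k'" by (simp add: geom)
   finally have e: "fps_const (of_nat kap) * (fps_const (a s) * fps_X * geom (a s)) * ?f ^ kap =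
    fps_const (of_nat kap) * (fps_const (a s) * fps_X) * ?f ^ k'" .
   have df: "fps_deriv ?f = - fps_const (a s)" by simp
   have "fps_X * fps_deriv (?f ^ kap) = - (fps_const (of_nat kap) * (fps_const (a s) * fps_X) * ?f ^ k')"
    unfolding fps_deriv_power df Suc diff_Suc_1 mult_minus_left mult_minus_right by (simp only: mult_ac)
   then show ?thesis unfolding mult_minus_left e .
  qed simp
  show ?case using insert.hyps insert.IH one
   by (simp add: distrib_left distrib_right mult.assoc)
 qed simp
 have Gp: "G = (\<Prod>s\<in>{..<n}\<times>{..<n}. (1 - fps_const ((\<lambda>(i,j). x i * y j) s) * fps_X) ^ kap)"
  by (simp add: G_def prod.cartesian_product case_prod_beta)
 have Sp: "S = (\<Sum>s\<in>{..<n}\<times>{..<n}. fps_const ((\<lambda>(i,j). x i * y j) s) * fps_X * geom ((\<lambda>(i,j). x i * y j) s))"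
  unfolding S_def evf_sfp sum.cartesian_product
  by (intro sum.cong refl) (auto simp: mult_ac simp flip: fps_const_mult)
 have XdG: "fps_X * fps_deriv G = - fps_const (of_nat kap) * S * G"
  unfolding Gp Sp by (rule XG) simp
 have "fps_X * fps_deriv (k * G) = (fps_X * fps_deriv k) * G + k * (fps_X * fps_deriv G)"
  by (simp add: algebra_simps)
 also have "\<dots> = 0" unfolding Xd XdG by (simp only: mult_minus_left mult_minus_right mult_ac add.right_inverse)
 finally have "fps_X * fps_deriv (k * G) = 0" .
 then have "fps_deriv (k * G) = 0" by (simp only: mult_eq_0_iff) simp
 then have "k * G = fps_const (fps_nth (k * G) 0)" by (simp only: fps_deriv_eq_0_iff)
 moreover have "fps_nth (k * G) 0 = 1"
 proof -
  have "fps_nth G 0 = 1" by (simp add: G_def fps_prod_nth_zero fps_nth_power_0)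
  then show ?thesis by (simp add: k_def Kpol_0)
 qed
 ultimately show ?thesis by (simp add: k_def G_def)
qed

section \<open>Spectrum of the Sekiguchi operators\<close>

text \<open>
 The numbers \<open>a\<^sub>i = \<lambda>\<^sub>i + \<kappa> \<rho>\<^sub>i\<close>; they are
 strictly decreasing, so the set of them determines the partition.\<close>

definition av :: "nat \<Rightarrow> nat \<Rightarrow> natfun \<Rightarrow> nat \<Rightarrow> nat" where
 "av n kap lam i = rho n i * kap + lam i"

definition dl :: "nat \<Rightarrow> nat \<Rightarrow> complex \<Rightarrow> natfun \<Rightarrow> complex" where
 "dl n kap X lam = (\<Prod>i<n. X + of_nat (av n kap lam i))"

lemma sekq_eigenvalue: "sekq n X (shv n kap id (pm n lam)) = dl n kap X lam"
 unfolding sekq_def dl_def by (intro prod.cong refl) (simp add: shv_def av_def)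

lemma av_strict: assumes "kap > 0" "lam \<in> Par n" "i < j" "j < n" shows "av n kap lam j < av n kap lam i"
proof -
 have "rho n j < rho n i" using assms by (simp add: rho_def)
 then have "rho n j * kap < rho n i * kap" using assms by simp
 moreover have "lam j \<le> lam i" using assms by (auto simp: Par_def partition_antimono)
 ultimately show ?thesis unfolding av_def by linarith
qed

lemma strict_dec_image_unique:
 fixes f g :: natfun
 assumes f: "\<And>i j. i < j \<Longrightarrow> j < n \<Longrightarrow> f j < f i" and g: "\<And>i j. i < j \<Longrightarrow> j < n \<Longrightarrow> g j < g i"
  and im: "f ` {..<n} = g ` {..<n}" and i: "i < n"
 shows "f i = g i"
proof -
 have rank: "card {v\<in>h ` {..<n}. v > h j} = j" if h: "\<And>i j. i < j \<Longrightarrow> j < n \<Longrightarrow> h j < h i" and j: "j < n"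
  for h :: natfun and j
 proof -
  have "h k > h j \<longleftrightarrow> k < j" if "k < n" for k using h[of j k] h[of k j] that j by (metis linorder_neqE_nat order_less_asym)
  then have "{v\<in>h ` {..<n}. v > h j} = h ` {..<j}" using j by force
  moreover have "inj_on h {..<j}"
   by (rule linorder_inj_onI) (use h j in \<open>force+\<close>)
  ultimately show ?thesis by (simp add: card_image)
 qed
 obtain j where j: "j < n" "f i = g j" using i im by blast
 have "i = j" using rank[of f i, OF f i] rank[of g j, OF g j(1)] j(2) im by metis
 then show ?thesis using j by simp
qed

definition dpoly :: "nat \<Rightarrow> nat \<Rightarrow> natfun \<Rightarrow> complex poly" where
 "dpoly n kap lam = (\<Prod>i<n. [:of_nat (av n kap lam i), 1:])"

lemma poly_dpoly: "poly (dpoly n kap lam) X = dl n kap X lam"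
 by (simp add: dpoly_def dl_def poly_prod add.commute)

lemma dl_zero: "dl n kap X lam = 0 \<longleftrightarrow> (\<exists>i<n. X = - of_nat (av n kap lam i))"
 by (auto simp: dl_def eq_neg_iff_add_eq_0)

lemma dpoly_inj:
 assumes "kap > 0" "lam \<in> Par n" "mu \<in> Par n" "dpoly n kap lam = dpoly n kap mu"
 shows "lam = mu"
proof (rule Par_eqI[OF assms(2,3)])
 fix i assume i: "i < n"
 have z: "(\<exists>i<n. X = - of_nat (av n kap lam i)) \<longleftrightarrow> (\<exists>i<n. X = - of_nat (av n kap mu i))" for X :: complex
  using assms(4) unfolding dl_zero[symmetric] poly_dpoly[symmetric] by simp
 have "av n kap lam ` {..<n} = av n kap mu ` {..<n}"
 proof (intro Set.set_eqI)
  fix v show "v \<in> av n kap lam ` {..<n} \<longleftrightarrow> v \<in> av n kap mu ` {..<n}"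
   using z[of "- of_nat v"] by (auto simp: image_iff)
 qed
 then have "av n kap lam i = av n kap mu i"
  using av_strict[OF assms(1,2)] av_strict[OF assms(1,3)] i by (intro strict_dec_image_unique[of n]) auto
 then show "lam i = mu i" by (simp add: av_def)
qed

lemma separating_point:
 assumes "kap > 0" "finite I" "I \<subseteq> Par n"
 obtains X where "\<And>lam mu. lam \<in> I \<Longrightarrow> mu \<in> I \<Longrightarrow> dl n kap X lam = dl n kap X mu \<Longrightarrow> lam = mu"
proof -
 define B where "B = (\<Union>lam\<in>I. \<Union>mu\<in>I - {lam}. {X. poly (dpoly n kap lam - dpoly n kap mu) X = 0})"
 have "finite B" unfolding B_def
 proof (intro finite_UN_I assms finite_Diff poly_roots_finite)
  fix lam mu assume "lam \<in> I" "mu \<in> I - {lam}"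
  then show "dpoly n kap lam - dpoly n kap mu \<noteq> 0" using dpoly_inj[OF assms(1), of lam n mu] assms(3) by auto
 qed
 then obtain X where "X \<notin> B" using infinite_UNIV_char_0 ex_new_if_finite by blast
 then show thesis by (intro that[of X]) (auto simp: B_def poly_dpoly)
qed

section \<open>Bilinear identities\<close>

definition lin_indep :: "'i set \<Rightarrow> ('i \<Rightarrow> mpol) \<Rightarrow> bool" where
 "lin_indep I B \<longleftrightarrow> (\<forall>c. (\<Sum>i\<in>I. const_pol (c i) * B i) = 0 \<longrightarrow> (\<forall>i\<in>I. c i = 0))"

lemma lin_indep_eq:
 assumes "lin_indep I B" "(\<Sum>i\<in>I. const_pol (c i) * B i) = (\<Sum>i\<in>I. const_pol (c' i) * B i)" "i \<in> I"
 shows "c i = c' i"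
proof -
 have "(\<Sum>i\<in>I. const_pol (c i - c' i) * B i) = 0"
  using assms(2) by (simp add: const_pol_diff left_diff_distrib sum_subtractf)
 then show ?thesis using assms(1,3) unfolding lin_indep_def by fastforce
qed

text \<open>
 A bilinear combination of two independent families vanishes if it vanishes where two given nonzero
 polynomials do not; \<open>x\<close> and \<open>y\<close> are treated one after the other.\<close>

lemma bilinear_zero:
 assumes liB: "lin_indep I B" and liC: "lin_indep J C" and V: "V \<noteq> 0" and W: "W \<noteq> 0"
  and z: "\<And>x y. eval_pol V x * eval_pol W y * (\<Sum>i\<in>I. \<Sum>j\<in>J. t i j * eval_pol (B i) x * eval_pol (C j) y) = 0"
  and ij: "i \<in> I" "j \<in> J"
 shows "t i j = 0"
proof -
 have "eval_pol W y * (\<Sum>j\<in>J. t i j * eval_pol (C j) y) = 0" for y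
 proof -
  define c where "c i = eval_pol W y * (\<Sum>j\<in>J. t i j * eval_pol (C j) y)" for i
  have "V * (\<Sum>i\<in>I. const_pol (c i) * B i) = 0"
  proof (rule eval_zero)
   fix x
   have "eval_pol (V * (\<Sum>i\<in>I. const_pol (c i) * B i)) x =
    eval_pol V x * eval_pol W y * (\<Sum>i\<in>I. \<Sum>j\<in>J. t i j * eval_pol (B i) x * eval_pol (C j) y)"
    by (simp add: c_def sum_distrib_left sum_distrib_right mult_ac)
   then show "eval_pol (V * (\<Sum>i\<in>I. const_pol (c i) * B i)) x = 0" using z by simp
  qed
  then have "(\<Sum>i\<in>I. const_pol (c i) * B i) = 0" using V by simp
  then have "c i = 0" using liB ij(1) unfolding lin_indep_def by blast
  then show ?thesis by (simp add: c_def)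
 qed
 then have "W * (\<Sum>j\<in>J. const_pol (t i j) * C j) = 0" by (intro eval_zero) simp
 then have "(\<Sum>j\<in>J. const_pol (t i j) * C j) = 0" using W by simp
 then show ?thesis using liC ij(2) unfolding lin_indep_def by blast
qed

lemma eval_vand_zero:
 assumes "i < n" "j < n" "i \<noteq> j" "y i = y j" shows "eval_pol (vand n) y = 0"
proof -
 have "(\<Prod>j<n. \<Prod>i<j. y i - y j) = 0" if "a < b" "b < n" "y a = y b" for a b
  by (rule prod_zero[OF finite_lessThan], rule bexI[of _ b], rule prod_zero[OF finite_lessThan], rule bexI[of _ a]) (use that in auto)
 then have "(\<Prod>j<n. \<Prod>i<j. y i - y j) = 0" using assms by (metis linorder_neqE_nat)
 then show ?thesis by (simp add: vand_def)
qed

text \<open>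
 If the kernel is diagonal in a basis, then \<open>D(X)\<close> is self-adjoint for the bilinear form
 with this kernel: expand \<open>kernel_symmetry\<close> in the basis and compare coefficients.\<close>

lemma kernel_matrix_symmetric:
 assumes kap: "kap > 0" and li: "lin_indep I B" and fin: "finite I" and B: "\<And>lam. lam \<in> I \<Longrightarrow> B lam \<in> sympol n"
  and K: "\<And>y. Kpol n kap d y = (\<Sum>lam\<in>I. const_pol (k lam * eval_pol (B lam) y) * B lam)"
  and M: "\<And>lam. lam \<in> I \<Longrightarrow> quot_op n kap (sekq n X) (B lam) = (\<Sum>mu\<in>I. const_pol (M lam mu) * B mu)"
  and I: "lam \<in> I" "mu \<in> I"
 shows "k lam * M lam mu = k mu * M mu lam"
proof -
 let ?D = "quot_op n kap (sekq n X)"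
 have DK: "?D (Kpol n kap d y) = (\<Sum>lam\<in>I. const_pol (k lam * eval_pol (B lam) y) * ?D (B lam))" for y
  unfolding K by (rule quot_op_sum[OF B qsym_sekq])
 have eDK: "eval_pol (?D (Kpol n kap d y)) x = (\<Sum>lam\<in>I. \<Sum>mu\<in>I. k lam * M lam mu * eval_pol (B mu) x * eval_pol (B lam) y)" for x y
  unfolding DK by (simp add: M sum_distrib_left mult_ac)
 define t where "t mu lam = k lam * M lam mu - k mu * M mu lam" for lam mu
 have T: "eval_pol (?D (Kpol n kap d y)) x - eval_pol (?D (Kpol n kap d x)) y =
   (\<Sum>mu\<in>I. \<Sum>lam\<in>I. t mu lam * eval_pol (B mu) x * eval_pol (B lam) y)" for x y
 proof -
  have 1: "eval_pol (?D (Kpol n kap d y)) x = (\<Sum>mu\<in>I. \<Sum>lam\<in>I. k lam * M lam mu * eval_pol (B mu) x * eval_pol (B lam) y)"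
   unfolding eDK by (rule sum.swap)
  have 2: "eval_pol (?D (Kpol n kap d x)) y = (\<Sum>mu\<in>I. \<Sum>lam\<in>I. k mu * M mu lam * eval_pol (B mu) x * eval_pol (B lam) y)"
   unfolding eDK by (simp add: mult_ac)
  show ?thesis unfolding 1 2 sum_subtractf[symmetric] t_def by (simp add: left_diff_distrib)
 qed
 have "t mu lam = 0"
 \<comment> \<open>
  the two polynomials vanish where coordinates of \<open>y\<close> are zero or coincide, which \<open>kernel_symmetry\<close> excludes\<close>
 proof (rule bilinear_zero[OF li li, of "vand n" "vand n * en n", OF _ _ _ I(2,1)])
  fix x y
  show "eval_pol (vand n) x * eval_pol (vand n * en n) y * (\<Sum>mu\<in>I. \<Sum>lam\<in>I. t mu lam * eval_pol (B mu) x * eval_pol (B lam) y) = 0"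
  proof (cases "eval_pol (vand n * en n) y = 0")
   case False
   then have v: "eval_pol (vand n) y \<noteq> 0" and e: "eval_pol (en n) y \<noteq> 0" by auto
   have nz: "y i \<noteq> 0" if "i < n" for i
    using e that by (auto simp: en_def mon_prod)
   have dist: "y i \<noteq> y j" if "i < n" "j < n" "i \<noteq> j" for i j
   proof
    assume eq: "y i = y j"
    have "eval_pol (vand n) y = 0" by (rule eval_vand_zero[OF that eq])
    then show False using v by simp
   qed
   note ks = kernel_symmetry[where y = y and n = n, OF kap nz dist, where x = x and d = d and X = X]
   have num: "numer n kap (sekq n X) (Kpol n kap d y) = vand n * ?D (Kpol n kap d y)" for y
    using quot_op(1)[OF sympol_Kpol qsym_sekq] by simp
   have "eval_pol (vand n) x * eval_pol (vand n) y * (eval_pol (?D (Kpol n kap d y)) x - eval_pol (?D (Kpol n kap d x)) y) = 0"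
    using ks unfolding num by (simp add: algebra_simps)
   then show ?thesis unfolding T[symmetric] by auto
  qed simp
 qed auto
 then show ?thesis by (simp add: t_def)
qed

section \<open>Existence of the Jack family\<close>

lemma PD_Par: "lam \<in> PD d \<Longrightarrow> d \<le> n \<Longrightarrow> lam \<in> Par n"
 using part_length_le_size[of lam] by (auto simp: PD_def Par_def)

lemma homogeneous_tri:
 assumes "n \<ge> 1" "f \<in> sympol n" "\<And>lam. lam \<in> Par n \<Longrightarrow> lkp f (pm n lam) \<noteq> 0 \<Longrightarrow> part_size lam = d"
 shows "tri n (\<lambda>i. if i = 0 then d else 0) f"
proof (rule triI[OF assms(2)])
 fix mu assume mu: "mu \<in> Par n" "lkp f (pm n mu) \<noteq> 0"
 have s: "(\<Sum>i<n. mu i) = d" using assms(3)[OF mu] mu(1) part_size_sum[of mu n] by (simp add: Par_def)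
 have r: "(\<Sum>i<k. if i = 0 then d else 0) = (if k = 0 then 0 else d)" for k :: nat by simp
 show "dle n mu (\<lambda>i. if i = 0 then d else 0)"
  unfolding dle_def r
 proof (intro conjI allI impI)
  fix S assume S: "S \<subseteq> {..<n}"
  then have "finite S" by (rule finite_subset) simp
  moreover have "(\<Sum>i\<in>S. mu i) \<le> d" unfolding s[symmetric] using S by (intro sum_mono2) auto
  ultimately show "(\<Sum>i\<in>S. mu i) \<le> (if card S = 0 then 0 else d)" by (auto simp: card_eq_0_iff)
 qed (use s assms(1) in auto)
qed

lemma tri_homogeneous:
 assumes "n \<ge> 1" "tri n (\<lambda>i. if i = 0 then d else 0) f" "lam \<in> Par n" "lkp f (pm n lam) \<noteq> 0"
 shows "part_size lam = d"
proof -
 have "dle n lam (\<lambda>i. if i = 0 then d else 0)" using lookup_tri_dle assms(2,4) by blast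
 then have "(\<Sum>i<n. lam i) = (\<Sum>i<n. if i = 0 then d else 0)" by (simp add: dle_def)
 then show ?thesis using assms(1,3) part_size_sum[of lam n] by (simp add: Par_def)
qed

definition PDn :: "nat \<Rightarrow> nat \<Rightarrow> natfun set" where "PDn n d = Par n \<inter> PD d"

lemma downset_PDn: "downset n (PDn n d)"
 unfolding downset_def PDn_def
 using finite_PD[of d] dle_size[of _ n] by (auto simp: PD_def Par_def)

lemma lookup_psp: assumes "is_partition lam" shows "lkp (psp n lam) m = (if kys m \<subseteq> {..<n} then power_sum_part lam m else 0)"
 unfolding psp_def by (rule lookup_restrict_vars[OF homog_psp[OF assms]])

lemma homog_lookup_size:
 assumes "homog d f" "lam \<in> Par n" "lkp (restrict_vars n f) (pm n lam) \<noteq> 0"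
 shows "part_size lam = d"
 using assms part_size_sum[of lam n] by (auto simp: lookup_restrict_vars[OF assms(1)] homog_def deg_pm Par_def split: if_splits)

lemma psp_span:
 assumes "f \<in> sympol n" "\<And>lam. lam \<in> Par n \<Longrightarrow> lkp f (pm n lam) \<noteq> 0 \<Longrightarrow> part_size lam = d"
 shows "\<exists>c. f = (\<Sum>mu\<in>PD d. const_pol (c mu) * psp n mu)"
proof -
 have "\<exists>c. f = (\<Sum>lam\<in>PDn n d. const_pol (c lam) * restrict_vars n (monomial_sf lam))"
  by (rule unitri_span[OF downset_PDn _ assms(1)]) (use assms(2) in \<open>auto simp: PDn_def PD_def Par_def intro: unitri_monomial\<close>)
 then obtain c where c: "f = (\<Sum>lam\<in>PDn n d. const_pol (c lam) * restrict_vars n (monomial_sf lam))" by blast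
 have "\<forall>lam\<in>PD d. \<exists>b. monomial_sf lam = (\<lambda>m. \<Sum>mu\<in>PD d. b mu * power_sum_part mu m)" using monomial_psum by blast
 then obtain b where b: "\<And>lam. lam \<in> PD d \<Longrightarrow> monomial_sf lam = (\<lambda>m. \<Sum>mu\<in>PD d. b lam mu * power_sum_part mu m)"
  by metis
 have rm: "restrict_vars n (monomial_sf lam) = (\<Sum>mu\<in>PD d. const_pol (b lam mu) * psp n mu)" if "lam \<in> PD d" for lam
 proof (rule poly_mapping_eqI)
  fix m
  have p: "is_partition lam" using that by (simp add: PD_def)
  have "(\<Sum>mu\<in>PD d. b lam mu * lkp (psp n mu) m) = (\<Sum>mu\<in>PD d. b lam mu * (if kys m \<subseteq> {..<n} then power_sum_part mu m else 0))"
   by (intro sum.cong refl) (simp add: lookup_psp PD_def)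
  then show "lkp (restrict_vars n (monomial_sf lam)) m = lkp (\<Sum>mu\<in>PD d. const_pol (b lam mu) * psp n mu) m"
   unfolding lookup_restrict_vars[OF homog_monomial_sf[OF p]] by (simp add: lookup_sum b[OF that])
 qed
 have "f = (\<Sum>lam\<in>PDn n d. \<Sum>mu\<in>PD d. const_pol (c lam * b lam mu) * psp n mu)"
  unfolding c by (intro sum.cong refl) (simp add: rm PDn_def sum_distrib_left const_pol_mult mult.assoc)
 also have "\<dots> = (\<Sum>mu\<in>PD d. const_pol (\<Sum>lam\<in>PDn n d. c lam * b lam mu) * psp n mu)"
  by (subst sum.swap) (simp add: const_pol_sum sum_distrib_right)
 finally show ?thesis by (intro exI[of _ "\<lambda>mu. \<Sum>lam\<in>PDn n d. c lam * b lam mu"])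
qed

lemma psp_lin_indep:
 assumes "d \<le> n" shows "lin_indep (PD d) (psp n)"
 unfolding lin_indep_def
proof (intro allI impI ballI)
 fix c lam assume z: "(\<Sum>lam\<in>PD d. const_pol (c lam) * psp n lam) = 0" and lam: "lam \<in> PD d"
 define c' where "c' lam = (if lam \<in> PD d then c lam else 0)" for lam
 have sub: "{lam. c' lam \<noteq> 0} \<subseteq> PD d" by (auto simp: c'_def split: if_splits)
 have eq: "(\<Sum>lam | c' lam \<noteq> 0. c' lam * power_sum_part lam m) = (\<Sum>lam\<in>PD d. c lam * power_sum_part lam m)" for m
  by (subst sum.mono_neutral_left[OF finite_PD sub]) (auto simp: c'_def)
 have "c' = (\<lambda>_. 0)"
 proof (rule psum_independent)
  show "finite {lam. c' lam \<noteq> 0}" using sub finite_PD finite_subset by blast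
  show "is_partition lam" if "c' lam \<noteq> 0" for lam using that by (auto simp: c'_def PD_def split: if_splits)
  fix m
  obtain mu where mu: "is_partition mu" "parts m = pmset mu" using expo_partition by blast
  show "(\<Sum>lam | c' lam \<noteq> 0. c' lam * power_sum_part lam m) = 0"
  proof (cases "mu \<in> PD d")
   case True
   then have muP: "mu \<in> Par n" using PD_Par assms by blast
   have "(\<Sum>lam\<in>PD d. c lam * power_sum_part lam m) = (\<Sum>lam\<in>PD d. c lam * lkp (psp n lam) (pm n mu))"
   proof (intro sum.cong refl)
    fix lam assume "lam \<in> PD d"
    then have "is_partition lam" by (simp add: PD_def)
    then show "c lam * power_sum_part lam m = c lam * lkp (psp n lam) (pm n mu)"
     using psp_symmetric mu(2) parts_pm[OF muP] by (simp add: lookup_psp keys_pm sf_symmetric_def)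
   qed
   also have "\<dots> = 0" using arg_cong[OF z, of "\<lambda>p. lkp p (pm n mu)"] by (simp add: lookup_sum)
   finally show ?thesis unfolding eq .
  next
   case False
   then have "power_sum_part lam m = 0" if "lam \<in> PD d" for lam
    using psp_nonzero(1)[OF _ mu(1,2)] that mu(1) by (auto simp: PD_def)
   then show ?thesis unfolding eq by simp
  qed
 qed
 then show "c lam = 0" using lam by (metis c'_def)
qed

lemma jack_scalar_PD:
 assumes "\<And>lam. psum_coeff f lam \<noteq> 0 \<Longrightarrow> lam \<in> PD d"
 shows "jack_scalar kap f g = (\<Sum>lam\<in>PD d. psum_coeff f lam * psum_coeff g lam / wgt kap lam)"
proof -
 have "jack_scalar kap f g = (\<Sum>lam | psum_coeff f lam \<noteq> 0. psum_coeff f lam * psum_coeff g lam / wgt kap lam)"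
  unfolding jack_scalar_def wgt_def by (intro sum.cong refl) simp
 also have "\<dots> = (\<Sum>lam\<in>PD d. psum_coeff f lam * psum_coeff g lam / wgt kap lam)"
  by (rule sum.mono_neutral_left[OF finite_PD]) (use assms in auto)
 finally show ?thesis .
qed

lemma wgt_nonzero: assumes "kap > 0" "is_partition lam" shows "wgt kap lam \<noteq> 0"
proof -
 have "0 \<notin># pmset lam" using assms(2) by (auto simp: pmset_def is_partition_def)
 then show ?thesis using assms zM_pos[of "pmset lam"] by (simp add: wgt_WM WM_def)
qed

text \<open>
 Eigenvectors of \<open>D(X)\<close> at a point \<open>X\<close> that separates the eigenvalues, in
 so many variables that power sums of the given degree are independent.  They are orthogonal because
 \<open>D(X)\<close> is self-adjoint for the power sum scalar product.\<close>

lemma jack_family_exists: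
 assumes kap: "kap > 0" shows "\<exists>P. is_jack_family kap P"
proof -
 \<comment> \<open>
  enough variables for the power sums of degree \<open>d\<close> to be independent, and at least one\<close>
 define N where "N d = Suc d" for d :: nat
 have "\<exists>X. \<forall>lam\<in>PD d. \<forall>mu\<in>PD d. dl (N d) kap X lam = dl (N d) kap X mu \<longrightarrow> lam = mu" for d
 proof -
  have "PD d \<subseteq> Par (N d)" using PD_Par by (auto simp: N_def)
  from separating_point[OF kap finite_PD this] show ?thesis by metis
 qed
 then obtain X where X: "\<And>d lam mu. lam \<in> PD d \<Longrightarrow> mu \<in> PD d \<Longrightarrow> dl (N d) kap (X d) lam = dl (N d) kap (X d) mu \<Longrightarrow> lam = mu"
  by metis
 let ?D = "\<lambda>d. quot_op (N d) kap (sekq (N d) (X d))"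
 have "\<exists>f. unitri (N d) lam f \<and> ?D d f = const_pol (dl (N d) kap (X d) lam) * f" if "lam \<in> PD d" for d lam
 proof -
  have "\<exists>f. unitri (N d) lam f \<and> ?D d f = const_pol (sekq (N d) (X d) (shv (N d) kap id (pm (N d) lam))) * f"
  proof (rule triangular_eigenvector[OF qsym_sekq, where d = d])
   show "lam \<in> Par (N d)" using that PD_Par by (auto simp: N_def)
   show "part_size lam = d" using that by (simp add: PD_def)
   show "\<exists>f. unitri (N d) lam f" if "lam \<in> Par (N d)" for lam using unitri_monomial[OF that] by blast
   fix lam mu assume "lam \<in> Par (N d)" "mu \<in> Par (N d)" "part_size lam = d" "part_size mu = d"
    "sekq (N d) (X d) (shv (N d) kap id (pm (N d) lam)) = sekq (N d) (X d) (shv (N d) kap id (pm (N d) mu))"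
   then show "lam = mu" unfolding sekq_eigenvalue by (intro X[of lam d mu]) (auto simp: PD_def Par_def)
  qed
  then show ?thesis unfolding sekq_eigenvalue .
 qed
 then have "\<forall>d. \<forall>lam\<in>PD d. \<exists>f. unitri (N d) lam f \<and> ?D d f = const_pol (dl (N d) kap (X d) lam) * f" by blast
 then have "\<exists>v. \<forall>lam\<in>PD d. unitri (N d) lam (v lam) \<and> ?D d (v lam) = const_pol (dl (N d) kap (X d) lam) * v lam" for d
  by (intro bchoice) blast
 then have "\<exists>v. \<forall>d. \<forall>lam\<in>PD d. unitri (N d) lam (v d lam) \<and> ?D d (v d lam) = const_pol (dl (N d) kap (X d) lam) * v d lam"
  by (intro choice) blast
 then obtain v where v: "\<And>d lam. lam \<in> PD d \<Longrightarrow> unitri (N d) lam (v d lam)"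
  and ev: "\<And>d lam. lam \<in> PD d \<Longrightarrow> ?D d (v d lam) = const_pol (dl (N d) kap (X d) lam) * v d lam"
  by blast
 define P :: "natfun \<Rightarrow> symfun" where
  "P lam m = (let d = part_size lam in \<Sum>mu\<in>PD d. lkp (v d lam) (pm (N d) mu) * monomial_sf mu m)" for lam m
 have hP: "homog d (P lam)" if "lam \<in> PD d" for lam d
  unfolding homog_def
 proof (intro allI impI)
  fix m assume nz: "P lam m \<noteq> 0"
  have ps: "part_size lam = d" using that by (simp add: PD_def)
  have "\<exists>mu\<in>PD d. monomial_sf mu m \<noteq> 0"
  proof (rule ccontr)
   assume "\<not> ?thesis"
   then have "P lam m = 0" unfolding P_def Let_def ps by (intro sum.neutral) auto
   then show False using nz by simp
  qed
  then obtain mu where "mu \<in> PD d" "monomial_sf mu m \<noteq> 0" by blast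
  then show "deg m = d" using homog_monomial_sf[of mu] by (auto simp: homog_def PD_def)
 qed
 have sP: "sf_symmetric (P lam)" for lam
  unfolding sf_symmetric_def
 proof (intro allI impI)
  fix m m' :: expo assume "parts m = parts m'"
  then have "monomial_sf mu m = monomial_sf mu m'" for mu using monomial_symmetric unfolding sf_symmetric_def by blast
  then show "P lam m = P lam m'" by (simp add: P_def)
 qed
 have rP: "restrict_vars (N d) (P lam) = v d lam" if "lam \<in> PD d" for lam d
 proof (rule sympol_eqI)
  show "restrict_vars (N d) (P lam) \<in> sympol (N d)" by (rule restrict_sympol[OF hP[OF that] sP])
  show vs: "v d lam \<in> sympol (N d)" using v[OF that] by (simp add: unitri_def tri_def)
  fix nu assume nu: "nu \<in> Par (N d)"
  have "P lam (pm (N d) nu) = (\<Sum>mu\<in>PD d. if mu = nu then lkp (v d lam) (pm (N d) nu) else 0)"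
   using that unfolding P_def Let_def PD_def mem_Collect_eq
   by (intro sum.cong) (auto simp: monomial_sf_pm[OF nu])
  also have "\<dots> = (if nu \<in> PD d then lkp (v d lam) (pm (N d) nu) else 0)" by (simp add: finite_PD)
  also have "\<dots> = lkp (v d lam) (pm (N d) nu)"
  proof (cases "lkp (v d lam) (pm (N d) nu) = 0")
   case False
   then have "dle (N d) nu lam" using v[OF that] lookup_tri_dle by (auto simp: unitri_def)
   then have "part_size nu = part_size lam" using dle_size[of lam "N d" nu] nu that PD_Par[OF that, of "N d"] by (simp add: N_def)
   then show ?thesis using nu that by (simp add: PD_def Par_def)
  qed simp
  finally show "lkp (restrict_vars (N d) (P lam)) (pm (N d) nu) = lkp (v d lam) (pm (N d) nu)"
   by (simp add: lookup_restrict_vars[OF hP[OF that]] keys_pm)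
 qed
 have form: "\<exists>u. P lam = (\<lambda>m. monomial_sf lam m + (\<Sum>\<mu> | dom_less \<mu> lam. u \<mu> * monomial_sf \<mu> m))" if lam: "is_partition lam" for lam
 proof -
  define d where "d = part_size lam"
  have lamd: "lam \<in> PD d" using lam by (simp add: PD_def d_def)
  define u where "u mu = lkp (v d lam) (pm (N d) mu)" for mu
  have sub: "insert lam {mu. dom_less mu lam} \<subseteq> PD d" using lamd by (auto simp: dom_less_def PD_def)
  have zero: "u mu = 0" if "mu \<in> PD d - insert lam {mu. dom_less mu lam}" for mu
  proof (rule ccontr)
   assume "u mu \<noteq> 0"
   then have "dle (N d) mu lam" using v[OF lamd] lookup_tri_dle by (auto simp: unitri_def u_def)
   then have "dom_less mu lam" using that PD_Par[of mu d "N d"] PD_Par[of lam d "N d"] lamd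
    by (intro dle_dom_less[of "N d"]) (auto simp: N_def)
   then show False using that by simp
  qed
  have "P lam m = monomial_sf lam m + (\<Sum>mu | dom_less mu lam. u mu * monomial_sf mu m)" for m
  proof -
   have "P lam m = (\<Sum>mu\<in>PD d. u mu * monomial_sf mu m)" by (simp add: P_def Let_def d_def u_def)
   also have "\<dots> = (\<Sum>mu\<in>insert lam {mu. dom_less mu lam}. u mu * monomial_sf mu m)"
    by (rule sum.mono_neutral_right[OF finite_PD sub]) (use zero in auto)
   also have "\<dots> = u lam * monomial_sf lam m + (\<Sum>mu | dom_less mu lam. u mu * monomial_sf mu m)"
    by (rule sum.insert) (use finite_subset[OF sub finite_PD] in \<open>auto simp: dom_less_def\<close>)
   also have "u lam = 1" using v[OF lamd] by (simp add: u_def unitri_def)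
   finally show ?thesis by simp
  qed
  then show ?thesis by blast
 qed
 have orth: "jack_scalar kap (P lam) (P mu) = 0" if part: "is_partition lam" "is_partition mu" and ne: "lam \<noteq> mu" for lam mu
 proof -
  define d where "d = part_size lam"
  define d' where "d' = part_size mu"
  have lamd: "lam \<in> PD d" and mud: "mu \<in> PD d'" using part by (auto simp: PD_def d_def d'_def)
  note cl = psum_coeff_symmetric[OF hP[OF lamd] sP] and cm = psum_coeff_symmetric[OF hP[OF mud] sP]
  have js: "jack_scalar kap (P lam) (P mu) = (\<Sum>nu\<in>PD d. psum_coeff (P lam) nu * psum_coeff (P mu) nu / wgt kap nu)"
   by (rule jack_scalar_PD) (rule cl(2))
  show ?thesis
  proof (cases "d = d'")
   case False
   have "psum_coeff (P mu) nu = 0" if "nu \<in> PD d" for nu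
    using cm(2)[of nu] that False by (auto simp: PD_def)
   then show ?thesis unfolding js by simp
  next
   case True
   then have mud: "mu \<in> PD d" using mud by simp
   let ?B = "psp (N d)"
   have dN: "d \<le> N d" "N d \<ge> 1" by (auto simp: N_def)
   note li = psp_lin_indep[OF dN(1)]
   have Bs: "?B nu \<in> sympol (N d)" if "nu \<in> PD d" for nu using that sympol_psp by (auto simp: PD_def)
   have "\<exists>c. ?D d (?B nu) = (\<Sum>rh\<in>PD d. const_pol (c rh) * ?B rh)" if nu: "nu \<in> PD d" for nu
   proof (rule psp_span)
    show "?D d (?B nu) \<in> sympol (N d)" by (rule quot_op(2)[OF Bs[OF nu] qsym_sekq])
    fix la assume la: "la \<in> Par (N d)" "lkp (?D d (?B nu)) (pm (N d) la) \<noteq> 0"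
    have "tri (N d) (\<lambda>i. if i = 0 then d else 0) (?B nu)"
    proof (rule homogeneous_tri[OF dN(2) Bs[OF nu]])
     fix rh assume "rh \<in> Par (N d)" "lkp (?B nu) (pm (N d) rh) \<noteq> 0"
     then show "part_size rh = d" using homog_lookup_size[OF homog_psp[of nu]] nu by (auto simp: PD_def psp_def)
    qed
    then show "part_size la = d" using tri_homogeneous[OF dN(2) quot_op_triangular[OF _ qsym_sekq] la] by blast
   qed
   then obtain M where M: "\<And>nu. nu \<in> PD d \<Longrightarrow> ?D d (?B nu) = (\<Sum>rh\<in>PD d. const_pol (M nu rh) * ?B rh)" by metis
   have sym: "wgt kap nu * M nu rh = wgt kap rh * M rh nu" if "nu \<in> PD d" "rh \<in> PD d" for nu rh
    by (rule kernel_matrix_symmetric[OF kap li finite_PD Bs _ M that]) (auto simp: Kpol_def)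
   have eig: "(\<Sum>nu\<in>PD d. psum_coeff (P la) nu * M nu rh) = dl (N d) kap (X d) la * psum_coeff (P la) rh"
    if la: "la \<in> PD d" and rh: "rh \<in> PD d" for la rh
   proof -
    let ?a = "psum_coeff (P la)"
    have va: "v d la = (\<Sum>nu\<in>PD d. const_pol (?a nu) * ?B nu)"
     unfolding rP[OF la, symmetric]
    proof (rule poly_mapping_eqI)
     fix m
     have "(\<Sum>nu\<in>PD d. ?a nu * lkp (?B nu) m) = (\<Sum>nu\<in>PD d. ?a nu * (if kys m \<subseteq> {..<N d} then power_sum_part nu m else 0))"
      by (intro sum.cong refl) (simp add: lookup_psp PD_def)
     then show "lkp (restrict_vars (N d) (P la)) m = lkp (\<Sum>nu\<in>PD d. const_pol (?a nu) * ?B nu) m"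
      unfolding lookup_restrict_vars[OF hP[OF la]] using psum_coeff_symmetric(1)[OF hP[OF la] sP, of m] by (simp add: lookup_sum)
    qed
    have "?D d (v d la) = (\<Sum>nu\<in>PD d. const_pol (?a nu) * ?D d (?B nu))"
     unfolding va by (rule quot_op_sum[OF Bs qsym_sekq])
    also have "\<dots> = (\<Sum>nu\<in>PD d. \<Sum>rh\<in>PD d. const_pol (?a nu * M nu rh) * ?B rh)"
     by (intro sum.cong refl) (simp add: M sum_distrib_left const_pol_mult mult.assoc)
    also have "\<dots> = (\<Sum>rh\<in>PD d. const_pol (\<Sum>nu\<in>PD d. ?a nu * M nu rh) * ?B rh)"
     by (subst sum.swap) (simp add: const_pol_sum sum_distrib_right)
    finally have 1: "?D d (v d la) = (\<Sum>rh\<in>PD d. const_pol (\<Sum>nu\<in>PD d. ?a nu * M nu rh) * ?B rh)" .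
    have "?D d (v d la) = (\<Sum>rh\<in>PD d. const_pol (dl (N d) kap (X d) la * ?a rh) * ?B rh)"
     unfolding ev[OF la] by (subst va) (simp add: sum_distrib_left const_pol_mult mult.assoc)
    then have eq: "(\<Sum>rh\<in>PD d. const_pol (\<Sum>nu\<in>PD d. ?a nu * M nu rh) * ?B rh) =
      (\<Sum>rh\<in>PD d. const_pol (dl (N d) kap (X d) la * ?a rh) * ?B rh)" using 1 by simp
    from lin_indep_eq[OF li eq rh] show ?thesis .
   qed
   let ?S = "jack_scalar kap (P lam) (P mu)" and ?a = "psum_coeff (P lam)" and ?b = "psum_coeff (P mu)"
   let ?e = "dl (N d) kap (X d)"
   have w: "wgt kap nu \<noteq> 0" if "nu \<in> PD d" for nu using that wgt_nonzero[OF kap] by (simp add: PD_def)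
   have "?e lam * ?S = (\<Sum>rh\<in>PD d. (?e lam * ?a rh) * ?b rh / wgt kap rh)"
    unfolding js by (simp add: sum_distrib_left mult.assoc)
   also have "\<dots> = (\<Sum>rh\<in>PD d. \<Sum>nu\<in>PD d. ?a nu * M nu rh * ?b rh / wgt kap rh)"
    by (intro sum.cong refl) (simp add: eig[OF lamd, symmetric] sum_distrib_right sum_divide_distrib)
   also have "\<dots> = (\<Sum>nu\<in>PD d. \<Sum>rh\<in>PD d. ?a nu * M nu rh * ?b rh / wgt kap rh)" by (rule sum.swap)
   also have "\<dots> = (\<Sum>nu\<in>PD d. \<Sum>rh\<in>PD d. ?a nu * (?b rh * M rh nu) / wgt kap nu)"
   proof (intro sum.cong refl)
    fix nu rh assume "nu \<in> PD d" "rh \<in> PD d"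
    then have "M nu rh / wgt kap rh = M rh nu / wgt kap nu"
     using sym[of nu rh] w[of nu] w[of rh] by (simp add: field_simps)
    then have "?a nu * ?b rh * (M nu rh / wgt kap rh) = ?a nu * ?b rh * (M rh nu / wgt kap nu)" by simp
    then show "?a nu * M nu rh * ?b rh / wgt kap rh = ?a nu * (?b rh * M rh nu) / wgt kap nu" by (simp add: mult_ac)
   qed
   also have "\<dots> = (\<Sum>nu\<in>PD d. ?a nu * (?e mu * ?b nu) / wgt kap nu)"
    by (intro sum.cong refl) (simp add: eig[OF mud, symmetric] sum_distrib_left sum_divide_distrib)
   also have "\<dots> = ?e mu * ?S" unfolding js by (simp add: sum_distrib_left mult_ac)
   finally have "(?e lam - ?e mu) * ?S = 0" by (simp add: left_diff_distrib)
   moreover have "?e lam \<noteq> ?e mu" using X[OF lamd mud] ne by blast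
   ultimately show ?thesis by simp
  qed
 qed
 have "is_jack_family kap P" unfolding is_jack_family_def using form orth by blast
 then show ?thesis by blast
qed

section \<open>Jack polynomials\<close>

text \<open>
 The norms for the power sum scalar product; they are independent of the number of variables.\<close>

definition jnorm :: "nat \<Rightarrow> natfun \<Rightarrow> complex" where
 "jnorm kap lam = jack_scalar kap (jack_sf kap lam) (jack_sf kap lam)"

lemma jack_family: "kap > 0 \<Longrightarrow> is_jack_family kap (jack_sf kap)"
 unfolding jack_sf_def using jack_family_exists someI_ex[of "is_jack_family kap"] by blast

lemma jack_sf_form:
 assumes "kap > 0" "is_partition lam"
 obtains u where "\<And>m. jack_sf kap lam m = monomial_sf lam m + (\<Sum>mu | dom_less mu lam. u mu * monomial_sf mu m)"
 using jack_family[OF assms(1)] assms(2) unfolding is_jack_family_def by metis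

lemma homog_jack: assumes "kap > 0" "is_partition lam" shows "homog (part_size lam) (jack_sf kap lam)"
proof -
 obtain u where u: "\<And>m. jack_sf kap lam m = monomial_sf lam m + (\<Sum>mu | dom_less mu lam. u mu * monomial_sf mu m)"
  using jack_sf_form[OF assms] by blast
 have "deg m = part_size lam" if "jack_sf kap lam m \<noteq> 0" for m
 proof (rule ccontr)
  assume ne: "deg m \<noteq> part_size lam"
  have "monomial_sf mu m = 0" if "is_partition mu" "part_size mu = part_size lam" for mu
   using homog_monomial_sf[OF that(1)] ne that(2) by (auto simp: homog_def)
  then have "jack_sf kap lam m = 0" unfolding u using assms(2) by (simp add: dom_less_def)
  then show False using that by simp
 qed
 then show ?thesis by (simp add: homog_def)
qed

lemma symmetric_jack: assumes "kap > 0" "is_partition lam" shows "sf_symmetric (jack_sf kap lam)"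
proof -
 obtain u where u: "\<And>m. jack_sf kap lam m = monomial_sf lam m + (\<Sum>mu | dom_less mu lam. u mu * monomial_sf mu m)"
  using jack_sf_form[OF assms] by blast
 show ?thesis unfolding sf_symmetric_def
 proof (intro allI impI)
  fix m m' :: expo assume "parts m = parts m'"
  then have "monomial_sf mu m = monomial_sf mu m'" for mu using monomial_symmetric unfolding sf_symmetric_def by blast
  then show "jack_sf kap lam m = jack_sf kap lam m'" by (simp add: u)
 qed
qed

lemma lookup_jack: "kap > 0 \<Longrightarrow> is_partition lam \<Longrightarrow> lkp (jack n kap lam) m = (if kys m \<subseteq> {..<n} then jack_sf kap lam m else 0)"
 unfolding jack_def by (rule lookup_restrict_vars[OF homog_jack])

lemma sympol_jack: "kap > 0 \<Longrightarrow> is_partition lam \<Longrightarrow> jack n kap lam \<in> sympol n"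
 unfolding jack_def by (rule restrict_sympol[OF homog_jack symmetric_jack])

lemma jack_sf_pm:
 assumes "kap > 0" "is_partition lam" "mu \<in> Par n" "jack_sf kap lam (pm n mu) \<noteq> 0"
 shows "mu = lam \<or> dom_less mu lam"
proof -
 obtain u where u: "\<And>m. jack_sf kap lam m = monomial_sf lam m + (\<Sum>mu | dom_less mu lam. u mu * monomial_sf mu m)"
  using jack_sf_form[OF assms(1,2)] by blast
 show ?thesis
 proof (rule ccontr)
  assume n: "\<not> ?thesis"
  have "monomial_sf lam (pm n mu) = 0" using n assms by (auto simp: monomial_sf_pm)
  moreover have "(\<Sum>nu | dom_less nu lam. u nu * monomial_sf nu (pm n mu)) = 0"
  proof (intro sum.neutral ballI)
   fix nu assume "nu \<in> {nu. dom_less nu lam}"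
   then have "is_partition nu" "nu \<noteq> mu" using n by (auto simp: dom_less_def)
   then show "u nu * monomial_sf nu (pm n mu) = 0" using assms by (simp add: monomial_sf_pm)
  qed
  ultimately show False using assms(4) u by simp
 qed
qed

lemma jack_sf_leading:
 assumes "kap > 0" "lam \<in> Par n" shows "jack_sf kap lam (pm n lam) = 1"
proof -
 have p: "is_partition lam" using assms by (simp add: Par_def)
 obtain u where u: "\<And>m. jack_sf kap lam m = monomial_sf lam m + (\<Sum>mu | dom_less mu lam. u mu * monomial_sf mu m)"
  using jack_sf_form[OF assms(1) p] by blast
 have "(\<Sum>nu | dom_less nu lam. u nu * monomial_sf nu (pm n lam)) = 0"
  by (intro sum.neutral ballI) (auto simp: dom_less_def monomial_sf_pm[OF assms(2)])
 then show ?thesis using assms p u by (simp add: monomial_sf_pm)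
qed

lemma unitri_jack: assumes "kap > 0" "lam \<in> Par n" shows "unitri n lam (jack n kap lam)"
proof -
 have p: "is_partition lam" using assms by (simp add: Par_def)
 have "tri n lam (jack n kap lam)"
 proof (rule triI[OF sympol_jack[OF assms(1) p]])
  fix mu assume mu: "mu \<in> Par n" "lkp (jack n kap lam) (pm n mu) \<noteq> 0"
  then have "mu = lam \<or> dom_less mu lam" using jack_sf_pm[OF assms(1) p mu(1)] by (simp add: lookup_jack[OF assms(1) p] keys_pm)
  then show "dle n mu lam" using dle_refl[OF assms(2)] dom_less_dle[of mu lam n] mu(1) assms(2) by (auto simp: Par_def)
 qed
 then show ?thesis using jack_sf_leading[OF assms] by (simp add: unitri_def lookup_jack[OF assms(1) p] keys_pm)
qed

lemma jack_eq_0: assumes "kap > 0" "is_partition lam" "part_length lam > n" shows "jack n kap lam = 0"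
proof (rule sympol_eqI[OF sympol_jack[OF assms(1,2)] sympol_0])
 fix mu assume mu: "mu \<in> Par n"
 have "jack_sf kap lam (pm n mu) = 0"
 proof (rule ccontr)
  assume "jack_sf kap lam (pm n mu) \<noteq> 0"
  then have "mu = lam \<or> dom_less mu lam" using jack_sf_pm[OF assms(1,2) mu] by blast
  then show False using dom_less_length[of mu lam] assms(3) mu by (auto simp: Par_def)
 qed
 then show "lkp (jack n kap lam) (pm n mu) = lkp 0 (pm n mu)" by (simp add: lookup_jack[OF assms(1,2)] keys_pm)
qed

lemma cut_jack: assumes "kap > 0" "is_partition lam" "k \<le> n" shows "cut k (jack n kap lam) = jack k kap lam"
proof (rule poly_mapping_eqI)
 fix m :: expo
 have "kys m \<subseteq> {..<k} \<Longrightarrow> kys m \<subseteq> {..<n}" using assms(3) by auto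
 then show "lkp (cut k (jack n kap lam)) m = lkp (jack k kap lam) m" by (simp add: lookup_cut lookup_jack[OF assms(1,2)])
qed

lemma lin_indep_jack: assumes "kap > 0" "finite I" "I \<subseteq> Par n" shows "lin_indep I (jack n kap)"
 unfolding lin_indep_def
proof (intro allI impI ballI)
 fix c lam assume "(\<Sum>lam\<in>I. const_pol (c lam) * jack n kap lam) = 0" "lam \<in> I"
 then show "c lam = 0" using unitri_indep[OF assms(2,3), of "jack n kap" c lam] unitri_jack[OF assms(1)] assms(3) by blast
qed

lemma jack_psum_coeff:
 assumes "kap > 0" "lam \<in> PD d"
 shows "jack_sf kap lam m = (\<Sum>nu\<in>PD d. psum_coeff (jack_sf kap lam) nu * power_sum_part nu m)"
  and "psum_coeff (jack_sf kap lam) nu \<noteq> 0 \<Longrightarrow> nu \<in> PD d"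
proof -
 have p: "is_partition lam" "part_size lam = d" using assms by (auto simp: PD_def)
 note c = psum_coeff_symmetric[OF homog_jack[OF assms(1) p(1)] symmetric_jack[OF assms(1) p(1)], unfolded p(2)]
 show "jack_sf kap lam m = (\<Sum>nu\<in>PD d. psum_coeff (jack_sf kap lam) nu * power_sum_part nu m)" by (rule c(1))
 show "psum_coeff (jack_sf kap lam) nu \<noteq> 0 \<Longrightarrow> nu \<in> PD d" by (rule c(2))
qed

lemma jack_psp:
 assumes "kap > 0" "lam \<in> PD d"
 shows "jack n kap lam = (\<Sum>nu\<in>PD d. const_pol (psum_coeff (jack_sf kap lam) nu) * psp n nu)"
proof (rule poly_mapping_eqI)
 fix m
 have p: "is_partition lam" using assms by (auto simp: PD_def)
 have "(\<Sum>nu\<in>PD d. psum_coeff (jack_sf kap lam) nu * lkp (psp n nu) m) =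
   (\<Sum>nu\<in>PD d. psum_coeff (jack_sf kap lam) nu * (if kys m \<subseteq> {..<n} then power_sum_part nu m else 0))"
  by (intro sum.cong refl) (simp add: lookup_psp PD_def)
 then show "lkp (jack n kap lam) m = lkp (\<Sum>nu\<in>PD d. const_pol (psum_coeff (jack_sf kap lam) nu) * psp n nu) m"
  unfolding lookup_jack[OF assms(1) p] using jack_psum_coeff(1)[OF assms, of m] by (simp add: lookup_sum)
qed

text \<open>
 Orthogonality makes the inverse of the transition matrix from power sums to Jack functions its
 transpose, up to the weights and norms.  The inverse is computed in so many variables that nothing
 is lost by the restriction, and the resulting expansion is valid for every \<open>n\<close>.\<close>

lemma kernel_jack_all:
 assumes kap: "kap > 0"
 shows "lam \<in> PD d \<Longrightarrow> jnorm kap lam \<noteq> 0"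
  and "Kpol n kap d y = (\<Sum>mu\<in>PD d. const_pol (eval_pol (jack n kap mu) y / jnorm kap mu) * jack n kap mu)"
proof -
 define N where "N = Suc d"
 define a where "a lam = psum_coeff (jack_sf kap lam)" for lam
 have sc: "jack_scalar kap (jack_sf kap lam) (jack_sf kap mu) = (\<Sum>nu\<in>PD d. a lam nu * a mu nu / wgt kap nu)" if "lam \<in> PD d" for lam mu
  unfolding a_def by (rule jack_scalar_PD[OF jack_psum_coeff(2)[OF kap that]])
 have sub: "PD d \<subseteq> Par N" using PD_Par[of _ d N] by (auto simp: N_def)
 have PDN: "PDn N d = PD d" using sub by (auto simp: PDn_def)
 have "\<exists>c. psp N lam = (\<Sum>mu\<in>PD d. const_pol (c mu) * jack N kap mu)" if "lam \<in> PD d" for lam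
  using unitri_span[OF downset_PDn[of N d], of "jack N kap" "psp N lam", unfolded PDN] sub unitri_jack[OF kap]
   sympol_psp homog_lookup_size[OF homog_psp] that unfolding PD_def psp_def Par_def by blast
 then obtain B where B: "\<And>lam. lam \<in> PD d \<Longrightarrow> psp N lam = (\<Sum>mu\<in>PD d. const_pol (B lam mu) * jack N kap mu)" by metis
 have orth: "jack_scalar kap (jack_sf kap lam) (jack_sf kap mu) = (if lam = mu then jnorm kap mu else 0)" if "lam \<in> PD d" "mu \<in> PD d" for lam mu
  using jack_family[OF kap] that by (auto simp: is_jack_family_def PD_def jnorm_def)
 have BA: "(\<Sum>mu\<in>PD d. B lam mu * a mu nu) = (if lam = nu then 1 else 0)" if lam: "lam \<in> PD d" and nu: "nu \<in> PD d" for lam nu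
 proof -
  have "(\<Sum>nu\<in>PD d. const_pol (if lam = nu then 1 else 0) * psp N nu) = (\<Sum>nu\<in>PD d. if lam = nu then psp N nu else 0)"
   by (intro sum.cong refl) auto
  also have "\<dots> = psp N lam" using lam finite_PD by simp
  also have "\<dots> = (\<Sum>mu\<in>PD d. \<Sum>nu\<in>PD d. const_pol (B lam mu * a mu nu) * psp N nu)"
   unfolding B[OF lam] a_def
   by (intro sum.cong refl) (simp add: jack_psp[OF kap, of _ d] sum_distrib_left const_pol_mult mult.assoc)
  also have "\<dots> = (\<Sum>nu\<in>PD d. const_pol (\<Sum>mu\<in>PD d. B lam mu * a mu nu) * psp N nu)"
   by (subst sum.swap) (simp add: const_pol_sum sum_distrib_right)
  finally have eq: "(\<Sum>nu\<in>PD d. const_pol (if lam = nu then 1 else 0) * psp N nu)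
    = (\<Sum>nu\<in>PD d. const_pol (\<Sum>mu\<in>PD d. B lam mu * a mu nu) * psp N nu)" .
  have "d \<le> N" by (simp add: N_def)
  from lin_indep_eq[OF psp_lin_indep[OF this] eq nu] show ?thesis by simp
 qed
 have NB: "jnorm kap mu * B lam mu = a mu lam / wgt kap lam" if lam: "lam \<in> PD d" and mu: "mu \<in> PD d" for lam mu
 proof -
  have "jnorm kap mu * B lam mu = (\<Sum>nu\<in>PD d. if nu = mu then B lam nu * jnorm kap mu else 0)" using mu finite_PD by simp
  also have "\<dots> = (\<Sum>nu\<in>PD d. B lam nu * jack_scalar kap (jack_sf kap nu) (jack_sf kap mu))"
   by (intro sum.cong refl) (simp add: orth mu)
  also have "\<dots> = (\<Sum>nu\<in>PD d. \<Sum>rh\<in>PD d. B lam nu * a nu rh * (a mu rh / wgt kap rh))"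
   by (intro sum.cong refl) (simp add: sc sum_distrib_left mult.assoc)
  also have "\<dots> = (\<Sum>rh\<in>PD d. (\<Sum>nu\<in>PD d. B lam nu * a nu rh) * (a mu rh / wgt kap rh))"
   by (subst sum.swap) (simp only: sum_distrib_right)
  also have "\<dots> = (\<Sum>rh\<in>PD d. if rh = lam then a mu rh / wgt kap rh else 0)"
   by (intro sum.cong refl) (simp add: BA lam)
  finally show ?thesis using lam finite_PD by simp
 qed
 have w: "wgt kap nu \<noteq> 0" if "nu \<in> PD d" for nu using that wgt_nonzero[OF kap] by (simp add: PD_def)
 have nz: "jnorm kap mu \<noteq> 0" if mu: "mu \<in> PD d" for mu
 proof
  assume "jnorm kap mu = 0"
  then have "a mu lam = 0" if "lam \<in> PD d" for lam using NB[OF that mu] w[OF that] by simp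
  then have "jack N kap mu = 0" unfolding jack_psp[OF kap mu] by (simp add: a_def)
  moreover have "unitri N mu (jack N kap mu)" using unitri_jack[OF kap] sub mu by blast
  ultimately show False by (simp add: unitri_def)
 qed
 then show "lam \<in> PD d \<Longrightarrow> jnorm kap lam \<noteq> 0" by blast
 have pn: "psp n lam = (\<Sum>mu\<in>PD d. const_pol (B lam mu) * jack n kap mu)" if lam: "lam \<in> PD d" for lam
 proof -
  have "(\<Sum>mu\<in>PD d. const_pol (B lam mu) * jack n kap mu) = (\<Sum>mu\<in>PD d. \<Sum>nu\<in>PD d. const_pol (B lam mu * a mu nu) * psp n nu)"
   by (intro sum.cong refl) (simp add: jack_psp[OF kap, of _ d] a_def sum_distrib_left const_pol_mult mult.assoc)
  also have "\<dots> = (\<Sum>nu\<in>PD d. const_pol (\<Sum>mu\<in>PD d. B lam mu * a mu nu) * psp n nu)"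
   by (subst sum.swap) (simp add: const_pol_sum sum_distrib_right)
  also have "\<dots> = (\<Sum>nu\<in>PD d. if lam = nu then psp n nu else 0)"
   by (intro sum.cong refl) (simp add: BA lam)
  finally show ?thesis using lam finite_PD by simp
 qed
 have "Kpol n kap d y = (\<Sum>lam\<in>PD d. \<Sum>mu\<in>PD d. const_pol (wgt kap lam * B lam mu * eval_pol (psp n lam) y) * jack n kap mu)"
  unfolding Kpol_def
  by (intro sum.cong refl, subst (2) pn) (auto simp: sum_distrib_left const_pol_mult mult_ac)
 also have "\<dots> = (\<Sum>mu\<in>PD d. const_pol (\<Sum>lam\<in>PD d. wgt kap lam * B lam mu * eval_pol (psp n lam) y) * jack n kap mu)"
  by (subst sum.swap) (simp add: const_pol_sum sum_distrib_right)
 also have "\<dots> = (\<Sum>mu\<in>PD d. const_pol (eval_pol (jack n kap mu) y / jnorm kap mu) * jack n kap mu)"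
 proof (intro sum.cong refl)
  fix mu assume mu: "mu \<in> PD d"
  have "wgt kap lam * B lam mu = a mu lam / jnorm kap mu" if "lam \<in> PD d" for lam
   using NB[OF that mu] w[OF that] nz[OF mu] by (simp add: field_simps)
  then have "(\<Sum>lam\<in>PD d. wgt kap lam * B lam mu * eval_pol (psp n lam) y) = (\<Sum>lam\<in>PD d. a mu lam * eval_pol (psp n lam) y) / jnorm kap mu"
   unfolding sum_divide_distrib by (intro sum.cong refl) simp
  also have "(\<Sum>lam\<in>PD d. a mu lam * eval_pol (psp n lam) y) = eval_pol (jack n kap mu) y"
   unfolding jack_psp[OF kap mu] by (simp add: a_def)
  finally show "const_pol (\<Sum>lam\<in>PD d. wgt kap lam * B lam mu * eval_pol (psp n lam) y) * jack n kap mu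
   = const_pol (eval_pol (jack n kap mu) y / jnorm kap mu) * jack n kap mu" by simp
 qed
 finally show "Kpol n kap d y = (\<Sum>mu\<in>PD d. const_pol (eval_pol (jack n kap mu) y / jnorm kap mu) * jack n kap mu)" .
qed

lemma kernel_jack:
 assumes kap: "kap > 0"
 shows "Kpol n kap d y = (\<Sum>mu\<in>PDn n d. const_pol (inverse (jnorm kap mu) * eval_pol (jack n kap mu) y) * jack n kap mu)"
proof -
 have "Kpol n kap d y = (\<Sum>mu\<in>PDn n d. const_pol (eval_pol (jack n kap mu) y / jnorm kap mu) * jack n kap mu)"
  unfolding kernel_jack_all(2)[OF kap]
 proof (rule sum.mono_neutral_right[OF finite_PD])
  show "\<forall>mu\<in>PD d - PDn n d. const_pol (eval_pol (jack n kap mu) y / jnorm kap mu) * jack n kap mu = 0"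
  proof
   fix mu assume "mu \<in> PD d - PDn n d"
   then have "is_partition mu" "part_length mu > n" by (auto simp: PDn_def Par_def PD_def)
   then show "const_pol (eval_pol (jack n kap mu) y / jnorm kap mu) * jack n kap mu = 0" by (simp add: jack_eq_0[OF kap])
  qed
 qed (auto simp: PDn_def)
 then show ?thesis by (simp add: divide_inverse mult.commute)
qed

lemma jack_span:
 assumes "kap > 0" "downset n I" "f \<in> sympol n" "\<And>lam. lam \<in> Par n \<Longrightarrow> lkp f (pm n lam) \<noteq> 0 \<Longrightarrow> lam \<in> I"
 shows "\<exists>c. f = (\<Sum>lam\<in>I. const_pol (c lam) * jack n kap lam)"
 by (rule unitri_span[OF assms(2) _ assms(3,4)]) (use assms in \<open>auto simp: downset_def intro: unitri_jack\<close>)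

text \<open>
 The matrix of \<open>D(X)\<close> in the Jack basis is triangular, and up to the norms symmetric,
 hence diagonal; the diagonal entries are given by \<open>quot_op_leading\<close>.\<close>

theorem quot_op_jack:
 assumes kap: "kap > 0" and lam: "lam \<in> Par n"
 shows "quot_op n kap (sekq n X) (jack n kap lam) = const_pol (dl n kap X lam) * jack n kap lam"
proof -
 let ?D = "quot_op n kap (sekq n X)"
 define d where "d = part_size lam"
 have lamd: "lam \<in> PDn n d" using lam by (simp add: PDn_def PD_def Par_def d_def)
 have uj: "unitri n mu (jack n kap mu)" if "mu \<in> PDn n d" for mu using that unitri_jack[OF kap] by (simp add: PDn_def)
 have js: "jack n kap mu \<in> sympol n" "tri n mu (jack n kap mu)" if "mu \<in> PDn n d" for mu
  using uj[OF that] by (auto simp: unitri_def tri_def)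
 have tD: "tri n mu (?D (jack n kap mu))" if "mu \<in> PDn n d" for mu
  by (rule quot_op_triangular[OF js(2)[OF that] qsym_sekq])
 define I where "I mu = {nu\<in>PDn n d. dle n nu mu}" for mu
 have dsI: "downset n (I mu)" for mu
  using downset_PDn[of n d] dle_trans[of n _ _ mu] unfolding downset_def I_def by auto
 have "\<exists>c. ?D (jack n kap mu) = (\<Sum>nu\<in>I mu. const_pol (c nu) * jack n kap nu)" if "mu \<in> PDn n d" for mu
 proof (rule jack_span[OF kap dsI])
  show "?D (jack n kap mu) \<in> sympol n" using tD[OF that] by (simp add: tri_def)
  fix nu assume "nu \<in> Par n" "lkp (?D (jack n kap mu)) (pm n nu) \<noteq> 0"
  then show "nu \<in> I mu" using lookup_tri_dle[OF tD[OF that]] dle_size[of mu n nu] that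
   by (auto simp: I_def PDn_def PD_def Par_def)
 qed
 then obtain c where c: "\<And>mu. mu \<in> PDn n d \<Longrightarrow> ?D (jack n kap mu) = (\<Sum>nu\<in>I mu. const_pol (c mu nu) * jack n kap nu)" by metis
 define M where "M mu nu = (if nu \<in> I mu then c mu nu else 0)" for mu nu
 have fin: "finite (PDn n d)" using downset_PDn by (simp add: downset_def)
 have M: "?D (jack n kap mu) = (\<Sum>nu\<in>PDn n d. const_pol (M mu nu) * jack n kap nu)" if "mu \<in> PDn n d" for mu
  unfolding c[OF that] M_def by (rule sum.mono_neutral_cong_left[OF fin]) (auto simp: I_def)
 have li: "lin_indep (PDn n d) (jack n kap)" using lin_indep_jack[OF kap fin] by (simp add: PDn_def)
 have sym: "inverse (jnorm kap mu) * M mu nu = inverse (jnorm kap nu) * M nu mu" if "mu \<in> PDn n d" "nu \<in> PDn n d" for mu nu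
  by (rule kernel_matrix_symmetric[OF kap li fin js(1) kernel_jack[OF kap] M that])
 have off: "M lam nu = 0" if "nu \<in> PDn n d" "nu \<noteq> lam" for nu
 proof (cases "dle n nu lam")
  case True
  have "\<not> dle n lam nu" using dle_wt_less[of lam n nu] dle_wt[of n lam nu] True that lam by (auto simp: PDn_def)
  then have "M nu lam = 0" by (simp add: M_def I_def)
  then have "inverse (jnorm kap lam) * M lam nu = 0" using sym[OF lamd that(1)] by simp
  moreover have "jnorm kap lam \<noteq> 0" using kernel_jack_all(1)[OF kap] lamd by (auto simp: PDn_def)
  ultimately show ?thesis by simp
 qed (simp add: M_def I_def)
 have "?D (jack n kap lam) = (\<Sum>nu\<in>PDn n d. if nu = lam then const_pol (M lam lam) * jack n kap lam else 0)"
  unfolding M[OF lamd] by (intro sum.cong refl) (auto simp: off)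
 then have eq: "?D (jack n kap lam) = const_pol (M lam lam) * jack n kap lam" using lamd fin by simp
 have "lkp (?D (jack n kap lam)) (pm n lam) = dl n kap X lam * lkp (jack n kap lam) (pm n lam)"
  using quot_op_leading[OF js(2)[OF lamd] qsym_sekq, of kap X] by (simp add: sekq_eigenvalue)
 then have "M lam lam = dl n kap X lam" unfolding eq using uj[OF lamd] by (simp add: unitri_def)
 then show ?thesis using eq by simp
qed

section \<open>Homogeneous polynomials\<close>

definition hom :: "nat \<Rightarrow> mpol \<Rightarrow> bool" where "hom d f \<longleftrightarrow> (\<forall>m. lkp f m \<noteq> 0 \<longrightarrow> deg m = d)"

lemma deg_add: "deg (a + b) = deg a + deg b"
proof -
 have *: "deg c = (\<Sum>i\<in>kys a \<union> kys b. lkp c i)" if "kys c \<subseteq> kys a \<union> kys b" for c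
  using deg_superset[OF _ that] by simp
 show ?thesis by (simp add: * keys_add_nat lookup_add sum.distrib)
qed

lemma deg_sgl [simp]: "deg (sgl i k) = k" by (cases "k = 0") (auto simp: deg_def)

lemma hom_0 [simp]: "hom d 0" by (simp add: hom_def)

lemma hom_add: assumes "hom d f" "hom d g" shows "hom d (f + g)"
 unfolding hom_def lookup_add using assms unfolding hom_def by (metis add.right_neutral)

lemma hom_sum: "(\<And>s. s \<in> S \<Longrightarrow> hom d (f s)) \<Longrightarrow> hom d (sum f S)"
 by (induction S rule: infinite_finite_induct) (auto intro: hom_add)

lemma hom_const_mult: "hom d f \<Longrightarrow> hom d (const_pol c * f)" by (simp add: hom_def)

lemma hom_theta: "hom d f \<Longrightarrow> hom d (theta k f)" by (simp add: hom_def theta_def)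

lemma hom_mult: assumes "hom d f" "hom e g" shows "hom (d + e) (f * g)"
proof -
 have k: "deg m = d" if "m \<in> kys f" for m using assms(1) that by (simp add: hom_def in_keys_iff)
 have l: "deg m = e" if "m \<in> kys g" for m using assms(2) that by (simp add: hom_def in_keys_iff)
 have "deg m = d + e" if "m \<in> kys (f * g)" for m
 proof -
  from keys_mult[of f g] that obtain a b where "m = a + b" "a \<in> kys f" "b \<in> kys g" by blast
  then show ?thesis using k l by (simp add: deg_add)
 qed
 then show ?thesis by (simp add: hom_def in_keys_iff)
qed

lemma hom_var: "hom 1 (var k)" by (simp add: hom_def var_def lookup_single when_def)

lemma hom_psum1: "hom 1 (psum1 n)" unfolding psum1_def by (intro hom_sum hom_var)

lemma Aop_cmult: "Aop n kap (const_pol c * f) = const_pol c * Aop n kap f"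
 unfolding Aop_def theta_cmult sum_distrib_left by (intro sum.cong refl) (simp add: distrib_left mult_ac)

lemma hom_Aop: "hom d f \<Longrightarrow> hom (Suc d) (Aop n kap f)"
 unfolding Aop_def
 by (intro hom_sum) (use hom_mult[OF hom_var] hom_add hom_const_mult hom_theta in fastforce)

lemma lookup_partial_deriv: "lkp (partial_deriv k f) m = of_nat (Suc (lkp m k)) * lkp f (sgl k 1 + m)"
proof -
 have "lkp (var k * partial_deriv k f) (sgl k 1 + m) = lkp (theta k f) (sgl k 1 + m)" by (simp add: theta_eq)
 then show ?thesis unfolding var_def lookup_single_times by (simp add: theta_def lookup_add)
qed

lemma hom_E0: assumes "hom (Suc d) f" shows "hom d (E0 n f)"
 unfolding E0_def
proof (rule hom_sum)
 fix k
 show "hom d (partial_deriv k f)"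
  unfolding hom_def
 proof (intro allI impI)
  fix m assume "lkp (partial_deriv k f) m \<noteq> 0"
  then have "lkp f (sgl k 1 + m) \<noteq> 0" by (simp add: lookup_partial_deriv)
  then have "deg (sgl k 1 + m) = Suc d" using assms by (simp add: hom_def)
  then show "deg m = d" by (simp add: deg_add)
 qed
qed

lemma hom_en: "hom n (en n)" by (simp add: hom_def en_def mon_def lookup_single when_def deg_pm)

lemma hom_jack: "kap > 0 \<Longrightarrow> is_partition lam \<Longrightarrow> hom (part_size lam) (jack n kap lam)"
 using homog_jack[of kap lam] by (simp add: hom_def homog_def lookup_jack)

lemma deg_pm_Par: "lam \<in> Par n \<Longrightarrow> deg (pm n lam) = part_size lam"
 using part_size_sum[of lam n] by (simp add: deg_pm Par_def)

lemma euler_hom: assumes "hom d f" "vars_in n f" shows "(\<Sum>i<n. theta i f) = of_nat d * f"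
proof (rule poly_mapping_eqI)
 fix m
 have l: "lkp (of_nat k * g) m = of_nat k * lkp (g::mpol) m" for k g by (simp flip: const_pol_of_nat)
 have "(\<Sum>i<n. of_nat (lkp m i)) * lkp f m = of_nat d * lkp f m"
 proof (cases "lkp f m = 0")
  case False
  then have "kys m \<subseteq> {..<n}" "deg m = d" using assms by (auto simp: hom_def vars_in_def in_keys_iff)
  then have "(\<Sum>i<n. lkp m i) = d" using deg_superset[of "{..<n}" m] by simp
  then show ?thesis by (simp flip: of_nat_sum)
 qed simp
 then show "lkp (\<Sum>i<n. theta i f) m = lkp (of_nat d * f) m"
  by (simp add: lookup_sum theta_def l sum_distrib_right)
qed

section \<open>Coefficients in the Jack basis\<close>

lemma finite_PDn: "finite (PDn n d)" using downset_PDn by (simp add: downset_def)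

lemma jack_expand:
 assumes "kap > 0" "f \<in> sympol n" "hom d f"
 shows "\<exists>c. f = (\<Sum>lam\<in>PDn n d. const_pol (c lam) * jack n kap lam)"
 by (rule jack_span[OF assms(1) downset_PDn assms(2)])
   (use assms(3) deg_pm_Par in \<open>auto simp: PDn_def PD_def Par_def hom_def\<close>)

definition jcoef :: "nat \<Rightarrow> nat \<Rightarrow> nat \<Rightarrow> mpol \<Rightarrow> natfun \<Rightarrow> complex" where
 "jcoef n kap d f = (SOME c. f = (\<Sum>lam\<in>PDn n d. const_pol (c lam) * jack n kap lam))"

lemma jcoef: assumes "kap > 0" "f \<in> sympol n" "hom d f"
 shows "f = (\<Sum>lam\<in>PDn n d. const_pol (jcoef n kap d f lam) * jack n kap lam)"
 unfolding jcoef_def by (rule someI_ex[OF jack_expand[OF assms]])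

lemma lin_indep_PDn: "kap > 0 \<Longrightarrow> lin_indep (PDn n d) (jack n kap)"
 by (rule lin_indep_jack[OF _ finite_PDn]) (auto simp: PDn_def)

lemma jcoef_unique:
 assumes "kap > 0" "f = (\<Sum>lam\<in>PDn n d. const_pol (c lam) * jack n kap lam)" "lam \<in> PDn n d"
 shows "jcoef n kap d f lam = c lam"
proof -
 have "f = (\<Sum>lam\<in>PDn n d. const_pol (jcoef n kap d f lam) * jack n kap lam)"
  unfolding jcoef_def by (rule someI[of "\<lambda>c. f = (\<Sum>lam\<in>PDn n d. const_pol (c lam) * jack n kap lam)"]) (rule assms(2))
 from lin_indep_eq[OF lin_indep_PDn[OF assms(1)] trans[OF this[symmetric] assms(2)] assms(3)] show ?thesis .
qed

lemma PDn_D: "lam \<in> PDn n d \<Longrightarrow> lam \<in> Par n \<and> is_partition lam \<and> part_size lam = d \<and> part_length lam \<le> n"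
 by (auto simp: PDn_def PD_def Par_def)

lemma PDn_jack:
 assumes "kap > 0" "lam \<in> PDn n d" shows "jack n kap lam \<in> sympol n" "hom d (jack n kap lam)"
 using sympol_jack[OF assms(1), of lam n] hom_jack[OF assms(1), of lam n] PDn_D[OF assms(2)] by auto

section \<open>Multiplication by the first power sum in the Jack basis\<close>

text \<open>
 The coefficients of \<open>p\<^sub>1 P\<^sub>\<mu>\<close> and, in \<open>apieri\<close>, of
 \<open>A P\<^sub>\<mu>\<close> in the Jack basis.\<close>

definition pieri :: "nat \<Rightarrow> nat \<Rightarrow> nat \<Rightarrow> natfun \<Rightarrow> natfun \<Rightarrow> complex" where
 "pieri n kap d mu nu = jcoef n kap (Suc d) (psum1 n * jack n kap mu) nu"

definition apieri :: "nat \<Rightarrow> nat \<Rightarrow> nat \<Rightarrow> natfun \<Rightarrow> natfun \<Rightarrow> complex" where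
 "apieri n kap d mu nu = jcoef n kap (Suc d) (Aop n kap (jack n kap mu)) nu"

lemma pieri: assumes "kap > 0" "mu \<in> PDn n d"
 shows "psum1 n * jack n kap mu = (\<Sum>nu\<in>PDn n (Suc d). const_pol (pieri n kap d mu nu) * jack n kap nu)"
  and "Aop n kap (jack n kap mu) = (\<Sum>nu\<in>PDn n (Suc d). const_pol (apieri n kap d mu nu) * jack n kap nu)"
 unfolding pieri_def apieri_def
 using PDn_jack[OF assms] hom_mult[OF hom_psum1 PDn_jack(2)[OF assms], of n]
 by (auto intro!: jcoef assms sympol_mult sympol_psum1 sympol_Aop hom_Aop)

text \<open>
 The commutation relation \<open>sekiguchi_raising\<close>, applied to \<open>P\<^sub>\<mu>\<close>.\<close>

lemma pieri_eigen:
 assumes kap: "kap > 0" and n: "n \<ge> 1" and mu: "mu \<in> PDn n d" and nu: "nu \<in> PDn n (Suc d)"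
 shows "(X * pieri n kap d mu nu + apieri n kap d mu nu) * dl n kap X nu =
   dl n kap X mu * ((X + 1) * pieri n kap d mu nu + apieri n kap d mu nu)"
proof -
 let ?D = "quot_op n kap (sekq n X)" and ?I = "PDn n (Suc d)"
 let ?b = "pieri n kap d mu" and ?a = "apieri n kap d mu"
 note J = PDn_jack[OF kap]
 have comb: "const_pol Y * (psum1 n * jack n kap mu) + Aop n kap (jack n kap mu) = (\<Sum>nu\<in>?I. const_pol (Y * ?b nu + ?a nu) * jack n kap nu)" for Y
  unfolding pieri[OF kap mu] sum_distrib_left sum.distrib[symmetric]
  by (intro sum.cong refl) (simp add: const_pol_add const_pol_mult distrib_right mult.assoc)
 have Dj: "?D (jack n kap la) = const_pol (dl n kap X la) * jack n kap la" if "la \<in> PDn n e" for la e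
  by (rule quot_op_jack[OF kap]) (use PDn_D[OF that] in auto)
 have "(\<Sum>nu\<in>?I. const_pol ((X * ?b nu + ?a nu) * dl n kap X nu) * jack n kap nu) = ?D (const_pol X * (psum1 n * jack n kap mu) + Aop n kap (jack n kap mu))"
  unfolding comb by (subst quot_op_sum[OF J(1) qsym_sekq], assumption) (simp add: Dj const_pol_mult mult.assoc)
 also have "\<dots> = const_pol (X + 1) * (psum1 n * ?D (jack n kap mu)) + Aop n kap (?D (jack n kap mu))"
  by (rule sekiguchi_raising[OF n J(1)[OF mu]])
 also have "\<dots> = const_pol (dl n kap X mu) * (const_pol (X + 1) * (psum1 n * jack n kap mu) + Aop n kap (jack n kap mu))"
  unfolding Dj[OF mu] Aop_cmult by (simp add: distrib_left mult_ac)
 also have "\<dots> = (\<Sum>nu\<in>?I. const_pol (dl n kap X mu * ((X + 1) * ?b nu + ?a nu)) * jack n kap nu)"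
  unfolding comb by (simp add: sum_distrib_left const_pol_mult mult.assoc)
 finally have eq: "(\<Sum>nu\<in>?I. const_pol ((X * ?b nu + ?a nu) * dl n kap X nu) * jack n kap nu) =
   (\<Sum>nu\<in>?I. const_pol (dl n kap X mu * ((X + 1) * ?b nu + ?a nu)) * jack n kap nu)" .
 from lin_indep_eq[OF lin_indep_PDn[OF kap] eq nu] show ?thesis .
qed

lemma av_image_card: assumes "kap > 0" "lam \<in> Par n" shows "card (av n kap lam ` {..<n}) = n"
proof -
 have "inj_on (av n kap lam) {..<n}"
  by (rule linorder_inj_onI) (use av_strict[OF assms] in \<open>force+\<close>)
 then show ?thesis by (simp add: card_image)
qed

lemma dl_zero_iff: "dl n kap (- of_nat v) lam = 0 \<longleftrightarrow> v \<in> av n kap lam ` {..<n}"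
 unfolding dl_zero by (auto simp: image_iff)

text \<open>
 Write \<open>a\<close> for the quotient of the two coefficients.  By \<open>pieri_eigen\<close>,
 \<open>(X + a) \<Prod>(X + a\<^sub>j(\<nu>)) = (X + 1 + a) \<Prod>(X + a\<^sub>j(\<mu>))\<close>
 for all \<open>X\<close>.  Comparing roots, \<open>a\<close> is one of the
 \<open>a\<^sub>i(\<mu>)\<close>, and \<open>\<nu>\<close> is obtained by replacing
 \<open>a\<^sub>i\<close> by \<open>a\<^sub>i + 1\<close>.\<close>

theorem pieri_support:
 assumes kap: "kap > 0" and n: "n \<ge> 1" and mu: "mu \<in> PDn n d" and nu: "nu \<in> PDn n (Suc d)"
  and nz: "pieri n kap d mu nu \<noteq> 0 \<or> apieri n kap d mu nu \<noteq> 0"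
 obtains i where "i < n" "nu = mu(i := Suc (mu i))"
  "apieri n kap d mu nu = pieri n kap d mu nu * of_nat (av n kap mu i)" "pieri n kap d mu nu \<noteq> 0"
proof -
 define b where "b = pieri n kap d mu nu"
 define al where "al = apieri n kap d mu nu"
 have P: "mu \<in> Par n" "nu \<in> Par n" using PDn_D[OF mu] PDn_D[OF nu] by auto
 \<comment> \<open>the sizes differ\<close>
 have ne: "nu \<noteq> mu" using PDn_D[OF mu] PDn_D[OF nu] by auto
 have eq: "(X * b + al) * dl n kap X nu = dl n kap X mu * ((X + 1) * b + al)" for X
  using pieri_eigen[OF kap n mu nu, of X] by (simp add: b_def al_def)
 have b0: "b \<noteq> 0"
 proof
  assume b: "b = 0"
  then have "al \<noteq> 0" using nz by (simp add: b_def al_def)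
  then have "dl n kap X nu = dl n kap X mu" for X using eq[of X] b by simp
  then have "dpoly n kap nu = dpoly n kap mu" unfolding poly_dpoly[symmetric] by (simp add: poly_eq_poly_eq_iff[symmetric] fun_eq_iff)
  then show False using dpoly_inj[OF kap P(2,1)] ne by simp
 qed
 let ?R = "\<lambda>la. av n kap la ` {..<n}"
 define a where "a = al / b"
 have ala: "al = a * b" using b0 by (simp add: a_def)
 have eqa: "(X + a) * dl n kap X nu = dl n kap X mu * (X + 1 + a)" for X
 proof -
  have "b * ((X + a) * dl n kap X nu) = b * (dl n kap X mu * (X + 1 + a))" using eq[of X] unfolding ala by (simp add: algebra_simps)
  then show ?thesis using b0 by simp
 qed
 \<comment> \<open>compare roots: first at \<open>X = -a\<close>, then at all negative integers\<close>
 have "dl n kap (- a) mu = 0" using eqa[of "- a"] by simp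
 then obtain i where i: "i < n" "a = of_nat (av n kap mu i)" by (auto simp: dl_zero)
 define w where "w = av n kap mu i"
 have aw: "a = of_nat w" using i by (simp add: w_def)
 have iff: "(v = w \<or> v \<in> ?R nu) \<longleftrightarrow> (v \<in> ?R mu \<or> v = Suc w)" for v
 proof -
  have e1: "- of_nat v + a = 0 \<longleftrightarrow> v = w" unfolding aw by (auto simp: eq_neg_iff_add_eq_0[symmetric] neg_eq_iff_add_eq_0)
  have e2: "- of_nat v + 1 + a = 0 \<longleftrightarrow> v = Suc w"
  proof -
   have "- of_nat v + 1 + a = of_nat (Suc w) - (of_nat v :: complex)" by (simp add: aw)
   then show ?thesis by (simp only: right_minus_eq of_nat_eq_iff) auto
  qed
  have "(- of_nat v + a) * dl n kap (- of_nat v) nu = 0 \<longleftrightarrow> dl n kap (- of_nat v) mu * (- of_nat v + 1 + a) = 0"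
   unfolding eqa ..
  then show ?thesis unfolding mult_eq_0_iff e1 e2 dl_zero_iff .
 qed
 have wR: "w \<in> ?R mu" using i(1) by (simp add: w_def)
 have cards: "card (?R mu) = n" "card (?R nu) = n" using av_image_card[OF kap] P by auto
 have fin: "finite (?R mu)" "finite (?R nu)" by auto
 \<comment> \<open>otherwise \<open>nu\<close> and \<open>mu\<close> would have the same roots\<close>
 have wN: "w \<notin> ?R nu"
 proof
  assume "w \<in> ?R nu"
  then have "?R nu = insert (Suc w) (?R mu)" using wR by (intro Set.set_eqI) (metis iff insert_iff)
  then have "?R mu \<subseteq> ?R nu" by (metis subset_insertI)
  then have "?R mu = ?R nu" using card_subset_eq[OF fin(2)] cards by metis
  then have "av n kap nu j = av n kap mu j" if "j < n" for j
   using strict_dec_image_unique[of n "av n kap nu" "av n kap mu" j] av_strict[OF kap P(1)] av_strict[OF kap P(2)] that by auto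
  then have "nu = mu" by (intro Par_eqI[OF P(2,1)]) (simp add: av_def)
  then show False using ne by simp
 qed
 have Rnu: "?R nu = insert (Suc w) (?R mu - {w})"
 proof (rule Set.set_eqI)
  fix v show "v \<in> ?R nu \<longleftrightarrow> v \<in> insert (Suc w) (?R mu - {w})"
   using iff[of v] wN by (cases "v = w") auto
 qed
 have SwR: "Suc w \<notin> ?R mu"
 proof
  assume "Suc w \<in> ?R mu"
  then have "?R nu = ?R mu - {w}" unfolding Rnu by auto
  then have "card (?R nu) = n - 1" using wR cards by simp
  then show False using cards n by simp
 qed
 define f where "f = (av n kap mu)(i := Suc w)"
 have fdec: "f k < f j" if "j < k" "k < n" for j k
 proof -
  have *: "av n kap mu k < av n kap mu j" using av_strict[OF kap P(1) that] .
  have "av n kap mu j \<noteq> Suc w" using SwR that by (metis dual_order.strict_trans imageI lessThan_iff)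
  then show ?thesis using * by (auto simp: f_def w_def)
 qed
 have inj: "inj_on (av n kap mu) {..<n}" using cards(1) by (simp add: eq_card_imp_inj_on)
 have "f ` {..<n} = insert (Suc w) (av n kap mu ` ({..<n} - {i}))" using i(1) by (auto simp: f_def image_iff)
 also have "av n kap mu ` ({..<n} - {i}) = ?R mu - {w}"
  using inj_on_image_set_diff[OF inj, of "{..<n}" "{i}"] i(1) by (simp add: w_def)
 finally have fim: "f ` {..<n} = ?R nu" using Rnu by simp
 have avn: "av n kap nu j = f j" if "j < n" for j
  by (rule strict_dec_image_unique[of n "av n kap nu" f j, OF av_strict[OF kap P(2)] fdec fim[symmetric] that])
 have "nu = mu(i := Suc (mu i))"
 proof
  fix j
  show "nu j = (mu(i := Suc (mu i))) j"
  proof (cases "j < n")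
   case True
   have "av n kap nu j = f j" by (rule avn[OF True])
   then show ?thesis by (cases "j = i") (auto simp: f_def w_def av_def)
  next
   case False
   then show ?thesis using Par_zero[OF P(1), of j] Par_zero[OF P(2), of j] i(1) by auto
  qed
 qed
 moreover have "al = b * of_nat (av n kap mu i)" using ala i(2) by simp
 ultimately show thesis using that i(1) b0 by (simp add: b_def al_def)
qed

section \<open>The lowering operator in the Jack basis\<close>

definition lowc :: "nat \<Rightarrow> nat \<Rightarrow> nat \<Rightarrow> natfun \<Rightarrow> natfun \<Rightarrow> complex" where
 "lowc n kap d lam mu = jcoef n kap d (E0 n (jack n kap lam)) mu"

lemma lowc: assumes "kap > 0" "lam \<in> PDn n (Suc d)"
 shows "E0 n (jack n kap lam) = (\<Sum>mu\<in>PDn n d. const_pol (lowc n kap d lam mu) * jack n kap mu)"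
 unfolding lowc_def
 by (rule jcoef[OF assms(1) sympol_E0[OF PDn_jack(1)[OF assms]] hom_E0[OF PDn_jack(2)[OF assms]]])

lemma E0_sum: "E0 n (\<Sum>s\<in>S. const_pol (c s) * f s) = (\<Sum>s\<in>S. const_pol (c s) * E0 n (f s))"
proof -
 have z: "E0 n 0 = 0" by (simp add: E0_def partial_deriv_def)
 have a: "E0 n (f + g) = E0 n f + E0 n g" for f g by (simp add: E0_def partial_deriv_add sum.distrib)
 have pd: "partial_deriv k (const_pol c * f) = const_pol c * partial_deriv k f" for k c f
  by (rule poly_mapping_eqI) (simp add: lookup_partial_deriv)
 have m: "E0 n (const_pol c * f) = const_pol c * E0 n f" for c f by (simp add: E0_def pd sum_distrib_left)
 show ?thesis by (induction S rule: infinite_finite_induct) (auto simp: z a m)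
qed

lemma Aop_sum: "Aop n kap (\<Sum>s\<in>S. const_pol (c s) * f s) = (\<Sum>s\<in>S. const_pol (c s) * Aop n kap (f s))"
proof -
 have z: "Aop n kap 0 = 0" by (simp add: Aop_def)
 have a: "Aop n kap (f + g) = Aop n kap f + Aop n kap g" for f g by (simp add: Aop_Rop Rop_add)
 show ?thesis by (induction S rule: infinite_finite_induct) (auto simp: z a Aop_cmult)
qed

lemma jnorm_nonzero: "kap > 0 \<Longrightarrow> lam \<in> PDn n d \<Longrightarrow> jnorm kap lam \<noteq> 0"
 using kernel_jack_all(1)[of kap lam d] by (simp add: PDn_def)

text \<open>
 The coefficients of the two sides of \<open>kernel_lowering\<close> in the products
 \<open>P\<^sub>\<mu>(x) P\<^sub>\<lambda>(y)\<close>.\<close>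

theorem lowc_pieri:
 assumes kap: "kap > 0" and n: "n \<ge> 1" and lam: "lam \<in> PDn n (Suc d)" and mu: "mu \<in> PDn n d"
 shows "lowc n kap d lam mu * jnorm kap mu = jnorm kap lam * (apieri n kap d mu lam + of_nat kap * pieri n kap d mu lam)"
proof -
 let ?I = "PDn n d" and ?J = "PDn n (Suc d)" and ?P = "jack n kap"
 define t where "t mu lam = inverse (jnorm kap lam) * lowc n kap d lam mu -
   inverse (jnorm kap mu) * (apieri n kap d mu lam + of_nat kap * pieri n kap d mu lam)" for mu lam
 have "t mu lam = 0"
 proof (rule bilinear_zero[OF lin_indep_PDn[OF kap] lin_indep_PDn[OF kap], of 1 1, OF _ _ _ mu lam])
  fix x y
  have "E0 n (Kpol n kap (Suc d) y) = (\<Sum>lam\<in>?J. const_pol (inverse (jnorm kap lam) * eval_pol (?P lam) y) * E0 n (?P lam))"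
   unfolding kernel_jack[OF kap, of n "Suc d" y] by (rule E0_sum)
  then have 1: "eval_pol (E0 n (Kpol n kap (Suc d) y)) x =
   (\<Sum>mu\<in>?I. \<Sum>lam\<in>?J. inverse (jnorm kap lam) * lowc n kap d lam mu * eval_pol (?P mu) x * eval_pol (?P lam) y)"
   by (subst sum.swap) (simp add: lowc[OF kap] sum_distrib_left mult_ac)
  have "Aop n kap (Kpol n kap d x) + const_pol (of_nat kap) * (psum1 n * Kpol n kap d x) =
   (\<Sum>mu\<in>?I. const_pol (inverse (jnorm kap mu) * eval_pol (?P mu) x) * (Aop n kap (?P mu) + const_pol (of_nat kap) * (psum1 n * ?P mu)))"
   unfolding kernel_jack[OF kap, of n d x] Aop_sum sum_distrib_left sum.distrib[symmetric]
   by (intro sum.cong refl) (simp add: algebra_simps)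
  then have 2: "eval_pol (Aop n kap (Kpol n kap d x) + const_pol (of_nat kap) * (psum1 n * Kpol n kap d x)) y =
   (\<Sum>mu\<in>?I. \<Sum>lam\<in>?J. inverse (jnorm kap mu) * (apieri n kap d mu lam + of_nat kap * pieri n kap d mu lam) * eval_pol (?P mu) x * eval_pol (?P lam) y)"
   unfolding sum_distrib_left
   by (simp add: pieri[OF kap] sum_distrib_left sum.distrib[symmetric] distrib_left distrib_right mult_ac)
  have "(\<Sum>mu\<in>?I. \<Sum>lam\<in>?J. t mu lam * eval_pol (?P mu) x * eval_pol (?P lam) y) = 0"
   using kernel_lowering[OF n, of kap d y x] unfolding 1 2 t_def left_diff_distrib sum_subtractf by simp
  then show "eval_pol 1 x * eval_pol 1 y * (\<Sum>mu\<in>?I. \<Sum>lam\<in>?J. t mu lam * eval_pol (?P mu) x * eval_pol (?P lam) y) = 0" by simp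
 qed auto
 then show ?thesis using jnorm_nonzero[OF kap lam] jnorm_nonzero[OF kap mu] unfolding t_def by (simp add: field_simps)
qed

text \<open>
 In exactly as many variables as there are parts, the monomial of \<open>\<lambda>\<close> with the
 last part lowered gets a contribution from \<open>x\<close>-to-the-\<open>\<lambda>\<close> only:
 the other candidates raise an earlier exponent, and are not dominated by \<open>\<lambda>\<close>.\<close>

lemma E0_jack_nonzero:
 assumes kap: "kap > 0" and lam: "is_partition lam" and k: "part_length lam = Suc k"
 shows "E0 (Suc k) (jack (Suc k) kap lam) \<noteq> 0"
proof -
 let ?P = "jack (Suc k) kap lam"
 define m where "m = pm (Suc k) (lam(k := lam k - 1))"
 have lP: "lam \<in> Par (Suc k)" using lam k by (simp add: Par_def)
 have lk: "lam k \<noteq> 0" using partition_support[OF lam, of k] k by simp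
 have u: "unitri (Suc k) lam ?P" by (rule unitri_jack[OF kap lP])
 have zero: "lkp ?P (sgl j 1 + m) = 0" if "j < k" for j
 proof (rule ccontr)
  assume "lkp ?P (sgl j 1 + m) \<noteq> 0"
  then have d: "dle (Suc k) (lkp (sgl j 1 + m)) lam" using u by (simp add: unitri_def tri_def in_keys_iff)
  have "(\<Sum>i<Suc j. lkp (sgl j 1 + m) i) \<le> (\<Sum>i<Suc j. lam i)" using dle_prefix[OF d, of "Suc j"] that by simp
  moreover have "(\<Sum>i<Suc j. lkp (sgl j 1 + m) i) = (\<Sum>i<Suc j. lam i + (if i = j then 1 else 0))"
   using that by (intro sum.cong refl) (auto simp: lookup_add m_def lookup_single)
  ultimately show False by (simp add: sum.distrib)
 qed
 have "sgl k 1 + m = pm (Suc k) lam" unfolding m_def using lk by (intro poly_mapping_eqI) (auto simp: lookup_add lookup_single)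
 then have top: "lkp ?P (sgl k 1 + m) = 1" using u by (simp add: unitri_def)
 have "lkp (E0 (Suc k) ?P) m = (\<Sum>j<Suc k. of_nat (Suc (lkp m j)) * lkp ?P (sgl j 1 + m))"
  by (simp add: E0_def lookup_sum lookup_add lookup_partial_deriv)
 also have "\<dots> = of_nat (Suc (lkp m k))" by (simp add: zero[simplified] top[simplified] del: of_nat_Suc)
 finally have "lkp (E0 (Suc k) ?P) m \<noteq> 0" by (simp del: of_nat_Suc)
 then show ?thesis by auto
qed

lemma cut_psum1: "k \<le> n \<Longrightarrow> cut k (psum1 n) = psum1 k"
proof -
 assume kn: "k \<le> n"
 have cv: "cut k (var i) = (if i < k then var i else 0)" for i by (auto simp: cut_def var_def)
 have "cut k (psum1 n) = (\<Sum>i<n. if i < k then var i else 0)" unfolding psum1_def cv[symmetric] unfolding cut_def dgn_sum ..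
 also have "\<dots> = (\<Sum>i<k. var i)" by (rule sum.mono_neutral_cong_right) (use kn in auto)
 finally show ?thesis by (simp add: psum1_def)
qed

lemma PDn_mono: "k \<le> n \<Longrightarrow> PDn k d \<subseteq> PDn n d" by (auto simp: PDn_def Par_def)

text \<open>
 Setting variables to zero maps Jack polynomials to Jack polynomials, so the coefficients do not
 depend on the number of variables.\<close>

lemma pieri_stable:
 assumes kap: "kap > 0" and kn: "k \<le> n" and mu: "mu \<in> PDn k d" and nu: "nu \<in> PDn k (Suc d)"
 shows "pieri k kap d mu nu = pieri n kap d mu nu"
proof -
 have mu': "mu \<in> PDn n d" using PDn_mono[OF kn] mu by blast
 have cj: "cut k (jack n kap la) = jack k kap la" if "is_partition la" for la by (rule cut_jack[OF kap that kn])
 have "psum1 k * jack k kap mu = cut k (psum1 n * jack n kap mu)"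
  using PDn_D[OF mu] by (simp add: cut_mult cut_psum1[OF kn] cj)
 also have "\<dots> = (\<Sum>nu\<in>PDn n (Suc d). const_pol (pieri n kap d mu nu) * cut k (jack n kap nu))"
  unfolding pieri(1)[OF kap mu'] unfolding cut_def dgn_sum const_pol_def dgn_cmult ..
 also have "\<dots> = (\<Sum>nu\<in>PDn n (Suc d). const_pol (pieri n kap d mu nu) * jack k kap nu)"
  by (intro sum.cong refl) (use PDn_D cj in auto)
 also have "\<dots> = (\<Sum>nu\<in>PDn k (Suc d). const_pol (pieri n kap d mu nu) * jack k kap nu)"
 proof (rule sum.mono_neutral_right[OF finite_PDn PDn_mono[OF kn]], rule ballI)
  fix nu assume "nu \<in> PDn n (Suc d) - PDn k (Suc d)"
  then have "is_partition nu" "part_length nu > k" by (auto simp: PDn_def Par_def PD_def)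
  then show "const_pol (pieri n kap d mu nu) * jack k kap nu = 0" by (simp add: jack_eq_0[OF kap])
 qed
 finally show ?thesis unfolding pieri_def[of k] by (rule jcoef_unique[OF kap _ nu])
qed

text \<open>
 By \<open>pieri_stable\<close> the number of variables may be taken to be the number of parts.
 There \<open>E P\<^sub>\<lambda> \<noteq> 0\<close>, and by \<open>lowc_pieri\<close> a nonzero
 coefficient of it is a nonzero Pieri coefficient.\<close>

theorem pieri_edge:
 assumes kap: "kap > 0" and lam: "lam \<in> PDn n (Suc d)"
 obtains mu where "mu \<in> PDn n d" "pieri n kap d mu lam \<noteq> 0"
proof -
 have p: "is_partition lam" and ln: "part_length lam \<le> n" and sz: "part_size lam = Suc d" using PDn_D[OF lam] by auto
 have "part_length lam \<noteq> 0" using sz part_size_sum[OF p, of 0] by auto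
 then obtain k where k: "part_length lam = Suc k" by (cases "part_length lam") auto
 have lk: "lam \<in> PDn (Suc k) (Suc d)" using p k sz by (simp add: PDn_def Par_def PD_def)
 have "\<exists>mu\<in>PDn (Suc k) d. lowc (Suc k) kap d lam mu \<noteq> 0"
  using lowc[OF kap lk] E0_jack_nonzero[OF kap p k] by (metis (no_types, lifting) const_pol_0 mult_zero_left sum.neutral)
 then obtain mu where mu: "mu \<in> PDn (Suc k) d" "lowc (Suc k) kap d lam mu \<noteq> 0" by blast
 have "pieri (Suc k) kap d mu lam \<noteq> 0 \<or> apieri (Suc k) kap d mu lam \<noteq> 0"
  using lowc_pieri[OF kap _ lk mu(1)] mu(2) jnorm_nonzero[OF kap mu(1)] by auto
 then have "pieri (Suc k) kap d mu lam \<noteq> 0" using pieri_support[OF kap _ mu(1) lk] by (metis le_add1 plus_1_eq_Suc)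
 then have "pieri n kap d mu lam \<noteq> 0" using pieri_stable[OF kap _ mu(1) lk, of n] ln k by simp
 then show thesis using that PDn_mono[of "Suc k" n d] ln k mu(1) by auto
qed

section \<open>The torus pairing\<close>

definition lx :: "nat \<Rightarrow> lpol" where "lx i = sgl (sgl i 1) 1"
definition lxi :: "nat \<Rightarrow> lpol" where "lxi i = sgl (sgl i (- 1)) 1"

lemma lxi_lx [simp]: "lxi i * lx i = 1" "lx i * lxi i = 1"
 by (simp_all add: lx_def lxi_def mult_single flip: single_add)

lemma emb_var: "emb (var i) = lx i"
proof -
 have "toint (sgl i 1) = sgl i 1" by (rule poly_mapping_eqI) (simp add: lookup_single when_def)
 then show ?thesis by (simp add: emb_def var_def lx_def)
qed

lemma lbar_lx: "lbar (lx i) = lxi i" by (simp add: lx_def lxi_def single_uminus)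
lemma lev_lx [simp]: "lev (lx i) y = y i" by (simp add: lx_def lmev_def)
lemma lev_lxi [simp]: "lev (lxi i) y = inverse (y i)" by (simp add: lxi_def lmev_def)

lemma lvars_lx: "i < n \<Longrightarrow> lvars n (lx i)" by (simp add: lx_def lvars_single)
lemma lvars_lxi: "i < n \<Longrightarrow> lvars n (lxi i)" by (simp add: lxi_def lvars_single)

text \<open>
 The weight:
 \<open>(x\<^sub>i - x\<^sub>j) (1/x\<^sub>i - 1/x\<^sub>j) = (1 - x\<^sub>i/x\<^sub>j) (1 - x\<^sub>j/x\<^sub>i)\<close>.\<close>

definition Lw :: "nat \<Rightarrow> nat \<Rightarrow> lpol" where "Lw n kap = (emb (vand n) * lbar (emb (vand n))) ^ kap"

lemma lbar_Lw: "lbar (Lw n kap) = Lw n kap"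
 by (simp add: Lw_def lbar_power lbar_mult lbar_lbar mult.commute)

lemma emb_vand: "emb (vand n) = (\<Prod>j<n. \<Prod>i<j. lx i - lx j)"
 by (simp add: vand_def emb_prod emb_diff emb_var)

lemma lbar_emb_vand: "lbar (emb (vand n)) = (\<Prod>j<n. \<Prod>i<j. lxi i - lxi j)"
 by (simp add: emb_vand lbar_prod lbar_diff lbar_lx)

lemma prod_off_diagonal:
 fixes g :: "nat \<Rightarrow> nat \<Rightarrow> 'a::comm_monoid_mult"
 shows "(\<Prod>i<n. \<Prod>j\<in>{..<n} - {i}. g i j) = (\<Prod>j<n. \<Prod>i<j. g i j * g j i)"
proof (induction n)
 case (Suc n)
 have 1: "(\<Prod>j\<in>{..<Suc n} - {i}. g i j) = g i n * (\<Prod>j\<in>{..<n} - {i}. g i j)" if "i < n" for i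
 proof -
  have "{..<Suc n} - {i} = insert n ({..<n} - {i})" using that by auto
  then show ?thesis by simp
 qed
 have 2: "{..<Suc n} - {n} = {..<n}" by auto
 show ?case by (simp add: 1 2 prod.distrib Suc.IH[unfolded prod.distrib] mult_ac)
qed simp

lemma lev_Lw: assumes "\<And>i. y i \<noteq> 0" shows "lev (Lw n kap) y = torus_weight n kap y"
proof -
 have "torus_weight n kap y = (\<Prod>j<n. \<Prod>i<j. (1 - inverse (y i) * y j) ^ kap * (1 - inverse (y j) * y i) ^ kap)"
  unfolding torus_weight_def by (rule prod_off_diagonal)
 also have "\<dots> = (\<Prod>j<n. \<Prod>i<j. (y i - y j) * (inverse (y i) - inverse (y j))) ^ kap"
  unfolding prod_power_distrib power_mult_distrib[symmetric]
  by (intro prod.cong refl arg_cong[of _ _ "\<lambda>z. z ^ kap"]) (use assms in \<open>simp add: field_simps\<close>)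
 also have "\<dots> = lev (Lw n kap) y"
  by (simp add: Lw_def lev_power lev_mult assms lbar_emb_vand lev_prod prod.distrib) (simp add: emb_vand lev_prod assms)
 finally show ?thesis ..
qed

lemma lvars_Lw: "lvars n (Lw n kap)"
 unfolding Lw_def lbar_emb_vand unfolding emb_vand
 by (intro lvars_power lvars_mult lvars_prod lvars_diff lvars_lx lvars_lxi) auto

lemma ltheta_prod_eigen:
 assumes "\<And>s. s \<in> S \<Longrightarrow> ltheta k (f s) = of_int (c s) * f s"
 shows "ltheta k (prod f S) = of_int (sum c S) * prod f S"
 using assms by (induction S rule: infinite_finite_induct) (simp_all add: ltheta_mult algebra_simps)

lemma ltheta_cint: "ltheta k (of_int c * f) = of_int c * ltheta k f"
proof -
 have "(of_int c :: lpol) = sgl 0 (of_int c)" by simp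
 then show ?thesis by (simp only: ltheta_def dgn_cmult)
qed

lemma ltheta_uminus: "ltheta k (- f) = - ltheta k f"
 using ltheta_cint[of k "-1" f] by simp

text \<open>Inverting the variables multiplies the Vandermonde product by a Laurent monomial, of degree
 \<open>-(n - 1)\<close> in each variable.\<close>

lemma lbar_vand_unit:
 obtains u where "lbar (emb (vand n)) = u * emb (vand n)"
  "\<And>k. k < n \<Longrightarrow> ltheta k u = - of_nat (n - 1) * u"
proof -
 define w where "w i j = - (lxi i * lxi j)" for i j
 define u where "u = (\<Prod>j<n. \<Prod>i<j. w i j)"
 have "w i j * (lx i - lx j) = lxi i - lxi j" for i j
 proof -
  have "w i j * (lx i - lx j) = lxi i * (lxi j * lx j) - lxi j * (lxi i * lx i)"
   by (simp add: w_def algebra_simps)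
  then show ?thesis by simp
 qed
 then have "lbar (emb (vand n)) = u * emb (vand n)"
  unfolding lbar_emb_vand unfolding emb_vand u_def prod.distrib[symmetric] by simp
 moreover have "ltheta k u = - of_nat (n - 1) * u" if k: "k < n" for k
 proof -
  define c where "c i j = - ((if i = k then 1 else 0) + (if j = k then 1 else 0 :: int))" for i j :: nat
  have xi: "ltheta k (lxi i) = of_int (if i = k then -1 else 0) * lxi i" for i
   by (simp add: lxi_def ltheta_single lookup_single single_uminus)
  have "ltheta k (w i j) = of_int (c i j) * w i j" for i j
   by (auto simp: w_def ltheta_uminus ltheta_mult xi c_def algebra_simps)
  then have "ltheta k u = of_int (\<Sum>j<n. \<Sum>i<j. c i j) * u"
   unfolding u_def by (intro ltheta_prod_eigen)
  moreover have "(\<Sum>j<n. \<Sum>i<j. c i j) = - int (n - 1)"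
  proof -
   have "(\<Sum>i<j. c i j) = - ((if k < j then 1 else 0) + (if j = k then int k else 0))" for j
    unfolding c_def sum_negf sum.distrib by (auto simp: sum.delta)
   then have "(\<Sum>j<n. \<Sum>i<j. c i j) = - ((\<Sum>j<n. if k < j then 1 else 0) + int k)"
    using k by (simp add: sum_negf sum_subtractf sum.distrib sum.delta)
   also have "(\<Sum>j<n. if k < j then 1 else 0 :: int) = int (card {j\<in>{..<n}. k < j})" by (simp add: sum.If_cases Int_def)
   also have "{j\<in>{..<n}. k < j} = {k<..<n}" by auto
   finally show ?thesis using k by simp
  qed
  ultimately show ?thesis by simp
 qed
 ultimately show thesis using that by blast
qed

lemma emb_vand_nonzero: "emb (vand n) \<noteq> 0" by (simp add: emb_eq_0)

lemma ltheta_power: "ltheta k (f ^ m) * f = of_nat m * f ^ m * ltheta k f"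
proof (induction m)
 case (Suc m)
 have "ltheta k (f ^ Suc m) * f = f ^ Suc m * ltheta k f + f * (ltheta k (f ^ m) * f)"
  unfolding power_Suc ltheta_mult by (simp only: distrib_right distrib_left mult_ac)
 then show ?case unfolding Suc.IH by (simp only: power_Suc of_nat_Suc distrib_right distrib_left mult_1_left mult_ac)
qed simp

text \<open>
 The logarithmic derivative of the weight, multiplied by the Vandermonde product in order to stay
 within Laurent polynomials.\<close>

lemma ltheta_Lw:
 assumes k: "k < n"
 shows "emb (vand n) * ltheta k (Lw n kap) =
  of_nat kap * (2 * emb (theta k (vand n)) - of_nat (n - 1) * emb (vand n)) * Lw n kap"
proof -
 let ?v = "emb (vand n)"
 obtain u where u: "lbar ?v = u * ?v" "ltheta k u = - of_nat (n - 1) * u" using lbar_vand_unit k by metis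
 let ?W = "?v * (u * ?v)" and ?t = "2 * ltheta k ?v - of_nat (n - 1) * ?v"
 have L: "Lw n m = ?W ^ m" for m by (simp add: Lw_def u)
 have W: "?v * ltheta k ?W = ?t * ?W" by (simp add: ltheta_mult u(2) algebra_simps)
 have u0: "u \<noteq> 0"
 proof
  assume "u = 0"
  then have "lbar (lbar ?v) = 0" using u(1) by simp
  then show False by (simp add: lbar_lbar emb_vand_nonzero)
 qed
 then have nz: "?W \<noteq> 0" by (simp add: emb_vand_nonzero)
 have "?W * (?v * ltheta k (?W ^ kap)) = of_nat kap * ?W ^ kap * (?v * ltheta k ?W)"
 proof -
  have "?W * (?v * ltheta k (?W ^ kap)) = ?v * (ltheta k (?W ^ kap) * ?W)" by (simp only: mult_ac)
  then show ?thesis unfolding ltheta_power by (simp only: mult_ac)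
 qed
 also have "\<dots> = ?W * (of_nat kap * ?t * ?W ^ kap)" unfolding W by (simp only: mult_ac)
 finally have "?W * (?v * ltheta k (?W ^ kap)) = ?W * (of_nat kap * ?t * ?W ^ kap)" .
 from mult_left_cancel[OF nz, THEN iffD1, OF this]
 have "?v * ltheta k (?W ^ kap) = of_nat kap * ?t * ?W ^ kap" .
 then show ?thesis by (simp only: L ltheta_emb)
qed

lemma emb_nat: "emb (of_nat k) = of_nat k" by (induction k) (auto simp: emb_add)

lemma emb_of_nat: "emb (of_nat k * f) = of_nat k * emb f" by (simp add: emb_nat emb_mult)

lemma Lw_euler: "(\<Sum>k<n. lx k * ltheta k (Lw n kap)) = of_nat (kap * (n - 1)) * emb (psum1 n) * Lw n kap"
proof -
 let ?v = "emb (vand n)" and ?L = "Lw n kap"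
 have "?v * (\<Sum>k<n. lx k * ltheta k ?L) = (\<Sum>k<n. lx k * (?v * ltheta k ?L))"
  unfolding sum_distrib_left by (intro sum.cong refl) (simp only: mult_ac)
 also have "\<dots> = (\<Sum>k<n. lx k * (of_nat kap * (2 * emb (theta k (vand n)) - of_nat (n - 1) * ?v) * ?L))"
  by (intro sum.cong refl) (simp add: ltheta_Lw)
 also have "\<dots> = of_nat kap * ?L * (2 * (\<Sum>k<n. lx k * emb (theta k (vand n))) - of_nat (n - 1) * ?v * (\<Sum>k<n. lx k))"
  unfolding sum_distrib_left sum_subtractf[symmetric]
  by (intro sum.cong refl) (simp only: ring_distribs mult_ac)
 also have "(\<Sum>k<n. lx k * emb (theta k (vand n))) = emb (\<Sum>k<n. var k * theta k (vand n))"
  by (simp add: emb_sum emb_mult emb_var)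
 also have "\<dots> = of_nat (n - 1) * emb (psum1 n) * ?v" unfolding vand_euler by (simp add: emb_nat emb_mult)
 also have "(\<Sum>k<n. lx k) = emb (psum1 n)" by (simp add: psum1_def emb_sum emb_var)
 finally have "?v * (\<Sum>k<n. lx k * ltheta k ?L) = ?v * (of_nat (kap * (n - 1)) * emb (psum1 n) * ?L)"
  unfolding of_nat_mult by (simp only: ring_distribs mult_ac add_ac mult_2 mult_2_right) (simp only: mult_ac add_diff_cancel_left' add_diff_cancel_right' add_diff_eq)
 from mult_left_cancel[OF emb_vand_nonzero, THEN iffD1, OF this] show ?thesis .
qed

text \<open>
 The torus pairing; it is bilinear, the complex conjugation being replaced by \<open>lbar\<close>.\<close>

definition tf :: "nat \<Rightarrow> nat \<Rightarrow> mpol \<Rightarrow> mpol \<Rightarrow> complex" where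
 "tf n kap f g = CT (emb f * lbar (emb g) * Lw n kap)"

lemma tf_sym: "tf n kap f g = tf n kap g f"
 using CT_lbar[of "emb f * lbar (emb g) * Lw n kap"]
 by (simp add: tf_def lbar_mult lbar_lbar lbar_Lw mult.commute)

lemma emb_const: "emb (const_pol c) = sgl 0 c" by (simp add: emb_def const_pol_def)

lemma tf_cmult: "tf n kap (const_pol c * f) g = c * tf n kap f g"
 by (simp add: tf_def emb_mult emb_const mult.assoc CT_cmult)

lemma tf_add: "tf n kap (f + f') g = tf n kap f g + tf n kap f' g"
 by (simp add: tf_def emb_add distrib_right CT_add)

lemma tf_sum: "tf n kap (\<Sum>s\<in>S. const_pol (c s) * f s) g = (\<Sum>s\<in>S. c s * tf n kap (f s) g)"
proof -
 have "tf n kap 0 g = 0" by (simp add: tf_def)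
 then show ?thesis by (induction S rule: infinite_finite_induct) (simp_all add: tf_add tf_cmult)
qed

lemma tf_sum_right: "tf n kap f (\<Sum>s\<in>S. const_pol (c s) * g s) = (\<Sum>s\<in>S. c s * tf n kap f (g s))"
 using tf_sum[of n kap c g S f] by (simp add: tf_sym)

text \<open>Integration by parts, with the Euler type identity for the weight.\<close>

theorem tf_raising_lowering: "tf n kap (Aop n kap f + psum1 n * f) g = tf n kap f (E0 n g)"
proof -
 let ?L = "Lw n kap" and ?F = "emb f" and ?G = "lbar (emb g)"
 have E: "lbar (emb (E0 n g)) = (\<Sum>k<n. - (lx k * ltheta k ?G))"
 proof -
  have "lbar (emb (partial_deriv k g)) = - (lx k * ltheta k ?G)" for k
  proof -
   have "lxi k * lbar (emb (partial_deriv k g)) = lbar (emb (theta k g))"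
    unfolding theta_eq[symmetric] by (simp add: emb_mult lbar_mult emb_var lbar_lx)
   then have "lxi k * lbar (emb (partial_deriv k g)) = - ltheta k ?G"
    by (simp add: ltheta_lbar ltheta_emb)
   then have "lx k * (lxi k * lbar (emb (partial_deriv k g))) = lx k * (- ltheta k ?G)" by (rule arg_cong)
   then show ?thesis by (simp flip: mult.assoc)
  qed
  then show ?thesis by (simp add: E0_def emb_sum lbar_sum)
 qed
 have lxk: "ltheta k (lx k) = lx k" for k by (simp add: lx_def ltheta_single)
 have "tf n kap f (E0 n g) = (\<Sum>k<n. CT (?F * - (lx k * ltheta k ?G) * ?L))"
  unfolding tf_def E sum_distrib_left sum_distrib_right CT_sum ..
 also have "\<dots> = (\<Sum>k<n. CT (ltheta k (lx k * ?F * ?L) * ?G))"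
  unfolding CT_parts by (intro sum.cong refl) (simp only: CT_uminus[symmetric] mult_minus_left mult_minus_right mult_ac)
 also have "\<dots> = CT ((\<Sum>k<n. ltheta k (lx k * ?F * ?L)) * ?G)"
  unfolding sum_distrib_right CT_sum ..
 also have "(\<Sum>k<n. ltheta k (lx k * ?F * ?L)) = (\<Sum>k<n. lx k) * ?F * ?L + (\<Sum>k<n. lx k * ltheta k ?F) * ?L + ?F * (\<Sum>k<n. lx k * ltheta k ?L)"
  unfolding sum_distrib_left sum_distrib_right sum.distrib[symmetric]
  by (intro sum.cong refl) (simp add: ltheta_mult lxk algebra_simps)
 also have "\<dots> = emb (Aop n kap f + psum1 n * f) * ?L"
 proof -
  have c: "emb (const_pol (of_nat ((n - 1) * kap))) = of_nat ((n - 1) * kap)"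
   using emb_of_nat[of "(n - 1) * kap" 1] unfolding const_pol_of_nat by simp
  have "emb (Aop n kap f) = of_nat (kap * (n - 1)) * (\<Sum>k<n. lx k) * ?F + (\<Sum>k<n. lx k * ltheta k ?F)"
   unfolding Aop_def emb_sum emb_mult emb_add emb_var c ltheta_emb sum_distrib_left sum_distrib_right sum.distrib[symmetric]
   by (intro sum.cong refl) (simp only: ring_distribs mult_ac)
  moreover have "emb (psum1 n) = (\<Sum>k<n. lx k)" by (simp add: psum1_def emb_sum emb_var)
  ultimately show ?thesis unfolding Lw_euler emb_add emb_mult by (simp only: ring_distribs mult_ac add_ac)
 qed
 finally show ?thesis by (simp add: tf_def mult_ac)
qed

lemma hom_vand: "\<exists>d. hom d (vand n)"
proof -
 have "\<exists>d. hom d (prod f S)" if "\<And>s. s \<in> S \<Longrightarrow> \<exists>d. hom d (f s)" for f and S :: "nat set"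
  using that
 proof (induction S rule: infinite_finite_induct)
  case (insert x S)
  then obtain d e where "hom d (f x)" "hom e (prod f S)" by blast
  then show ?case using insert hom_mult by (metis prod.insert)
 qed (auto intro!: exI[of _ 0] simp: hom_def lookup_one when_def deg_def)
 note P = this
 have "hom 1 (var i - var j)" for i j
  using hom_add[OF hom_var hom_const_mult[OF hom_var], of i "-1" j] by (simp add: const_pol_uminus)
 then show ?thesis unfolding vand_def by (intro P) blast
qed

lemma Lw_homogeneous: "(\<Sum>k<n. ltheta k (Lw n kap)) = 0"
proof -
 let ?v = "emb (vand n)"
 let ?E = "\<lambda>f. \<Sum>k<n. ltheta k f"
 have Em: "?E (f * g) = ?E f * g + f * ?E g" for f g
  by (simp add: ltheta_mult sum.distrib sum_distrib_left sum_distrib_right)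
 obtain d where "hom d (vand n)" using hom_vand by blast
 then have "(\<Sum>k<n. theta k (vand n)) = of_nat d * vand n" by (rule euler_hom[OF _ vars_in_vand])
 then have v: "?E ?v = of_nat d * ?v" by (simp add: ltheta_emb emb_of_nat flip: emb_sum)
 have "?E (lbar ?v) = - lbar (?E ?v)" by (simp add: ltheta_lbar lbar_sum sum_negf)
 also have "lbar (?E ?v) = of_nat d * lbar ?v"
 proof -
  have "(of_nat d :: lpol) = sgl 0 (of_nat d)" by simp
  then have "lbar (of_nat d) = of_nat d" by (metis lbar_single neg_equal_zero minus_zero)
  then show ?thesis unfolding v by (simp add: lbar_mult)
 qed
 finally have W: "?E (?v * lbar ?v) = 0" unfolding Em v by (simp add: algebra_simps)
 have "?E (f ^ m) = 0" if "?E f = 0" for f m by (induction m) (simp_all add: Em that)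
 then show ?thesis unfolding Lw_def using W by blast
qed

text \<open>
 The total Euler operator kills the weight, so integration by parts gives
 \<open>(d - e) \<langle>f, g\<rangle>' = 0\<close>.\<close>

lemma tf_degree:
 assumes f: "hom d f" "vars_in n f" and g: "hom e g" "vars_in n g" and ne: "d \<noteq> e"
 shows "tf n kap f g = 0"
proof -
 let ?L = "Lw n kap" and ?F = "emb f" and ?G = "lbar (emb g)"
 have F: "(\<Sum>k<n. ltheta k ?F) = of_nat d * ?F"
  using euler_hom[OF f] by (simp add: ltheta_emb emb_of_nat flip: emb_sum)
 have G: "(\<Sum>k<n. ltheta k ?G) = - (of_nat e * ?G)"
 proof -
  have "(of_nat e :: lpol) = sgl 0 (of_nat e)" by simp
  then have c: "lbar (of_nat e) = of_nat e" by (metis lbar_single minus_zero)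
  have "(\<Sum>k<n. ltheta k (emb g)) = of_nat e * emb g"
   using euler_hom[OF g] by (simp add: ltheta_emb emb_of_nat flip: emb_sum)
  then have "lbar (\<Sum>k<n. ltheta k (emb g)) = of_nat e * ?G" by (simp add: lbar_mult c)
  then show ?thesis by (simp add: ltheta_lbar lbar_sum sum_negf)
 qed
 have "0 = CT (\<Sum>k<n. ltheta k (?F * ?G * ?L))" by (simp add: CT_sum CT_ltheta)
 also have "(\<Sum>k<n. ltheta k (?F * ?G * ?L)) = (\<Sum>k<n. ltheta k ?F) * ?G * ?L + ?F * (\<Sum>k<n. ltheta k ?G) * ?L + ?F * ?G * (\<Sum>k<n. ltheta k ?L)"
  unfolding sum_distrib_left sum_distrib_right sum.distrib[symmetric]
  by (intro sum.cong refl) (simp add: ltheta_mult algebra_simps)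
 also have "\<dots> = (of_nat d - of_nat e) * (?F * ?G * ?L)"
  unfolding F G Lw_homogeneous by (simp add: algebra_simps)
 also have "(of_nat d - of_nat e :: lpol) = sgl 0 (of_nat d - of_nat e)" by (simp add: single_diff)
 finally have "(of_nat d - of_nat e) * tf n kap f g = 0" unfolding CT_cmult tf_def by simp
 then show ?thesis using ne by simp
qed

definition sqs :: "nat \<Rightarrow> nat \<Rightarrow> natfun \<Rightarrow> nat" where "sqs n kap lam = (\<Sum>i<n. (av n kap lam i)\<^sup>2)"

text \<open>The coefficient of \<open>X\<close>-to-the-\<open>(n - 2)\<close> in the generating function is, up to a factor and a
 constant in each degree, the divergence form operator \<open>f \<mapsto> \<Sum>\<theta>\<^sub>i (\<Delta> \<theta>\<^sub>i f) / \<Delta>\<close>, which is visibly self-adjoint.\<close>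

lemma jack_divergence_form:
 assumes kap: "kap > 0" and lam: "lam \<in> PDn n d"
 shows "(\<Sum>i<n. ltheta i (Lw n kap * emb (theta i (jack n kap lam)))) =
  sgl 0 (of_nat (sqs n kap lam) - (of_nat kap ^ 2 * of_nat (\<Sum>i<n. rho n i ^ 2) + of_nat (kap * (n - 1) * d))) *
   (Lw n kap * emb (jack n kap lam))"
proof -
 let ?P = "jack n kap lam" and ?L = "Lw n kap" and ?v = "emb (vand n)"
 note J = PDn_jack[OF kap lam]
 have vP: "vars_in n ?P" using J(1) by (simp add: sympol_iff)
 have deg: "(\<Sum>i<n. lkp m i) = d" if "m \<in> kys ?P" for m
  using deg_superset[of "{..<n}" m] vP J(2) that by (auto simp: vars_in_def hom_def in_keys_iff)
 have "(\<Sum>i<n. lam i) = d" using PDn_D[OF lam] part_size_sum[of lam n] by auto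
 then have a: "(\<Sum>i<n. of_nat (av n kap lam i)) = of_nat kap * of_nat (\<Sum>i<n. rho n i) + (of_nat d :: complex)"
  by (simp add: av_def sum.distrib mult.commute flip: of_nat_sum sum_distrib_left)
 have eig: "numer n kap (sekq n X) ?P = const_pol (\<Prod>i<n. X + of_nat (av n kap lam i)) * (vand n * ?P)" for X
  using quot_op(1)[OF J(1) qsym_sekq, of kap X] PDn_D[OF lam]
  by (simp add: quot_op_jack[OF kap] dl_def mult_ac)
 define h where "h = (of_nat (sqs n kap lam) :: complex)"
 define r where "r = of_nat kap ^ 2 * (of_nat (\<Sum>i<n. rho n i ^ 2) :: complex)"
 define S1 where "S1 = (\<Sum>i<n. emb (theta i (vand n)) * emb (theta i ?P))"
 define S2 where "S2 = (\<Sum>i<n. emb (theta i (theta i ?P)))"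
 have "const_pol h * (vand n * ?P) = const_pol r * (vand n * ?P)
   + const_pol (2 * of_nat kap) * (\<Sum>i<n. theta i (vand n) * theta i ?P) + vand n * (\<Sum>i<n. theta i (theta i ?P))"
  using numer_square[OF deg a eig] unfolding numer_sqq_expand h_def r_def sqs_def by simp
 then have "emb (const_pol h * (vand n * ?P)) = emb (const_pol r * (vand n * ?P)
   + const_pol (2 * of_nat kap) * (\<Sum>i<n. theta i (vand n) * theta i ?P) + vand n * (\<Sum>i<n. theta i (theta i ?P)))"
  by (rule arg_cong)
 then have 1: "sgl 0 h * (?v * emb ?P) = sgl 0 r * (?v * emb ?P) + sgl 0 (2 * of_nat kap) * S1 + ?v * S2"
  unfolding emb_add emb_mult emb_sum emb_const S1_def S2_def .
 have c2: "sgl 0 (2 * of_nat kap) = (2 * of_nat kap :: lpol)"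
  using single_of_nat[of "2 * kap", where 'a = "nat \<Rightarrow>\<^sub>0 int" and 'b = complex] by simp
 have e: "(\<Sum>i<n. emb (theta i ?P)) = of_nat d * emb ?P"
  using euler_hom[OF J(2) vP] by (simp add: emb_of_nat flip: emb_sum)
 have "?v * (\<Sum>i<n. ltheta i (?L * emb (theta i ?P))) = (\<Sum>i<n. (?v * ltheta i ?L) * emb (theta i ?P) + ?v * ?L * emb (theta i (theta i ?P)))"
  unfolding sum_distrib_left by (intro sum.cong refl) (simp add: ltheta_mult ltheta_emb distrib_left mult_ac)
 also have "\<dots> = (\<Sum>i<n. of_nat kap * (2 * emb (theta i (vand n)) - of_nat (n - 1) * ?v) * ?L * emb (theta i ?P) + ?v * ?L * emb (theta i (theta i ?P)))"
  by (intro sum.cong refl) (simp add: ltheta_Lw)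
 also have "\<dots> = ?L * ((2 * of_nat kap) * S1 - of_nat (kap * (n - 1)) * ?v * (\<Sum>i<n. emb (theta i ?P)) + ?v * S2)"
  unfolding S1_def S2_def sum_distrib_left sum_subtractf[symmetric] sum.distrib[symmetric] of_nat_mult
  by (intro sum.cong refl) (simp only: ring_distribs mult_ac)
 also have "\<dots> = ?L * (sgl 0 h * (?v * emb ?P) - sgl 0 r * (?v * emb ?P) - of_nat (kap * (n - 1)) * ?v * (of_nat d * emb ?P))"
  unfolding 1 c2 e by (simp only: algebra_simps)
 also have "\<dots> = ?v * ((sgl 0 h - (sgl 0 r + of_nat (kap * (n - 1) * d))) * (?L * emb ?P))"
  unfolding of_nat_mult by (simp only: ring_distribs mult_ac add_ac diff_diff_eq)
 finally have "?v * (\<Sum>i<n. ltheta i (?L * emb (theta i ?P))) = ?v * ((sgl 0 h - (sgl 0 r + of_nat (kap * (n - 1) * d))) * (?L * emb ?P))" .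
 from mult_left_cancel[OF emb_vand_nonzero, THEN iffD1, OF this]
 have "(\<Sum>i<n. ltheta i (?L * emb (theta i ?P))) = (sgl 0 h - (sgl 0 r + of_nat (kap * (n - 1) * d))) * (?L * emb ?P)" .
 then show ?thesis unfolding h_def r_def by (simp only: single_diff single_add single_of_nat)
qed

text \<open>
 An operator in divergence form is symmetric for the pairing, so eigenvectors with different
 eigenvalues are orthogonal.\<close>

lemma tf_orthogonal:
 assumes kap: "kap > 0" and lam: "lam \<in> PDn n d" and mu: "mu \<in> PDn n d" and h: "sqs n kap lam \<noteq> sqs n kap mu"
 shows "tf n kap (jack n kap lam) (jack n kap mu) = 0"
proof -
 let ?L = "Lw n kap"
 define c where "c = (of_nat kap ^ 2 * of_nat (\<Sum>i<n. rho n i ^ 2) + of_nat (kap * (n - 1) * d) :: complex)"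
 define s where "s f g = (\<Sum>i<n. CT (?L * emb (theta i f) * lbar (emb (theta i g))))" for f g
 have sc: "s f g = s g f" for f g
 proof -
  have "CT (?L * emb (theta i f) * lbar (emb (theta i g))) = CT (?L * emb (theta i g) * lbar (emb (theta i f)))" for i
   using CT_lbar[of "?L * emb (theta i f) * lbar (emb (theta i g))"]
   by (simp add: lbar_mult lbar_lbar lbar_Lw mult_ac)
  then show ?thesis by (simp add: s_def)
 qed
 have key: "(of_nat (sqs n kap la) - c) * tf n kap (jack n kap la) g = s (jack n kap la) g" if la: "la \<in> PDn n d" for la g
 proof -
  let ?P = "jack n kap la"
  have "s ?P g = (\<Sum>i<n. CT (ltheta i (?L * emb (theta i ?P)) * lbar (emb g)))"
   unfolding s_def CT_parts by (simp add: ltheta_lbar ltheta_emb CT_uminus)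
  also have "\<dots> = CT ((\<Sum>i<n. ltheta i (?L * emb (theta i ?P))) * lbar (emb g))"
   unfolding sum_distrib_right CT_sum ..
  also have "\<dots> = (of_nat (sqs n kap la) - c) * CT (?L * emb ?P * lbar (emb g))"
   unfolding jack_divergence_form[OF kap la] c_def[symmetric] mult.assoc[of "sgl 0 z :: lpol" for z] CT_cmult ..
  finally show ?thesis by (simp add: tf_def mult_ac)
 qed
 have "(of_nat (sqs n kap lam) - c) * tf n kap (jack n kap lam) (jack n kap mu) =
  (of_nat (sqs n kap mu) - c) * tf n kap (jack n kap lam) (jack n kap mu)"
  using key[OF lam, of "jack n kap mu"] key[OF mu, of "jack n kap lam"] sc tf_sym[of n kap "jack n kap lam"] by metis
 then have "(of_nat (sqs n kap lam) - of_nat (sqs n kap mu)) * tf n kap (jack n kap lam) (jack n kap mu) = 0"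
  by (simp add: algebra_simps)
 then show ?thesis using h by simp
qed

section \<open>The norms of the Jack polynomials on the torus\<close>

text \<open>
 The quotient of the norm for the torus pairing by the norm for the power sum scalar product.\<close>

definition nratio :: "nat \<Rightarrow> nat \<Rightarrow> natfun \<Rightarrow> complex" where
 "nratio n kap lam = tf n kap 1 1 * (\<Prod>i<n. \<Prod>s<lam i. of_nat (rho n i * kap + s + kap) / of_nat (rho n i * kap + s + 1))"

lemma nratio_step:
 assumes "i < n"
 shows "nratio n kap (mu(i := Suc (mu i))) = nratio n kap mu * (of_nat (av n kap mu i + kap) / of_nat (av n kap mu i + 1))"
proof -
 define f where "f j s = (of_nat (rho n j * kap + s + kap) / of_nat (rho n j * kap + s + 1) :: complex)" for j s
 have "(\<Prod>j<n. \<Prod>s<(mu(i := Suc (mu i))) j. f j s) = (\<Prod>j<n. (\<Prod>s<mu j. f j s) * (if j = i then f i (mu i) else 1))"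
  by (intro prod.cong refl) auto
 also have "\<dots> = (\<Prod>j<n. \<Prod>s<mu j. f j s) * f i (mu i)"
  unfolding prod.distrib using assms by (simp add: prod.delta)
 finally show ?thesis by (simp add: nratio_def f_def av_def)
qed

lemma PDn_0: "PDn n 0 = {\<lambda>_. 0}"
proof -
 have "lam = (\<lambda>_. 0)" if "lam \<in> PDn n 0" for lam
 proof -
  have "(\<Sum>i<n. lam i) = 0" using PDn_D[OF that] part_size_sum[of lam n] by auto
  then show ?thesis using PDn_D[OF that] by (intro Par_eqI[of lam n]) (auto simp: Par_def is_partition_def part_length_def antimono_def)
 qed
 moreover have "(\<lambda>_. 0) \<in> PDn n 0" by (auto simp: PDn_def Par_def PD_def is_partition_def part_length_def part_size_def antimono_def)
 ultimately show ?thesis by blast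
qed

lemma jack_0: assumes kap: "kap > 0" shows "jack n kap (\<lambda>_. 0) = 1" "jnorm kap (\<lambda>_. 0) = 1"
proof -
 let ?o = "\<lambda>_::nat. 0::nat"
 have m: "?o \<in> PDn n 0" by (simp add: PDn_0)
 have pm0: "pm n ?o = 0" by (rule poly_mapping_eqI) simp
 have "lkp (jack n kap ?o) 0 = 1" using unitri_jack[OF kap, of ?o n] PDn_D[OF m] pm0 by (simp add: unitri_def)
 moreover have "lkp (jack n kap ?o) a = 0" if "a \<noteq> 0" for a
 proof (rule ccontr)
  assume "lkp (jack n kap ?o) a \<noteq> 0"
  then have "deg a = 0" using PDn_jack(2)[OF kap m] by (simp add: hom_def)
  then have "a = 0" by (simp add: deg_def in_keys_iff poly_mapping_eqI)
  then show False using that by simp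
 qed
 ultimately show P: "jack n kap ?o = 1" by (intro poly_mapping_eqI) (auto simp: lookup_one when_def)
 have "Kpol n kap 0 y = const_pol (inverse (jnorm kap ?o))" for y
  using kernel_jack[OF kap, of n 0 y] by (simp add: PDn_0 P)
 then have "const_pol (inverse (jnorm kap ?o)) = 1" using Kpol_0 by metis
 then have "eval_pol (const_pol (inverse (jnorm kap ?o))) (\<lambda>_. 0) = 1" by simp
 then show "jnorm kap ?o = 1" by simp
qed

lemma sqs_step: "i < n \<Longrightarrow> sqs n kap (mu(i := Suc (mu i))) = sqs n kap mu + (2 * av n kap mu i + 1)"
proof -
 assume i: "i < n"
 have "sqs n kap (mu(i := Suc (mu i))) = (\<Sum>j<n. (av n kap mu j)\<^sup>2 + (if j = i then 2 * av n kap mu i + 1 else 0))"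
  unfolding sqs_def by (intro sum.cong refl) (auto simp: av_def power2_eq_square)
 also have "\<dots> = sqs n kap mu + (2 * av n kap mu i + 1)" unfolding sum.distrib sqs_def using i by (simp add: sum.delta)
 finally show ?thesis .
qed

lemma av_inj: assumes "kap > 0" "lam \<in> Par n" "i < n" "j < n" "av n kap lam i = av n kap lam j" shows "i = j"
 using av_strict[OF assms(1,2), of i j] av_strict[OF assms(1,2), of j i] assms by (metis less_irrefl nat_neq_iff)

text \<open>
 Induction on the degree along an edge from \<open>\<mu>\<close> to \<open>\<lambda>\<close>:
 evaluate
 \<open>\<langle>(A + p\<^sub>1) P\<^sub>\<mu>, P\<^sub>\<nu>\<rangle>' = \<langle>P\<^sub>\<mu>, E P\<^sub>\<nu>\<rangle>'\<close>
 in both ways.  The partitions which occur in \<open>(A + p\<^sub>1) P\<^sub>\<mu>\<close> have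
 different eigenvalues \<open>\<Sum> a\<^sub>i\<^sup>2\<close>, so only the term of
 \<open>\<lambda>\<close> survives on the left if \<open>\<nu>\<close> has the same eigenvalue as
 \<open>\<lambda>\<close>.\<close>

theorem tf_jack_same_degree:
 assumes kap: "kap > 0" and n: "n \<ge> 1" and lam: "lam \<in> PDn n d" and nu: "nu \<in> PDn n d"
 shows "tf n kap (jack n kap lam) (jack n kap nu) = (if lam = nu then nratio n kap lam * jnorm kap lam else 0)"
 using lam nu
proof (induction d arbitrary: lam nu)
 case 0
 then show ?case by (simp add: PDn_0 jack_0[OF kap] nratio_def)
next
 case (Suc d)
 show ?case
 proof (cases "sqs n kap lam = sqs n kap nu")
  case False
  then show ?thesis using tf_orthogonal[OF kap Suc.prems] by auto
 next
  case hl: True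
  obtain mu where mu: "mu \<in> PDn n d" and b: "pieri n kap d mu lam \<noteq> 0" using pieri_edge[OF kap Suc.prems(1)] by blast
  have muP: "mu \<in> Par n" using PDn_D[OF mu] by simp
  let ?b = "pieri n kap d mu" and ?a = "apieri n kap d mu" and ?J = "PDn n (Suc d)" and ?P = "jack n kap"
  obtain i where i: "i < n" "lam = mu(i := Suc (mu i))" "?a lam = ?b lam * of_nat (av n kap mu i)"
   using pieri_support[OF kap n mu Suc.prems(1)] b by metis
  define A where "A = av n kap mu i"
  \<comment> \<open>
   within the support of the Pieri coefficients, \<open>\<Sum> a\<^sub>i\<^sup>2\<close> grows by
   \<open>2 a\<^sub>i + 1\<close>, which determines \<open>i\<close>\<close>
  have other: "?a la = 0 \<and> ?b la = 0" if la: "la \<in> ?J" "la \<noteq> lam" "sqs n kap la = sqs n kap lam" for la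
  proof (rule ccontr)
   assume "\<not> ?thesis"
   then obtain j where j: "j < n" "la = mu(j := Suc (mu j))" using pieri_support[OF kap n mu la(1)] by metis
   then have "av n kap mu j = av n kap mu i" using la(3) i(2) by (simp add: sqs_step[OF j(1)] sqs_step[OF i(1)])
   then show False using av_inj[OF kap muP j(1) i(1)] j i la(2) by simp
  qed
  have term0: "(?a la + ?b la) * tf n kap (?P la) (?P nu) = 0" if la: "la \<in> ?J" "la \<noteq> lam" for la
  proof (cases "sqs n kap la = sqs n kap lam")
   case True
   then show ?thesis using other[OF la] by simp
  next
   case False
   then have "tf n kap (?P la) (?P nu) = 0" using tf_orthogonal[OF kap la(1) Suc.prems(2)] hl by simp
   then show ?thesis by simp
  qed
  have R: "Aop n kap (?P mu) + psum1 n * ?P mu = (\<Sum>la\<in>?J. const_pol (?a la + ?b la) * ?P la)"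
   unfolding pieri[OF kap mu] sum.distrib[symmetric] by (intro sum.cong refl) (simp add: const_pol_add distrib_right)
  have "tf n kap (Aop n kap (?P mu) + psum1 n * ?P mu) (?P nu) = (\<Sum>la\<in>?J. (?a la + ?b la) * tf n kap (?P la) (?P nu))"
   unfolding R by (rule tf_sum)
  also have "\<dots> = (\<Sum>la\<in>{lam}. (?a la + ?b la) * tf n kap (?P la) (?P nu))"
   by (rule sum.mono_neutral_right[OF finite_PDn]) (use Suc.prems(1) term0 in auto)
  also have "\<dots> = ?b lam * (of_nat (A + 1) * tf n kap (?P lam) (?P nu))" by (simp add: i(3) A_def algebra_simps)
  finally have 1: "tf n kap (?P mu) (E0 n (?P nu)) = ?b lam * (of_nat (A + 1) * tf n kap (?P lam) (?P nu))"
   unfolding tf_raising_lowering .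
  have "tf n kap (?P mu) (E0 n (?P nu)) = (\<Sum>mu'\<in>PDn n d. lowc n kap d nu mu' * tf n kap (?P mu) (?P mu'))"
   unfolding lowc[OF kap Suc.prems(2)] by (rule tf_sum_right)
  also have "\<dots> = (\<Sum>mu'\<in>{mu}. lowc n kap d nu mu' * tf n kap (?P mu) (?P mu'))"
   by (rule sum.mono_neutral_right[OF finite_PDn]) (use mu Suc.IH[OF mu] in auto)
  also have "\<dots> = nratio n kap mu * (lowc n kap d nu mu * jnorm kap mu)" by (simp add: Suc.IH[OF mu mu])
  also have "\<dots> = nratio n kap mu * (jnorm kap nu * (?a nu + of_nat kap * ?b nu))"
   by (simp add: lowc_pieri[OF kap n Suc.prems(2) mu])
  finally have 2: "?b lam * (of_nat (A + 1) * tf n kap (?P lam) (?P nu)) = nratio n kap mu * (jnorm kap nu * (?a nu + of_nat kap * ?b nu))"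
   unfolding 1 .
  have A1: "(of_nat (A + 1) :: complex) \<noteq> 0" unfolding Suc_eq_plus1[symmetric] by (rule of_nat_neq_0)
  show ?thesis
  proof (cases "nu = lam")
   case True
   have "?b lam * (of_nat (A + 1) * tf n kap (?P lam) (?P nu)) = ?b lam * (nratio n kap mu * jnorm kap lam * of_nat (A + kap))"
    using 2[unfolded True] unfolding True by (simp add: i(3) A_def algebra_simps)
   then have "of_nat (A + 1) * tf n kap (?P lam) (?P nu) = nratio n kap mu * jnorm kap lam * of_nat (A + kap)"
    using b by (metis mult_left_cancel)
   then have "tf n kap (?P lam) (?P nu) = nratio n kap mu * jnorm kap lam * of_nat (A + kap) / of_nat (A + 1)"
    using A1 by (metis nonzero_mult_div_cancel_left)
   moreover have "nratio n kap lam = nratio n kap mu * (of_nat (A + kap) / of_nat (A + 1))"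
    using nratio_step[OF i(1), of kap mu] by (simp only: i(2) A_def)
   ultimately show ?thesis using True by simp
  next
   case False
   then have "?a nu = 0 \<and> ?b nu = 0" using other[OF Suc.prems(2)] hl by simp
   then have "?b lam * (of_nat (A + 1) * tf n kap (?P lam) (?P nu)) = 0" unfolding 2 by simp
   then show ?thesis using b A1 False by (simp del: of_nat_add)
  qed
 qed
qed

theorem tf_jack:
 assumes kap: "kap > 0" and n: "n \<ge> 1" and lam: "lam \<in> Par n" and nu: "nu \<in> Par n"
 shows "tf n kap (jack n kap lam) (jack n kap nu) = (if lam = nu then nratio n kap lam * jnorm kap lam else 0)"
proof -
 have l: "lam \<in> PDn n (part_size lam)" and m: "nu \<in> PDn n (part_size nu)" using lam nu by (auto simp: PDn_def PD_def Par_def)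
 show ?thesis
 proof (cases "part_size lam = part_size nu")
  case True
  then show ?thesis using tf_jack_same_degree[OF kap n l] m by simp
 next
  case False
  have "tf n kap (jack n kap lam) (jack n kap nu) = 0"
   by (rule tf_degree[OF PDn_jack(2)[OF kap l] _ PDn_jack(2)[OF kap m] _ False])
     (use PDn_jack(1)[OF kap l] PDn_jack(1)[OF kap m] in \<open>simp_all add: sympol_iff\<close>)
  then show ?thesis using False by auto
 qed
qed

section \<open>The constant term of the weight\<close>

text \<open>
 Dyson's product with one exponent for each \<open>i\<close>; different exponents and index sets are
 what makes the induction possible.\<close>

definition dyf :: "nat set \<Rightarrow> nat \<Rightarrow> lpol" where "dyf S i = (\<Prod>j\<in>S - {i}. 1 - lxi i * lx j)"

definition dyson :: "nat set \<Rightarrow> natfun \<Rightarrow> lpol" where "dyson S a = (\<Prod>i\<in>S. dyf S i ^ a i)"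

text \<open>
 Lagrange interpolation of the constant 1 at the points \<open>z\<^sub>k\<close>, evaluated at 0.\<close>

lemma lagrange_at_zero:
 fixes z :: "'i \<Rightarrow> complex"
 assumes S: "finite S" "S \<noteq> {}" and inj: "inj_on z S"
 shows "(\<Sum>k\<in>S. \<Prod>j\<in>S - {k}. z j / (z j - z k)) = 1"
proof -
 define p where "p = (\<Sum>k\<in>S. \<Prod>j\<in>S - {k}. Polynomial.smult (1 / (z k - z j)) [:- z j, 1:])"
 have pe: "poly p x = (\<Sum>k\<in>S. \<Prod>j\<in>S - {k}. (x - z j) / (z k - z j))" for x
  by (simp add: p_def poly_sum poly_prod diff_divide_distrib)
 have "degree (\<Prod>j\<in>S - {k}. Polynomial.smult (1 / (z k - z j)) [:- z j, 1:]) \<le> card S - 1" if "k \<in> S" for k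
 proof -
  have "degree (\<Prod>j\<in>S - {k}. Polynomial.smult (1 / (z k - z j)) [:- z j, 1:]) \<le>
    (\<Sum>j\<in>S - {k}. degree (Polynomial.smult (1 / (z k - z j)) [:- z j, 1:]))"
   using degree_prod_sum_le[of "S - {k}" "\<lambda>j. Polynomial.smult (1 / (z k - z j)) [:- z j, 1:]"] S by (simp add: o_def)
  also have "\<dots> \<le> (\<Sum>j\<in>S - {k}. 1)" by (intro sum_mono) (auto intro: order.trans[OF degree_smult_le])
  also have "\<dots> = card S - 1" using that S by simp
  finally show ?thesis .
 qed
 then have "degree p \<le> card S - 1" unfolding p_def by (intro degree_sum_le S) auto
 then have deg: "degree p < card (z ` S)" using S inj card_gt_0_iff[of S] by (simp add: card_image)
 have "poly p x = poly 1 x" if "x \<in> z ` S" for x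
 proof -
  from that obtain l where l: "l \<in> S" "x = z l" by blast
  have "(\<Prod>j\<in>S - {k}. (x - z j) / (z k - z j)) = (if k = l then 1 else 0)" if "k \<in> S" for k
  proof (cases "k = l")
   case True
   have "z l \<noteq> z j" if "j \<in> S - {k}" for j using inj_onD[OF inj, of l j] l that True by auto
   then show ?thesis using True l by (simp add: prod.neutral)
  next
   case False
   then show ?thesis using l S by (intro prod_zero[THEN trans]) auto
  qed
  then have "poly p x = (\<Sum>k\<in>S. if k = l then 1 else 0)" unfolding pe by (intro sum.cong refl) auto
  then show ?thesis using S l by simp
 qed
 then have "p = 1" using deg S inj by (intro poly_eqI_degree[of "z ` S"]) (auto simp: card_image card_gt_0_iff)
 then have "poly p 0 = 1" by simp
 moreover have "- z j / (z k - z j) = z j / (z j - z k)" for j k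
  by (metis minus_diff_eq minus_divide_divide minus_minus)
 ultimately show ?thesis unfolding pe by simp
qed

text \<open>
 After division by the product this is \<open>lagrange_at_zero\<close> for the points
 \<open>1 / y\<^sub>k\<close>.  If two of the points coincide, then both sides vanish.\<close>

lemma dyf_lagrange:
 assumes S: "finite S" "S \<noteq> {}"
 shows "(\<Sum>k\<in>S. \<Prod>i\<in>S - {k}. dyf S i) = (\<Prod>i\<in>S. dyf S i)"
proof -
 have "lev ((\<Sum>k\<in>S. \<Prod>i\<in>S - {k}. dyf S i) - (\<Prod>i\<in>S. dyf S i)) y = 0" if y: "\<And>i. y i \<noteq> 0" for y
 proof -
  define g where "g i = (\<Prod>j\<in>S - {i}. 1 - inverse (y i) * y j)" for i
  have lg: "lev (dyf S i) y = g i" for i by (simp add: dyf_def g_def lev_prod lev_mult y)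
  have "(\<Sum>k\<in>S. \<Prod>i\<in>S - {k}. g i) = (\<Prod>i\<in>S. g i)"
  proof (cases "inj_on y S")
   case True
   have inj: "inj_on (\<lambda>i. inverse (y i)) S" using True by (auto simp: inj_on_def)
   have g0: "g i \<noteq> 0" if "i \<in> S" for i
    using S True that y by (auto simp: g_def inj_on_def field_simps)
   have inv: "(\<Prod>j\<in>S - {k}. inverse (y j) / (inverse (y j) - inverse (y k))) = inverse (g k)" if "k \<in> S" for k
   proof -
    have "inverse (y j) / (inverse (y j) - inverse (y k)) = inverse (1 - inverse (y k) * y j)" if "j \<in> S - {k}" for j
     using y[of j] y[of k] True that \<open>k \<in> S\<close> by (auto simp: field_simps inj_on_def)
    then show ?thesis unfolding g_def prod_inversef[symmetric] by (intro prod.cong refl) (simp add: o_def)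
   qed
   have "(\<Sum>k\<in>S. \<Prod>i\<in>S - {k}. g i) = (\<Sum>k\<in>S. (\<Prod>i\<in>S. g i) * inverse (g k))"
    using S g0 by (intro sum.cong refl) (simp add: prod.remove[of S])
   also have "\<dots> = (\<Prod>i\<in>S. g i) * (\<Sum>k\<in>S. \<Prod>j\<in>S - {k}. inverse (y j) / (inverse (y j) - inverse (y k)))"
    by (simp add: inv sum_distrib_left)
   finally show ?thesis unfolding lagrange_at_zero[OF S inj] by simp
  next
   case False
   then obtain i j where ij: "i \<in> S" "j \<in> S" "i \<noteq> j" "y i = y j" by (auto simp: inj_on_def)
   have z0: "g a = 0" if "a \<in> S" "b \<in> S" "a \<noteq> b" "y a = y b" for a b
    unfolding g_def using that S y by (intro prod_zero) (auto intro!: bexI[of _ b])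
   have z: "g i = 0" "g j = 0" using z0[of i j] z0[of j i] ij by auto
   have "(\<Prod>i\<in>S - {k}. g i) = 0" for k
    using S ij z by (cases "k = i") (auto intro!: prod_zero)
   moreover have "(\<Prod>i\<in>S. g i) = 0" using S ij z by (auto intro!: prod_zero)
   ultimately show ?thesis by simp
  qed
  then show ?thesis by (simp add: lev_sum lev_prod y lg)
 qed
 then have "(\<Sum>k\<in>S. \<Prod>i\<in>S - {k}. dyf S i) - (\<Prod>i\<in>S. dyf S i) = 0" by (rule lev_zero)
 then show ?thesis by simp
qed

definition xord :: "nat \<Rightarrow> int \<Rightarrow> lpol \<Rightarrow> bool" where "xord k c f \<longleftrightarrow> (\<forall>a\<in>kys f. lkp a k \<ge> c)"

lemma xord_add: "xord k c f \<Longrightarrow> xord k c g \<Longrightarrow> xord k c (f + g)"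
 unfolding xord_def using keys_add[of f g] by blast
lemma xord_uminus: "xord k c f \<Longrightarrow> xord k c (- f)" by (simp add: xord_def)
lemma xord_mult: "xord k c f \<Longrightarrow> xord k d g \<Longrightarrow> xord k (c + d) (f * g)"
 unfolding xord_def using keys_mult[of f g] by (fastforce simp: lookup_add dest: subsetD[OF keys_mult])
lemma xord_mono: "xord k c f \<Longrightarrow> d \<le> c \<Longrightarrow> xord k d f" unfolding xord_def by force
lemma xord_1: "xord k 0 1" by (auto simp: xord_def in_keys_iff lookup_one when_def split: if_splits)
lemma xord_lx: "xord k (if i = k then 1 else 0) (lx i)" "i \<noteq> k \<Longrightarrow> xord k 0 (lxi i)"
 by (auto simp: xord_def lx_def lxi_def lookup_single)
lemma xord_prod0: "(\<And>s. s \<in> S \<Longrightarrow> xord k 0 (f s)) \<Longrightarrow> xord k 0 (prod f S)"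
 by (induction S rule: infinite_finite_induct) (auto intro: xord_1 xord_mult[of k 0 _ 0, simplified])
lemma xord_power0: "xord k 0 f \<Longrightarrow> xord k 0 (f ^ m)" using xord_prod0[of "{..<m}" k "\<lambda>_. f"] by simp
lemma CT_xord: "xord k 1 f \<Longrightarrow> CT f = 0" unfolding CT_def xord_def by (metis in_keys_iff lookup_zero not_one_le_zero)

lemma xord_unit_prod: "(\<And>s. s \<in> S \<Longrightarrow> xord k 1 (f s - 1)) \<Longrightarrow> xord k 1 (prod f S - 1)"
proof (induction S rule: infinite_finite_induct)
 case (insert x S)
 \<comment> \<open>\<open>u v - 1 = (u - 1) (v - 1) + (u - 1) + (v - 1)\<close>\<close>
 have e: "prod f (insert x S) - 1 = (f x - 1) * (prod f S - 1) + ((f x - 1) + (prod f S - 1))"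
  using insert by (simp add: algebra_simps)
 have a: "xord k 1 (f x - 1)" "xord k 1 (prod f S - 1)" using insert by auto
 show ?case unfolding e using xord_mono[OF xord_mult[OF a], of 1] by (intro xord_add a) auto
qed (simp_all add: xord_def)

text \<open>
 If the exponent of \<open>k\<close> is zero, then \<open>x\<^sub>k\<close> occurs in numerators
 only, so for the constant term it may be set to zero.\<close>

lemma dyson_zero_exponent:
 assumes S: "finite S" and k: "k \<in> S" "a k = 0"
 shows "CT (dyson S a) = CT (dyson (S - {k}) a)"
proof -
 let ?T = "S - {k}"
 define h where "h = (\<Prod>i\<in>?T. (1 - lxi i * lx k) ^ a i)"
 have s: "dyf S i = (1 - lxi i * lx k) * dyf ?T i" if "i \<in> ?T" for i
 proof -
  have "S - {i} = insert k (?T - {i})" using that k by auto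
  then show ?thesis using S by (simp add: dyf_def)
 qed
 have "dyson S a = (\<Prod>i\<in>?T. dyf S i ^ a i)" unfolding dyson_def using S k by (simp add: prod.remove[of S k])
 also have "\<dots> = dyson ?T a * h"
  unfolding h_def dyson_def prod.distrib[symmetric] by (intro prod.cong refl) (simp add: s power_mult_distrib mult.commute)
 also have "\<dots> = dyson ?T a + dyson ?T a * (h - 1)" by (simp add: algebra_simps)
 finally have e: "dyson S a = dyson ?T a + dyson ?T a * (h - 1)" .
 have "xord k 1 ((1 - lxi i * lx k) ^ m - 1)" if "i \<in> ?T" for i m
 proof -
  have "xord k 1 ((1 - lxi i * lx k) - 1)"
   using xord_uminus[OF xord_mult[OF xord_lx(2) xord_lx(1)], of i k k] that by simp
  then show ?thesis using xord_unit_prod[of "{..<m}" k "\<lambda>_. 1 - lxi i * lx k"] by simp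
 qed
 then have h: "xord k 1 (h - 1)" unfolding h_def by (rule xord_unit_prod)
 have "xord k 0 (1 - lxi i * lx j)" if "i \<in> ?T" "j \<in> ?T" for i j
  using xord_add[OF xord_1[of k] xord_uminus[of k 0 "lxi i * lx j"]] xord_mult[OF xord_lx(2)[of i k] xord_lx(1)[of k j]] that by simp
 then have "xord k 0 (dyson ?T a)" unfolding dyson_def dyf_def by (intro xord_prod0 xord_power0) auto
 from CT_xord[OF xord_mono[OF xord_mult[OF this h]]] show ?thesis by (simp add: e CT_add)
qed

lemma dyson_recursion:
 assumes S: "finite S" "S \<noteq> {}" and a: "\<And>i. i \<in> S \<Longrightarrow> a i > 0"
 shows "dyson S a = (\<Sum>k\<in>S. dyson S (a(k := a k - 1)))"
proof -
 define G where "G = (\<Prod>i\<in>S. dyf S i ^ (a i - 1))"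
 have "dyson S (a(k := a k - 1)) = G * (\<Prod>i\<in>S - {k}. dyf S i)" if k: "k \<in> S" for k
 proof -
  have "(\<Prod>i\<in>S - {k}. dyf S i) = (\<Prod>i\<in>S. if i = k then 1 else dyf S i)"
   using S k by (simp add: prod.remove[of S k])
  then have "G * (\<Prod>i\<in>S - {k}. dyf S i) = (\<Prod>i\<in>S. dyf S i ^ (a i - 1) * (if i = k then 1 else dyf S i))"
   by (simp add: G_def prod.distrib)
  also have "\<dots> = dyson S (a(k := a k - 1))"
   unfolding dyson_def using a by (intro prod.cong refl) (auto simp: power_minus_mult simp del: One_nat_def)
  finally show ?thesis ..
 qed
 then have "(\<Sum>k\<in>S. dyson S (a(k := a k - 1))) = G * (\<Prod>i\<in>S. dyf S i)"
  by (simp add: dyf_lagrange[OF S] flip: sum_distrib_left)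
 also have "\<dots> = dyson S a"
  unfolding G_def dyson_def prod.distrib[symmetric] using a by (intro prod.cong refl) (simp add: power_minus_mult del: One_nat_def)
 finally show ?thesis ..
qed

text \<open>
 Good's proof: by the two preceding lemmas the constant terms satisfy the recursion and the boundary
 values of the multinomial coefficients.\<close>

theorem dyson_constant_term:
 assumes "finite S"
 shows "CT (dyson S a) * (\<Prod>i\<in>S. fact (a i)) = fact (\<Sum>i\<in>S. a i)"
 using assms
proof (induction "card S + (\<Sum>i\<in>S. a i)" arbitrary: S a rule: less_induct)
 case less
 note S = less.prems
 consider "S = {}" | k where "k \<in> S" "a k = 0" | "S \<noteq> {}" "\<And>i. i \<in> S \<Longrightarrow> a i > 0" by blast
 then show ?case
 proof cases
  case 1
  then show ?thesis by (simp add: dyson_def)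
 next
  case 2
  have s: "(\<Sum>i\<in>S. a i) = (\<Sum>i\<in>S - {k}. a i)" using 2 S by (simp add: sum.remove[of S k])
  have p: "(\<Prod>i\<in>S. fact (a i)) = (\<Prod>i\<in>S - {k}. fact (a i) :: complex)" using 2 S by (simp add: prod.remove[of S k])
  have "card (S - {k}) < card S" by (rule card_Diff1_less[OF S 2(1)])
  then show ?thesis using less.hyps[of "S - {k}" a] S unfolding dyson_zero_exponent[of S k a, OF S 2] s p by simp
 next
  case 3
  have "CT (dyson S (a(k := a k - 1))) * (\<Prod>i\<in>S. fact (a i)) = of_nat (a k) * fact ((\<Sum>i\<in>S. a i) - 1)" if k: "k \<in> S" for k
  proof -
   have s: "(\<Sum>i\<in>S. (a(k := a k - 1)) i) = (\<Sum>i\<in>S. a i) - 1" "(\<Sum>i\<in>S. a i) > 0"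
    using S k 3(2)[OF k] by (simp_all add: sum.remove[of S k])
   have p: "(\<Prod>i\<in>S. fact (a i)) = of_nat (a k) * (\<Prod>i\<in>S. fact ((a(k := a k - 1)) i) :: complex)"
    using S k 3(2)[OF k] by (simp add: prod.remove[of S k] fact_reduce)
   have "CT (dyson S (a(k := a k - 1))) * (\<Prod>i\<in>S. fact ((a(k := a k - 1)) i)) = fact ((\<Sum>i\<in>S. a i) - 1)"
    using less.hyps[of S "a(k := a k - 1)"] S s by simp
   then show ?thesis unfolding p by (simp add: mult.left_commute)
  qed
  note C = this
  have "CT (dyson S a) * (\<Prod>i\<in>S. fact (a i)) = (\<Sum>k\<in>S. of_nat (a k) * fact ((\<Sum>i\<in>S. a i) - 1))"
  proof -
   have "CT (dyson S a) = (\<Sum>k\<in>S. CT (dyson S (a(k := a k - 1))))"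
    by (subst dyson_recursion[of S a, OF S 3]) (simp_all add: CT_sum)
   then show ?thesis by (simp only: sum_distrib_right C cong: sum.cong)
  qed
  also have "\<dots> = of_nat (\<Sum>i\<in>S. a i) * fact ((\<Sum>i\<in>S. a i) - 1)" by (simp flip: sum_distrib_right)
  also have "\<dots> = fact (\<Sum>i\<in>S. a i)"
  proof -
   have "(\<Sum>i\<in>S. a i) > 0" using 3 S by (metis all_not_in_conv sum_pos)
   then show ?thesis by (simp only: fact_reduce[of "\<Sum>i\<in>S. a i"])
  qed
  finally show ?thesis .
 qed
qed

corollary tf_1_1: "tf n kap 1 1 = fact (n * kap) / fact kap ^ n"
proof -
 have "lev (Lw n kap - dyson {..<n} (\<lambda>_. kap)) y = 0" if "\<And>i. y i \<noteq> 0" for y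
  by (simp add: lev_Lw that torus_weight_def dyson_def dyf_def lev_prod lev_power lev_mult prod_power_distrib)
 then have "Lw n kap - dyson {..<n} (\<lambda>_. kap) = 0" by (rule lev_zero)
 then have "tf n kap 1 1 * fact kap ^ n = fact (n * kap)"
  using dyson_constant_term[of "{..<n}" "\<lambda>_. kap"] by (simp add: tf_def)
 then show ?thesis by (simp add: field_simps)
qed

section \<open>The norm ratio and the Baxter eigenvalue\<close>

lemma fact_ratio:
 assumes "kap > 0"
 shows "(\<Prod>s<m. of_nat (r + s + kap) / of_nat (r + s + 1) :: complex) =
  (fact (r + m + kap - 1) / fact (r + m)) * (fact r / fact (r + kap - 1))"
proof (induction m)
 case (Suc m)
 have 1: "fact (r + Suc m + kap - 1) = of_nat (r + m + kap) * (fact (r + m + kap - 1) :: complex)"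
  using assms by (subst fact_reduce) auto
 have 2: "fact (r + Suc m) = of_nat (r + m + 1) * (fact (r + m) :: complex)" by simp
 show ?case unfolding prod.lessThan_Suc Suc.IH 1 2 by (simp add: field_simps)
qed simp

lemma rho_fact_prod:
 assumes "kap > 0"
 shows "(\<Prod>i<n. fact (rho n i * kap) / fact (rho n i * kap + kap - 1) :: complex) = fact n * of_nat kap ^ n / fact (n * kap)"
proof -
 have "(\<Prod>i<n. f (rho n i)) = (\<Prod>i<n. f i)" for f :: point
  unfolding rho_def using prod.nat_diff_reindex[of f n] by simp
 then have "(\<Prod>i<n. fact (rho n i * kap) / fact (rho n i * kap + kap - 1) :: complex) = (\<Prod>i<n. fact (i * kap) / fact (i * kap + kap - 1))" .
 \<comment> \<open>
  a telescoping product, with the factor \<open>(i + 1) \<kappa>\<close> left over in each step\<close>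
 also have "\<dots> = fact n * of_nat kap ^ n / fact (n * kap)"
 proof (induction n)
  case (Suc n)
  define c where "c = (of_nat (Suc n * kap) :: complex)"
  have c: "fact (Suc n * kap) = c * fact (n * kap + kap - 1)"
   using assms unfolding c_def by (subst fact_reduce) (auto simp: add.commute)
  have c0: "c \<noteq> 0" unfolding c_def of_nat_eq_0_iff using assms by simp
  have d: "fact (Suc n) * of_nat kap ^ Suc n = c * (fact n * of_nat kap ^ n :: complex)" by (simp add: c_def algebra_simps)
  show ?case unfolding prod.lessThan_Suc Suc.IH c d using c0 by simp
 qed simp
 finally show ?thesis .
qed

theorem nratio_eigenvalue:
 assumes kap: "kap > 0" and mu: "\<And>i. i < n \<Longrightarrow> int (mu i) = int (lam i) - gam"
 shows "nratio n kap mu = baxter_norm n kap * baxter_eigenvalue n kap gam lam"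
proof -
 have g: "Gamma (of_int (int (lam i) - gam + (int (rho n i) + 1) * int kap)) /
  Gamma (of_int (int (lam i) - gam + int (rho n i) * int kap + 1)) =
  (fact (rho n i * kap + mu i + kap - 1) / fact (rho n i * kap + mu i) :: complex)" if "i < n" for i
 proof -
  have 1: "int (lam i) - gam + (int (rho n i) + 1) * int kap = int (Suc (rho n i * kap + mu i + kap - 1))"
   using mu[OF that] kap by (simp add: algebra_simps of_nat_diff)
  have 2: "int (lam i) - gam + int (rho n i) * int kap + 1 = int (Suc (rho n i * kap + mu i))"
   using mu[OF that] by (simp add: algebra_simps)
  have 3: "Gamma (of_nat (Suc m)) = (fact m :: complex)" for m using Gamma_fact[of m, where 'a = complex] by (simp add: add.commute)
  show ?thesis unfolding 1 2 of_int_of_nat_eq 3 ..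
 qed
 have "nratio n kap mu = fact (n * kap) / fact kap ^ n * ((\<Prod>i<n. fact (rho n i * kap + mu i + kap - 1) / fact (rho n i * kap + mu i)) *
   (fact n * of_nat kap ^ n / fact (n * kap)))"
  unfolding nratio_def tf_1_1 fact_ratio[OF kap] prod.distrib rho_fact_prod[OF kap] ..
 also have "(\<Prod>i<n. fact (rho n i * kap + mu i + kap - 1) / fact (rho n i * kap + mu i)) = baxter_eigenvalue n kap gam lam"
  unfolding baxter_eigenvalue_def by (intro prod.cong refl) (simp only: g lessThan_iff)
 finally have e: "nratio n kap mu = fact n * of_nat kap ^ n / fact kap ^ n * baxter_eigenvalue n kap gam lam" by simp
 have "fact kap = of_nat kap * (Gamma (of_nat kap) :: complex)"
  using kap Gamma_fact[of "kap - 1", where 'a = complex] by (subst fact_reduce) (auto simp: of_nat_diff)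
 then have "fact n * of_nat kap ^ n / fact kap ^ n = baxter_norm n kap"
  using kap by (simp add: baxter_norm_def power_mult_distrib)
 then show ?thesis using e by simp
qed

lemma eigenvalue_pole:
 assumes "gam > int (lam i)" "gam \<le> int (lam i) + int kap" "i = n - 1" "n \<ge> 1"
 shows "baxter_eigenvalue n kap gam lam = 0"
proof -
 have "rho n i = 0" using assms by (simp add: rho_def)
 moreover have "Gamma (of_int (int (lam i) - gam + 1) :: complex) = 0"
  by (intro Gamma_nonpos_Int nonpos_Ints_of_int) (use assms in simp)
 ultimately show ?thesis unfolding baxter_eigenvalue_def using assms by (intro prod_zero bexI[of _ i]) auto
qed

section \<open>Expansion of the Baxter integral\<close>

lemma mev_scale: "mev (\<lambda>i. c * y i) m = c ^ deg m * mev y m"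
 by (simp add: mev_def deg_def power_mult_distrib prod.distrib power_sum)

lemma eval_scale: "eval_pol (dgn (\<lambda>m. c ^ deg m) f) y = eval_pol f (\<lambda>i. c * y i)"
 by (induction f rule: poly_mapping_induct) (simp_all add: dgn_add eval_single mev_scale)

text \<open>
 The polydisc contains the torus of radius one half, and scaling the variables reduces to
 \<open>lev_zero_torus\<close>.\<close>

lemma eval_zero_polydisc:
 assumes z: "\<And>x. (\<And>i. i < n \<Longrightarrow> 0 < norm (x i) \<and> norm (x i) < 1) \<Longrightarrow> eval_pol f x = 0"
 shows "f = 0"
proof -
 let ?g = "dgn (\<lambda>m. (1 / 2) ^ deg m) f"
 have "lev (emb ?g) y = 0" if "\<And>i. norm (y i) = 1" for y
  unfolding lev_emb eval_scale by (rule z) (simp add: norm_mult that)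
 then have "?g = 0" using lev_zero_torus[of "emb ?g"] by (simp add: emb_eq_0)
 then have "lkp ?g m = 0" for m by simp
 then show ?thesis by (intro poly_mapping_eqI) simp
qed

text \<open>
 Uniform domination of the coefficients by a convergent series; stable under products by the Cauchy
 product, so that it passes from geometric series to the kernel.\<close>

definition dominated :: "'a set \<Rightarrow> ('a \<Rightarrow> complex fps) \<Rightarrow> ('a \<Rightarrow> complex) \<Rightarrow> bool" where
 "dominated Y F v \<longleftrightarrow> (\<exists>g. summable g \<and> (\<forall>k. g k \<ge> 0) \<and>
   (\<forall>y\<in>Y. (\<forall>k. norm (fps_nth (F y) k) \<le> g k) \<and> (\<lambda>k. fps_nth (F y) k) sums v y))"

lemma dominated_1: "dominated Y (\<lambda>_. 1) (\<lambda>_. 1)"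
proof -
 have "(\<lambda>k. fps_nth (1 :: complex fps) k) sums 1" using sums_single[of 0 "\<lambda>_. 1 :: complex"] by (simp add: fps_one_nth eq_commute)
 moreover have "summable (\<lambda>k. if k = 0 then 1 else 0 :: real)" using sums_single[of 0 "\<lambda>_. 1 :: real"] by (simp add: sums_iff)
 ultimately show ?thesis unfolding dominated_def
  by (intro exI[of _ "\<lambda>k. if k = 0 then 1 else 0"] conjI ballI allI) (assumption | simp add: fps_one_nth)+
qed

lemma dominated_mult:
 assumes "dominated Y F v" "dominated Y G w"
 shows "dominated Y (\<lambda>y. F y * G y) (\<lambda>y. v y * w y)"
proof -
 obtain g where g: "summable g" "\<And>k. g k \<ge> 0"
  "\<And>y k. y \<in> Y \<Longrightarrow> norm (fps_nth (F y) k) \<le> g k" "\<And>y. y \<in> Y \<Longrightarrow> (\<lambda>k. fps_nth (F y) k) sums v y"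
  using assms(1) unfolding dominated_def by blast
 obtain h where h: "summable h" "\<And>k. h k \<ge> 0"
  "\<And>y k. y \<in> Y \<Longrightarrow> norm (fps_nth (G y) k) \<le> h k" "\<And>y. y \<in> Y \<Longrightarrow> (\<lambda>k. fps_nth (G y) k) sums w y"
  using assms(2) unfolding dominated_def by blast
 define q where "q k = (\<Sum>i\<le>k. g i * h (k - i))" for k
 have "summable q" unfolding q_def
  by (rule summable_Cauchy_product) (use g h in simp_all)
 moreover have "q k \<ge> 0" for k unfolding q_def by (intro sum_nonneg) (simp add: g h)
 moreover have "norm (fps_nth (F y * G y) k) \<le> q k" if "y \<in> Y" for y k
  unfolding fps_mult_nth atLeast0AtMost q_def
  by (intro order.trans[OF norm_sum] sum_mono) (simp add: norm_mult mult_mono g h that)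
 moreover have "(\<lambda>k. fps_nth (F y * G y) k) sums (v y * w y)" if y: "y \<in> Y" for y
 proof -
  have "summable (\<lambda>k. norm (fps_nth (F y) k))" "summable (\<lambda>k. norm (fps_nth (G y) k))"
   using g(3)[OF y] h(3)[OF y] g(1) h(1) by (auto intro: summable_comparison_test' simp: )
  from Cauchy_product_sums[OF this] show ?thesis
   using g(4)[OF y] h(4)[OF y] by (simp add: fps_mult_nth atLeast0AtMost sums_iff)
 qed
 ultimately show ?thesis unfolding dominated_def by blast
qed

lemma dominated_prod:
 "(\<And>s. s \<in> S \<Longrightarrow> dominated Y (F s) (v s)) \<Longrightarrow> dominated Y (\<lambda>y. \<Prod>s\<in>S. F s y) (\<lambda>y. \<Prod>s\<in>S. v s y)"
 by (induction S rule: infinite_finite_induct) (auto intro: dominated_1 dominated_mult)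

lemma fps_nth_Abs_fps: "fps_nth (Abs_fps f) = f" by (rule ext) simp

lemma dominated_geometric:
 assumes "norm a < 1" "\<And>y. y \<in> Y \<Longrightarrow> norm (b y) = 1"
 shows "dominated Y (\<lambda>y. Abs_fps (\<lambda>k. (a * b y) ^ k)) (\<lambda>y. 1 / (1 - a * b y))"
proof -
 show ?thesis
  unfolding dominated_def
  by (intro exI[of _ "\<lambda>k. norm a ^ k"])
    (use assms in \<open>auto simp: fps_nth_Abs_fps norm_mult norm_power intro!: summable_geometric geometric_sums\<close>)
qed

lemma kernel_dominated:
 assumes x: "\<And>i. i < n \<Longrightarrow> norm (x i) < 1"
 shows "dominated {y. \<forall>i. norm (y i) = 1} (\<lambda>y. Abs_fps (\<lambda>d. eval_pol (Kpol n kap d y) x))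
  (\<lambda>y. \<Prod>i<n. \<Prod>j<n. 1 / (1 - x i * y j) ^ kap)"
proof -
 let ?Y = "{y :: nat \<Rightarrow> complex. \<forall>i. norm (y i) = 1}"
 define G where "G y = (\<Prod>i<n. \<Prod>j<n. \<Prod>s<kap. Abs_fps (\<lambda>k. (x i * y j) ^ k))" for y
 have "dominated ?Y G (\<lambda>y. \<Prod>i<n. \<Prod>j<n. \<Prod>s<kap. 1 / (1 - x i * y j))"
  unfolding G_def by (intro dominated_prod dominated_geometric) (use x in auto)
 moreover have "Abs_fps (\<lambda>d. eval_pol (Kpol n kap d y) x) = G y" for y
 proof -
  define D where "D = (\<Prod>i<n. \<Prod>j<n. (1 - fps_const (x i * y j) * fps_X :: complex fps) ^ kap)"
  have "G y * D = (\<Prod>i<n. \<Prod>j<n. (Abs_fps (\<lambda>k. (x i * y j) ^ k) * (1 - fps_const (x i * y j) * fps_X)) ^ kap)"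
   by (simp add: G_def D_def prod.distrib power_mult_distrib)
  then have "G y * D = 1" using geom by (simp add: geom_def mult.commute)
  moreover have "Abs_fps (\<lambda>d. eval_pol (Kpol n kap d y) x) * D = 1" unfolding D_def by (rule kernel_product)
  ultimately have "Abs_fps (\<lambda>d. eval_pol (Kpol n kap d y) x) * D = G y * D" and "D \<noteq> 0" by auto
  then show ?thesis by simp
 qed
 ultimately show ?thesis by (simp add: power_one_over)
qed

definition lxp :: "nat \<Rightarrow> int \<Rightarrow> lpol" where "lxp n gam = (\<Prod>i<n. sgl (sgl i gam) 1)"

lemma lev_lxp: assumes "\<And>i. y i \<noteq> 0" shows "lev (lxp n gam) y = (\<Prod>i<n. y i powi gam)"
proof -
 have "lmev y (sgl i gam) = y i powi gam" for i by (cases "gam = 0") (simp_all add: lmev_def)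
 then show ?thesis by (simp add: lxp_def lev_prod assms)
qed

lemma lvars_lxp: "lvars n (lxp n gam)"
 unfolding lxp_def by (intro lvars_prod lvars_single) auto

text \<open>
 Expand the kernel by degree.  The coefficients are bounded on the torus by a convergent series, so
 the sum may be integrated term by term; each term is the integral of a Laurent polynomial.\<close>

lemma baxter_integral_sums:
 assumes x: "\<And>i. i < n \<Longrightarrow> norm (x i) < 1" and f: "vars_in n f"
 shows "(\<lambda>d. (\<Prod>i<n. x i powi gam) * CT (emb (Kpol n kap d x) * (lxp n gam * Lw n kap * lbar (emb f))))
  sums baxter_integral n kap gam f x"
proof -
 define P where "P = (\<Prod>i<n. x i powi gam)"
 define H where "H = lxp n gam * Lw n kap * lbar (emb f)"
 let ?y = "\<lambda>t i. cis (2 * pi * t i)"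
 have H: "lvars n H" unfolding H_def by (intro lvars_mult lvars_lxp lvars_Lw lvars_lbar lvars_emb f)
 have KH: "lvars n (emb (Kpol n kap d x) * H)" for d
  using sympol_Kpol[of n kap d x] by (intro lvars_mult lvars_emb H) (simp add: sympol_iff)
 obtain g where g: "summable g" "\<And>k. g k \<ge> 0"
  "\<And>y k. (\<And>i. norm (y i) = 1) \<Longrightarrow> norm (eval_pol (Kpol n kap k y) x) \<le> g k"
  "\<And>y. (\<And>i. norm (y i) = 1) \<Longrightarrow> (\<lambda>k. eval_pol (Kpol n kap k y) x) sums (\<Prod>i<n. \<Prod>j<n. 1 / (1 - x i * y j) ^ kap)"
  using kernel_dominated[of n x kap, OF x] unfolding dominated_def by (auto simp: fps_nth_Abs_fps)
 define F where "F d t = P * lev (emb (Kpol n kap d x) * H) (?y t)" for d and t :: "nat \<Rightarrow> real"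
 have F: "F d t = P * eval_pol (Kpol n kap d (?y t)) x * lev H (?y t)" for d t
  by (simp add: F_def lev_mult lev_emb Kpol_swap[of n kap d x])
 have iF: "integrable (tor n) (F d)" for d
  unfolding F_def by (intro integrable_mult_right lev_torus(1) KH)
 have bound: "norm (F d t) \<le> g d * norm (P * lev H (?y t))" for d t
 proof -
  have "norm (F d t) = norm (eval_pol (Kpol n kap d (?y t)) x) * norm (P * lev H (?y t))"
   by (simp add: F norm_mult)
  also have "\<dots> \<le> g d * norm (P * lev H (?y t))" by (intro mult_right_mono g(3)) auto
  finally show ?thesis .
 qed
 have iH: "integrable (tor n) (\<lambda>t. norm (P * lev H (?y t)))"
  by (intro integrable_norm integrable_mult_right lev_torus(1) H)
 have s1: "AE t in tor n. summable (\<lambda>d. norm (F d t))"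
  by (rule AE_I2) (rule summable_comparison_test'[OF summable_mult2[OF g(1)], where N = 0], use bound in simp)
 have s2: "summable (\<lambda>d. \<integral>t. norm (F d t) \<partial>tor n)"
 proof (rule summable_comparison_test'[OF summable_mult2[OF g(1)], where N = 0])
  fix d
  have "(\<integral>t. norm (F d t) \<partial>tor n) \<le> (\<integral>t. g d * norm (P * lev H (?y t)) \<partial>tor n)"
   by (intro integral_mono integrable_norm iF integrable_mult_right iH bound)
  then show "norm (\<integral>t. norm (F d t) \<partial>tor n) \<le> g d * (\<integral>t. norm (P * lev H (?y t)) \<partial>tor n)" by simp
 qed
 have "(\<lambda>d. \<integral>t. F d t \<partial>tor n) sums (\<integral>t. suminf (\<lambda>d. F d t) \<partial>tor n)"
  by (rule sums_integral[OF iF s1 s2])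
 moreover have "(\<integral>t. F d t \<partial>tor n) = P * CT (emb (Kpol n kap d x) * H)" for d
  using lev_torus(2)[OF KH, of d] by (simp add: F_def torus_integral_def)
 moreover have "suminf (\<lambda>d. F d t) = (\<Prod>i<n. (x i * ?y t i) powi gam) * (\<Prod>i<n. \<Prod>j<n. 1 / (1 - x i * ?y t j) ^ kap) *
   torus_weight n kap (?y t) * eval_pol f (\<lambda>i. inverse (?y t i))" for t
 proof -
  have "(\<lambda>d. P * eval_pol (Kpol n kap d (?y t)) x * lev H (?y t)) sums
   (P * (\<Prod>i<n. \<Prod>j<n. 1 / (1 - x i * ?y t j) ^ kap) * lev H (?y t))"
   by (intro sums_mult2 sums_mult g(4)) auto
  moreover have "lev H (?y t) = (\<Prod>i<n. ?y t i powi gam) * torus_weight n kap (?y t) * eval_pol f (\<lambda>i. inverse (?y t i))"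
   by (simp add: H_def lev_mult lev_lxp lev_Lw lev_lbar lev_emb)
  ultimately show ?thesis
   unfolding F[symmetric] by (simp add: sums_iff P_def power_int_mult_distrib prod.distrib mult_ac)
 qed
 ultimately show ?thesis unfolding P_def H_def by (simp add: baxter_integral_def torus_integral_def)
qed

section \<open>Shifting partitions by columns\<close>

definition addp :: "nat \<Rightarrow> nat \<Rightarrow> natfun \<Rightarrow> nat \<Rightarrow> nat" where
 "addp n k lam i = (if i < n then lam i + k else 0)"

lemma Par_I: assumes "antimono lam" "\<And>i. i \<ge> n \<Longrightarrow> lam i = 0" shows "lam \<in> Par n"
proof -
 have s: "{i. lam i \<noteq> 0} \<subseteq> {..<n}"
 proof
  fix i assume "i \<in> {i. lam i \<noteq> 0}"
  then show "i \<in> {..<n}" using assms(2)[of i] by (cases "i < n") auto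
 qed
 then have "finite {i. lam i \<noteq> 0}" by (rule finite_subset) simp
 moreover have "part_length lam \<le> n" unfolding part_length_def using card_mono[OF _ s] by simp
 ultimately show ?thesis using assms(1) by (simp add: Par_def is_partition_def)
qed

lemma Par_antimono: "lam \<in> Par n \<Longrightarrow> i \<le> j \<Longrightarrow> lam j \<le> lam i"
 by (simp add: Par_def is_partition_def antimonoD)

lemma addp_Par: "lam \<in> Par n \<Longrightarrow> addp n k lam \<in> Par n"
 by (rule Par_I) (auto simp: addp_def antimono_def Par_antimono)

lemma dl_inj: assumes kap: "kap > 0" and P: "lam \<in> Par n" "mu \<in> Par n" and e: "\<And>X. dl n kap X lam = dl n kap X mu"
 shows "lam = mu"
proof -
 have "dpoly n kap lam = dpoly n kap mu" using e unfolding poly_dpoly[symmetric] by (simp add: poly_eq_poly_eq_iff[symmetric] fun_eq_iff)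
 then show ?thesis using dpoly_inj[OF kap P] by simp
qed

text \<open>
 Both sides are eigenvectors with the same eigenvalue polynomial, by \<open>sekiguchi_en\<close>, and
 these polynomials determine the partition; the leading coefficients agree.\<close>

lemma en_jack:
 assumes kap: "kap > 0" and mu: "mu \<in> Par n"
 shows "en n * jack n kap mu = jack n kap (addp n 1 mu)"
proof -
 define d where "d = part_size mu"
 define f where "f = en n * jack n kap mu"
 let ?I = "PDn n (n + d)" and ?nu = "addp n 1 mu"
 have md: "mu \<in> PDn n d" using mu by (simp add: PDn_def PD_def Par_def d_def)
 note J = PDn_jack[OF kap md]
 have f: "f \<in> sympol n" "hom (n + d) f"
  unfolding f_def using sympol_mult[OF sympol_en J(1)] hom_mult[OF hom_en J(2)] by auto
 obtain c where c: "f = (\<Sum>la\<in>?I. const_pol (c la) * jack n kap la)" using jack_expand[OF kap f] by blast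
 have nuP: "?nu \<in> Par n" by (rule addp_Par[OF mu])
 have "part_size ?nu = n + d"
 proof -
  have "part_size ?nu = (\<Sum>i<n. ?nu i)" "part_size mu = (\<Sum>i<n. mu i)" using nuP mu by (auto simp: Par_def part_size_sum)
  then show ?thesis by (simp add: addp_def sum_Suc d_def)
 qed
 then have nu: "?nu \<in> ?I" using nuP by (simp add: PDn_def PD_def Par_def)
 have ev: "quot_op n kap (sekq n X) f = const_pol (dl n kap X ?nu) * f" for X
 proof -
  have "dl n kap (X + 1) mu = dl n kap X ?nu" by (simp add: dl_def av_def addp_def add_ac)
  then show ?thesis unfolding f_def sekiguchi_en[OF J(1)] quot_op_jack[OF kap mu] by (simp add: mult_ac)
 qed
 have ce: "c la * dl n kap X la = dl n kap X ?nu * c la" if la: "la \<in> ?I" for la X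
 proof -
  have "(\<Sum>la\<in>?I. const_pol (c la * dl n kap X la) * jack n kap la) = quot_op n kap (sekq n X) f"
   unfolding c by (subst quot_op_sum[OF PDn_jack(1)[OF kap] qsym_sekq], assumption)
    (intro sum.cong refl, use PDn_D in \<open>simp add: quot_op_jack[OF kap] const_pol_mult mult.assoc\<close>)
  also have "\<dots> = (\<Sum>la\<in>?I. const_pol (dl n kap X ?nu * c la) * jack n kap la)"
   unfolding ev by (subst c) (simp add: sum_distrib_left const_pol_mult mult.assoc)
  finally show ?thesis by (rule lin_indep_eq[OF lin_indep_PDn[OF kap] _ la])
 qed
 have c0: "c la = 0" if la: "la \<in> ?I" "la \<noteq> ?nu" for la
 proof (rule ccontr)
  assume "c la \<noteq> 0"
  then have "dl n kap X la = dl n kap X ?nu" for X using ce[OF la(1), of X] by simp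
  then show False using dl_inj[OF kap _ nuP] PDn_D[OF la(1)] la(2) by blast
 qed
 have "f = (\<Sum>la\<in>{?nu}. const_pol (c la) * jack n kap la)"
  unfolding c by (rule sum.mono_neutral_right[OF finite_PDn]) (use nu c0 in auto)
 then have fc: "f = const_pol (c ?nu) * jack n kap ?nu" by simp
 have "pm n (\<lambda>_. 1) + pm n mu = pm n ?nu" unfolding pm_add by (rule poly_mapping_eqI) (simp add: addp_def)
 then have "lkp f (pm n ?nu) = lkp (jack n kap mu) (pm n mu)" unfolding f_def en_def using lookup_mon_mult by metis
 then have "c ?nu = 1" using fc unitri_jack[OF kap mu] unitri_jack[OF kap nuP] by (simp add: unitri_def)
 then show ?thesis using fc by (simp add: f_def)
qed

lemma en_power_jack:
 assumes kap: "kap > 0" and mu: "mu \<in> Par n"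
 shows "en n ^ k * jack n kap mu = jack n kap (addp n k mu)"
proof (induction k)
 case 0
 have "addp n 0 mu = mu" using Par_zero[OF mu] by (auto simp: addp_def)
 then show ?case by simp
next
 case (Suc k)
 have "addp n 1 (addp n k mu) = addp n (Suc k) mu" by (auto simp: addp_def)
 then show ?case using en_jack[OF kap addp_Par[OF mu, of k]] Suc.IH by (simp add: mult.assoc)
qed

lemma emb_en: "emb (en n ^ k) = lxp n (int k)"
proof -
 have e: "lev (emb (en n ^ k)) y = (\<Prod>i<n. y i) ^ k" for y
 proof -
  have "en n = (\<Prod>i<n. var i)" unfolding en_def using mon_prod[of n "\<lambda>_. 1"] by simp
  then show ?thesis by (simp add: lev_emb)
 qed
 have "emb (en n ^ k) - lxp n (int k) = 0"
  by (rule lev_zero) (simp add: lev_diff e lev_lxp prod_power_distrib)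
 then show "emb (en n ^ k) = lxp n (int k)" by simp
qed

lemma lbar_lxp: "lbar (lxp n gam) = lxp n (- gam)"
 by (simp add: lxp_def lbar_prod single_uminus)

lemma lxp_cancel: "lxp n gam * lxp n (- gam) = 1"
proof -
 have "lxp n gam * lxp n (- gam) - 1 = 0"
  by (rule lev_zero) (simp add: lev_diff lev_mult lev_lxp power_int_minus flip: prod.distrib)
 then show ?thesis by simp
qed

lemma tf_en: "tf n kap (en n ^ k * f) (en n ^ k * g) = tf n kap f g"
proof -
 have "emb (en n ^ k * f) * lbar (emb (en n ^ k * g)) = (lxp n (int k) * lxp n (- int k)) * (emb f * lbar (emb g))"
  by (simp add: emb_mult lbar_mult emb_en lbar_lxp mult_ac)
 then show ?thesis by (simp add: tf_def lxp_cancel)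
qed

text \<open>
 \<open>\<lambda> - (\<gamma>, \<dots>, \<gamma>)\<close>, truncated at zero; the truncation does
 not occur when \<open>\<gamma>\<close> is at most the last part.\<close>

definition subp :: "nat \<Rightarrow> int \<Rightarrow> natfun \<Rightarrow> nat \<Rightarrow> nat" where
 "subp n gam lam i = (if i < n then nat (int (lam i) - gam) else 0)"

lemma subp_Par: assumes "lam \<in> Par n" shows "subp n gam lam \<in> Par n"
proof (rule Par_I)
 show "antimono (subp n gam lam)"
 proof (rule antimonoI)
  fix i j :: nat assume "i \<le> j"
  then show "subp n gam lam j \<le> subp n gam lam i" using Par_antimono[OF assms, of i j] by (auto simp: subp_def)
 qed
qed (simp add: subp_def)

lemma last_part_le: "lam \<in> Par n \<Longrightarrow> i < n \<Longrightarrow> lam (n - 1) \<le> lam i" by (rule Par_antimono) auto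

text \<open>
 For \<open>\<gamma> \<ge> 0\<close> the factor
 \<open>(y\<^sub>1 \<dots> y\<^sub>n)\<^sup>\<gamma>\<close> is absorbed into
 \<open>P\<^sub>\<mu>(y)\<close>, for \<open>\<gamma> < 0\<close> into
 \<open>P\<^sub>\<lambda>(1/y)\<close>; then orthogonality applies.\<close>

lemma shift_pairing:
 assumes kap: "kap > 0" and n: "n \<ge> 1" and lam: "lam \<in> Par n" and mu: "mu \<in> Par n"
 shows "CT (emb (jack n kap mu) * (lxp n gam * Lw n kap * lbar (emb (jack n kap lam)))) =
  (if gam \<le> int (lam (n - 1)) \<and> mu = subp n gam lam then nratio n kap mu * jnorm kap mu else 0)"
proof (cases "gam \<ge> 0")
 case True
 define k where "k = nat gam"
 have g: "gam = int k" using True by (simp add: k_def)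
 have iff: "gam \<le> int (lam (n - 1)) \<and> mu = subp n gam lam \<longleftrightarrow> addp n k mu = lam"
 proof
  assume a: "gam \<le> int (lam (n - 1)) \<and> mu = subp n gam lam"
  show "addp n k mu = lam"
   using a last_part_le[OF lam] by (intro Par_eqI[OF addp_Par[OF mu] lam]) (force simp: addp_def subp_def g)
 next
  assume a: "addp n k mu = lam"
  have "lam (n - 1) = mu (n - 1) + k" using n by (simp add: addp_def flip: a)
  moreover have "mu = subp n gam lam"
   by (rule Par_eqI[OF mu subp_Par[OF lam]]) (simp add: subp_def addp_def g flip: a)
  ultimately show "gam \<le> int (lam (n - 1)) \<and> mu = subp n gam lam" by (simp add: g)
 qed
 have "CT (emb (jack n kap mu) * (lxp n gam * Lw n kap * lbar (emb (jack n kap lam)))) = tf n kap (en n ^ k * jack n kap mu) (jack n kap lam)"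
  unfolding tf_def emb_mult emb_en g by (simp only: mult_ac)
 also have "\<dots> = (if addp n k mu = lam then nratio n kap mu * jnorm kap mu else 0)"
 proof (cases "addp n k mu = lam")
  case True
  then have "jack n kap lam = en n ^ k * jack n kap mu" by (simp add: en_power_jack[OF kap mu])
  then show ?thesis using True by (simp add: tf_en tf_jack[OF kap n mu mu])
 next
  case False
  then show ?thesis by (simp add: en_power_jack[OF kap mu] tf_jack[OF kap n addp_Par[OF mu] lam])
 qed
 finally show ?thesis by (simp only: iff)
next
 case False
 define k where "k = nat (- gam)"
 have g: "gam = - int k" using False by (simp add: k_def)
 have s: "subp n gam lam = addp n k lam" by (auto simp: subp_def addp_def g nat_int_add)
 have "CT (emb (jack n kap mu) * (lxp n gam * Lw n kap * lbar (emb (jack n kap lam)))) = tf n kap (jack n kap mu) (en n ^ k * jack n kap lam)"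
  unfolding tf_def emb_mult lbar_mult emb_en lbar_lxp g by (simp only: mult_ac)
 also have "\<dots> = (if mu = addp n k lam then nratio n kap mu * jnorm kap mu else 0)"
  by (simp add: en_power_jack[OF kap lam] tf_jack[OF kap n mu addp_Par[OF lam]])
 finally show ?thesis using False by (simp add: s)
qed

lemma eval_jack_shift:
 assumes kap: "kap > 0" and lam: "lam \<in> Par n" and g: "gam \<le> int (lam (n - 1))" and x: "\<And>i. i < n \<Longrightarrow> x i \<noteq> 0"
 shows "(\<Prod>i<n. x i powi gam) * eval_pol (jack n kap (subp n gam lam)) x = eval_pol (jack n kap lam) x"
proof -
 have en: "eval_pol (en n ^ k) x = (\<Prod>i<n. x i ^ k)" for k
 proof -
  have "en n = (\<Prod>i<n. var i)" unfolding en_def using mon_prod[of n "\<lambda>_. 1"] by simp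
  then show ?thesis by (simp add: prod_power_distrib)
 qed
 show ?thesis
 proof (cases "gam \<ge> 0")
  case True
  define k where "k = nat gam"
  have gk: "gam = int k" using True by (simp add: k_def)
  have "addp n k (subp n gam lam) = lam"
   using g last_part_le[OF lam] by (intro Par_eqI[OF addp_Par[OF subp_Par[OF lam]] lam]) (force simp: addp_def subp_def gk)
  then have "jack n kap lam = en n ^ k * jack n kap (subp n gam lam)" by (simp add: en_power_jack[OF kap subp_Par[OF lam]])
  then show ?thesis by (simp only: eval_mult en gk power_int_of_nat)
 next
  case False
  define k where "k = nat (- gam)"
  have gk: "gam = - int k" using False by (simp add: k_def)
  have s: "subp n gam lam = addp n k lam" by (auto simp: subp_def addp_def gk nat_int_add)
  have "(\<Prod>i<n. x i powi gam) * (\<Prod>i<n. x i ^ k) = (\<Prod>i<n. x i powi gam * x i ^ k)" by (simp add: prod.distrib)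
  also have "\<dots> = 1" by (intro prod.neutral) (simp add: gk power_int_minus x)
  finally have "(\<Prod>i<n. x i powi gam) * (\<Prod>i<n. x i ^ k) = 1" .
  then show ?thesis unfolding s en_power_jack[OF kap lam, symmetric] eval_mult en mult.assoc[symmetric] by simp
 qed
qed

section \<open>The Baxter operator is diagonal on Jack polynomials\<close>

text \<open>
 For \<open>\<gamma>\<close> larger than the last part no partition has the shift
 \<open>\<lambda>\<close>, and the integral vanishes.\<close>

definition bax_ev :: "nat \<Rightarrow> nat \<Rightarrow> int \<Rightarrow> natfun \<Rightarrow> complex" where
 "bax_ev n kap gam lam = (if gam \<le> int (lam (n - 1)) then nratio n kap (subp n gam lam) else 0)"

lemma baxter_integral_jack:
 assumes kap: "kap > 0" and n: "n \<ge> 1" and lam: "lam \<in> Par n" and x: "\<And>i. i < n \<Longrightarrow> 0 < norm (x i) \<and> norm (x i) < 1"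
 shows "(\<lambda>d. (\<Prod>i<n. x i powi gam) * CT (emb (Kpol n kap d x) * (lxp n gam * Lw n kap * lbar (emb (jack n kap lam)))))
  sums (bax_ev n kap gam lam * eval_pol (jack n kap lam) x)"
proof -
 let ?P = "\<Prod>i<n. x i powi gam" and ?R = "lxp n gam * Lw n kap * lbar (emb (jack n kap lam))"
 define mu where "mu = subp n gam lam"
 define D where "D = part_size mu"
 have muP: "mu \<in> Par n" unfolding mu_def by (rule subp_Par[OF lam])
 have muD: "mu \<in> PDn n d \<longleftrightarrow> d = D" for d using muP by (auto simp: PDn_def PD_def Par_def D_def)
 have t: "?P * CT (emb (Kpol n kap d x) * ?R) = (if d = D then bax_ev n kap gam lam * eval_pol (jack n kap lam) x else 0)" for d
 proof -
  have "CT (emb (Kpol n kap d x) * ?R) = (\<Sum>nu\<in>PDn n d. inverse (jnorm kap nu) * eval_pol (jack n kap nu) x * CT (emb (jack n kap nu) * ?R))"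
   unfolding kernel_jack[OF kap, of n d x] emb_sum emb_mult emb_const sum_distrib_right CT_sum
   by (intro sum.cong refl) (simp only: mult.assoc[of "sgl 0 z :: lpol" for z] CT_cmult)
  also have "\<dots> = (\<Sum>nu\<in>PDn n d. if nu = mu then (if gam \<le> int (lam (n - 1)) then
    inverse (jnorm kap mu) * eval_pol (jack n kap mu) x * (nratio n kap mu * jnorm kap mu) else 0) else 0)"
   by (intro sum.cong refl, subst shift_pairing[OF kap n lam]) (use PDn_D in \<open>auto simp: mu_def\<close>)
  also have "\<dots> = (if d = D then if gam \<le> int (lam (n - 1)) then
    inverse (jnorm kap mu) * eval_pol (jack n kap mu) x * (nratio n kap mu * jnorm kap mu) else 0 else 0)"
   by (subst sum.delta[OF finite_PDn]) (simp add: muD)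
  finally have e: "CT (emb (Kpol n kap d x) * ?R) = \<dots>" .
  show ?thesis
  proof (cases "d = D \<and> gam \<le> int (lam (n - 1))")
   case True
   then have "jnorm kap mu \<noteq> 0" using jnorm_nonzero[OF kap, of mu n D] muD by simp
   then have "?P * CT (emb (Kpol n kap d x) * ?R) = nratio n kap mu * (?P * eval_pol (jack n kap mu) x)" using True unfolding e by simp
   also have "\<dots> = nratio n kap mu * eval_pol (jack n kap lam) x"
    unfolding mu_def using eval_jack_shift[OF kap lam, of gam x] True x by fastforce
   finally show ?thesis using True by (simp add: bax_ev_def mu_def)
  next
   case False
   then show ?thesis unfolding e by (auto simp: bax_ev_def)
  qed
 qed
 show ?thesis unfolding t using sums_single[of D "\<lambda>_. bax_ev n kap gam lam * eval_pol (jack n kap lam) x"] by simp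
qed

lemma baxter_image_jack_sum:
 assumes kap: "kap > 0" and n: "n \<ge> 1" and I: "I \<subseteq> Par n" "finite I"
 shows "is_baxter_image n kap gam (\<Sum>lam\<in>I. const_pol (c lam) * jack n kap lam)
  (\<Sum>lam\<in>I. const_pol (c lam * bax_ev n kap gam lam) * jack n kap lam)"
proof -
 let ?f = "\<Sum>lam\<in>I. const_pol (c lam) * jack n kap lam"
 have J: "jack n kap lam \<in> sympol n" if "lam \<in> I" for lam
  using sympol_jack[OF kap] I that by (auto simp: Par_def)
 have "?f \<in> sympol n" by (intro sympol_sum sympol_cmult J)
 then have v: "vars_in n ?f" by (simp add: sympol_iff)
 have "(\<Sum>lam\<in>I. c lam * (bax_ev n kap gam lam * eval_pol (jack n kap lam) x)) = baxter_integral n kap gam ?f x"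
  if x: "\<forall>i<n. 0 < norm (x i) \<and> norm (x i) < 1" for x
 proof -
  let ?P = "\<Prod>i<n. x i powi gam" and ?R = "\<lambda>f. lxp n gam * Lw n kap * lbar (emb f)"
  have "(\<lambda>d. \<Sum>lam\<in>I. c lam * (?P * CT (emb (Kpol n kap d x) * ?R (jack n kap lam)))) sums
   (\<Sum>lam\<in>I. c lam * (bax_ev n kap gam lam * eval_pol (jack n kap lam) x))"
   by (intro sums_sum sums_mult baxter_integral_jack[OF kap n]) (use I x in auto)
  moreover have "(\<Sum>lam\<in>I. c lam * (?P * CT (emb (Kpol n kap d x) * ?R (jack n kap lam)))) = ?P * CT (emb (Kpol n kap d x) * ?R ?f)" for d
  proof -
   have "emb (Kpol n kap d x) * ?R ?f = (\<Sum>lam\<in>I. sgl 0 (c lam) * (emb (Kpol n kap d x) * ?R (jack n kap lam)))"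
    unfolding emb_sum emb_mult emb_const lbar_sum lbar_mult lbar_single sum_distrib_left minus_zero
    by (intro sum.cong refl) (simp only: mult_ac)
   then show ?thesis unfolding CT_sum CT_cmult sum_distrib_left by (simp only: CT_sum CT_cmult sum_distrib_left mult.left_commute)
  qed
  ultimately have "(\<lambda>d. ?P * CT (emb (Kpol n kap d x) * ?R ?f)) sums
   (\<Sum>lam\<in>I. c lam * (bax_ev n kap gam lam * eval_pol (jack n kap lam) x))" by simp
  moreover have "(\<lambda>d. ?P * CT (emb (Kpol n kap d x) * ?R ?f)) sums baxter_integral n kap gam ?f x"
   by (rule baxter_integral_sums[OF _ v]) (use x in auto)
  ultimately show ?thesis by (rule sums_unique2)
 qed
 then show ?thesis
  unfolding is_baxter_image_def using J by (auto intro!: sympol_sum sympol_cmult simp: mult.assoc)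
qed

lemma baxter_image_unique:
 assumes "is_baxter_image n kap gam f g" "is_baxter_image n kap gam f h"
 shows "g = h"
proof -
 have "g - h = 0" by (rule eval_zero_polydisc[of n]) (use assms in \<open>simp add: is_baxter_image_def\<close>)
 then show ?thesis by simp
qed

lemma baxter_jack_sum:
 assumes "kap > 0" "n \<ge> 1" "I \<subseteq> Par n" "finite I"
 shows "baxter n kap gam (\<Sum>lam\<in>I. const_pol (c lam) * jack n kap lam) =
  (\<Sum>lam\<in>I. const_pol (c lam * bax_ev n kap gam lam) * jack n kap lam)"
 unfolding baxter_def
 by (rule the_equality) (use baxter_image_jack_sum[OF assms] baxter_image_unique in blast)+

lemma sekiguchi_jack_sum:
 assumes kap: "kap > 0" and I: "I \<subseteq> Par n"
 shows "sekiguchi n kap X (\<Sum>lam\<in>I. const_pol (c lam) * jack n kap lam) =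
  (\<Sum>lam\<in>I. const_pol (c lam * dl n kap X lam) * jack n kap lam)"
 unfolding sekiguchi_quot
 by (subst quot_op_sum[OF _ qsym_sekq])
   (use sympol_jack[OF kap] I in \<open>auto simp: quot_op_jack[OF kap] subset_iff Par_def const_pol_mult mult.assoc intro!: sum.cong\<close>)

lemma sympol_jack_sum:
 assumes kap: "kap > 0" and f: "f \<in> sympol n"
 obtains I c where "I \<subseteq> Par n" "finite I" "f = (\<Sum>lam\<in>I. const_pol (c lam) * jack n kap lam)"
proof -
 define I where "I = (\<Union>d\<in>deg ` kys f. PDn n d)"
 have I: "downset n I" using downset_PDn[of n] unfolding downset_def I_def by fastforce
 have "\<exists>c. f = (\<Sum>lam\<in>I. const_pol (c lam) * jack n kap lam)"
 proof (rule jack_span[OF kap I f])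
  fix lam assume "lam \<in> Par n" "lkp f (pm n lam) \<noteq> 0"
  then show "lam \<in> I" unfolding I_def
   by (auto simp: in_keys_iff PDn_def PD_def Par_def deg_pm_Par intro!: bexI[of _ "pm n lam"])
 qed
 then show thesis using that I unfolding downset_def by blast
qed

text \<open>
 For \<open>\<gamma>\<close> up to the last part this is the recursion of the norm ratios.  For the
 next value of \<open>\<gamma>\<close> the left hand side is zero by definition and the right hand
 side because the last factor of \<open>D(1 - \<gamma>)\<close> vanishes.\<close>

lemma bax_ev_difference:
 assumes kap: "kap > 0" and n: "n \<ge> 1" and lam: "lam \<in> Par n"
 shows "dl n kap (of_int (int kap - gam)) lam * bax_ev n kap gam lam = dl n kap (of_int (1 - gam)) lam * bax_ev n kap (gam - 1) lam"
proof -
 consider "gam \<le> int (lam (n - 1))" | "gam = int (lam (n - 1)) + 1" | "gam > int (lam (n - 1)) + 1" by linarith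
 then show ?thesis
 proof cases
  case 1
  have g: "int (subp n gam lam i) = int (lam i) - gam" if "i < n" for i
   using last_part_le[OF lam that] 1 that by (simp add: subp_def)
  have s: "subp n (gam - 1) lam i = Suc (subp n gam lam i)" if "i < n" for i
   using last_part_le[OF lam that] 1 that by (simp add: subp_def)
  let ?a = "\<lambda>i. rho n i * kap + subp n gam lam i"
  have d: "dl n kap (of_int (m - gam)) lam = (\<Prod>i<n. of_int (int (?a i) + m))" for m
   unfolding dl_def
  proof (intro prod.cong refl)
   fix i assume "i \<in> {..<n}"
   then have "m - gam + int (av n kap lam i) = int (?a i) + m" using g[of i] by (simp add: av_def)
   then show "of_int (m - gam) + of_nat (av n kap lam i) = (of_int (int (?a i) + m) :: complex)"
    by (metis of_int_add of_int_of_nat_eq)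
  qed
  have "nratio n kap (subp n (gam - 1) lam) = nratio n kap (subp n gam lam) * (\<Prod>i<n. of_nat (?a i + kap) / of_nat (?a i + 1))"
  proof -
   define q where "q i s = (of_nat (rho n i * kap + s + kap) / of_nat (rho n i * kap + s + 1) :: complex)" for i s
   have "(\<Prod>i<n. \<Prod>s<subp n (gam - 1) lam i. q i s) = (\<Prod>i<n. (\<Prod>s<subp n gam lam i. q i s) * q i (subp n gam lam i))"
    by (intro prod.cong refl) (simp add: s)
   then show ?thesis unfolding nratio_def q_def prod.distrib by simp
  qed
  moreover have "(\<Prod>i<n. of_nat (?a i + kap) / of_nat (?a i + 1)) = dl n kap (of_int (int kap - gam)) lam / dl n kap (of_int (1 - gam)) lam"
   unfolding d prod_dividef by (simp add: add_ac)
  moreover have "dl n kap (of_int (1 - gam)) lam \<noteq> 0"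
  proof -
   have "of_int (int (?a i) + 1) \<noteq> (0 :: complex)" for i unfolding of_int_eq_0_iff by linarith
   then show ?thesis unfolding d by simp
  qed
  ultimately show ?thesis using 1 by (simp add: bax_ev_def)
 next
  case 2
  have "av n kap lam (n - 1) = lam (n - 1)" by (simp add: av_def rho_def)
  then have "of_int (1 - gam) + of_nat (av n kap lam (n - 1)) = (0 :: complex)" using 2 by simp
  then have "dl n kap (of_int (1 - gam)) lam = 0" unfolding dl_def using n by (intro prod_zero bexI[of _ "n - 1"]) auto
  then show ?thesis using 2 by (simp add: bax_ev_def)
 next
  case 3
  then show ?thesis by (simp add: bax_ev_def)
 qed
qed

text \<open>
 If \<open>\<gamma>\<close> exceeds the last part by at most \<open>\<kappa>\<close>, the last
 denominator of the Gamma quotient is at a pole, so that the quotient is zero.\<close>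

lemma bax_ev_eigenvalue:
 assumes kap: "kap > 0" and n: "n \<ge> 1" and lam: "lam \<in> Par n" and g: "gam \<le> int (lam (n - 1)) + int kap"
 shows "bax_ev n kap gam lam = baxter_norm n kap * baxter_eigenvalue n kap gam lam"
proof (cases "gam \<le> int (lam (n - 1))")
 case True
 then show ?thesis unfolding bax_ev_def
  using nratio_eigenvalue[OF kap, of n "subp n gam lam" lam gam] last_part_le[OF lam] by (force simp: subp_def)
next
 case False
 then show ?thesis using eigenvalue_pole[of lam "n - 1" gam kap n] g n by (simp add: bax_ev_def)
qed

theorem theorem2p5:
  fixes l n \<kappa> :: nat and \<gamma> :: int and W :: "mpol set"
  assumes "n = l + 1" and "\<kappa> \<ge> 1"
    and W: "W = sekiguchi n \<kappa> (of_int (1 - \<gamma>)) ` sympol n"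
  shows
    "(\<forall>f \<in> sympol n. is_baxter_image n \<kappa> \<gamma> f (baxter n \<kappa> \<gamma> f)) \<and>
     (\<forall>lam. is_partition lam \<and> part_length lam \<le> n \<longrightarrow>
        (\<gamma> \<le> int (lam l) + int \<kappa> \<longrightarrow>
           baxter n \<kappa> \<gamma> (jack n \<kappa> lam) =
             const_pol (baxter_norm n \<kappa> * baxter_eigenvalue n \<kappa> \<gamma> lam) * jack n \<kappa> lam) \<and>
        (\<gamma> > int (lam l) + int \<kappa> \<longrightarrow> baxter n \<kappa> \<gamma> (jack n \<kappa> lam) = 0)) \<and>
     (\<forall>X. \<forall>f \<in> sympol n.
        baxter n \<kappa> \<gamma> (sekiguchi n \<kappa> X f) = sekiguchi n \<kappa> X (baxter n \<kappa> \<gamma> f)) \<and>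
     (\<gamma> \<le> 0 \<longrightarrow> W = sympol n) \<and>
     bij_betw (sekiguchi n \<kappa> (of_int (1 - \<gamma>))) W W \<and>
     (\<forall>f \<in> W. baxter n \<kappa> \<gamma> f \<in> W \<and>
        (sekiguchi n \<kappa> (of_int (int \<kappa> - \<gamma>))
          \<circ> inv_into W (sekiguchi n \<kappa> (of_int (1 - \<gamma>)))
          \<circ> baxter n \<kappa> \<gamma>) f = baxter n \<kappa> (\<gamma> - 1) f) \<and>
     (\<forall>f \<in> sympol n.
        sekiguchi n \<kappa> (of_int (int \<kappa> - \<gamma>)) (baxter n \<kappa> \<gamma> f) =
        sekiguchi n \<kappa> (of_int (1 - \<gamma>)) (baxter n \<kappa> (\<gamma> - 1) f))"
proof -
 have \<kappa>: "\<kappa> > 0" and n: "n \<ge> 1" and l: "l = n - 1" using assms by auto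
 let ?S = "\<lambda>I c. \<Sum>lam\<in>I. const_pol (c lam) * jack n \<kappa> lam"
 let ?D = "sekiguchi n \<kappa>" and ?D1 = "sekiguchi n \<kappa> (of_int (1 - \<gamma>))" and ?d1 = "dl n \<kappa> (of_int (1 - \<gamma>))"
 note bax = baxter_jack_sum[OF \<kappa> n] and sek = sekiguchi_jack_sum[OF \<kappa>]
 have span: "\<exists>I c. I \<subseteq> Par n \<and> finite I \<and> f = ?S I c" if "f \<in> sympol n" for f
  by (rule sympol_jack_sum[OF \<kappa> that]) blast
 have S: "?S I c \<in> sympol n" if "I \<subseteq> Par n" for I c
  using that sympol_jack[OF \<kappa>] by (intro sympol_sum sympol_cmult) (auto simp: Par_def)
 have image: "is_baxter_image n \<kappa> \<gamma> f (baxter n \<kappa> \<gamma> f)" if fS: "f \<in> sympol n" for f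
 proof -
  obtain I c where I: "I \<subseteq> Par n" "finite I" "f = ?S I c" using span[OF fS] by blast
  show ?thesis unfolding I(3) bax[OF I(1,2)] by (rule baxter_image_jack_sum[OF \<kappa> n I(1,2)])
 qed
 have jack: "baxter n \<kappa> \<gamma> (jack n \<kappa> lam) = const_pol (bax_ev n \<kappa> \<gamma> lam) * jack n \<kappa> lam" if "lam \<in> Par n" for lam
  using bax[of "{lam}" \<gamma> "\<lambda>_. 1"] that by simp
 have eigen: "(\<gamma> \<le> int (lam l) + int \<kappa> \<longrightarrow> baxter n \<kappa> \<gamma> (jack n \<kappa> lam) =
    const_pol (baxter_norm n \<kappa> * baxter_eigenvalue n \<kappa> \<gamma> lam) * jack n \<kappa> lam) \<and>
   (\<gamma> > int (lam l) + int \<kappa> \<longrightarrow> baxter n \<kappa> \<gamma> (jack n \<kappa> lam) = 0)" if "lam \<in> Par n" for lam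
  using jack[OF that] bax_ev_eigenvalue[OF \<kappa> n that, of \<gamma>] unfolding l by (auto simp: bax_ev_def)
 have comm: "baxter n \<kappa> \<gamma>' (?D X f) = ?D X (baxter n \<kappa> \<gamma>' f)" and mem: "baxter n \<kappa> \<gamma>' f \<in> sympol n"
  if fS: "f \<in> sympol n" for X f \<gamma>'
 proof -
  obtain I c where I: "I \<subseteq> Par n" "finite I" "f = ?S I c" using span[OF fS] by blast
  show "baxter n \<kappa> \<gamma>' (?D X f) = ?D X (baxter n \<kappa> \<gamma>' f)"
   unfolding I(3) sek[OF I(1)] bax[OF I(1,2)] by (simp add: mult_ac)
  show "baxter n \<kappa> \<gamma>' f \<in> sympol n" unfolding I(3) bax[OF I(1,2)] by (rule S[OF I(1)])
 qed
 have diff: "?D (of_int (int \<kappa> - \<gamma>)) (baxter n \<kappa> \<gamma> f) = ?D1 (baxter n \<kappa> (\<gamma> - 1) f)" if fS: "f \<in> sympol n" for f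
 proof -
  obtain I c where I: "I \<subseteq> Par n" "finite I" "f = ?S I c" using span[OF fS] by blast
  have "c lam * bax_ev n \<kappa> \<gamma> lam * dl n \<kappa> (of_int (int \<kappa> - \<gamma>)) lam = c lam * bax_ev n \<kappa> (\<gamma> - 1) lam * ?d1 lam"
   if "lam \<in> I" for lam
  proof -
   have "lam \<in> Par n" using that I(1) by blast
   from bax_ev_difference[OF \<kappa> n this, of \<gamma>] show ?thesis by (simp only: mult_ac)
  qed
  then show ?thesis unfolding I(3) bax[OF I(1,2)] sek[OF I(1)] by (simp only: cong: sum.cong)
 qed
 \<comment> \<open>
  \<open>W\<close> is spanned by the Jack polynomials on which \<open>D(1 - \<gamma>)\<close> does
  not vanish\<close>
 have dense: "?S I c \<in> W" if "I \<subseteq> Par n" "\<And>lam. lam \<in> I \<Longrightarrow> ?d1 lam = 0 \<Longrightarrow> c lam = 0" for I c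
 proof -
  have "?S I c = ?D1 (?S I (\<lambda>lam. c lam / ?d1 lam))"
   unfolding sek[OF that(1)] using that(2) by (intro sum.cong refl arg_cong2[of _ _ _ _ "(*)"] arg_cong[of _ _ const_pol]) auto
  then show ?thesis unfolding W by (rule image_eqI) (rule S[OF that(1)])
 qed
 have WS: "W \<subseteq> sympol n"
 proof
  fix f assume "f \<in> W"
  then obtain h where h: "h \<in> sympol n" "f = ?D1 h" unfolding W by blast
  obtain I c where I: "I \<subseteq> Par n" "finite I" "h = ?S I c" using span[OF h(1)] by blast
  show "f \<in> sympol n" unfolding h(2) I(3) sek[OF I(1)] by (rule S[OF I(1)])
 qed
 have D1W: "?D1 ` W = W"
 proof
  show "?D1 ` W \<subseteq> W" using WS unfolding W by blast
  show "W \<subseteq> ?D1 ` W"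
  proof
   fix f assume "f \<in> W"
   then obtain h where h: "h \<in> sympol n" "f = ?D1 h" unfolding W by blast
   obtain I c where I: "I \<subseteq> Par n" "finite I" "h = ?S I c" using span[OF h(1)] by blast
   let ?c = "\<lambda>lam. if ?d1 lam = 0 then 0 else c lam"
   have "f = ?D1 (?S I ?c)" unfolding h(2) I(3) sek[OF I(1)] by (intro sum.cong refl) simp
   moreover have "?S I ?c \<in> W" by (rule dense[OF I(1)]) simp
   ultimately show "f \<in> ?D1 ` W" by blast
  qed
 qed
 have inj: "inj_on ?D1 W"
 proof (rule inj_onI)
  fix f g assume fg: "f \<in> W" "g \<in> W" "?D1 f = ?D1 g"
  obtain f' g' where h: "f' \<in> sympol n" "f = ?D1 f'" "g' \<in> sympol n" "g = ?D1 g'" using fg unfolding W by blast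
  have lin: "?D1 (a - b) = ?D1 a - ?D1 b" if "a \<in> sympol n" "b \<in> sympol n" for a b
  proof -
   have "?D1 ((a - b) + b) = ?D1 (a - b) + ?D1 b"
    unfolding sekiguchi_quot by (rule quot_op_add[OF sympol_diff[OF that] that(2) qsym_sekq])
   then show ?thesis by simp
  qed
  have fgS: "f \<in> sympol n" "g \<in> sympol n" using fg WS by auto
  obtain I c where I: "I \<subseteq> Par n" "finite I" "f' - g' = ?S I c" using span[OF sympol_diff[OF h(1,3)]] by blast
  have e: "f - g = ?S I (\<lambda>lam. c lam * ?d1 lam)" using lin[OF h(1,3)] unfolding h(2,4) I(3) sek[OF I(1)] by simp
  have "?D1 (f - g) = 0" unfolding lin[OF fgS] using fg(3) by simp
  then have z: "?S I (\<lambda>lam. c lam * ?d1 lam * ?d1 lam) = 0" unfolding e sek[OF I(1)] .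
  have c0: "c lam * ?d1 lam * ?d1 lam = 0" if "lam \<in> I" for lam
   by (rule lin_indep_jack[OF \<kappa> I(2,1), unfolded lin_indep_def, rule_format, OF z that])
  have c1: "c lam * ?d1 lam = 0" if "lam \<in> I" for lam using c0[OF that] by simp
  have "f - g = 0" unfolding e
  proof (rule sum.neutral, rule ballI)
   fix lam assume "lam \<in> I"
   from c1[OF this] show "const_pol (c lam * ?d1 lam) * jack n \<kappa> lam = 0" by (simp only: const_pol_0 mult_zero_left)
  qed
  then show "f = g" by simp
 qed
 have all: "W = sympol n" if g: "\<gamma> \<le> 0"
 proof
  show "sympol n \<subseteq> W"
  proof
   fix f assume "f \<in> sympol n"
   then obtain I c where I: "I \<subseteq> Par n" "finite I" "f = ?S I c" using span by blast
   have "?d1 lam \<noteq> 0" for lam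
   proof -
    have "of_int (1 - \<gamma>) + of_nat (av n \<kappa> lam i) \<noteq> (0 :: complex)" for i
    proof -
     have "1 - \<gamma> + int (av n \<kappa> lam i) \<noteq> 0" using g by linarith
     then show ?thesis by (metis of_int_add of_int_eq_0_iff of_int_of_nat_eq)
    qed
    then show ?thesis unfolding dl_def by simp
   qed
   then show "f \<in> W" unfolding I(3) by (intro dense[OF I(1)]) simp
  qed
 qed (rule WS)
 have quotient: "baxter n \<kappa> \<gamma> f \<in> W \<and>
   (?D (of_int (int \<kappa> - \<gamma>)) \<circ> inv_into W ?D1 \<circ> baxter n \<kappa> \<gamma>) f = baxter n \<kappa> (\<gamma> - 1) f" if f: "f \<in> W" for f
 proof -
  have BW: "baxter n \<kappa> \<gamma> h \<in> W" if "h \<in> W" for h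
  proof -
   obtain h' where "h' \<in> sympol n" "h = ?D1 h'" using \<open>h \<in> W\<close> unfolding W by blast
   then show ?thesis unfolding W using comm[of h' \<gamma>] mem[of h' \<gamma>] by auto
  qed
  obtain w where w: "w \<in> W" "f = ?D1 w" using f D1W by blast
  have ws: "w \<in> sympol n" using w(1) WS by blast
  have "inv_into W ?D1 (baxter n \<kappa> \<gamma> f) = baxter n \<kappa> \<gamma> w"
   unfolding w(2) comm[OF ws] by (rule inv_into_f_f[OF inj BW[OF w(1)]])
  then show ?thesis using BW[OF f] diff[OF ws] comm[OF ws, of "\<gamma> - 1"] w(2) by simp
 qed
 show ?thesis
 proof (intro conjI ballI allI)
  show "bij_betw ?D1 W W" using inj D1W by (simp add: bij_betw_def)
 qed (use image eigen comm all quotient diff in \<open>auto simp: Par_def\<close>)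
qed

end
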